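(* Let $((A,\mu),(A^*,\gamma))$ be a Lie bialgebroid and let $N:A\to A$ be a vector bundle endomorphism. Assume that $N$ is proportional to a cps structure on $A$ and that ${}^tN$ is proportional to a cps structure on $A^*$. Then $((A,\mu_N),(A^*,\gamma_{-{}^tN}))$ is a Lie bialgebroid and its double is the Courant algebroid $(A\oplus A^*,\{\widetilde{\mathcal N},\mu+\gamma\})$, where $\mathcal N=\begin{pmatrix}N&0\\0&-{}^tN\end{pmatrix}$.
   Context: Let $A$ be a (smooth, real, finite rank) vector bundle over a manifold $M$, and equip $E=A\oplus A^*$ with the canonical symmetric bilinear form $\langle X+\xi,Y+\eta\rangle=\xi(Y)+\eta(X)$. $\mathcal A=\bigoplus_k\mathcal A^k$ is the graded algebra of functions on the graded manifold $T^*[2]A[1]$, with its canonical Poisson bracket $\{\cdot,\cdot\}$ of degree $-2$ (the big bracket), with $\{a,b\}=-(-1)^{|a||b|}\{b,a\}$ and the graded Leibniz and Jacobi identities. For a local basis $(e_\alpha)$ of $\Gamma A$ with dual basis $(\epsilon^\alpha)$, local coordinates are $(x^i,\tau^\alpha,p_i,\theta_\alpha)$ of degrees $0,1,2,1$, with non-vanishing brackets $\{x^i,p_j\}=\delta^i_j$, $\{\tau^\alpha,\theta_\beta\}=\delta^\alpha_\beta$. $\mathcal A^0=C^\infty(M)$; $\mathcal A^1=\Gamma(A\oplus A^* )$, with $X=X^\alpha e_\alpha$ identified with $X^\alpha\theta_\alpha$ and $\xi=\xi_\alpha\epsilon^\alpha$ with $\xi_\alpha\tau^\alpha$; $\{u,v\}=\langle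 u,v\rangle$ for sections of $E$. A Lie algebroid structure on $A$ is given by $\mu\in\mathcal A^3$, locally a combination with coefficients in $C^\infty(M)$ of terms $\tau^\alpha p_i$ and $\tau^\alpha\tau^\beta\theta_\gamma$, with $\{\mu,\mu\}=0$: anchor $\rho(X)f=\{\{X,\mu\},f\}$, bracket $[X,Y]^\mu=\{\{X,\mu\},Y\}$. A Lie algebroid structure on $A^*$ is given similarly by $\gamma\in\mathcal A^3$ (terms $\theta_\alpha p_i$ and $\theta_\alpha\theta_\beta\tau^\gamma$), $\{\gamma,\gamma\}=0$, $[\xi,\eta]^\gamma=\{\{\xi,\gamma\},\eta\}$. They form a Lie bialgebroid iff moreover $\{\mu,\gamma\}=0$. The double of a Lie bialgebroid $((A,\mu),(A^*,\gamma))$ is the Courant algebroid $A\oplus A^*$ with structure $\Theta=\mu+\gamma$. (A Courant algebroid structure is an element $\Theta\in\mathcal A^3$ with $\{\Theta,\Theta\}=0$; its Dorfman bracket is $\{\{u,\Theta\},v\}$ and its anchor $\rho(u)f=\{\{u,\Theta\},f\}$.) For a skew-symmetric endomorphism $\mathcal N$ of $E$ ($\langle\mathcal Nu,v\rangle+\langle u,\mathcal Nv\rangle=0$), $\widetilde{\mathcal N}\in\mathcal A^2$ is the unique element with $\mathcal N(u)=\{u,\widetilde{\mathcal N}\}$ for all $u\in\Gamma E$. For an endomorphism $N$ of $A$ and $\mathcal N=\begin{pmatrix}N&0\\0&-{}^tN\end{pmatrix}$, $\widetilde{\mathcal N}$ is locally $N^\alpha_\beta\tau^\beta\theta_\alpha$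 and is also denoted $N$; set $\mu_N=\{N,\mu\}$ and $\gamma_{-{}^tN}=\{N,\gamma\}$, whose associated brackets are $[X,Y]^\mu_N=[NX,Y]^\mu+[X,NY]^\mu-N[X,Y]^\mu$ on $\Gamma A$ and the analogous bracket $[\cdot,\cdot]^\gamma_{-{}^tN}$ on $\Gamma(A^* )$. An almost cps structure on a Lie algebroid $B$ is an endomorphism $P$ of $B$ with $P^2=\epsilon\,\mathrm{Id}_B$, $\epsilon\in\{-1,1,0\}$; it is a cps structure if moreover its torsion $(u,v)\mapsto[Pu,Pv]-P([Pu,v]+[u,Pv]-P[u,v])$ for the Lie algebroid bracket of $B$ vanishes. "Proportional to" means equal to a real constant multiple of. Here $A$ and $A^*$ carry the Lie algebroid structures $\mu$ and $\gamma$. *)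

theory Defs
  imports "HOL-Analysis.Analysis" "HOL-Library.Multiset" "HOL-Library.Function_Algebras"
begin

text \<open>The pointwise real vector space structure on functions; it makes the dual of a vector
  bundle a vector bundle in the sense used below, and provides sums and multiples of functions on
  the graded manifold.\<close>

instantiation "fun" :: (type, real_vector) real_vector
begin

definition scaleR_fun :: "real \<Rightarrow> ('a \<Rightarrow> 'b) \<Rightarrow> 'a \<Rightarrow> 'b"
  where "scaleR_fun r f = (\<lambda>x. r *\<^sub>R f x)"

instance
  by standard (simp_all add: scaleR_fun_def fun_eq_iff scaleR_add_right scaleR_add_left)

end

section \<open>Smooth vector bundles\<close>

text \<open>The base manifold is the type \<open>'m\<close>.  The fibres are subspaces, not necessarily disjoint, of one
  real vector space \<open>'v\<close>; this is no restriction, since a section remembers the base point.  A chart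
  consists of an open set, coordinates on it with values in \<^term>\<open>Euclidean_space n\<close> (so
  \<open>n = 0\<close> is allowed), and a local frame of the bundle.\<close>

record ('m, 'v) bundle_chart =
  chart_dom :: "'m set"
  chart_coord :: "'m \<Rightarrow> nat \<Rightarrow> real"
  chart_frame :: "nat \<Rightarrow> 'm \<Rightarrow> 'v"

record ('m, 'v) vbundle =
  base_dim :: nat
  bundle_rank :: nat
  fibre :: "'m \<Rightarrow> 'v set"
  charts :: "('m, 'v) bundle_chart set"

text \<open>\<open>coord_line c i x t\<close> is the point whose coordinates in the chart \<open>c\<close> are those of \<open>x\<close>,
  except that the \<open>i\<close>-th one is \<open>t\<close>.\<close>

definition coord_line :: "('m, 'v) bundle_chart \<Rightarrow> nat \<Rightarrow> 'm \<Rightarrow> real \<Rightarrow> 'm" where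
  "coord_line c i x t = inv_into (chart_dom c) (chart_coord c) ((chart_coord c x)(i := t))"

definition chart_partial :: "('m, 'v) bundle_chart \<Rightarrow> nat \<Rightarrow> ('m \<Rightarrow> real) \<Rightarrow> 'm \<Rightarrow> real" where
  "chart_partial c i f x = deriv (\<lambda>t. f (coord_line c i x t)) (chart_coord c x i)"

text \<open>All iterated partial derivatives in the chart \<open>c\<close> exist and are continuous on the open
  set \<open>W\<close>.\<close>

definition smooth_on_chart ::
    "nat \<Rightarrow> ('m::topological_space, 'v) bundle_chart \<Rightarrow> 'm set \<Rightarrow> ('m \<Rightarrow> real) \<Rightarrow> bool" where
  "smooth_on_chart n c W f \<longleftrightarrow>
     (\<forall>is. set is \<subseteq> {..<n} \<longrightarrow>
        continuous_on W (foldr (chart_partial c) is f) \<and>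
        (\<forall>i<n. \<forall>x\<in>W. (\<lambda>t. foldr (chart_partial c) is f (coord_line c i x t))
                          differentiable (at (chart_coord c x i))))"

text \<open>The dual frame; its value is \<open>0\<close> on vectors outside the fibre over \<open>x\<close>.\<close>

definition coframe :: "nat \<Rightarrow> ('m, 'v::real_vector) bundle_chart \<Rightarrow> nat \<Rightarrow> 'm \<Rightarrow> 'v \<Rightarrow> real" where
  "coframe r c \<alpha> x v = representation ((\<lambda>\<beta>. chart_frame c \<beta> x) ` {..<r}) v (chart_frame c \<alpha> x)"

definition smooth_vector_bundle ::
    "('m::{second_countable_topology, t2_space}, 'v::real_vector) vbundle \<Rightarrow> bool" where
  "smooth_vector_bundle B \<longleftrightarrow>
     (\<Union>c\<in>charts B. chart_dom c) = UNIV \<and>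
     (\<forall>c\<in>charts B.
        open (chart_dom c) \<and>
        openin (Euclidean_space (base_dim B)) (chart_coord c ` chart_dom c) \<and>
        homeomorphic_map (top_of_set (chart_dom c))
          (subtopology (Euclidean_space (base_dim B)) (chart_coord c ` chart_dom c))
          (chart_coord c) \<and>
        (\<forall>x\<in>chart_dom c.
           inj_on (\<lambda>\<alpha>. chart_frame c \<alpha> x) {..<bundle_rank B} \<and>
           independent ((\<lambda>\<alpha>. chart_frame c \<alpha> x) ` {..<bundle_rank B}) \<and>
           span ((\<lambda>\<alpha>. chart_frame c \<alpha> x) ` {..<bundle_rank B}) = fibre B x)) \<and>
     (\<forall>c\<in>charts B. \<forall>d\<in>charts B.
        (\<forall>i<base_dim B.
           smooth_on_chart (base_dim B) c (chart_dom c \<inter> chart_dom d) (\<lambda>x. chart_coord d x i)) \<and>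
        (\<forall>\<alpha><bundle_rank B. \<forall>\<beta><bundle_rank B.
           smooth_on_chart (base_dim B) c (chart_dom c \<inter> chart_dom d)
             (\<lambda>x. coframe (bundle_rank B) d \<alpha> x (chart_frame c \<beta> x))))"

definition sections ::
    "('m::topological_space, 'v::real_vector) vbundle \<Rightarrow> ('m \<Rightarrow> 'v) set" where
  "sections B = {s. (\<forall>x. s x \<in> fibre B x) \<and>
     (\<forall>c\<in>charts B. \<forall>\<alpha><bundle_rank B.
        smooth_on_chart (base_dim B) c (chart_dom c) (\<lambda>x. coframe (bundle_rank B) c \<alpha> x (s x)))}"

text \<open>Only the values of \<open>P x\<close> on the fibre over \<open>x\<close> matter.\<close>

definition bundle_endomorphism ::
    "('m::topological_space, 'v::real_vector) vbundle \<Rightarrow> ('m \<Rightarrow> 'v \<Rightarrow> 'v) \<Rightarrow> bool" where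
  "bundle_endomorphism B P \<longleftrightarrow>
     (\<forall>x. \<forall>v\<in>fibre B x. P x v \<in> fibre B x) \<and>
     (\<forall>x. \<forall>v\<in>fibre B x. \<forall>w\<in>fibre B x. P x (v + w) = P x v + P x w) \<and>
     (\<forall>x. \<forall>v\<in>fibre B x. \<forall>a. P x (a *\<^sub>R v) = a *\<^sub>R P x v) \<and>
     (\<forall>c\<in>charts B. \<forall>\<alpha><bundle_rank B. \<forall>\<beta><bundle_rank B.
        smooth_on_chart (base_dim B) c (chart_dom c)
          (\<lambda>x. coframe (bundle_rank B) c \<alpha> x (P x (chart_frame c \<beta> x))))"

text \<open>An element of the dual of the fibre \<open>F\<close> is a linear form on \<open>F\<close>, extended by \<open>0\<close> outside \<open>F\<close>.\<close>

definition dual_space :: "'v::real_vector set \<Rightarrow> ('v \<Rightarrow> real) set" where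
  "dual_space F = {\<phi>. (\<forall>v\<in>F. \<forall>w\<in>F. \<phi> (v + w) = \<phi> v + \<phi> w) \<and>
     (\<forall>v\<in>F. \<forall>a. \<phi> (a *\<^sub>R v) = a * \<phi> v) \<and> (\<forall>v. v \<notin> F \<longrightarrow> \<phi> v = 0)}"

definition dual_bundle :: "('m, 'v::real_vector) vbundle \<Rightarrow> ('m, 'v \<Rightarrow> real) vbundle" where
  "dual_bundle B =
     \<lparr> base_dim = base_dim B, bundle_rank = bundle_rank B,
       fibre = (\<lambda>x. dual_space (fibre B x)),
       charts = (\<lambda>c. \<lparr> chart_dom = chart_dom c, chart_coord = chart_coord c,
                       chart_frame = coframe (bundle_rank B) c \<rparr>) ` charts B \<rparr>"

definition transpose_endo ::
    "('m, 'v) vbundle \<Rightarrow> ('m \<Rightarrow> 'v \<Rightarrow> 'v) \<Rightarrow> 'm \<Rightarrow> ('v \<Rightarrow> real) \<Rightarrow> 'v \<Rightarrow> real" where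
  "transpose_endo B N x \<phi> = (\<lambda>v. if v \<in> fibre B x then \<phi> (N x v) else 0)"

text \<open>Sections of \<open>A \<oplus> A\<^sup>*\<close> and the endomorphism with diagonal blocks \<open>N\<close> and \<open>- \<^sup>tN\<close>.\<close>

definition double_sections ::
    "('m::topological_space, 'v::real_vector) vbundle \<Rightarrow> ('m \<Rightarrow> 'v \<times> ('v \<Rightarrow> real)) set" where
  "double_sections B =
     {u. (\<lambda>x. fst (u x)) \<in> sections B \<and> (\<lambda>x. snd (u x)) \<in> sections (dual_bundle B)}"

definition double_endo ::
    "('m, 'v) vbundle \<Rightarrow> ('m \<Rightarrow> 'v \<Rightarrow> 'v) \<Rightarrow> 'm \<Rightarrow> 'v \<times> ('v \<Rightarrow> real) \<Rightarrow> 'v \<times> ('v \<Rightarrow> real)" where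
  "double_endo B N x u = (N x (fst u), - transpose_endo B N x (snd u))"


section \<open>Polynomials in odd and even variables\<close>

text \<open>The real algebra generated by anticommuting \<open>\<tau>\<^sup>\<alpha>\<close>, \<open>\<theta>\<^sub>\<alpha>\<close> (degree 1) and commuting \<open>p\<^sub>i\<close>
  (degree 2).  The odd generators are numbered by natural numbers: \<open>\<tau>\<^sup>\<alpha>\<close> has number
  \<open>2\<alpha>\<close> and \<open>\<theta>\<^sub>\<alpha>\<close> has number \<open>2\<alpha> + 1\<close>.  An element is given by its coefficients; the
  pair \<open>(S, m)\<close> stands for the product of the odd generators with numbers in \<open>S\<close>, in increasing
  order, times the product of the \<open>p\<^sub>i\<close>, \<open>i\<close> in the multiset \<open>m\<close>.  The operations \<open>+\<close>, \<open>-\<close>,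
  \<open>*\<^sub>R\<close> are the pointwise ones, but the product is \<open>\<odot>\<close> (not the pointwise \<open>*\<close>).\<close>

type_synonym monom = "nat set \<times> nat multiset"
type_synonym spoly = "monom \<Rightarrow> real"

definition tau_no :: "nat \<Rightarrow> nat" where "tau_no \<alpha> = 2 * \<alpha>"
definition theta_no :: "nat \<Rightarrow> nat" where "theta_no \<alpha> = 2 * \<alpha> + 1"

definition smonom :: "monom \<Rightarrow> spoly" where
  "smonom k = (\<lambda>l. if l = k then 1 else 0)"

definition sone :: spoly where "sone = smonom ({}, {#})"
definition sodd :: "nat \<Rightarrow> spoly" where "sodd s = smonom ({s}, {#})"
definition sp :: "nat \<Rightarrow> spoly" where "sp i = smonom ({}, {#i#})"

definition shuffle_sign :: "nat set \<Rightarrow> nat set \<Rightarrow> real" where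
  "shuffle_sign S T = (- 1) ^ card {(s, t). s \<in> S \<and> t \<in> T \<and> t < s}"

definition smult :: "spoly \<Rightarrow> spoly \<Rightarrow> spoly"  (infixl "\<odot>" 70) where
  "a \<odot> b = (\<lambda>(S, m). \<Sum>T\<in>Pow S. \<Sum>l\<in>{l. l \<subseteq># m}.
      shuffle_sign T (S - T) * a (T, l) * b (S - T, m - l))"

text \<open>Left and right derivative with respect to an odd generator, derivative with respect
  to \<open>p\<^sub>i\<close>.\<close>

definition lderiv :: "nat \<Rightarrow> spoly \<Rightarrow> spoly" where
  "lderiv s a = (\<lambda>(S, m). if s \<in> S then 0 else (- 1) ^ card {t\<in>S. t < s} * a (insert s S, m))"

definition rderiv :: "nat \<Rightarrow> spoly \<Rightarrow> spoly" where
  "rderiv s a = (\<lambda>(S, m). if s \<in> S then 0 else (- 1) ^ card {t\<in>S. s < t} * a (insert s S, m))"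

definition pderiv_p :: "nat \<Rightarrow> spoly \<Rightarrow> spoly" where
  "pderiv_p i a = (\<lambda>(S, m). real (count m i + 1) * a (S, add_mset i m))"

text \<open>The algebra homomorphism sending the odd generators to \<open>G s\<close> and \<open>p\<^sub>i\<close> to \<open>P i\<close> (applied
  to polynomials only, so that the sum is finite).\<close>

definition ssubst :: "(nat \<Rightarrow> spoly) \<Rightarrow> (nat \<Rightarrow> spoly) \<Rightarrow> spoly \<Rightarrow> spoly" where
  "ssubst G P a = (\<Sum>(S, m)\<in>{k. a k \<noteq> 0}. a (S, m) *\<^sub>R
      (foldr (\<odot>) (map G (sorted_list_of_set S)) sone \<odot>
       foldr (\<odot>) (map P (sorted_list_of_multiset m)) sone))"


section \<open>Functions on the graded manifold and the big bracket\<close>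

text \<open>A function on \<open>T\<^sup>*[2]A[1]\<close> is given by its local expressions in the coordinates
  \<open>(x\<^sup>i, \<tau>\<^sup>\<alpha>, p\<^sub>i, \<theta>\<^sub>\<alpha>)\<close> induced by each chart: the value \<open>a c x\<close> is the polynomial in
  \<open>\<tau>\<^sup>\<alpha>, p\<^sub>i, \<theta>\<^sub>\<alpha>\<close> obtained from the expression in the chart \<open>c\<close> by evaluating its
  coefficients at the base point \<open>x\<close> (and \<open>0\<close> if \<open>c\<close> is not a chart around \<open>x\<close>).\<close>

type_synonym ('m, 'v) gfun = "('m, 'v) bundle_chart \<Rightarrow> 'm \<Rightarrow> spoly"

text \<open>The odd coordinates of the chart \<open>d\<close> in terms of those of \<open>c\<close>, for
  \<open>e\<^sup>c\<^sub>\<beta> = g\<^sup>\<alpha>\<^sub>\<beta> e\<^sup>d\<^sub>\<alpha>\<close>: the \<open>\<tau>\<^sup>\<alpha>\<close> transform as the dual frame and the \<open>\<theta>\<^sub>\<alpha>\<close> as the frame.\<close>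

definition change_odd ::
    "nat \<Rightarrow> ('m, 'v::real_vector) bundle_chart \<Rightarrow> ('m, 'v) bundle_chart \<Rightarrow> 'm \<Rightarrow> nat \<Rightarrow> spoly" where
  "change_odd r c d x s =
     (if even s
      then \<Sum>\<beta><r. coframe r d (s div 2) x (chart_frame c \<beta> x) *\<^sub>R sodd (tau_no \<beta>)
      else \<Sum>\<beta><r. coframe r c \<beta> x (chart_frame d (s div 2) x) *\<^sub>R sodd (theta_no \<beta>))"

text \<open>Cotangent lift: \<open>p'\<^sub>i = (\<partial>x\<^sup>j / \<partial>x'\<^sup>i) (p\<^sub>j + (g\<^sup>-\<^sup>1)\<^sup>\<beta>\<^sub>\<gamma> (\<partial>g\<^sup>\<gamma>\<^sub>\<alpha> / \<partial>x\<^sup>j) \<tau>\<^sup>\<alpha> \<theta>\<^sub>\<beta>)\<close>, primes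
  referring to \<open>d\<close>.  The second term is the one for which \<open>{p'\<^sub>i, \<tau>'\<^sup>\<gamma>} = {p'\<^sub>i, \<theta>'\<^sub>\<gamma>} = 0\<close>.\<close>

definition change_p ::
    "nat \<Rightarrow> nat \<Rightarrow> ('m, 'v::real_vector) bundle_chart \<Rightarrow> ('m, 'v) bundle_chart \<Rightarrow> 'm \<Rightarrow> nat \<Rightarrow> spoly"
  where
  "change_p n r c d x i =
     (\<Sum>j<n. chart_partial d i (\<lambda>y. chart_coord c y j) x *\<^sub>R
        (sp j + (\<Sum>\<alpha><r. \<Sum>\<beta><r.
           (\<Sum>\<gamma><r. coframe r c \<beta> x (chart_frame d \<gamma> x) *
                  chart_partial c j (\<lambda>y. coframe r d \<gamma> y (chart_frame c \<alpha> y)) x) *\<^sub>R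
           (sodd (tau_no \<alpha>) \<odot> sodd (theta_no \<beta>)))))"

text \<open>The space \<open>\<A>\<^sup>k\<close> of functions of degree \<open>k\<close>.\<close>

definition gfuns ::
    "('m::topological_space, 'v::real_vector) vbundle \<Rightarrow> nat \<Rightarrow> ('m, 'v) gfun set" where
  "gfuns B k = {a.
     (\<forall>c x S m. a c x (S, m) \<noteq> 0 \<longrightarrow>
        c \<in> charts B \<and> x \<in> chart_dom c \<and>
        S \<subseteq> tau_no ` {..<bundle_rank B} \<union> theta_no ` {..<bundle_rank B} \<and>
        set_mset m \<subseteq> {..<base_dim B} \<and> card S + 2 * size m = k) \<and>
     (\<forall>c\<in>charts B. \<forall>l. smooth_on_chart (base_dim B) c (chart_dom c) (\<lambda>x. a c x l)) \<and>
     (\<forall>c\<in>charts B. \<forall>d\<in>charts B. \<forall>x\<in>chart_dom c \<inter> chart_dom d.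
        a c x = ssubst (change_odd (bundle_rank B) c d x)
                       (change_p (base_dim B) (bundle_rank B) c d x) (a d x))}"

definition partial_x :: "('m, 'v) bundle_chart \<Rightarrow> nat \<Rightarrow> ('m \<Rightarrow> spoly) \<Rightarrow> 'm \<Rightarrow> spoly" where
  "partial_x c i f x = (\<lambda>l. chart_partial c i (\<lambda>y. f y l) x)"

text \<open>The Poisson bracket with \<open>{x\<^sup>i, p\<^sub>j} = \<delta>\<^sup>i\<^sub>j\<close> and \<open>{\<tau>\<^sup>\<alpha>, \<theta>\<^sub>\<beta>} = \<delta>\<^sup>\<alpha>\<^sub>\<beta>\<close>.  Right derivatives of the
  first argument and left derivatives of the second produce the signs of
  \<open>{a, b} = - (-1)\<^bsup>|a||b|\<^esup> {b, a}\<close> and \<open>{a, bc} = {a, b} c + (-1)\<^bsup>|a||b|\<^esup> b {a, c}\<close>.\<close>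

definition big_bracket ::
    "('m, 'v) vbundle \<Rightarrow> ('m, 'v) gfun \<Rightarrow> ('m, 'v) gfun \<Rightarrow> ('m, 'v) gfun" where
  "big_bracket B a b = (\<lambda>c x.
     if c \<in> charts B \<and> x \<in> chart_dom c then
       (\<Sum>i<base_dim B. partial_x c i (a c) x \<odot> pderiv_p i (b c x)
                      - pderiv_p i (a c x) \<odot> partial_x c i (b c) x) +
       (\<Sum>\<alpha><bundle_rank B. rderiv (tau_no \<alpha>) (a c x) \<odot> lderiv (theta_no \<alpha>) (b c x)
                         + rderiv (theta_no \<alpha>) (a c x) \<odot> lderiv (tau_no \<alpha>) (b c x))
     else 0)"

text \<open>The identification of the sections of \<open>A \<oplus> A\<^sup>*\<close> with \<open>\<A>\<^sup>1\<close>: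
  \<open>X + \<xi> \<mapsto> X\<^sup>\<alpha> \<theta>\<^sub>\<alpha> + \<xi>\<^sub>\<alpha> \<tau>\<^sup>\<alpha>\<close>.\<close>

definition gfun_of_section ::
    "('m, 'v::real_vector) vbundle \<Rightarrow> ('m \<Rightarrow> 'v \<times> ('v \<Rightarrow> real)) \<Rightarrow> ('m, 'v) gfun" where
  "gfun_of_section B u = (\<lambda>c x.
     if c \<in> charts B \<and> x \<in> chart_dom c then
       \<Sum>\<alpha><bundle_rank B. coframe (bundle_rank B) c \<alpha> x (fst (u x)) *\<^sub>R sodd (theta_no \<alpha>)
                        + snd (u x) (chart_frame c \<alpha> x) *\<^sub>R sodd (tau_no \<alpha>)
     else 0)"

definition gfun_of_vec ::
    "('m, 'v::real_vector) vbundle \<Rightarrow> ('m \<Rightarrow> 'v) \<Rightarrow> ('m, 'v) gfun" where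
  "gfun_of_vec B X = gfun_of_section B (\<lambda>x. (X x, 0))"

definition gfun_of_covec ::
    "('m, 'v::real_vector) vbundle \<Rightarrow> ('m \<Rightarrow> 'v \<Rightarrow> real) \<Rightarrow> ('m, 'v) gfun" where
  "gfun_of_covec B \<xi> = gfun_of_section B (\<lambda>x. (0, \<xi> x))"

text \<open>The element of \<open>\<A>\<^sup>2\<close> representing an endomorphism \<open>T\<close> of \<open>A \<oplus> A\<^sup>*\<close>.\<close>

definition tilde ::
    "('m::topological_space, 'v::real_vector) vbundle
      \<Rightarrow> ('m \<Rightarrow> 'v \<times> ('v \<Rightarrow> real) \<Rightarrow> 'v \<times> ('v \<Rightarrow> real)) \<Rightarrow> ('m, 'v) gfun" where
  "tilde B T = (THE a. a \<in> gfuns B 2 \<and>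
     (\<forall>u\<in>double_sections B.
        gfun_of_section B (\<lambda>x. T x (u x)) = big_bracket B (gfun_of_section B u) a))"


section \<open>Lie algebroids, Lie bialgebroids and Courant algebroids\<close>

definition lie_algebroid ::
    "('m::topological_space, 'v::real_vector) vbundle \<Rightarrow> ('m, 'v) gfun \<Rightarrow> bool" where
  "lie_algebroid A \<mu> \<longleftrightarrow> \<mu> \<in> gfuns A 3 \<and>
     (\<forall>c x k. \<mu> c x k \<noteq> 0 \<longrightarrow>
        (\<exists>\<alpha> i. k = ({tau_no \<alpha>}, {#i#})) \<or>
        (\<exists>\<alpha> \<beta> \<gamma>. k = ({tau_no \<alpha>, tau_no \<beta>, theta_no \<gamma>}, {#}))) \<and>
     big_bracket A \<mu> \<mu> = 0"

text \<open>A Lie algebroid structure on \<open>A\<^sup>*\<close>, as a function on \<open>T\<^sup>*[2]A[1]\<close>.\<close>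

definition dual_lie_algebroid ::
    "('m::topological_space, 'v::real_vector) vbundle \<Rightarrow> ('m, 'v) gfun \<Rightarrow> bool" where
  "dual_lie_algebroid A \<gamma> \<longleftrightarrow> \<gamma> \<in> gfuns A 3 \<and>
     (\<forall>c x k. \<gamma> c x k \<noteq> 0 \<longrightarrow>
        (\<exists>\<alpha> i. k = ({theta_no \<alpha>}, {#i#})) \<or>
        (\<exists>\<alpha> \<beta> \<delta>. k = ({theta_no \<alpha>, theta_no \<beta>, tau_no \<delta>}, {#}))) \<and>
     big_bracket A \<gamma> \<gamma> = 0"

definition lie_bialgebroid ::
    "('m::topological_space, 'v::real_vector) vbundle \<Rightarrow> ('m, 'v) gfun \<Rightarrow> ('m, 'v) gfun \<Rightarrow> bool" where
  "lie_bialgebroid A \<mu> \<gamma> \<longleftrightarrow>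
     lie_algebroid A \<mu> \<and> dual_lie_algebroid A \<gamma> \<and> big_bracket A \<mu> \<gamma> = 0"

definition courant_algebroid ::
    "('m::topological_space, 'v::real_vector) vbundle \<Rightarrow> ('m, 'v) gfun \<Rightarrow> bool" where
  "courant_algebroid A \<Theta> \<longleftrightarrow> \<Theta> \<in> gfuns A 3 \<and> big_bracket A \<Theta> \<Theta> = 0"

definition double_structure :: "('m, 'v) gfun \<Rightarrow> ('m, 'v) gfun \<Rightarrow> ('m, 'v) gfun" where
  "double_structure \<mu> \<gamma> = \<mu> + \<gamma>"

definition lie_bracket ::
    "('m::topological_space, 'v::real_vector) vbundle \<Rightarrow> ('m, 'v) gfun
      \<Rightarrow> ('m \<Rightarrow> 'v) \<Rightarrow> ('m \<Rightarrow> 'v) \<Rightarrow> 'm \<Rightarrow> 'v" where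
  "lie_bracket A \<mu> X Y = (THE Z. Z \<in> sections A \<and>
     gfun_of_vec A Z = big_bracket A (big_bracket A (gfun_of_vec A X) \<mu>) (gfun_of_vec A Y))"

definition dual_lie_bracket ::
    "('m::topological_space, 'v::real_vector) vbundle \<Rightarrow> ('m, 'v) gfun
      \<Rightarrow> ('m \<Rightarrow> 'v \<Rightarrow> real) \<Rightarrow> ('m \<Rightarrow> 'v \<Rightarrow> real) \<Rightarrow> 'm \<Rightarrow> 'v \<Rightarrow> real" where
  "dual_lie_bracket A \<gamma> \<xi> \<eta> = (THE \<zeta>. \<zeta> \<in> sections (dual_bundle A) \<and>
     gfun_of_covec A \<zeta> = big_bracket A (big_bracket A (gfun_of_covec A \<xi>) \<gamma>) (gfun_of_covec A \<eta>))"


section \<open>Cps structures\<close>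

definition torsion ::
    "(('m \<Rightarrow> 'v::real_vector) \<Rightarrow> ('m \<Rightarrow> 'v) \<Rightarrow> 'm \<Rightarrow> 'v) \<Rightarrow> ('m \<Rightarrow> 'v \<Rightarrow> 'v)
      \<Rightarrow> ('m \<Rightarrow> 'v) \<Rightarrow> ('m \<Rightarrow> 'v) \<Rightarrow> 'm \<Rightarrow> 'v" where
  "torsion br P u v = (\<lambda>x.
     let Pu = (\<lambda>y. P y (u y)); Pv = (\<lambda>y. P y (v y))
     in br Pu Pv x - P x (br Pu v x + br u Pv x - P x (br u v x)))"

definition almost_cps ::
    "('m::topological_space, 'v::real_vector) vbundle \<Rightarrow> ('m \<Rightarrow> 'v \<Rightarrow> 'v) \<Rightarrow> bool" where
  "almost_cps B P \<longleftrightarrow> bundle_endomorphism B P \<and>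
     (\<exists>\<epsilon>\<in>{- 1, 1, 0 :: real}. \<forall>x. \<forall>v\<in>fibre B x. P x (P x v) = \<epsilon> *\<^sub>R v)"

text \<open>The argument \<open>br\<close> is the bracket of the Lie algebroid \<open>B\<close>.\<close>

definition cps ::
    "('m::topological_space, 'v::real_vector) vbundle
      \<Rightarrow> (('m \<Rightarrow> 'v) \<Rightarrow> ('m \<Rightarrow> 'v) \<Rightarrow> 'm \<Rightarrow> 'v) \<Rightarrow> ('m \<Rightarrow> 'v \<Rightarrow> 'v) \<Rightarrow> bool" where
  "cps B br P \<longleftrightarrow> almost_cps B P \<and>
     (\<forall>u\<in>sections B. \<forall>v\<in>sections B. \<forall>x. torsion br P u v x = 0)"

definition proportional ::
    "('m, 'v::real_vector) vbundle \<Rightarrow> ('m \<Rightarrow> 'v \<Rightarrow> 'v) \<Rightarrow> ('m \<Rightarrow> 'v \<Rightarrow> 'v) \<Rightarrow> bool" where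
  "proportional B N P \<longleftrightarrow> (\<exists>a::real. \<forall>x. \<forall>v\<in>fibre B x. N x v = a *\<^sub>R P x v)"

end

theory Submission
  imports Defs
begin

text \<open>Let \<open>D = {N, \<cdot>}\<close>, where \<open>N\<close> also denotes the function of the endomorphism; \<open>D\<close> is a derivation of
  the big bracket.  Suppose that \<open>N\<^sup>2 = \<lambda> Id\<close> on \<open>A\<close> and that \<open>N\<close> has no torsion for \<open>\<mu>\<close>.  For sections \<open>X\<close>,
  \<open>Y\<close> of \<open>A\<close> the derived bracket \<open>{{X, D\<^sup>2\<mu> - \<lambda>\<mu>}, Y}\<close> is then a combination of the torsion and of
  \<open>N\<^sup>2 - \<lambda> Id\<close>, hence \<open>0\<close>.  A function with the shape of a Lie algebroid structure is determined
  by its derived brackets (use sections with compact support in a chart), so \<open>D\<^sup>2\<mu> = \<lambda>\<mu>\<close>, and likewise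
  \<open>D\<^sup>2\<gamma> = \<lambda>'\<gamma>\<close>.  For \<open>a, b \<in> {\<mu>, \<gamma>}\<close> with \<open>{a, b} = 0\<close>, applying \<open>D\<^sup>2\<close> gives
  \<open>{D\<^sup>2a, b} + 2 {Da, Db} + {a, D\<^sup>2b} = 0\<close>, whose outer terms are multiples of \<open>{a, b}\<close>; hence
  \<open>{Da, Db} = 0\<close>.  That the local expressions of \<open>N\<close> and \<open>Da\<close> agree on overlaps of charts follows from
  nondegeneracy and from checking the commutation of \<open>D\<close> with coordinate changes on generators.\<close>

section \<open>The supercommutative algebra of polynomials\<close>

text \<open>The big bracket of two arbitrary functions is never shown to be compatible with
  coordinate changes. Only brackets with a section or with the function of \<open>N\<close> are
  needed globally: \<open>Da\<close> has to lie in \<open>gfuns\<close>, whereas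
  \<open>{Da, Db} = 0\<close> can be read in each chart separately. Likewise the Jacobi identity is
  proved only with a quadratic first argument. At a fixed point the bracket with a section or with
  \<open>N\<close> is a derivation of an algebra of polynomials, so identities for it are checked on
  generators. Smoothness is given by iterated partial derivatives, and the chain rule and the
  symmetry of second derivatives come from the continuity of the partials; the symmetry enters the
  Jacobi identity. If \<open>N\<close> is \<open>a\<close> times a cps structure \<open>P\<close>
  with \<open>P\<^sup>2 = e\<close>, then the constant is \<open>a\<^sup>2 * e\<close>. For
  \<open>a = 0\<close> the structure \<open>P\<close> cannot be recovered from \<open>N\<close>, and
  a separate argument is given. The constants for \<mu> and \<gamma> may differ: each of them
  multiplies a bracket that is zero.\<close>

definition odd_mul :: "nat \<Rightarrow> spoly \<Rightarrow> spoly" where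
  "odd_mul s a = (\<lambda>(S, m). if s \<in> S then (- 1) ^ card {t\<in>S. t < s} * a (S - {s}, m) else 0)"

definition even_mul :: "nat \<Rightarrow> spoly \<Rightarrow> spoly" where
  "even_mul i a = (\<lambda>(S, m). if i \<in># m then a (S, m - {#i#}) else 0)"

text \<open>The parity involution. All signs of the graded calculus are expressed through it, so
  that the Leibniz and commutation rules need no homogeneous arguments.\<close>

definition grading_inv :: "spoly \<Rightarrow> spoly" where
  "grading_inv a = (\<lambda>(S, m). (- 1) ^ card S * a (S, m))"

text \<open>Outside this subspace the product is degenerate: the sum in it is \<open>0\<close> at \<open>(S, m)\<close> with \<open>S\<close> infinite.\<close>

definition is_gpoly :: "spoly \<Rightarrow> bool" where
  "is_gpoly a \<longleftrightarrow> finite {k. a k \<noteq> 0} \<and> (\<forall>S m. a (S, m) \<noteq> 0 \<longrightarrow> finite S)"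

lemma finite_submultisets: "finite {l. l \<subseteq># (m :: 'a multiset)}"
proof -
  have "{l. l \<subseteq># m} \<subseteq> mset ` {xs. set xs \<subseteq> set_mset m \<and> length xs \<le> size m}"
  proof
    fix l assume "l \<in> {l. l \<subseteq># m}"
    then have l: "l \<subseteq># m" by simp
    obtain xs where xs: "mset xs = l" using ex_mset by blast
    have "set xs \<subseteq> set_mset m" using l xs by (metis mset_subset_eqD set_mset_mset subsetI)
    moreover have "length xs \<le> size m" using l xs by (metis size_mset size_mset_mono)
    ultimately show "l \<in> mset ` {xs. set xs \<subseteq> set_mset m \<and> length xs \<le> size m}" using xs by blast
  qed
  then show ?thesis by (rule finite_subset) (simp add: finite_lists_length_le)
qed

text \<open>Removing one copy of \<open>i\<close> is a bijection from the submultisets containing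
  \<open>i\<close>. With its analogue for sets it pulls a single generator out of the convolution
  sum that defines the product.\<close>

lemma sum_submultisets_remove:
  fixes f :: "'a multiset \<Rightarrow> 'b::comm_monoid_add"
  shows "(\<Sum>l\<in>{l. l \<subseteq># m}. if i \<in># l then f l else 0) =
    (if i \<in># m then (\<Sum>l\<in>{l. l \<subseteq># m - {#i#}}. f (add_mset i l)) else 0)"
proof (cases "i \<in># m")
  case True
  then obtain m' where m: "m = add_mset i m'" by (meson mset_add)
  have "(\<Sum>l\<in>{l. l \<subseteq># m}. if i \<in># l then f l else 0) = (\<Sum>l\<in>{l. l \<subseteq># m \<and> i \<in># l}. f l)"
    by (rule sum.mono_neutral_cong_right) (auto simp: finite_submultisets)
  also have "{l. l \<subseteq># m \<and> i \<in># l} = add_mset i ` {l. l \<subseteq># m'}"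
    unfolding m by (auto simp: image_iff) (metis mset_add mset_subset_eq_add_mset_cancel)
  also have "sum f (add_mset i ` {l. l \<subseteq># m'}) = (\<Sum>l\<in>{l. l \<subseteq># m'}. f (add_mset i l))"
    by (subst sum.reindex) (auto simp: inj_on_def)
  finally show ?thesis by (simp add: m)
next
  case False
  then have "\<And>l. l \<subseteq># m \<Longrightarrow> i \<notin># l" by (meson mset_subset_eqD)
  then show ?thesis using False by (auto intro!: sum.neutral)
qed

lemma sum_Pow_remove:
  fixes f :: "'a set \<Rightarrow> 'b::comm_monoid_add"
  assumes "finite S"
  shows "(\<Sum>T\<in>Pow S. if s \<in> T then f T else 0) =
    (if s \<in> S then (\<Sum>T\<in>Pow (S - {s}). f (insert s T)) else 0)"
proof (cases "s \<in> S")
  case True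
  have "(\<Sum>T\<in>Pow S. if s \<in> T then f T else 0) = (\<Sum>T\<in>{T. T \<subseteq> S \<and> s \<in> T}. f T)"
    by (rule sum.mono_neutral_cong_right) (use assms in auto)
  also have "{T. T \<subseteq> S \<and> s \<in> T} = insert s ` Pow (S - {s})"
  proof (intro equalityI subsetI)
    fix T assume "T \<in> {T. T \<subseteq> S \<and> s \<in> T}"
    then show "T \<in> insert s ` Pow (S - {s})"
      by (intro image_eqI[of _ _ "T - {s}"]) auto
  qed (use True in auto)
  also have "sum f (insert s ` Pow (S - {s})) = (\<Sum>T\<in>Pow (S - {s}). f (insert s T))"
    by (subst sum.reindex) (auto simp: inj_on_def)
  finally show ?thesis using True by simp
qed (use assms in \<open>auto intro!: sum.neutral\<close>)

text \<open>The new inversions are those of \<open>s\<close> with the smaller elements of the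
  complement.\<close>

lemma shuffle_sign_insert:
  assumes "finite S" "T \<subseteq> S" "s \<notin> S"
  shows "shuffle_sign (insert s T) (S - T) = (- 1) ^ card {t\<in>S - T. t < s} * shuffle_sign T (S - T)"
proof -
  have e: "{(a, t). a \<in> insert s T \<and> t \<in> S - T \<and> t < a} =
    Pair s ` {t\<in>S - T. t < s} \<union> {(a, t). a \<in> T \<and> t \<in> S - T \<and> t < a}" by auto
  have f: "finite {(a, t). a \<in> T \<and> t \<in> S - T \<and> t < a}"
    by (rule finite_subset[of _ "T \<times> S"]) (use assms finite_subset in auto)
  have "card {(a, t). a \<in> insert s T \<and> t \<in> S - T \<and> t < a} =
    card {t\<in>S - T. t < s} + card {(a, t). a \<in> T \<and> t \<in> S - T \<and> t < a}"
    unfolding e by (subst card_Un_disjoint) (use assms f in \<open>auto simp: card_image inj_on_def\<close>)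
  then show ?thesis by (simp add: shuffle_sign_def power_add)
qed

lemma smult_infinite: "infinite S \<Longrightarrow> (a \<odot> b) (S, m) = 0"
  by (simp add: smult_def finite_Pow_iff)

text \<open>The inversions of \<open>s\<close> in \<open>S\<close> split into those with
  \<open>T\<close>, counted by \<open>odd_mul\<close> on the first factor, and those with
  \<open>S - T\<close>, counted by the shuffle sign. Together with the induction over generators
  this yields associativity without any computation with triple shuffles.\<close>

lemma odd_mul_smult: "odd_mul s a \<odot> b = odd_mul s (a \<odot> b)"
proof (intro ext, clarify)
  fix S :: "nat set" and m :: "nat multiset"
  show "(odd_mul s a \<odot> b) (S, m) = odd_mul s (a \<odot> b) (S, m)"
  proof (cases "finite S")
    case False
    then show ?thesis by (simp add: smult_infinite odd_mul_def)
  next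
    case fin: True
    have "(odd_mul s a \<odot> b) (S, m) = (\<Sum>T\<in>Pow S. if s \<in> T then \<Sum>l\<in>{l. l \<subseteq># m}.
        shuffle_sign T (S - T) * ((- 1) ^ card {t\<in>T. t < s} * a (T - {s}, l)) * b (S - T, m - l) else 0)"
      by (auto simp: smult_def odd_mul_def intro!: sum.cong)
    also have "\<dots> = (if s \<in> S then \<Sum>T\<in>Pow (S - {s}). \<Sum>l\<in>{l. l \<subseteq># m}.
        shuffle_sign (insert s T) (S - insert s T) * ((- 1) ^ card {t\<in>insert s T. t < s} *
          a (insert s T - {s}, l)) * b (S - insert s T, m - l) else 0)"
      by (rule sum_Pow_remove[OF fin])
    also have "\<dots> = odd_mul s (a \<odot> b) (S, m)"
    proof (cases "s \<in> S")
      case True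
      have "shuffle_sign (insert s T) (S - insert s T) * ((- 1) ^ card {t\<in>insert s T. t < s} *
          a (insert s T - {s}, l)) * b (S - insert s T, m - l) =
          (- 1) ^ card {t\<in>S. t < s} * (shuffle_sign T (S - {s} - T) * a (T, l) * b (S - {s} - T, m - l))"
        if T: "T \<in> Pow (S - {s})" for T l
      proof -
        have 1: "S - insert s T = (S - {s}) - T" "insert s T - {s} = T" using T by auto
        have 2: "{t\<in>insert s T. t < s} = {t\<in>T. t < s}" by auto
        have "{t\<in>S. t < s} = {t\<in>S - {s} - T. t < s} \<union> {t\<in>T. t < s}" using T by auto
        moreover have "finite {t\<in>T. t < s}" "finite {t\<in>S - {s} - T. t < s}"
          using fin T by (auto intro: finite_subset)
        ultimately have 3: "card {t\<in>S. t < s} = card {t\<in>S - {s} - T. t < s} + card {t\<in>T. t < s}"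
          by (simp add: card_Un_disjoint disjoint_iff)
        have 4: "shuffle_sign (insert s T) (S - {s} - T) =
            (- 1) ^ card {t\<in>S - {s} - T. t < s} * shuffle_sign T (S - {s} - T)"
          by (rule shuffle_sign_insert) (use fin T in auto)
        show ?thesis unfolding 1 2 3 4 power_add by (simp only: mult_ac)
      qed
      then show ?thesis using True by (simp add: odd_mul_def smult_def sum_distrib_left)
    qed (simp add: odd_mul_def)
    finally show ?thesis .
  qed
qed

lemma even_mul_smult: "even_mul i a \<odot> b = even_mul i (a \<odot> b)"
proof (intro ext, clarify)
  fix S :: "nat set" and m :: "nat multiset"
  have "(\<Sum>l\<in>{l. l \<subseteq># m}. shuffle_sign T (S - T) * even_mul i a (T, l) * b (S - T, m - l)) =
     (if i \<in># m then \<Sum>l\<in>{l. l \<subseteq># m - {#i#}}. shuffle_sign T (S - T) * a (T, l) * b (S - T, m - {#i#} - l) else 0)"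
    for T
  proof -
    have "(\<Sum>l\<in>{l. l \<subseteq># m}. shuffle_sign T (S - T) * even_mul i a (T, l) * b (S - T, m - l)) =
      (\<Sum>l\<in>{l. l \<subseteq># m}. if i \<in># l then shuffle_sign T (S - T) * a (T, l - {#i#}) * b (S - T, m - l) else 0)"
      by (auto simp: even_mul_def intro!: sum.cong)
    also have "\<dots> = (if i \<in># m then \<Sum>l\<in>{l. l \<subseteq># m - {#i#}}.
        shuffle_sign T (S - T) * a (T, add_mset i l - {#i#}) * b (S - T, m - add_mset i l) else 0)"
      by (rule sum_submultisets_remove)
    also have "m - add_mset i l = m - {#i#} - l" for l by simp
    finally show ?thesis by simp
  qed
  then show "(even_mul i a \<odot> b) (S, m) = even_mul i (a \<odot> b) (S, m)"
    by (simp add: smult_def even_mul_def)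
qed

lemma smult_add_left: "(a + b) \<odot> c = a \<odot> c + b \<odot> c"
  by (auto simp: smult_def fun_eq_iff algebra_simps sum.distrib)

lemma smult_add_right: "a \<odot> (b + c) = a \<odot> b + a \<odot> c"
  by (auto simp: smult_def fun_eq_iff algebra_simps sum.distrib)

lemma smult_scaleR_left: "(x *\<^sub>R a) \<odot> c = x *\<^sub>R (a \<odot> c)"
  by (auto simp: smult_def fun_eq_iff algebra_simps scaleR_fun_def sum_distrib_left)

lemma smult_scaleR_right: "a \<odot> (x *\<^sub>R c) = x *\<^sub>R (a \<odot> c)"
  by (auto simp: smult_def fun_eq_iff algebra_simps scaleR_fun_def sum_distrib_left)

lemma is_gpolyI: "finite K \<Longrightarrow> (\<And>S m. a (S, m) \<noteq> 0 \<Longrightarrow> (S, m) \<in> K \<and> finite S) \<Longrightarrow> is_gpoly a"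
  unfolding is_gpoly_def using finite_subset[of "{k. a k \<noteq> 0}" K] by (simp add: subset_iff)

lemma is_gpoly_image:
  assumes "is_gpoly a"
    and "\<And>S m. b (S, m) \<noteq> 0 \<Longrightarrow> \<exists>S' m'. a (S', m') \<noteq> 0 \<and> h (S', m') = (S, m) \<and> (finite S' \<longrightarrow> finite S)"
  shows "is_gpoly b"
proof (rule is_gpolyI[of "h ` {k. a k \<noteq> 0}"])
  show "finite (h ` {k. a k \<noteq> 0})" using assms(1) by (simp add: is_gpoly_def)
  fix S m assume "b (S, m) \<noteq> 0"
  then obtain S' m' where "a (S', m') \<noteq> 0" "h (S', m') = (S, m)" "finite S' \<longrightarrow> finite S"
    using assms(2) by blast
  moreover have "finite S'" using assms(1) calculation(1) by (auto simp: is_gpoly_def)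
  ultimately show "(S, m) \<in> h ` {k. a k \<noteq> 0} \<and> finite S"
    by (metis (mono_tags, lifting) image_eqI mem_Collect_eq)
qed

lemma is_gpoly_fst: "is_gpoly a \<Longrightarrow> a (S, m) \<noteq> 0 \<Longrightarrow> finite S"
  by (auto simp: is_gpoly_def)

lemma is_gpoly_zero: "is_gpoly 0"
  by (simp add: is_gpoly_def)

lemma is_gpoly_smonom: "finite (fst k) \<Longrightarrow> is_gpoly (smonom k)"
  by (rule is_gpolyI[of "{k}"]) (auto simp: smonom_def split: if_splits)

lemma is_gpoly_add: "is_gpoly a \<Longrightarrow> is_gpoly b \<Longrightarrow> is_gpoly (a + b)"
  by (rule is_gpolyI[of "{k. a k \<noteq> 0} \<union> {k. b k \<noteq> 0}"])
    (auto simp: is_gpoly_def, metis add.right_neutral)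

lemma is_gpoly_uminus: "is_gpoly a \<Longrightarrow> is_gpoly (- a)"
  by (rule is_gpolyI[of "{k. a k \<noteq> 0}"]) (auto simp: is_gpoly_def)

lemma is_gpoly_diff: "is_gpoly a \<Longrightarrow> is_gpoly b \<Longrightarrow> is_gpoly (a - b)"
  using is_gpoly_add[of a "- b"] is_gpoly_uminus by simp

lemma is_gpoly_scaleR: "is_gpoly a \<Longrightarrow> is_gpoly (x *\<^sub>R a)"
  by (rule is_gpolyI[of "{k. a k \<noteq> 0}"]) (auto simp: is_gpoly_def scaleR_fun_def)

lemma is_gpoly_lderiv: "is_gpoly a \<Longrightarrow> is_gpoly (lderiv s a)"
  by (erule is_gpoly_image[where h = "\<lambda>(S, m). (S - {s}, m)"])
    (auto simp: lderiv_def split: if_splits intro!: exI[of _ "insert s _"])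

lemma is_gpoly_rderiv: "is_gpoly a \<Longrightarrow> is_gpoly (rderiv s a)"
  by (erule is_gpoly_image[where h = "\<lambda>(S, m). (S - {s}, m)"])
    (auto simp: rderiv_def split: if_splits intro!: exI[of _ "insert s _"])

lemma is_gpoly_pderiv_p: "is_gpoly a \<Longrightarrow> is_gpoly (pderiv_p i a)"
  by (erule is_gpoly_image[where h = "\<lambda>(S, m). (S, m - {#i#})"])
    (force simp: pderiv_p_def split: if_splits)

lemma is_gpoly_grading_inv: "is_gpoly a \<Longrightarrow> is_gpoly (grading_inv a)"
  by (rule is_gpolyI[of "{k. a k \<noteq> 0}"]) (auto simp: is_gpoly_def grading_inv_def)

lemma is_gpoly_smult:
  assumes "is_gpoly a" "is_gpoly b"
  shows "is_gpoly (a \<odot> b)"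
proof (rule is_gpolyI[of "(\<lambda>((S, m), (T, l)). (S \<union> T, m + l)) ` ({k. a k \<noteq> 0} \<times> {k. b k \<noteq> 0})"])
  show "finite ((\<lambda>((S, m), (T, l)). (S \<union> T, m + l)) ` ({k. a k \<noteq> 0} \<times> {k. b k \<noteq> 0}))"
    using assms by (auto simp: is_gpoly_def)
  fix S :: "nat set" and m :: "nat multiset"
  assume nz: "(a \<odot> b) (S, m) \<noteq> 0"
  then have "finite S" using smult_infinite by blast
  moreover have "(\<Sum>T\<in>Pow S. \<Sum>l\<in>{l. l \<subseteq># m}. shuffle_sign T (S - T) * a (T, l) * b (S - T, m - l)) \<noteq> 0"
    using nz by (simp add: smult_def)
  then obtain T where T: "T \<in> Pow S" and
    "(\<Sum>l\<in>{l. l \<subseteq># m}. shuffle_sign T (S - T) * a (T, l) * b (S - T, m - l)) \<noteq> 0"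
    by (rule sum.not_neutral_contains_not_neutral)
  then obtain l where "l \<in> {l. l \<subseteq># m}" "shuffle_sign T (S - T) * a (T, l) * b (S - T, m - l) \<noteq> 0"
    by (elim sum.not_neutral_contains_not_neutral)
  then have l: "l \<subseteq># m" and "a (T, l) \<noteq> 0" "b (S - T, m - l) \<noteq> 0" by auto
  moreover have "(S, m) = (T \<union> (S - T), l + (m - l))" using T l by auto
  ultimately show "(S, m) \<in> (\<lambda>((S, m), (T, l)). (S \<union> T, m + l)) ` ({k. a k \<noteq> 0} \<times> {k. b k \<noteq> 0}) \<and> finite S"
    by (force simp: image_iff)
qed

text \<open>No sign arises since \<open>s\<close> precedes all of \<open>S\<close>. Monomials can
  thus be built by left multiplications if the odd generators are added in decreasing order.\<close>

lemma odd_mul_smonom: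
  assumes "\<And>t. t \<in> S \<Longrightarrow> s < t"
  shows "odd_mul s (smonom (S, m)) = smonom (insert s S, m)"
proof -
  have s: "s \<notin> S" using assms by blast
  have e: "{t \<in> insert s S. t < s} = {}" using assms by (auto dest: order_less_trans)
  have "odd_mul s (smonom (S, m)) (T, l) = smonom (insert s S, m) (T, l)" for T l
  proof (cases "T = insert s S")
    case True
    show ?thesis unfolding True odd_mul_def prod.case e using s by (simp add: smonom_def)
  next
    case False
    then have "s \<in> T \<Longrightarrow> T - {s} \<noteq> S" by blast
    then show ?thesis using False by (simp add: odd_mul_def smonom_def)
  qed
  then show ?thesis by auto
qed

lemma even_mul_smonom: "even_mul i (smonom (S, m)) = smonom (S, add_mset i m)"
  by (auto simp: even_mul_def smonom_def fun_eq_iff)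

lemma sum_fun_apply: "sum f I x = (\<Sum>i\<in>I. f i x)"
  by (induction I rule: infinite_finite_induct) simp_all

lemma is_gpoly_expand:
  assumes "is_gpoly a"
  shows "a = (\<Sum>k\<in>{k. a k \<noteq> 0}. a k *\<^sub>R smonom k)"
proof
  fix k
  have "(\<Sum>k\<in>{k. a k \<noteq> 0}. a k *\<^sub>R smonom k) l = (\<Sum>k\<in>{k. a k \<noteq> 0}. if k = l then a k else 0)" for l
    by (simp add: sum_fun_apply scaleR_fun_def smonom_def) (rule sum.cong, auto)
  then show "a k = (\<Sum>k\<in>{k. a k \<noteq> 0}. a k *\<^sub>R smonom k) k"
    using assms by (simp add: is_gpoly_def)
qed

text \<open>Polynomials are combinations of products of generators, applied one at a time from the
  left to the unit. Zero is no separate case, being \<open>0 *\<^sub>R sone\<close>.\<close>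

lemma is_gpoly_induct [consumes 1, case_names one odd even add scaleR]:
  assumes a: "is_gpoly a"
    and one: "P sone"
    and o: "\<And>s a. is_gpoly a \<Longrightarrow> P a \<Longrightarrow> P (odd_mul s a)"
    and e: "\<And>i a. is_gpoly a \<Longrightarrow> P a \<Longrightarrow> P (even_mul i a)"
    and add: "\<And>a b. is_gpoly a \<Longrightarrow> is_gpoly b \<Longrightarrow> P a \<Longrightarrow> P b \<Longrightarrow> P (a + b)"
    and sc: "\<And>x a. is_gpoly a \<Longrightarrow> P a \<Longrightarrow> P (x *\<^sub>R a)"
  shows "P a"
proof -
  have m1: "P (smonom ({}, m))" for m
    by (induction m) (use one e in \<open>auto simp: sone_def even_mul_smonom[symmetric] is_gpoly_smonom\<close>)
  have m: "P (smonom (S, m))" if "finite S" for S m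
    using that
  proof (induction S rule: finite_linorder_min_induct)
    case empty
    then show ?case by (rule m1)
  next
    case (insert s S)
    then show ?case using o[of "smonom (S, m)" s] by (simp add: odd_mul_smonom is_gpoly_smonom)
  qed
  have "P (0 *\<^sub>R sone)" using one by (intro sc) (simp_all add: sone_def is_gpoly_smonom)
  then have zero: "P 0" by simp
  have "P (\<Sum>k\<in>K. a k *\<^sub>R smonom k) \<and> is_gpoly (\<Sum>k\<in>K. a k *\<^sub>R smonom k)" if "finite K" "K \<subseteq> {k. a k \<noteq> 0}" for K
    using that
  proof (induction K)
    case empty
    show ?case unfolding sum.empty using zero is_gpoly_zero ..
  next
    case (insert k K)
    obtain S l where k: "k = (S, l)" by fastforce
    have f: "finite S" using insert.prems a is_gpoly_fst k by auto
    have "is_gpoly (a k *\<^sub>R smonom k)" "P (a k *\<^sub>R smonom k)"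
      using m[OF f] f by (auto simp: k is_gpoly_smonom is_gpoly_scaleR intro!: sc)
    moreover have "(\<Sum>k\<in>insert k K. a k *\<^sub>R smonom k) = a k *\<^sub>R smonom k + (\<Sum>k\<in>K. a k *\<^sub>R smonom k)"
      by (rule sum.insert[OF insert.hyps])
    moreover have "P (\<Sum>k\<in>K. a k *\<^sub>R smonom k)" "is_gpoly (\<Sum>k\<in>K. a k *\<^sub>R smonom k)"
      using insert by blast+
    ultimately show ?case by (simp only: add is_gpoly_add simp_thms)
  qed
  then show ?thesis using is_gpoly_expand[OF a] a by (metis (no_types, lifting) is_gpoly_def order_refl)
qed

lemma sone_smult: "is_gpoly b \<Longrightarrow> sone \<odot> b = b"
proof (intro ext, clarify)
  fix S :: "nat set" and m :: "nat multiset"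
  assume b: "is_gpoly b"
  show "(sone \<odot> b) (S, m) = b (S, m)"
  proof (cases "finite S")
    case True
    have "(sone \<odot> b) (S, m) = (\<Sum>T\<in>Pow S. if T = {} then \<Sum>l\<in>{l. l \<subseteq># m}. if l = {#} then b (S, m) else 0 else 0)"
      by (auto simp: smult_def sone_def smonom_def shuffle_sign_def intro!: sum.cong)
    then show ?thesis using True by (simp add: finite_submultisets)
  next
    case False
    then show ?thesis using b is_gpoly_fst smult_infinite by metis
  qed
qed

lemma smult_sone: "is_gpoly a \<Longrightarrow> a \<odot> sone = a"
proof (induction a rule: is_gpoly_induct)
  case one
  show ?case by (rule sone_smult) (simp add: sone_def is_gpoly_smonom)
qed (simp_all only: odd_mul_smult even_mul_smult smult_add_left smult_scaleR_left)

lemma smult_assoc: "is_gpoly a \<Longrightarrow> is_gpoly b \<Longrightarrow> is_gpoly c \<Longrightarrow> a \<odot> b \<odot> c = a \<odot> (b \<odot> c)"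
  by (induction a rule: is_gpoly_induct)
    (simp_all only: sone_smult is_gpoly_smult odd_mul_smult even_mul_smult smult_add_left smult_scaleR_left)

text \<open>On these functions the product is associative and has a unit. As a type they form an
  instance of \<open>real_algebra_1\<close>, so that ring simplification applies;
  \<open>coef\<close> leads back to coefficients.\<close>

typedef gpoly = "{a. is_gpoly a}"
  morphisms coef Abs_gpoly
  using is_gpoly_zero by blast

setup_lifting type_definition_gpoly

instantiation gpoly :: real_algebra_1
begin

lift_definition zero_gpoly :: gpoly is "0" by (rule is_gpoly_zero)
lift_definition one_gpoly :: gpoly is sone by (simp add: sone_def is_gpoly_smonom)
lift_definition plus_gpoly :: "gpoly \<Rightarrow> gpoly \<Rightarrow> gpoly" is "(+)" by (rule is_gpoly_add)
lift_definition minus_gpoly :: "gpoly \<Rightarrow> gpoly \<Rightarrow> gpoly" is "(-)" by (rule is_gpoly_diff)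
lift_definition uminus_gpoly :: "gpoly \<Rightarrow> gpoly" is "uminus" by (rule is_gpoly_uminus)
lift_definition scaleR_gpoly :: "real \<Rightarrow> gpoly \<Rightarrow> gpoly" is scaleR by (rule is_gpoly_scaleR)
lift_definition times_gpoly :: "gpoly \<Rightarrow> gpoly \<Rightarrow> gpoly" is smult by (rule is_gpoly_smult)

instance
proof
  fix a b c :: gpoly and x y :: real
  show "a + b + c = a + (b + c)" by transfer (rule add.assoc)
  show "a + b = b + a" by transfer (rule add.commute)
  show "0 + a = a" by transfer (rule add_0)
  show "- a + a = 0" by transfer (rule left_minus)
  show "a - b = a + - b" by transfer (rule diff_conv_add_uminus)
  show "a * b * c = a * (b * c)" by transfer (rule smult_assoc)
  show "(a + b) * c = a * c + b * c" by transfer (rule smult_add_left)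
  show "a * (b + c) = a * b + a * c" by transfer (rule smult_add_right)
  show "1 * a = a" by transfer (rule sone_smult)
  show "a * 1 = a" by transfer (rule smult_sone)
  show "(0::gpoly) \<noteq> 1" by transfer (simp add: sone_def smonom_def fun_eq_iff)
  show "x *\<^sub>R (a + b) = x *\<^sub>R a + x *\<^sub>R b" by transfer (rule scaleR_add_right)
  show "(x + y) *\<^sub>R a = x *\<^sub>R a + y *\<^sub>R a" by transfer (rule scaleR_add_left)
  show "x *\<^sub>R y *\<^sub>R a = (x * y) *\<^sub>R a" by transfer (rule scaleR_scaleR)
  show "1 *\<^sub>R a = a" by transfer (rule scaleR_one)
  show "x *\<^sub>R a * b = x *\<^sub>R (a * b)" by transfer (rule smult_scaleR_left)
  show "a * x *\<^sub>R b = x *\<^sub>R (a * b)" by transfer (rule smult_scaleR_right)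
qed

end

section \<open>Generators, derivatives and the parity involution on the algebra\<close>

lift_definition og :: "nat \<Rightarrow> gpoly" is sodd by (simp add: sodd_def is_gpoly_smonom)
lift_definition mg :: "nat \<Rightarrow> gpoly" is sp by (simp add: sp_def is_gpoly_smonom)
lift_definition dl :: "nat \<Rightarrow> gpoly \<Rightarrow> gpoly" is lderiv by (rule is_gpoly_lderiv)
lift_definition dr :: "nat \<Rightarrow> gpoly \<Rightarrow> gpoly" is rderiv by (rule is_gpoly_rderiv)
lift_definition dp :: "nat \<Rightarrow> gpoly \<Rightarrow> gpoly" is pderiv_p by (rule is_gpoly_pderiv_p)
lift_definition ginv :: "gpoly \<Rightarrow> gpoly" is grading_inv by (rule is_gpoly_grading_inv)

lemma coef_plus: "coef (a + b) k = coef a k + coef b k"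
  by transfer simp

lemma coef_uminus: "coef (- a) k = - coef a k"
  by transfer simp

lemma coef_scaleR: "coef (x *\<^sub>R a) k = x * coef a k"
  by transfer (simp add: scaleR_fun_def)

lemma coef_zero: "coef 0 k = 0"
  by transfer simp

lemma coef_sum: "coef (sum f I) k = (\<Sum>i\<in>I. coef (f i) k)"
  by (induction I rule: infinite_finite_induct) (simp_all add: coef_zero coef_plus)

lemma odd_mul_sone: "odd_mul s sone = sodd s"
  using odd_mul_smonom[of "{}" s "{#}"] by (simp add: sone_def sodd_def)

lemma even_mul_sone: "even_mul i sone = sp i"
  by (simp add: sone_def sp_def even_mul_smonom)

lemma sodd_smult: "is_gpoly a \<Longrightarrow> sodd s \<odot> a = odd_mul s a"
  by (simp only: odd_mul_sone[symmetric] odd_mul_smult sone_smult)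

lemma sp_smult: "is_gpoly a \<Longrightarrow> sp i \<odot> a = even_mul i a"
  by (simp only: even_mul_sone[symmetric] even_mul_smult sone_smult)

lemma gpoly_induct [case_names one odd mom add scaleR]:
  assumes "P 1" "\<And>s a. P a \<Longrightarrow> P (og s * a)" "\<And>i a. P a \<Longrightarrow> P (mg i * a)"
    "\<And>a b. P a \<Longrightarrow> P b \<Longrightarrow> P (a + b)" "\<And>x a. P a \<Longrightarrow> P (x *\<^sub>R a)"
  shows "P a"
proof -
  have "\<forall>a. coef a = b \<longrightarrow> P a" if "is_gpoly b" for b
    using that
  proof (induction b rule: is_gpoly_induct)
    case one
    then show ?case using assms(1) one_gpoly.rep_eq coef_inject by metis
  next
    case (odd s b)
    have "coef a = odd_mul s b \<Longrightarrow> a = og s * Abs_gpoly b" for a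
      using odd.hyps by (simp add: coef_inject[symmetric] times_gpoly.rep_eq og.rep_eq Abs_gpoly_inverse sodd_smult)
    moreover have "P (og s * Abs_gpoly b)"
      using odd by (intro assms(2)) (simp add: Abs_gpoly_inverse)
    ultimately show ?case by blast
  next
    case (even s b)
    have "coef a = even_mul s b \<Longrightarrow> a = mg s * Abs_gpoly b" for a
      using even.hyps by (simp add: coef_inject[symmetric] times_gpoly.rep_eq mg.rep_eq Abs_gpoly_inverse sp_smult)
    moreover have "P (mg s * Abs_gpoly b)"
      using even by (intro assms(3)) (simp add: Abs_gpoly_inverse)
    ultimately show ?case by blast
  next
    case (add b c)
    have "coef a = b + c \<Longrightarrow> a = Abs_gpoly b + Abs_gpoly c" for a
      using add.hyps by (simp add: coef_inject[symmetric] plus_gpoly.rep_eq Abs_gpoly_inverse)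
    moreover have "P (Abs_gpoly b + Abs_gpoly c)"
      using add by (intro assms(4)) (simp_all add: Abs_gpoly_inverse)
    ultimately show ?case by blast
  next
    case (scaleR x b)
    have "coef a = x *\<^sub>R b \<Longrightarrow> a = x *\<^sub>R Abs_gpoly b" for a
      using scaleR.hyps by (simp add: coef_inject[symmetric] scaleR_gpoly.rep_eq Abs_gpoly_inverse)
    moreover have "P (x *\<^sub>R Abs_gpoly b)"
      using scaleR by (intro assms(5)) (simp add: Abs_gpoly_inverse)
    ultimately show ?case by blast
  qed
  then show ?thesis using coef[of a] by blast
qed

lemma card_less_insert:
  assumes "finite S" "t \<notin> S"
  shows "card {u \<in> insert t S. u < s} = card {u\<in>S. u < s} + (if t < s then 1 else 0)"
proof -
  have "{u \<in> insert t S. u < s} = (if t < s then insert t {u\<in>S. u < s} else {u\<in>S. u < s})" by auto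
  then show ?thesis using assms by auto
qed

lemma card_less_remove:
  assumes "finite S" "t \<in> S"
  shows "card {u\<in>S. u < s} = card {u \<in> S - {t}. u < s} + (if t < s then 1 else 0)"
  using card_less_insert[of "S - {t}" t s] assms by (simp add: insert_absorb)

text \<open>Deleting \<open>t\<close> changes the position of \<open>s\<close> if and only if
  \<open>t < s\<close>, and vice versa. Exactly one of the two signs therefore changes when the
  order of the multiplications is reversed.\<close>

lemma odd_mul_anticomm:
  assumes "is_gpoly a"
  shows "odd_mul s (odd_mul t a) = - odd_mul t (odd_mul s a)"
proof (intro ext, clarify)
  fix S m
  show "odd_mul s (odd_mul t a) (S, m) = (- odd_mul t (odd_mul s a)) (S, m)"
  proof (cases "finite S \<and> s \<in> S \<and> t \<in> S \<and> s \<noteq> t")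
    case True
    then have "card {u\<in>S. u < s} = card {u\<in>S - {t}. u < s} + (if t < s then 1 else 0)"
      "card {u\<in>S. u < t} = card {u\<in>S - {s}. u < t} + (if s < t then 1 else 0)"
      using card_less_remove[of S t s] card_less_remove[of S s t] by blast+
    moreover have "S - {t} - {s} = S - {s} - {t}" by blast
    ultimately show ?thesis using True by (cases "s < t") (simp_all add: odd_mul_def)
  next
    case False
    have "infinite S \<Longrightarrow> a (S - {t} - {s}, m) = 0 \<and> a (S - {s} - {t}, m) = 0"
      using is_gpoly_fst[OF assms] by (metis finite_Diff2 finite.emptyI finite_insert)
    then show ?thesis using False by (auto simp: odd_mul_def)
  qed
qed

lemma odd_anticomm: "og s * og t = - (og t * og s)"
proof transfer
  fix s t
  have g: "is_gpoly (sodd u)" for u by (simp add: sodd_def is_gpoly_smonom)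
  have "sodd s \<odot> sodd t = odd_mul s (odd_mul t sone)" for s t
    by (simp add: sodd_smult g odd_mul_sone)
  then show "sodd s \<odot> sodd t = - (sodd t \<odot> sodd s)"
    using odd_mul_anticomm[of sone s t] by (simp add: sone_def is_gpoly_smonom)
qed

lemma mom_odd: "mg i * og s = og s * mg i"
proof transfer
  fix i s
  have g: "is_gpoly (sodd s)" "is_gpoly (sp i)" by (simp_all add: sodd_def sp_def is_gpoly_smonom)
  have "even_mul i (odd_mul s sone) = odd_mul s (even_mul i sone)"
    by (auto simp: odd_mul_def even_mul_def fun_eq_iff)
  then show "sp i \<odot> sodd s = sodd s \<odot> sp i" unfolding sodd_smult[OF g(2)] sp_smult[OF g(1)]
    by (simp only: odd_mul_sone even_mul_sone)
qed

lemma mom_mom: "mg i * mg j = mg j * mg i"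
proof transfer
  fix i j
  have g: "is_gpoly (sp i)" for i by (simp add: sp_def is_gpoly_smonom)
  show "sp i \<odot> sp j = sp j \<odot> sp i"
    unfolding sp_smult[OF g] by (simp add: sp_def even_mul_smonom add_mset_commute)
qed

text \<open>The canonical anticommutation relation between a left derivative and a left
  multiplication. The Leibniz rule for arbitrary products follows from it by induction over
  generators.\<close>

lemma lderiv_odd_mul:
  assumes "is_gpoly a"
  shows "lderiv s (odd_mul t a) = (if s = t then a else 0) - odd_mul t (lderiv s a)"
proof (intro ext, clarify)
  fix S m
  show "lderiv s (odd_mul t a) (S, m) = ((if s = t then a else 0) - odd_mul t (lderiv s a)) (S, m)"
  proof (cases "finite S")
    case False
    then have "a (insert s S - {t}, m) = 0" "a (S, m) = 0" "a (insert s (S - {t}), m) = 0"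
      using is_gpoly_fst[OF assms] False by (metis finite_Diff2 finite.emptyI finite_insert)+
    then show ?thesis by (auto simp: odd_mul_def lderiv_def)
  next
    case fin: True
    show ?thesis
    proof (cases "s = t")
      case True
      show ?thesis
      proof (cases "t \<in> S")
        case True
        have "card {u\<in>S - {t}. u < t} = card {u\<in>S. u < t}"
          by (rule arg_cong[where f = card]) auto
        moreover have "insert t (S - {t}) = S" using True by blast
        ultimately show ?thesis using True \<open>s = t\<close> by (simp add: odd_mul_def lderiv_def)
      next
        case False
        have "card {u\<in>insert t S. u < t} = card {u\<in>S. u < t}"
          by (rule arg_cong[where f = card]) auto
        moreover have "insert t S - {t} = S" using False by blast
        ultimately show ?thesis using False \<open>s = t\<close> by (simp add: odd_mul_def lderiv_def)
      qed
    next
      case False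
      show ?thesis
      proof (cases "t \<in> S \<and> s \<notin> S")
        case True
        have "card {u\<in>S. u < s} = card {u\<in>S - {t}. u < s} + (if t < s then 1 else 0)"
          "card {u\<in>insert s S. u < t} = card {u\<in>S. u < t} + (if s < t then 1 else 0)"
          using True fin by (intro card_less_remove card_less_insert; simp)+
        moreover have "insert s S - {t} = insert s (S - {t})" using False by auto
        ultimately show ?thesis using True False by (auto simp: odd_mul_def lderiv_def)
      qed (use False in \<open>auto simp: odd_mul_def lderiv_def\<close>)
    qed
  qed
qed

lemma dl_odd: "dl s (og t * a) = (if s = t then a else 0) - og t * dl s a"
proof transfer
  fix s t a assume "is_gpoly a"
  then show "lderiv s (sodd t \<odot> a) = (if s = t then a else 0) - sodd t \<odot> lderiv s a"
    by (simp only: sodd_smult is_gpoly_lderiv lderiv_odd_mul)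
qed

lemma dl_mom: "dl s (mg i * a) = mg i * dl s a"
proof transfer
  fix s i a assume a: "is_gpoly a"
  show "lderiv s (sp i \<odot> a) = sp i \<odot> lderiv s a"
    unfolding sp_smult[OF a] sp_smult[OF is_gpoly_lderiv[OF a]]
    by (auto simp: even_mul_def lderiv_def fun_eq_iff)
qed

lemma dp_odd: "dp i (og t * a) = og t * dp i a"
proof transfer
  fix t i a assume a: "is_gpoly a"
  show "pderiv_p i (sodd t \<odot> a) = sodd t \<odot> pderiv_p i a"
    unfolding sodd_smult[OF a] sodd_smult[OF is_gpoly_pderiv_p[OF a]]
    by (auto simp: odd_mul_def pderiv_p_def fun_eq_iff)
qed

lemma dp_mom: "dp i (mg j * a) = (if i = j then a else 0) + mg j * dp i a"
proof transfer
  fix i j a assume a: "is_gpoly a"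
  show "pderiv_p i (sp j \<odot> a) = (if i = j then a else 0) + sp j \<odot> pderiv_p i a"
    unfolding sp_smult[OF a] sp_smult[OF is_gpoly_pderiv_p[OF a]]
    by (auto simp: even_mul_def pderiv_p_def fun_eq_iff algebra_simps
        not_in_iff dest!: multi_member_split)
qed

lemma grading_inv_sodd:
  assumes a: "is_gpoly a"
  shows "grading_inv (sodd t \<odot> a) = - (sodd t \<odot> grading_inv a)"
  proof (intro ext, clarify)
    fix S m
    show "grading_inv (sodd t \<odot> a) (S, m) = (- (sodd t \<odot> grading_inv a)) (S, m)"
    proof (cases "finite S")
      case True
      have "t \<in> S \<Longrightarrow> (- 1) ^ card S = - ((- 1 :: real) ^ card (S - {t}))"
        using card.remove[OF True] by (metis mult_minus1 power_Suc)
      then show ?thesis unfolding sodd_smult[OF a] fun_Compl_def sodd_smult[OF is_gpoly_grading_inv[OF a]]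
        by (auto simp: odd_mul_def grading_inv_def)
    next
      case False
      then show ?thesis using is_gpoly_fst[OF a, of "S - {t}" m]
        unfolding sodd_smult[OF a] fun_Compl_def sodd_smult[OF is_gpoly_grading_inv[OF a]]
        by (auto simp: odd_mul_def grading_inv_def)
    qed
  qed

lemma ginv_odd: "ginv (og t * a) = - (og t * ginv a)"
  unfolding coef_inject[symmetric]
  by (simp only: ginv.rep_eq times_gpoly.rep_eq uminus_gpoly.rep_eq og.rep_eq grading_inv_sodd coef[simplified])

lemma ginv_mom: "ginv (mg i * a) = mg i * ginv a"
proof transfer
  fix i a assume a: "is_gpoly a"
  show "grading_inv (sp i \<odot> a) = sp i \<odot> grading_inv a"
    unfolding sp_smult[OF a] sp_smult[OF is_gpoly_grading_inv[OF a]]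
    by (auto simp: even_mul_def grading_inv_def fun_eq_iff)
qed

lemma dl_one [simp]: "dl s 1 = 0" and dp_one [simp]: "dp i 1 = 0" and ginv_one [simp]: "ginv 1 = 1"
  by (transfer, auto simp: lderiv_def pderiv_p_def grading_inv_def sone_def smonom_def fun_eq_iff)+

lemma ginv_linear [simp]:
  "ginv 0 = 0" "ginv (a + b) = ginv a + ginv b" "ginv (a - b) = ginv a - ginv b"
  "ginv (- a) = - ginv a" "ginv (x *\<^sub>R a) = x *\<^sub>R ginv a"
  by (transfer, auto simp: grading_inv_def fun_eq_iff algebra_simps scaleR_fun_def)+

lemma dl_linear [simp]:
  "dl s 0 = 0" "dl s (a + b) = dl s a + dl s b" "dl s (a - b) = dl s a - dl s b"
  "dl s (- a) = - dl s a" "dl s (x *\<^sub>R a) = x *\<^sub>R dl s a"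
  by (transfer, auto simp: lderiv_def fun_eq_iff algebra_simps scaleR_fun_def)+

lemma dp_linear [simp]:
  "dp s 0 = 0" "dp s (a + b) = dp s a + dp s b" "dp s (a - b) = dp s a - dp s b"
  "dp s (- a) = - dp s a" "dp s (x *\<^sub>R a) = x *\<^sub>R dp s a"
  by (transfer, auto simp: pderiv_p_def fun_eq_iff algebra_simps scaleR_fun_def)+

lemma ginv_sum: "ginv (sum f I) = (\<Sum>i\<in>I. ginv (f i))"
  by (induction I rule: infinite_finite_induct) simp_all

lemma dl_sum: "dl s (sum f I) = (\<Sum>i\<in>I. dl s (f i))"
  by (induction I rule: infinite_finite_induct) simp_all

lemma dp_sum: "dp s (sum f I) = (\<Sum>i\<in>I. dp s (f i))"
  by (induction I rule: infinite_finite_induct) simp_all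

lemma dl_gen [simp]: "dl s (og t) = (if s = t then 1 else 0)" "dl s (mg i) = 0"
  using dl_odd[of s t 1] dl_mom[of s i 1] by simp_all

lemma dp_gen [simp]: "dp i (og t) = 0" "dp i (mg j) = (if i = j then 1 else 0)"
  using dp_odd[of i t 1] dp_mom[of i j 1] by simp_all

lemma ginv_gen [simp]: "ginv (og t) = - og t" "ginv (mg i) = mg i"
  using ginv_odd[of t 1] ginv_mom[of i 1] by simp_all

lemma ginv_mult: "ginv (a * b) = ginv a * ginv b"
  by (induction a rule: gpoly_induct)
    (simp_all add: ginv_odd ginv_mom mult.assoc distrib_right)

lemma ginv_ginv [simp]: "ginv (ginv a) = a"
  by (induction a rule: gpoly_induct) (simp_all add: ginv_odd ginv_mom)

lemma dp_mult: "dp i (a * b) = dp i a * b + a * dp i b"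
  by (induction a rule: gpoly_induct)
    (simp_all add: dp_odd dp_mom mult.assoc distrib_right distrib_left scaleR_add_right algebra_simps)

lemma dl_mult: "dl s (a * b) = dl s a * b + ginv a * dl s b"
  by (induction a rule: gpoly_induct)
    (simp_all add: dl_odd dl_mom ginv_odd ginv_mom mult.assoc algebra_simps)

text \<open>Graded commutativity with a generator as one factor: \<open>ginv\<close> collects one
  sign for each odd generator in \<open>z\<close>.\<close>

lemma odd_comm: "og s * z = ginv z * og s"
proof (induction z rule: gpoly_induct)
  case (odd t a)
  have "og s * (og t * a) = - (og t * (og s * a))"
    by (simp add: mult.assoc[symmetric] odd_anticomm[of s t])
  then show ?case by (simp add: odd ginv_odd mult.assoc)
next
  case (mom i a)
  have "og s * (mg i * a) = mg i * (og s * a)"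
    by (simp add: mult.assoc[symmetric] mom_odd)
  then show ?case by (simp add: mom ginv_mom mult.assoc)
qed (simp_all add: algebra_simps)

lemma mom_comm: "mg i * z = z * mg i"
proof (induction z rule: gpoly_induct)
  case (odd t a)
  have "mg i * (og t * a) = og t * (mg i * a)"
    by (simp add: mult.assoc[symmetric] mom_odd)
  then show ?case by (simp add: odd mult.assoc)
next
  case (mom j a)
  have "mg i * (mg j * a) = mg j * (mg i * a)"
    by (simp add: mult.assoc[symmetric] mom_mom[of i j])
  then show ?case by (simp add: mom mult.assoc)
qed (simp_all add: algebra_simps)

lemma dl_dl: "dl s (dl t a) = - dl t (dl s a)"
  by (induction a rule: gpoly_induct) (simp_all add: dl_odd dl_mom algebra_simps)

lemma dl_dp: "dl s (dp i a) = dp i (dl s a)"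
  by (induction a rule: gpoly_induct) (simp_all add: dl_odd dl_mom dp_odd dp_mom algebra_simps)

lemma dp_dp: "dp i (dp j a) = dp j (dp i a)"
  by (induction a rule: gpoly_induct) (simp_all add: dp_odd dp_mom algebra_simps)

lemma dl_ginv: "dl s (ginv a) = - ginv (dl s a)"
  by (induction a rule: gpoly_induct) (simp_all add: dl_odd dl_mom ginv_odd ginv_mom algebra_simps)

lemma dp_ginv: "dp i (ginv a) = ginv (dp i a)"
  by (induction a rule: gpoly_induct) (simp_all add: dp_odd dp_mom ginv_odd ginv_mom algebra_simps)

text \<open>The two derivatives bring the generator to the front and to the back of a monomial;
  between these positions it passes each of the other \<open>card S\<close> odd generators once.
  Right derivatives can thus be eliminated from the bracket.\<close>

lemma dr_eq: "dr s a = ginv (dl s a)"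
proof transfer
  fix s a assume a: "is_gpoly a"
  show "rderiv s a = grading_inv (lderiv s a)"
  proof (intro ext, clarify)
    fix S m
    show "rderiv s a (S, m) = grading_inv (lderiv s a) (S, m)"
    proof (cases "finite S \<and> s \<notin> S")
      case True
      then have "x < s \<or> s < x" if "x \<in> S" for x using that by (cases x s rule: linorder_cases) auto
      then have "S = {t\<in>S. t < s} \<union> {t\<in>S. s < t}" by blast
      then have "card S = card ({t\<in>S. t < s} \<union> {t\<in>S. s < t})" by (rule arg_cong)
      also have "\<dots> = card {t\<in>S. t < s} + card {t\<in>S. s < t}"
        by (rule card_Un_disjoint) (use True in auto)
      finally show ?thesis using True by (simp add: rderiv_def grading_inv_def lderiv_def power_add mult_ac)
    next
      case False
      then show ?thesis using is_gpoly_fst[OF a, of "insert s S" m]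
        by (auto simp: rderiv_def grading_inv_def lderiv_def)
    qed
  qed
qed

subsection \<open>Substitution homomorphisms\<close>

definition ordprod :: "(nat \<Rightarrow> gpoly) \<Rightarrow> nat set \<Rightarrow> gpoly" where
  "ordprod G S = prod_list (map G (sorted_list_of_set S))"

definition mprod :: "(nat \<Rightarrow> gpoly) \<Rightarrow> nat multiset \<Rightarrow> gpoly" where
  "mprod P m = prod_list (map P (sorted_list_of_multiset m))"

definition gsub :: "(nat \<Rightarrow> gpoly) \<Rightarrow> (nat \<Rightarrow> gpoly) \<Rightarrow> gpoly \<Rightarrow> gpoly" where
  "gsub G P a = (\<Sum>(S, m)\<in>{k. coef a k \<noteq> 0}. coef a (S, m) *\<^sub>R (ordprod G S * mprod P m))"

lemma finite_coef [simp]: "finite {k. coef a k \<noteq> 0}"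
  using coef[of a] by (simp add: is_gpoly_def)

lemma coef_finite: "coef a (S, m) \<noteq> 0 \<Longrightarrow> finite S"
  using coef[of a] by (auto simp: is_gpoly_def)

lemma gsub_superset:
  assumes "finite K" "{k. coef a k \<noteq> 0} \<subseteq> K"
  shows "gsub G P a = (\<Sum>(S, m)\<in>K. coef a (S, m) *\<^sub>R (ordprod G S * mprod P m))"
  unfolding gsub_def by (rule sum.mono_neutral_left) (use assms in auto)

lemma gsub_add: "gsub G P (a + b) = gsub G P a + gsub G P b"
proof -
  let ?K = "{k. coef a k \<noteq> 0} \<union> {k. coef b k \<noteq> 0}"
  have f: "finite ?K" by simp
  have "{k. coef (a + b) k \<noteq> 0} \<subseteq> ?K" by (auto simp: coef_plus)
  then show ?thesis
    by (simp add: gsub_superset[OF f, of "a + b"] gsub_superset[OF f, of a] gsub_superset[OF f, of b]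
        coef_plus scaleR_add_left sum.distrib case_prod_unfold)
qed

lemma gsub_scaleR: "gsub G P (x *\<^sub>R a) = x *\<^sub>R gsub G P a"
proof -
  have "{k. coef (x *\<^sub>R a) k \<noteq> 0} \<subseteq> {k. coef a k \<noteq> 0}" by (auto simp: coef_scaleR)
  then show ?thesis unfolding gsub_superset[OF finite_coef \<open>_ \<subseteq> _\<close>]
    by (simp add: gsub_def coef_scaleR scaleR_sum_right case_prod_unfold)
qed

lemma gsub_zero [simp]: "gsub G P 0 = 0"
  by (simp add: gsub_def coef_zero)

lemma gsub_sum: "gsub G P (sum f I) = (\<Sum>i\<in>I. gsub G P (f i))"
  by (induction I rule: infinite_finite_induct) (simp_all add: gsub_add)

lemma ordprod_insert_min:
  assumes "finite S" "\<And>t. t \<in> S \<Longrightarrow> s < t"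
  shows "ordprod G (insert s S) = G s * ordprod G S"
proof -
  have "s \<notin> S" using assms by blast
  then have "sorted_list_of_set (insert s S) = insort s (sorted_list_of_set S)"
    using assms(1) by (simp add: sorted_list_of_set_insert_remove)
  also have "\<dots> = s # sorted_list_of_set S"
    by (rule insort_is_Cons) (use assms in \<open>auto simp: order_less_imp_le\<close>)
  finally show ?thesis by (simp add: ordprod_def)
qed

text \<open>The new factor moves to its place in the increasing product and picks up a sign at each
  smaller one. If it is already present, the product is zero, since anticommutation with itself
  forces its square to vanish.\<close>

lemma ordprod_mult:
  assumes ac: "\<And>s t. G s * G t = - (G t * G s)" and "finite S"
  shows "G s * ordprod G S =
    (if s \<in> S then 0 else (- 1) ^ card {t\<in>S. t < s} *\<^sub>R ordprod G (insert s S))"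
  using assms(2)
proof (induction S rule: finite_linorder_min_induct)
  case empty
  then show ?case using ordprod_insert_min[of "{}" s G] by simp
next
  case (insert b A)
  have sq: "G b * G b = 0" using ac[of b b] by (simp add: eq_neg_iff_add_eq_0 flip: scaleR_2)
  have b: "b \<notin> A" using insert by blast
  have e: "ordprod G (insert b A) = G b * ordprod G A"
    using insert by (intro ordprod_insert_min) auto
  consider "s = b" | "s < b" | "b < s" by linarith
  then show ?case
  proof cases
    case 1
    then show ?thesis unfolding e by (simp add: mult.assoc[symmetric] sq)
  next
    case 2
    then have s: "\<And>t. t \<in> insert b A \<Longrightarrow> s < t" using insert by (auto intro: less_trans)
    then have c: "{t \<in> insert b A. t < s} = {}" "s \<notin> insert b A" by (auto dest: less_asym)
    show ?thesis unfolding c(1) using c(2) ordprod_insert_min[of "insert b A" s G] s insert(1) by simp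
  next
    case 3
    have "G s * ordprod G (insert b A) = - (G b * (G s * ordprod G A))"
      unfolding e by (simp add: mult.assoc[symmetric] ac[of s b])
    also have "\<dots> = (if s \<in> A then 0 else (- 1) ^ Suc (card {t\<in>A. t < s}) *\<^sub>R (G b * ordprod G (insert s A)))"
      by (simp add: insert.IH)
    also have "G b * ordprod G (insert s A) = ordprod G (insert s (insert b A))"
      by (subst insert_commute, rule ordprod_insert_min[symmetric]) (use insert 3 in auto)
    also have "Suc (card {t\<in>A. t < s}) = card {t \<in> insert b A. t < s}"
      using card_less_insert[OF insert(1) b, of s] 3 by simp
    finally show ?thesis using 3 by auto
  qed
qed

lemma mprod_add:
  assumes "\<And>i z. P i * z = z * P i"
  shows "mprod P (add_mset i m) = P i * mprod P m"
proof -
  have "prod_list (map P (insort i xs)) = P i * prod_list (map P xs)" for xs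
    by (induction xs) (auto simp: mult.assoc[symmetric] assms[of i "P _"])
  then show ?thesis by (simp add: mprod_def)
qed

lemma coef_og: "coef (og s * a) (S, m) =
    (if s \<in> S then (- 1) ^ card {t\<in>S. t < s} * coef a (S - {s}, m) else 0)"
proof -
  have "coef (og s * a) = odd_mul s (coef a)"
    using coef[of a] by (simp add: times_gpoly.rep_eq og.rep_eq sodd_smult)
  then show ?thesis by (simp add: odd_mul_def)
qed

lemma coef_mg: "coef (mg i * a) (S, m) = (if i \<in># m then coef a (S, m - {#i#}) else 0)"
proof -
  have "coef (mg i * a) = even_mul i (coef a)"
    using coef[of a] by (simp add: times_gpoly.rep_eq mg.rep_eq sp_smult)
  then show ?thesis by (simp add: even_mul_def)
qed

lemma coef_one: "coef 1 k = (if k = ({}, {#}) then 1 else 0)"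
  by transfer (simp add: sone_def smonom_def)

lemma gsub_one: "gsub G P 1 = 1"
  by (simp add: gsub_superset[of "{({}, {#})}"] coef_one ordprod_def mprod_def)

lemma gsub_og:
  assumes ac: "\<And>s t. G s * G t = - (G t * G s)"
  shows "gsub G P (og s * a) = G s * gsub G P a"
proof -
  let ?A = "{k. coef a k \<noteq> 0}"
  let ?K = "(\<lambda>(S, m). (insert s S, m)) ` {k\<in>?A. s \<notin> fst k}"
  have "{k. coef (og s * a) k \<noteq> 0} \<subseteq> ?K"
  proof (clarify)
    fix S m assume "coef (og s * a) (S, m) \<noteq> 0"
    then have "s \<in> S" "coef a (S - {s}, m) \<noteq> 0" by (auto simp: coef_og split: if_splits)
    then show "(S, m) \<in> ?K" by (intro image_eqI[of _ _ "(S - {s}, m)"]) auto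
  qed
  then have "gsub G P (og s * a) = (\<Sum>(S, m)\<in>?K. coef (og s * a) (S, m) *\<^sub>R (ordprod G S * mprod P m))"
    by (intro gsub_superset) auto
  also have "\<dots> = (\<Sum>(S, m)\<in>{k\<in>?A. s \<notin> fst k}.
      coef (og s * a) (insert s S, m) *\<^sub>R (ordprod G (insert s S) * mprod P m))"
    by (subst sum.reindex) (auto simp: inj_on_def insert_ident intro!: sum.cong)
  also have "\<dots> = (\<Sum>(S, m)\<in>{k\<in>?A. s \<notin> fst k}. coef a (S, m) *\<^sub>R (G s * ordprod G S * mprod P m))"
  proof (rule sum.cong[OF refl], clarify)
    fix S m assume nz: "coef a (S, m) \<noteq> 0" and s: "s \<notin> fst (S, m)"
    then have f: "finite S" using coef_finite by blast
    have "{t \<in> insert s S. t < s} = {t \<in> S. t < s}" by auto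
    moreover have "insert s S - {s} = S" using s by auto
    ultimately show "coef (og s * a) (insert s S, m) *\<^sub>R (ordprod G (insert s S) * mprod P m) =
        coef a (S, m) *\<^sub>R (G s * ordprod G S * mprod P m)"
      using s by (simp add: coef_og ordprod_mult[where G = G, OF ac f] mult.commute)
  qed
  \<comment> \<open>The added terms have \<open>s\<close> in \<open>S\<close>; they vanish because a
    repeated anticommuting factor gives \<open>0\<close>.\<close>
  also have "\<dots> = (\<Sum>(S, m)\<in>?A. coef a (S, m) *\<^sub>R (G s * ordprod G S * mprod P m))"
    by (rule sum.mono_neutral_left)
      (auto simp: ordprod_mult[where G = G, OF ac] dest: coef_finite)
  also have "\<dots> = G s * gsub G P a"
    by (simp add: gsub_def sum_distrib_left mult.assoc case_prod_unfold)
  finally show ?thesis .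
qed

lemma gsub_mg:
  assumes c: "\<And>i z. P i * z = z * P i"
  shows "gsub G P (mg i * a) = P i * gsub G P a"
proof -
  let ?A = "{k. coef a k \<noteq> 0}"
  let ?K = "(\<lambda>(S, m). (S, add_mset i m)) ` ?A"
  have "{k. coef (mg i * a) k \<noteq> 0} \<subseteq> ?K"
  proof (clarify)
    fix S m assume "coef (mg i * a) (S, m) \<noteq> 0"
    then have "i \<in># m" "coef a (S, m - {#i#}) \<noteq> 0" by (auto simp: coef_mg split: if_splits)
    then show "(S, m) \<in> ?K" by (intro image_eqI[of _ _ "(S, m - {#i#})"]) auto
  qed
  then have "gsub G P (mg i * a) = (\<Sum>(S, m)\<in>?K. coef (mg i * a) (S, m) *\<^sub>R (ordprod G S * mprod P m))"
    by (intro gsub_superset) auto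
  also have "\<dots> = (\<Sum>(S, m)\<in>?A. coef a (S, m) *\<^sub>R (ordprod G S * mprod P (add_mset i m)))"
    by (subst sum.reindex) (auto simp: inj_on_def coef_mg intro!: sum.cong)
  also have "\<dots> = (\<Sum>(S, m)\<in>?A. P i * (coef a (S, m) *\<^sub>R (ordprod G S * mprod P m)))"
    by (intro sum.cong) (auto simp: mprod_add[where P = P, OF c] c[of i "ordprod G _"] simp flip: mult.assoc)
  also have "\<dots> = P i * gsub G P a"
    by (simp add: gsub_def sum_distrib_left case_prod_unfold)
  finally show ?thesis .
qed

text \<open>The derivations \<open>ad\<close> annihilate generators whose numbers are out of range.
  Sending these generators to \<open>0\<close> makes the intertwining relations true on every
  generator, and it changes nothing on polynomials in the generators of a chart.\<close>

definition restrict_gens :: "nat \<Rightarrow> (nat \<Rightarrow> gpoly) \<Rightarrow> nat \<Rightarrow> gpoly" where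
  "restrict_gens R G s = (if s < R then G s else 0)"

definition gens_in :: "nat \<Rightarrow> nat \<Rightarrow> gpoly \<Rightarrow> bool" where
  "gens_in R n a \<longleftrightarrow> (\<forall>S m. coef a (S, m) \<noteq> 0 \<longrightarrow> S \<subseteq> {..<R} \<and> set_mset m \<subseteq> {..<n})"

lemma ssubst_coef:
  assumes "gens_in R n a"
  shows "ssubst (\<lambda>s. coef (G s)) (\<lambda>i. coef (P i)) (coef a) =
    coef (gsub (restrict_gens R G) (restrict_gens n P) a)"
proof -
  have f: "foldr (\<odot>) (map (\<lambda>s. coef (H s)) xs) sone = coef (prod_list (map H xs))" for H and xs :: "nat list"
    by (induction xs) (simp_all add: one_gpoly.rep_eq times_gpoly.rep_eq)
  have "ordprod (restrict_gens R G) S * mprod (restrict_gens n P) m = ordprod G S * mprod P m"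
    if "coef a (S, m) \<noteq> 0" for S m
  proof -
    have "S \<subseteq> {..<R}" "set_mset m \<subseteq> {..<n}" "finite S"
      using assms that coef_finite by (auto simp: gens_in_def)
    then have "map (restrict_gens R G) (sorted_list_of_set S) = map G (sorted_list_of_set S)"
      "map (restrict_gens n P) (sorted_list_of_multiset m) = map P (sorted_list_of_multiset m)"
      by (auto simp: restrict_gens_def)
    then show ?thesis by (simp only: ordprod_def mprod_def)
  qed
  then have "gsub (restrict_gens R G) (restrict_gens n P) a = gsub G P a"
    unfolding gsub_def by (intro sum.cong) auto
  also have "coef \<dots> = ssubst (\<lambda>s. coef (G s)) (\<lambda>i. coef (P i)) (coef a)"
  proof
    fix k
    show "coef (gsub G P a) k = ssubst (\<lambda>s. coef (G s)) (\<lambda>i. coef (P i)) (coef a) k"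
      unfolding gsub_def coef_sum ssubst_def f sum_fun_apply
      by (intro sum.cong)
        (auto simp: coef_scaleR scaleR_fun_def times_gpoly.rep_eq ordprod_def mprod_def)
  qed
  finally show ?thesis ..
qed

text \<open>Both sides are derivations along the homomorphism \<open>gsub G P\<close>, so they agree
  once they agree on generators. The conditions on \<open>ginv\<close> say that the homomorphism
  preserves parity, as the sign in the Leibniz rule demands.\<close>

lemma gsub_odd_derivation:
  assumes ac: "\<And>s t. G s * G t = - (G t * G s)" and c: "\<And>i z. P i * z = z * P i"
    and g: "\<And>s. ginv (G s) = - G s" "\<And>i. ginv (P i) = P i"
    and D: "\<And>a b. D (a * b) = D a * b + ginv a * D b" "\<And>a b. D (a + b) = D a + D b" "\<And>x a. D (x *\<^sub>R a) = x *\<^sub>R D a"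
    and E: "\<And>a b. E (a * b) = E a * b + ginv a * E b" "\<And>a b. E (a + b) = E a + E b" "\<And>x a. E (x *\<^sub>R a) = x *\<^sub>R E a"
    and gen: "\<And>s. D (G s) = gsub G P (E (og s))" "\<And>i. D (P i) = gsub G P (E (mg i))"
  shows "D (gsub G P a) = gsub G P (E a)"
proof -
  have mult: "gsub G P (a * b) = gsub G P a * gsub G P b" for a b
    by (induction a rule: gpoly_induct)
      (simp_all add: gsub_one gsub_og[where G = G, OF ac] gsub_mg[where P = P, OF c] mult.assoc distrib_right gsub_add gsub_scaleR)
  have one: "D 1 = 0" "E 1 = 0" using D(1)[of 1 1] E(1)[of 1 1] by simp_all
  have minus: "gsub G P (a - b) = gsub G P a - gsub G P b" for a b
    using gsub_add[of G P "a - b" b] by simp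
  show ?thesis
    by (induction a rule: gpoly_induct)
      (simp_all add: gsub_one gsub_og[where G = G, OF ac] gsub_mg[where P = P, OF c] D E g gen mult gsub_add gsub_scaleR
        one minus)
qed

lemma gsub_even_derivation:
  assumes ac: "\<And>s t. G s * G t = - (G t * G s)" and c: "\<And>i z. P i * z = z * P i"
    and D: "\<And>a b. D (a * b) = D a * b + a * D b" "\<And>a b. D (a + b) = D a + D b" "\<And>x a. D (x *\<^sub>R a) = x *\<^sub>R D a"
    and E: "\<And>a b. E (a * b) = E a * b + a * E b" "\<And>a b. E (a + b) = E a + E b" "\<And>x a. E (x *\<^sub>R a) = x *\<^sub>R E a"
    and gen: "\<And>s. D (G s) = gsub G P (E (og s))" "\<And>i. D (P i) = gsub G P (E (mg i))"
  shows "D (gsub G P a) = gsub G P (E a)"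
proof -
  have mult: "gsub G P (a * b) = gsub G P a * gsub G P b" for a b
    by (induction a rule: gpoly_induct)
      (simp_all add: gsub_one gsub_og[where G = G, OF ac] gsub_mg[where P = P, OF c] mult.assoc distrib_right gsub_add gsub_scaleR)
  have "D 1 = 0" "E 1 = 0" using D(1)[of 1 1] E(1)[of 1 1] by simp_all
  then show ?thesis
    by (induction a rule: gpoly_induct)
      (simp_all add: gsub_one gsub_og[where G = G, OF ac] gsub_mg[where P = P, OF c] D E gen mult gsub_add gsub_scaleR)
qed

subsection \<open>The bracket at a point\<close>

text \<open>Interchanges the numbers of the paired generators \<open>\<tau>\<^sup>\<alpha>\<close> and \<open>\<theta>\<^sub>\<alpha>\<close>.\<close>

definition dual_no :: "nat \<Rightarrow> nat" where
  "dual_no s = (if even s then s + 1 else s - 1)"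

lemma dual_no_dual_no [simp]: "dual_no (dual_no s) = s"
  by (auto simp: dual_no_def elim: oddE)

lemma dual_no_less [simp]: "even R \<Longrightarrow> dual_no s < R \<longleftrightarrow> s < R"
  by (auto simp: dual_no_def elim!: oddE evenE)

lemma sum_dual_no: "even R \<Longrightarrow> (\<Sum>s<R. f (dual_no s)) = (\<Sum>s<R. f s)" for f :: "nat \<Rightarrow> 'a::comm_monoid_add"
  by (rule sum.reindex_bij_witness[of _ dual_no dual_no]) auto

text \<open>The bracket of two functions at a point, in terms of their values \<open>a\<close>, \<open>b\<close> and partial
  derivatives \<open>a'\<close>, \<open>b'\<close> with respect to the base coordinates.\<close>

definition brk :: "nat \<Rightarrow> nat \<Rightarrow> gpoly \<Rightarrow> (nat \<Rightarrow> gpoly) \<Rightarrow> gpoly \<Rightarrow> (nat \<Rightarrow> gpoly) \<Rightarrow> gpoly" where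
  "brk n R a a' b b' =
     (\<Sum>i<n. a' i * dp i b - dp i a * b' i) + (\<Sum>s<R. ginv (dl s a) * dl (dual_no s) b)"

text \<open>The Hamiltonian vector field of a function \<open>q\<close> without momenta. Without
  them no derivative of the second argument along the base occurs, so it acts on single polynomials
  and not merely on functions; this is what makes the checks on generators possible.\<close>

definition ad :: "nat \<Rightarrow> nat \<Rightarrow> gpoly \<Rightarrow> (nat \<Rightarrow> gpoly) \<Rightarrow> gpoly \<Rightarrow> gpoly" where
  "ad n R q q' z = (\<Sum>i<n. q' i * dp i z) + (\<Sum>s<R. ginv (dl (dual_no s) q) * dl s z)"

definition lin :: "gpoly set" where "lin = span (range og)"
definition quad :: "gpoly set" where "quad = span {og s * og t | s t. True}"

lemma brk_eq_ad:
  assumes "even R" "\<And>i. i < n \<Longrightarrow> dp i a = 0"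
  shows "brk n R a a' b b' = ad n R a a' b"
proof -
  have "(\<Sum>s<R. ginv (dl (dual_no s) a) * dl s b) = (\<Sum>s<R. ginv (dl s a) * dl (dual_no s) b)"
    using sum_dual_no[OF assms(1), of "\<lambda>s. ginv (dl s a) * dl (dual_no s) b"] by simp
  then show ?thesis using assms(2) by (simp add: brk_def ad_def)
qed

lemma ad_linear:
  "ad n R q q' 0 = 0"
  "ad n R q q' (a + b) = ad n R q q' a + ad n R q q' b"
  "ad n R q q' (a - b) = ad n R q q' a - ad n R q q' b"
  "ad n R q q' (- a) = - ad n R q q' a"
  "ad n R q q' (x *\<^sub>R a) = x *\<^sub>R ad n R q q' a"
  by (simp_all add: ad_def distrib_left sum.distrib algebra_simps sum_negf sum_subtractf scaleR_sum_right)

lemma ad_sum: "ad n R q q' (sum f I) = (\<Sum>i\<in>I. ad n R q q' (f i))"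
  by (induction I rule: infinite_finite_induct) (simp_all add: ad_linear)

lemma linD:
  assumes "z \<in> lin"
  shows "z * a = ginv a * z" "ginv z = - z" "dp i z = 0"
proof -
  have "z * a = ginv a * z \<and> ginv z = - z \<and> dp i z = 0"
    using assms unfolding lin_def
    by (induction rule: span_induct_alt) (auto simp: odd_comm algebra_simps)
  then show "z * a = ginv a * z" "ginv z = - z" "dp i z = 0" by auto
qed

lemma dl_lin: "z \<in> lin \<Longrightarrow> \<exists>x. dl s z = x *\<^sub>R 1"
  unfolding lin_def
proof (induction rule: span_induct_alt)
  case base
  then show ?case by (auto intro: exI[of _ 0])
next
  case (step c x y)
  then obtain t d where "x = og t" "dl s y = d *\<^sub>R 1" by auto
  then show ?case by (auto intro: exI[of _ "c + d"] exI[of _ d] simp: scaleR_add_left)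
qed

lemma quadD:
  assumes "z \<in> quad"
  shows "z * a = a * z" "ginv z = z" "dp i z = 0" "dl s z \<in> lin"
proof -
  have "z * a = a * z \<and> ginv z = z \<and> dp i z = 0 \<and> dl s z \<in> lin"
    using assms unfolding quad_def
  proof (induction rule: span_induct_alt)
    case base
    then show ?case by (simp add: lin_def span_zero)
  next
    case (step c x y)
    then obtain t u where x: "x = og t * og u" by auto
    have "og t * og u * a = a * (og t * og u)"
      by (metis odd_comm mult.assoc ginv_ginv)
    moreover have "dl s (og t * og u) = (if s = t then og u else 0) - (if s = u then og t else 0)"
      by (simp add: dl_odd)
    then have "dl s (og t * og u) \<in> lin" unfolding lin_def
      by (auto intro!: span_diff span_base span_zero span_neg)
    ultimately show ?case using step x
      by (auto simp: algebra_simps ginv_mult dp_mult lin_def intro!: span_add span_scale)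
  qed
  then show "z * a = a * z" "ginv z = z" "dp i z = 0" "dl s z \<in> lin" by auto
qed

text \<open>The factors \<open>dl t q\<close> are odd, so the sign they produce on passing
  \<open>a\<close> cancels the one in the Leibniz rule of \<open>dl s\<close>; the factors
  \<open>q' i\<close> are central.\<close>

lemma ad_quad_mult:
  assumes "q \<in> quad" "\<And>i. i < n \<Longrightarrow> q' i \<in> quad"
  shows "ad n R q q' (a * b) = ad n R q q' a * b + a * ad n R q q' b"
proof -
  have 1: "q' i * dp i (a * b) = q' i * dp i a * b + a * (q' i * dp i b)" if "i < n" for i
    using quadD(1)[OF assms(2)[OF that], of a]
    by (simp add: dp_mult distrib_left mult.assoc[symmetric])
  have 2: "ginv (dl t q) * dl s (a * b) = ginv (dl t q) * dl s a * b + a * (ginv (dl t q) * dl s b)" for s t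
    using linD(1)[OF quadD(4)[OF assms(1), of t], of "ginv a"] linD(2)[OF quadD(4)[OF assms(1), of t]]
    by (simp add: dl_mult distrib_left mult.assoc[symmetric])
  show ?thesis
    by (simp add: ad_def 1 2 sum.distrib sum_distrib_left sum_distrib_right distrib_left distrib_right)
qed

text \<open>Here \<open>dl t q\<close> is a scalar and the sign of \<open>dl s\<close> survives,
  while \<open>q' i\<close> is odd and contributes the same sign. The bracket with a section is thus
  an odd derivation.\<close>

lemma ad_lin_mult:
  assumes "q \<in> lin" "\<And>i. i < n \<Longrightarrow> q' i \<in> lin"
  shows "ad n R q q' (a * b) = ad n R q q' a * b + ginv a * ad n R q q' b"
proof -
  have 1: "q' i * dp i (a * b) = q' i * dp i a * b + ginv a * (q' i * dp i b)" if "i < n" for i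
    using linD(1)[OF assms(2)[OF that], of a]
    by (simp add: dp_mult distrib_left mult.assoc[symmetric])
  have 2: "ginv (dl t q) * dl s (a * b) = ginv (dl t q) * dl s a * b + ginv a * (ginv (dl t q) * dl s b)" for s t
  proof -
    obtain x where "dl t q = x *\<^sub>R 1" using dl_lin[OF assms(1)] by blast
    then show ?thesis by (simp add: dl_mult distrib_left mult.assoc[symmetric] scaleR_add_right)
  qed
  show ?thesis
    by (simp add: ad_def 1 2 sum.distrib sum_distrib_left sum_distrib_right distrib_left distrib_right)
qed

lemma ad_dp_comm:
  assumes "q \<in> quad" "\<And>i. i < n \<Longrightarrow> q' i \<in> quad"
  shows "dp j (ad n R q q' z) = ad n R q q' (dp j z)"
proof -
  have "dp j (ginv (dl t q)) = 0" for t
    using linD(3)[OF quadD(4)[OF assms(1)]] by (simp add: dp_ginv)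
  then show ?thesis
    by (simp add: ad_def dp_sum dp_mult quadD(3)[OF assms(2)] dl_dp dp_dp[of _ j])
qed

text \<open>The correction is the bracket with \<open>dl t q\<close>, written out: the commutator of
  a coordinate field with a Hamiltonian field is again Hamiltonian. The minus sign comes from
  exchanging \<open>dl t\<close> with \<open>dl (dual_no s)\<close>.\<close>

lemma ad_dl_comm:
  assumes q: "q \<in> quad" "\<And>i. i < n \<Longrightarrow> q' i \<in> quad"
  shows "dl t (ad n R q q' z) = ad n R q q' (dl t z) +
    ((\<Sum>i<n. dl t (q' i) * dp i z) - (\<Sum>s<R. dl t (dl (dual_no s) q) * dl s z))"
proof -
  have 1: "dl t (q' i * dp i z) = dl t (q' i) * dp i z + q' i * dp i (dl t z)" if "i < n" for i
    using quadD(2)[OF q(2)[OF that]] by (simp add: dl_mult dl_dp)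
  have 2: "dl t (ginv (dl u q) * dl s z) = - (dl t (dl u q) * dl s z) + ginv (dl u q) * dl s (dl t z)" for s u
    using linD(2)[OF quadD(4)[OF q(1), of u]] by (simp add: dl_mult dl_dl[of t s])
  show ?thesis
    by (simp add: ad_def dl_sum 1 2 sum.distrib sum_negf sum_subtractf)
qed

lemma ginv_ad:
  assumes q: "q \<in> quad" "\<And>i. i < n \<Longrightarrow> q' i \<in> quad"
  shows "ginv (ad n R q q' z) = ad n R q q' (ginv z)"
proof -
  have 1: "ginv (q' i * dp i z) = q' i * dp i (ginv z)" if "i < n" for i
    using quadD(2)[OF q(2)[OF that]] by (simp add: ginv_mult dp_ginv)
  have 2: "ginv (ginv (dl u q) * dl s z) = ginv (dl u q) * dl s (ginv z)" for s u
    using linD(2)[OF quadD(4)[OF q(1), of u]] by (simp add: ginv_mult dl_ginv)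
  show ?thesis by (simp add: ad_def ginv_sum 1 2)
qed

text \<open>A quadratic \<open>q\<close> with symmetric second derivatives \<open>q''\<close> acts on brackets as a derivation;
  \<open>ad n R (q' i) (q'' i)\<close> is the commutator of the \<open>i\<close>-th partial derivative with \<open>ad n R q q'\<close>.\<close>

lemma ad_brk:
  assumes R: "even R"
    and q: "q \<in> quad" "\<And>i. i < n \<Longrightarrow> q' i \<in> quad" "\<And>i j. i < n \<Longrightarrow> j < n \<Longrightarrow> q'' i j \<in> quad"
    and sym: "\<And>i j. i < n \<Longrightarrow> j < n \<Longrightarrow> q'' i j = q'' j i"
  shows "ad n R q q' (brk n R a a' b b') =
    brk n R (ad n R q q' a) (\<lambda>i. ad n R q q' (a' i) + ad n R (q' i) (q'' i) a) b b' +
    brk n R a a' (ad n R q q' b) (\<lambda>i. ad n R q q' (b' i) + ad n R (q' i) (q'' i) b)"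
proof -
  define E where "E = ad n R q q'"
  define X where "X i = ad n R (q' i) (q'' i)" for i
  define Y where "Y t z = (\<Sum>i<n. dl t (q' i) * dp i z) - (\<Sum>s<R. dl t (dl (dual_no s) q) * dl s z)" for t z
  have mult: "E (x * y) = E x * y + x * E y" for x y
    unfolding E_def by (rule ad_quad_mult) (use q in auto)
  have dpE: "dp j (E z) = E (dp j z)" for j z
    unfolding E_def by (rule ad_dp_comm) (use q in auto)
  have dlE: "dl t (E z) = E (dl t z) + Y t z" for t z
    unfolding E_def Y_def by (rule ad_dl_comm) (use q in auto)
  have giE: "ginv (E z) = E (ginv z)" for z
    unfolding E_def by (rule ginv_ad) (use q in auto)
  have Elin: "E (x + y) = E x + E y" "E (x - y) = E x - E y" for x y
    by (simp_all add: E_def ad_linear)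
  have Esum: "E (sum f I) = (\<Sum>i\<in>I. E (f i))" for f :: "nat \<Rightarrow> gpoly" and I
    by (simp add: E_def ad_sum)
  have lhs: "E (brk n R a a' b b') =
      (\<Sum>i<n. E (a' i) * dp i b + a' i * E (dp i b) - (E (dp i a) * b' i + dp i a * E (b' i))) +
      (\<Sum>s<R. E (ginv (dl s a)) * dl (dual_no s) b + ginv (dl s a) * E (dl (dual_no s) b))"
    by (simp add: brk_def Elin Esum mult)
  \<comment> \<open>The derivation property of \<open>E\<close> reproduces the left-hand side. What
    is left over are the commutators of \<open>E\<close> with the partial derivatives, in four sums
    that have to cancel.\<close>
  have rhs: "brk n R (E a) (\<lambda>i. E (a' i) + X i a) b b' + brk n R a a' (E b) (\<lambda>i. E (b' i) + X i b) =
      E (brk n R a a' b b') +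
      (((\<Sum>i<n. X i a * dp i b) + (\<Sum>s<R. ginv (Y s a) * dl (dual_no s) b)) +
       ((\<Sum>s<R. ginv (dl s a) * Y (dual_no s) b) - (\<Sum>i<n. dp i a * X i b)))"
    unfolding lhs by (simp add: brk_def dpE dlE giE algebra_simps sum.distrib sum_subtractf)
  have lq: "dl s (q' i) \<in> lin" if "i < n" for i s using quadD(4) q(2) that by blast
  have gdl: "ginv (dl s (q' i)) = - dl s (q' i)" if "i < n" for i s using linD(2)[OF lq[OF that]] .
  \<comment> \<open>Each of these sums occurs twice with opposite signs: second base derivatives of
    \<open>q\<close> in \<open>T1\<close>, where the symmetry of \<open>q''\<close> is used, mixed
    derivatives in \<open>T2\<close> and \<open>T4\<close>, second odd derivatives in
    \<open>T6\<close>.\<close>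
  define T1 where "T1 = (\<Sum>i<n. \<Sum>j<n. q'' i j * dp j a * dp i b)"
  define T2 where "T2 = (\<Sum>i<n. \<Sum>s<R. ginv (dl s a) * dl (dual_no s) (q' i) * dp i b)"
  define T4 where "T4 = (\<Sum>i<n. \<Sum>s<R. dp i a * dl (dual_no s) (q' i) * dl s b)"
  define T6 where "T6 = (\<Sum>s<R. \<Sum>t<R. ginv (dl t a) * (dl (dual_no s) (dl (dual_no t) q) * dl s b))"
  have m: "\<exists>x. dl s (dl t q) = x *\<^sub>R 1" for s t
    using dl_lin[OF quadD(4)[OF q(1)]] by blast
  have "(\<Sum>s<R. ginv (dl s (q' i)) * z s) = - (\<Sum>s<R. dl s (q' i) * z s)" if "i < n" for i z
    using gdl[OF that] by (simp add: sum_negf)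
  have X: "X i z = (\<Sum>j<n. q'' i j * dp j z) - (\<Sum>s<R. dl (dual_no s) (q' i) * dl s z)" if "i < n" for i z
    unfolding X_def ad_def using gdl[OF that] by (simp add: sum_negf)
  have c2: "dl (dual_no s) (q' i) * dl s a = ginv (dl s a) * dl (dual_no s) (q' i)" if "i < n" for i s
    by (rule linD(1)[OF lq[OF that]])
  have Xa: "(\<Sum>i<n. X i a * dp i b) = T1 - T2"
    unfolding T1_def T2_def sum_subtractf[symmetric]
    by (rule sum.cong) (simp_all add: X c2 left_diff_distrib sum_distrib_right mult.assoc)
  have c1: "dp i a * (q'' i j * dp j b) = q'' j i * dp i a * dp j b" if "i < n" "j < n" for i j
    using quadD(1)[OF q(3)[OF that], of "dp i a"] sym[OF that] by (simp add: mult.assoc[symmetric])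
  have Xb: "(\<Sum>i<n. dp i a * X i b) = T1 - T4"
  proof -
    have "(\<Sum>i<n. dp i a * X i b) = (\<Sum>i<n. \<Sum>j<n. q'' j i * dp i a * dp j b) - T4"
      unfolding T4_def sum_subtractf[symmetric]
      by (rule sum.cong) (simp_all add: X c1 right_diff_distrib sum_distrib_left mult.assoc)
    also have "(\<Sum>i<n. \<Sum>j<n. q'' j i * dp i a * dp j b) = T1"
      unfolding T1_def by (rule sum.swap)
    finally show ?thesis .
  qed
  have giY: "ginv (Y s a) * dl (dual_no s) b =
      - (\<Sum>i<n. dp i a * dl s (q' i) * dl (dual_no s) b) -
      (\<Sum>t<R. ginv (dl t a) * (dl s (dl (dual_no t) q) * dl (dual_no s) b))" for s
  proof -
    have "ginv (dl s (q' i) * dp i a) = - (dp i a * dl s (q' i))" if "i < n" for i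
      using linD(1)[OF lq[OF that], of s "ginv (dp i a)"] gdl[OF that, of s] by (simp add: ginv_mult)
    moreover have "ginv (dl s (dl t q) * z) = ginv z * dl s (dl t q)" for t z
      using m[of s t] by (auto simp: ginv_mult)
    ultimately show ?thesis
      by (simp add: Y_def ginv_sum left_diff_distrib sum_distrib_right sum_negf mult.assoc)
  qed
  have Ya: "(\<Sum>s<R. ginv (Y s a) * dl (dual_no s) b) = - T4 - T6"
  proof -
    have "(\<Sum>s<R. ginv (Y s a) * dl (dual_no s) b) =
      (\<Sum>s<R. ginv (Y (dual_no s) a) * dl (dual_no (dual_no s)) b)"
      using sum_dual_no[OF R, of "\<lambda>s. ginv (Y s a) * dl (dual_no s) b"] by simp
    also have "\<dots> = - (\<Sum>s<R. \<Sum>i<n. dp i a * dl (dual_no s) (q' i) * dl s b) - T6"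
      unfolding giY T6_def by (simp add: sum_subtractf sum_negf)
    also have "(\<Sum>s<R. \<Sum>i<n. dp i a * dl (dual_no s) (q' i) * dl s b) = T4"
      unfolding T4_def by (rule sum.swap)
    finally show ?thesis .
  qed
  have Yb: "(\<Sum>s<R. ginv (dl s a) * Y (dual_no s) b) = T2 + T6"
  proof -
    have "ginv (dl s a) * Y (dual_no s) b = (\<Sum>i<n. ginv (dl s a) * dl (dual_no s) (q' i) * dp i b) +
       (\<Sum>t<R. ginv (dl s a) * (dl (dual_no t) (dl (dual_no s) q) * dl t b))" for s
      by (simp add: Y_def right_diff_distrib distrib_left sum_distrib_left mult.assoc
          dl_dl[of "dual_no s" "dual_no _"] sum_negf)
    then have "(\<Sum>s<R. ginv (dl s a) * Y (dual_no s) b) =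
        (\<Sum>s<R. \<Sum>i<n. ginv (dl s a) * dl (dual_no s) (q' i) * dp i b) +
        (\<Sum>s<R. \<Sum>t<R. ginv (dl s a) * (dl (dual_no t) (dl (dual_no s) q) * dl t b))"
      by (simp add: sum.distrib)
    also have "(\<Sum>s<R. \<Sum>i<n. ginv (dl s a) * dl (dual_no s) (q' i) * dp i b) = T2"
      unfolding T2_def by (rule sum.swap)
    also have "(\<Sum>s<R. \<Sum>t<R. ginv (dl s a) * (dl (dual_no t) (dl (dual_no s) q) * dl t b)) = T6"
      unfolding T6_def by (rule sum.swap)
    finally show ?thesis .
  qed
  have "((\<Sum>i<n. X i a * dp i b) + (\<Sum>s<R. ginv (Y s a) * dl (dual_no s) b)) +
       ((\<Sum>s<R. ginv (dl s a) * Y (dual_no s) b) - (\<Sum>i<n. dp i a * X i b)) = 0"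
    unfolding Xa Xb Ya Yb by simp
  then show ?thesis using rhs unfolding E_def X_def by simp
qed

section \<open>Partial derivatives\<close>

lemma MVT_closed_segment:
  fixes f :: "real \<Rightarrow> real"
  assumes "\<And>s. s \<in> closed_segment a b \<Longrightarrow> (f has_field_derivative f' s) (at s)"
  shows "\<exists>\<xi>\<in>closed_segment a b. f b - f a = f' \<xi> * (b - a)"
proof -
  consider "a = b" | "a < b" | "b < a" by linarith
  then show ?thesis
  proof cases
    case 2
    then obtain z where "a < z" "z < b" "f b - f a = (b - a) * f' z"
      using MVT2[of a b f f'] assms by (auto simp: closed_segment_eq_real_ivl)
    then show ?thesis using 2 by (intro bexI[of _ z]) (auto simp: closed_segment_eq_real_ivl)
  next
    case 3
    then obtain z where "b < z" "z < a" "f a - f b = (a - b) * f' z"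
      using MVT2[of b a f f'] assms by (auto simp: closed_segment_eq_real_ivl)
    then show ?thesis using 3
      by (intro bexI[of _ z]) (auto simp: closed_segment_eq_real_ivl algebra_simps)
  qed auto
qed

lemma closed_segment_abs_less:
  fixes a b \<xi> z :: real
  assumes "\<xi> \<in> closed_segment a b" "\<bar>a - z\<bar> < d" "\<bar>b - z\<bar> < d"
  shows "\<bar>\<xi> - z\<bar> < d"
  using assms by (auto simp: closed_segment_eq_real_ivl split: if_splits)

definition box_around :: "nat \<Rightarrow> (nat \<Rightarrow> real) \<Rightarrow> real \<Rightarrow> (nat \<Rightarrow> real) set" where
  "box_around n z0 \<delta> = {z. (\<forall>i<n. \<bar>z i - z0 i\<bar> < \<delta>) \<and> (\<forall>i\<ge>n. z i = z0 i)}"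

text \<open>Continuous partial derivatives suffice for the chain rule: move along the curve one coordinate
  at a time and apply the mean value theorem to each step.\<close>

lemma DERIV_chain_box:
  fixes F :: "(nat \<Rightarrow> real) \<Rightarrow> real"
  assumes \<delta>: "\<delta> > 0"
    and der: "\<And>j z. j < n \<Longrightarrow> z \<in> box_around n z0 \<delta> \<Longrightarrow>
      ((\<lambda>t. F (z(j := t))) has_field_derivative F' j z) (at (z j))"
    and cont: "\<And>j \<epsilon>. j < n \<Longrightarrow> \<epsilon> > 0 \<Longrightarrow> \<exists>\<eta>>0. \<forall>z\<in>box_around n z0 \<eta>. \<bar>F' j z - F' j z0\<bar> < \<epsilon>"
    and curve: "\<And>j. j < n \<Longrightarrow> ((\<lambda>t. z t j) has_field_derivative z' j) (at t0)"
    and z0: "z t0 = z0" and rest: "\<And>t j. j \<ge> n \<Longrightarrow> z t j = z0 j"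
  shows "((\<lambda>t. F (z t)) has_field_derivative (\<Sum>j<n. F' j z0 * z' j)) (at t0)"
proof -
  \<comment> \<open>The point \<open>w m t\<close> follows the curve in its first \<open>m\<close>
    coordinates and rests at \<open>z0\<close> in the others, so two consecutive ones differ in a
    single coordinate.\<close>
  define w where "w m t j = (if j < m then z t j else z0 j)" for m t j
  have near: "\<forall>\<^sub>F t in at t0. z t \<in> box_around n z0 \<eta>" if "\<eta> > 0" for \<eta>
  proof -
    have "\<forall>\<^sub>F t in at t0. \<bar>z t j - z0 j\<bar> < \<eta>" if "j < n" for j
    proof -
      have "((\<lambda>t. z t j) \<longlongrightarrow> z t0 j) (at t0)"
        using DERIV_isCont[OF curve[OF that]] by (simp add: isCont_def)
      then show ?thesis using \<open>\<eta> > 0\<close> unfolding z0 tendsto_iff by (auto simp: dist_real_def)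
    qed
    then have "\<forall>\<^sub>F t in at t0. \<forall>j\<in>{..<n}. \<bar>z t j - z0 j\<bar> < \<eta>"
      by (intro eventually_ball_finite) auto
    then show ?thesis by eventually_elim (use rest in \<open>auto simp: box_around_def\<close>)
  qed
  have "((\<lambda>t. F (w m t)) has_field_derivative (\<Sum>j<m. F' j z0 * z' j)) (at t0)" if "m \<le> n" for m
    using that
  proof (induction m)
    case 0
    have "w 0 t = z0" for t by (simp add: w_def fun_eq_iff)
    then show ?case by simp
  next
    case (Suc m)
    then have m: "m < n" by simp
    define \<phi> where "\<phi> t = F (w (Suc m) t) - F (w m t)" for t
    \<comment> \<open>The mean value theorem gives \<open>q\<close> as a partial derivative at an
      intermediate point \<zeta>. That \<zeta> lies in every box around \<open>z0\<close> containing
      \<open>z t\<close> makes \<open>q\<close> converge, although nothing is known about its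
      dependence on \<open>t\<close>.\<close>
    have "\<exists>q. z t \<in> box_around n z0 \<delta> \<longrightarrow> \<phi> t = q * (z t m - z0 m) \<and>
        (\<exists>\<zeta>. q = F' m \<zeta> \<and> (\<forall>\<eta>. z t \<in> box_around n z0 \<eta> \<longrightarrow> \<zeta> \<in> box_around n z0 \<eta>))" for t
    proof (cases "z t \<in> box_around n z0 \<delta>")
      case True
      have inbox: "(w m t)(m := s) \<in> box_around n z0 \<eta>"
        if "s \<in> closed_segment (z0 m) (z t m)" "z t \<in> box_around n z0 \<eta>" for s \<eta>
      proof -
        have "\<bar>s - z0 m\<bar> < \<eta>"
          by (rule closed_segment_abs_less[OF that(1)]) (use that(2) m in \<open>auto simp: box_around_def dest!: spec[of _ m]\<close>)
        then show ?thesis using that(2) m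
          by (force simp: box_around_def w_def)
      qed
      have "((\<lambda>s. F ((w m t)(m := s))) has_field_derivative F' m ((w m t)(m := s))) (at s)"
        if "s \<in> closed_segment (z0 m) (z t m)" for s
        using der[OF m inbox[OF that True]] by simp
      from MVT_closed_segment[OF this] obtain \<xi> where \<xi>: "\<xi> \<in> closed_segment (z0 m) (z t m)"
        and eq: "F ((w m t)(m := z t m)) - F ((w m t)(m := z0 m)) = F' m ((w m t)(m := \<xi>)) * (z t m - z0 m)"
        by blast
      have "(w m t)(m := z t m) = w (Suc m) t" "(w m t)(m := z0 m) = w m t"
        by (auto simp: w_def fun_eq_iff less_Suc_eq)
      then show ?thesis using eq inbox[OF \<xi>] unfolding \<phi>_def by metis
    qed simp
    then obtain q where q: "\<And>t. z t \<in> box_around n z0 \<delta> \<Longrightarrow> \<phi> t = q t * (z t m - z0 m) \<and>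
        (\<exists>\<zeta>. q t = F' m \<zeta> \<and> (\<forall>\<eta>. z t \<in> box_around n z0 \<eta> \<longrightarrow> \<zeta> \<in> box_around n z0 \<eta>))"
      by metis
    have qlim: "(q \<longlongrightarrow> F' m z0) (at t0)"
    proof (rule tendstoI)
      fix \<epsilon> :: real assume "\<epsilon> > 0"
      then obtain \<eta> where "\<eta> > 0" and \<eta>: "\<And>z. z \<in> box_around n z0 \<eta> \<Longrightarrow> \<bar>F' m z - F' m z0\<bar> < \<epsilon>"
        using cont[OF m] by blast
      show "\<forall>\<^sub>F t in at t0. dist (q t) (F' m z0) < \<epsilon>"
        using near[OF \<delta>] near[OF \<open>\<eta> > 0\<close>]
      proof eventually_elim
        case (elim t)
        then show ?case using q[of t] \<eta> by (metis dist_real_def)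
      qed
    qed
    have w0: "w m t0 = z0" "w (Suc m) t0 = z0" by (auto simp: w_def z0)
    have "((\<lambda>t. q t * ((z t m - z t0 m) / (t - t0))) \<longlongrightarrow> F' m z0 * z' m) (at t0)"
      using curve[OF m] by (intro tendsto_mult qlim) (simp add: has_field_derivative_iff)
    moreover have "\<forall>\<^sub>F t in at t0. q t * ((z t m - z t0 m) / (t - t0)) = (\<phi> t - \<phi> t0) / (t - t0)"
      using near[OF \<delta>]
    proof eventually_elim
      case (elim t)
      then show ?case using q[OF elim] by (simp add: \<phi>_def w0 z0)
    qed
    ultimately have "(\<phi> has_field_derivative F' m z0 * z' m) (at t0)"
      unfolding has_field_derivative_iff by (rule Lim_transform_eventually)
    from DERIV_add[OF Suc.IH this] Suc.prems show ?case by (simp add: \<phi>_def)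
  qed
  from this[of n] have "((\<lambda>t. F (w n t)) has_field_derivative (\<Sum>j<n. F' j z0 * z' j)) (at t0)" by simp
  moreover have "w n t = z t" for t using rest by (auto simp: w_def fun_eq_iff)
  ultimately show ?thesis by simp
qed

text \<open>The mean value theorem is applied to the difference of \<open>G s (t0 + h)\<close> and
  \<open>G s t0\<close> as a function of \<open>s\<close>, and then to \<open>Gs s\<close> in the
  second variable.\<close>

lemma mixed_difference:
  fixes G :: "real \<Rightarrow> real \<Rightarrow> real"
  assumes "h > 0"
    and 1: "\<And>s t. \<bar>s - s0\<bar> \<le> h \<Longrightarrow> \<bar>t - t0\<bar> \<le> h \<Longrightarrow> ((\<lambda>s. G s t) has_field_derivative Gs s t) (at s)"
    and 2: "\<And>s t. \<bar>s - s0\<bar> \<le> h \<Longrightarrow> \<bar>t - t0\<bar> \<le> h \<Longrightarrow> ((\<lambda>t. Gs s t) has_field_derivative Gst s t) (at t)"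
  shows "\<exists>s t. \<bar>s - s0\<bar> \<le> h \<and> \<bar>t - t0\<bar> \<le> h \<and>
    G (s0 + h) (t0 + h) - G (s0 + h) t0 - G s0 (t0 + h) + G s0 t0 = Gst s t * h * h"
proof -
  have "\<exists>s. s0 < s \<and> s < s0 + h \<and>
      (G (s0 + h) (t0 + h) - G (s0 + h) t0) - (G s0 (t0 + h) - G s0 t0) = (s0 + h - s0) * (Gs s (t0 + h) - Gs s t0)"
    by (rule MVT2[where f = "\<lambda>s. G s (t0 + h) - G s t0"]) (use assms(1) in \<open>auto intro!: DERIV_diff 1\<close>)
  then obtain s where s: "s0 < s" "s < s0 + h" and e1:
      "(G (s0 + h) (t0 + h) - G (s0 + h) t0) - (G s0 (t0 + h) - G s0 t0) = h * (Gs s (t0 + h) - Gs s t0)"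
    by auto
  have "\<exists>t. t0 < t \<and> t < t0 + h \<and> Gs s (t0 + h) - Gs s t0 = (t0 + h - t0) * Gst s t"
    by (rule MVT2) (use assms(1) s in \<open>auto intro!: 2\<close>)
  then obtain t where t: "t0 < t" "t < t0 + h" "Gs s (t0 + h) - Gs s t0 = h * Gst s t" by auto
  show ?thesis using s t(1,2) e1 unfolding t(3) by (intro exI[of _ s] exI[of _ t]) (auto simp: algebra_simps)
qed

text \<open>The second difference over a small square is, up to the factor \<open>h * h\<close>, a
  value of either mixed derivative somewhere near the corner. By continuity two distinct limits are
  impossible.\<close>

lemma mixed_partials_eq:
  fixes G :: "real \<Rightarrow> real \<Rightarrow> real"
  assumes "\<delta> > 0"
    and 1: "\<And>s t. \<bar>s - s0\<bar> < \<delta> \<Longrightarrow> \<bar>t - t0\<bar> < \<delta> \<Longrightarrow> ((\<lambda>s. G s t) has_field_derivative Gs s t) (at s)"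
    and 2: "\<And>s t. \<bar>s - s0\<bar> < \<delta> \<Longrightarrow> \<bar>t - t0\<bar> < \<delta> \<Longrightarrow> ((\<lambda>t. G s t) has_field_derivative Gt s t) (at t)"
    and 3: "\<And>s t. \<bar>s - s0\<bar> < \<delta> \<Longrightarrow> \<bar>t - t0\<bar> < \<delta> \<Longrightarrow> ((\<lambda>t. Gs s t) has_field_derivative Gst s t) (at t)"
    and 4: "\<And>s t. \<bar>s - s0\<bar> < \<delta> \<Longrightarrow> \<bar>t - t0\<bar> < \<delta> \<Longrightarrow> ((\<lambda>s. Gt s t) has_field_derivative Gts s t) (at s)"
    and c1: "\<And>\<epsilon>. \<epsilon> > 0 \<Longrightarrow> \<exists>\<eta>>0. \<forall>s t. \<bar>s - s0\<bar> < \<eta> \<longrightarrow> \<bar>t - t0\<bar> < \<eta> \<longrightarrow> \<bar>Gst s t - Gst s0 t0\<bar> < \<epsilon>"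
    and c2: "\<And>\<epsilon>. \<epsilon> > 0 \<Longrightarrow> \<exists>\<eta>>0. \<forall>s t. \<bar>s - s0\<bar> < \<eta> \<longrightarrow> \<bar>t - t0\<bar> < \<eta> \<longrightarrow> \<bar>Gts s t - Gts s0 t0\<bar> < \<epsilon>"
  shows "Gst s0 t0 = Gts s0 t0"
proof (rule ccontr)
  assume ne: "Gst s0 t0 \<noteq> Gts s0 t0"
  \<comment> \<open>Half the distance of the two values, so that their neighbourhoods of this radius
    are disjoint.\<close>
  define \<epsilon> where "\<epsilon> = \<bar>Gst s0 t0 - Gts s0 t0\<bar> / 2"
  have "\<epsilon> > 0" using ne by (simp add: \<epsilon>_def)
  obtain \<eta>1 where "\<eta>1 > 0" and \<eta>1: "\<And>s t. \<bar>s - s0\<bar> < \<eta>1 \<Longrightarrow> \<bar>t - t0\<bar> < \<eta>1 \<Longrightarrow> \<bar>Gst s t - Gst s0 t0\<bar> < \<epsilon>"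
    using c1[OF \<open>\<epsilon> > 0\<close>] by blast
  obtain \<eta>2 where "\<eta>2 > 0" and \<eta>2: "\<And>s t. \<bar>s - s0\<bar> < \<eta>2 \<Longrightarrow> \<bar>t - t0\<bar> < \<eta>2 \<Longrightarrow> \<bar>Gts s t - Gts s0 t0\<bar> < \<epsilon>"
    using c2[OF \<open>\<epsilon> > 0\<close>] by blast
  define h where "h = min \<delta> (min \<eta>1 \<eta>2) / 2"
  have h: "h > 0" "h < \<delta>" "h < \<eta>1" "h < \<eta>2"
    using \<open>\<delta> > 0\<close> \<open>\<eta>1 > 0\<close> \<open>\<eta>2 > 0\<close> by (auto simp: h_def)
  have "\<exists>s t. \<bar>s - s0\<bar> \<le> h \<and> \<bar>t - t0\<bar> \<le> h \<and>
      G (s0 + h) (t0 + h) - G (s0 + h) t0 - G s0 (t0 + h) + G s0 t0 = Gst s t * h * h"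
    by (rule mixed_difference[of h s0 t0 G Gs]) (use h 1 3 in auto)
  then obtain s t where st: "\<bar>s - s0\<bar> \<le> h" "\<bar>t - t0\<bar> \<le> h"
    and e: "G (s0 + h) (t0 + h) - G (s0 + h) t0 - G s0 (t0 + h) + G s0 t0 = Gst s t * h * h" by blast
  have "\<exists>t s. \<bar>t - t0\<bar> \<le> h \<and> \<bar>s - s0\<bar> \<le> h \<and>
      G (s0 + h) (t0 + h) - G s0 (t0 + h) - G (s0 + h) t0 + G s0 t0 = Gts s t * h * h"
    by (rule mixed_difference[of h t0 s0 "\<lambda>t s. G s t" "\<lambda>t s. Gt s t"]) (use h 2 4 in auto)
  then obtain s' t' where st': "\<bar>s' - s0\<bar> \<le> h" "\<bar>t' - t0\<bar> \<le> h"
    and e': "G (s0 + h) (t0 + h) - G s0 (t0 + h) - G (s0 + h) t0 + G s0 t0 = Gts s' t' * h * h" by blast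
  have "Gst s t * h * h = Gts s' t' * h * h" using e e' by linarith
  then have eq: "Gst s t = Gts s' t'" using h(1) by simp
  have b1: "\<bar>Gst s t - Gst s0 t0\<bar> < \<epsilon>" by (rule \<eta>1) (use st h in auto)
  have b2: "\<bar>Gts s' t' - Gts s0 t0\<bar> < \<epsilon>" by (rule \<eta>2) (use st' h in auto)
  have "\<bar>Gst s0 t0 - Gts s0 t0\<bar> < \<epsilon> + \<epsilon>" using b1 b2 eq by linarith
  then show False by (simp add: \<epsilon>_def)
qed

text \<open>The smooth functions vanishing on the negative axis from which bump functions are built.\<close>

definition flat_exp :: "nat \<Rightarrow> real \<Rightarrow> real" where
  "flat_exp j t = (if t > 0 then (1 / t) ^ j * exp (- (1 / t)) else 0)"

lemma power_le_fact_exp: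
  fixes x :: real
  assumes "x \<ge> 0"
  shows "x ^ m \<le> fact m * exp x"
proof -
  have "(\<Sum>i\<in>{m}. x ^ i /\<^sub>R fact i) \<le> (\<Sum>i. x ^ i /\<^sub>R fact i)"
    by (rule sum_le_suminf) (use assms summable_exp[of x] in auto)
  then show ?thesis by (simp add: exp_def field_simps)
qed

text \<open>The inequality \<open>u ^ (j + 2) \<le> fact (j + 2) * exp u\<close> at
  \<open>u = 1 / t\<close>. The quadratic order on the right makes the difference quotient at
  \<open>0\<close> tend to \<open>0\<close>.\<close>

lemma flat_exp_bound: "\<bar>flat_exp j t\<bar> \<le> fact (j + 2) * t\<^sup>2"
proof (cases "t > 0")
  case True
  then have "(1 / t) ^ (j + 2) \<le> fact (j + 2) * exp (1 / t)"
    by (intro power_le_fact_exp) auto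
  then have "(1 / t) ^ (j + 2) * (t\<^sup>2 * exp (- (1 / t))) \<le> fact (j + 2) * exp (1 / t) * (t\<^sup>2 * exp (- (1 / t)))"
    by (rule mult_right_mono) simp
  also have "\<dots> = fact (j + 2) * t\<^sup>2 * (exp (1 / t) * exp (- (1 / t)))" by (simp only: mult_ac)
  also have "\<dots> = fact (j + 2) * t\<^sup>2" by (simp add: exp_minus)
  also have "(1 / t) ^ (j + 2) * (t\<^sup>2 * exp (- (1 / t))) = (1 / t) ^ j * exp (- (1 / t))"
    using True by (simp add: power_add power_divide power2_eq_square)
  finally show ?thesis using True by (simp add: flat_exp_def)
qed (simp add: flat_exp_def)

lemma flat_exp_pos: "t > 0 \<Longrightarrow> flat_exp j t > 0"
  by (simp add: flat_exp_def)

text \<open>The linear combinations of the functions \<open>flat_exp j\<close> are closed under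
  differentiation; this is why the whole family is introduced, and it gives smoothness of every
  order by induction.\<close>

lemma DERIV_flat_exp:
  "(flat_exp j has_field_derivative (flat_exp (j + 2) t - real j * flat_exp (j + 1) t)) (at t)"
proof -
  consider "t > 0" | "t < 0" | "t = 0" by linarith
  then show ?thesis
  proof cases
    case 1
    define u where "u = 1 / t"
    have d: "((\<lambda>t. 1 / t) has_field_derivative - u\<^sup>2) (at t)"
      using DERIV_inverse[of t UNIV] 1
      by (simp add: u_def inverse_eq_divide power2_eq_square numeral_2_eq_2)
    have "((\<lambda>t. (1 / t) ^ j * exp (- (1 / t))) has_field_derivative
        ((real j * (- u\<^sup>2 * u ^ (j - Suc 0))) * exp (- u) + (exp (- u) * - (- u\<^sup>2)) * u ^ j)) (at t)"
      using DERIV_mult[OF DERIV_power[OF d, of j] DERIV_fun_exp[OF DERIV_minus[OF d]]]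
      by (simp only: u_def[symmetric])
    moreover have "(real j * (- u\<^sup>2 * u ^ (j - Suc 0))) * exp (- u) + (exp (- u) * - (- u\<^sup>2)) * u ^ j =
        flat_exp (j + 2) t - real j * flat_exp (j + 1) t"
      using 1 by (cases j) (simp_all add: flat_exp_def u_def[symmetric] algebra_simps power2_eq_square)
    ultimately have "((\<lambda>t. (1 / t) ^ j * exp (- (1 / t))) has_field_derivative
        (flat_exp (j + 2) t - real j * flat_exp (j + 1) t)) (at t)" by simp
    moreover have "\<forall>\<^sub>F s in nhds t. (1 / s) ^ j * exp (- (1 / s)) = flat_exp j s"
      using eventually_nhds_in_open[of "{0<..}" t] 1 by (auto simp: flat_exp_def elim!: eventually_mono)
    ultimately show ?thesis by (subst DERIV_cong_ev[OF refl _ refl, symmetric]) auto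
  next
    case 2
    have "\<forall>\<^sub>F s in nhds t. 0 = flat_exp j s"
      using eventually_nhds_in_open[of "{..<0}" t] 2 by (auto simp: flat_exp_def elim!: eventually_mono)
    moreover have "((\<lambda>s. 0) has_field_derivative (flat_exp (j + 2) t - real j * flat_exp (j + 1) t)) (at t)"
      using 2 by (simp add: flat_exp_def)
    ultimately show ?thesis by (subst DERIV_cong_ev[OF refl _ refl, symmetric]) auto
  next
    case 3
    have b: "norm (flat_exp j s / s) \<le> fact (j + 2) * \<bar>s\<bar>" for s
      using flat_exp_bound[of j s]
      by (cases "s = 0") (simp_all add: abs_divide divide_le_eq power2_eq_square mult.assoc)
    have "((\<lambda>s. fact (j + 2) * \<bar>s\<bar>) \<longlongrightarrow> fact (j + 2) * \<bar>0\<bar>) (at (0::real))"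
      by (intro tendsto_intros)
    then have "((\<lambda>s. flat_exp j s / s) \<longlongrightarrow> 0) (at 0)"
      by (intro Lim_null_comparison[of "\<lambda>s. flat_exp j s / s" "\<lambda>s. fact (j + 2) * \<bar>s\<bar>"]) (use b in auto)
    then show ?thesis using 3 by (simp add: has_field_derivative_iff flat_exp_def)
  qed
qed

section \<open>Smooth functions in charts\<close>

lemma Euclidean_space_eq: "Euclidean_space n = top_of_set {x. \<forall>i\<ge>n. x i = 0}"
  by (simp add: Euclidean_space_def euclidean_product_topology)

text \<open>Coordinates are sequences with the product topology. A box varies only the first
  \<open>n\<close> of them, so a positive lower bound for finitely many radii is enough.\<close>

lemma open_contains_box:
  fixes T :: "(nat \<Rightarrow> real) set"
  assumes "open T" "z0 \<in> T"
  shows "\<exists>\<delta>>0. box_around n z0 \<delta> \<subseteq> T"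
proof -
  have "openin (product_topology (\<lambda>i. euclidean) UNIV) T"
    using assms(1) by (simp add: euclidean_product_topology)
  from product_topology_open_contains_basis[OF this assms(2)] obtain X :: "nat \<Rightarrow> real set"
    where X: "z0 \<in> (\<Pi>\<^sub>E i\<in>UNIV. X i)" "\<And>i. open (X i)" "(\<Pi>\<^sub>E i\<in>UNIV. X i) \<subseteq> T"
    by auto
  have "\<exists>e>0. \<forall>t. \<bar>t - z0 i\<bar> < e \<longrightarrow> t \<in> X i" for i
    using X(1) X(2)[of i] by (auto simp: open_dist dist_real_def)
  then obtain e where e: "\<And>i. e i > 0" "\<And>i t. \<bar>t - z0 i\<bar> < e i \<Longrightarrow> t \<in> X i" by metis
  \<comment> \<open>The additional \<open>1\<close> keeps the minimum meaningful for
    \<open>n = 0\<close>.\<close>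
  define \<delta> where "\<delta> = Min (insert 1 (e ` {..<n}))"
  have "\<delta> > 0" unfolding \<delta>_def by (subst Min_gr_iff) (auto simp: e)
  moreover have le: "\<delta> \<le> e i" if "i < n" for i unfolding \<delta>_def by (rule Min_le) (use that in auto)
  have "box_around n z0 \<delta> \<subseteq> T"
  proof
    fix z assume z: "z \<in> box_around n z0 \<delta>"
    have "z i \<in> X i" for i
    proof (cases "i < n")
      case True
      then have "\<bar>z i - z0 i\<bar> < \<delta>" using z by (auto simp: box_around_def)
      then show ?thesis using le[OF True] by (intro e(2)) auto
    next
      case False
      then have "z i = z0 i" using z by (auto simp: box_around_def)
      then show ?thesis using X(1) by auto
    qed
    then show "z \<in> T" using X(3) by auto
  qed
  ultimately show ?thesis by blast
qed

locale smooth_bundle =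
  fixes B :: "('m::{second_countable_topology, t2_space}, 'v::real_vector) vbundle"
  assumes smooth_vector_bundle: "smooth_vector_bundle B"
begin

abbreviation "dimB \<equiv> base_dim B"
abbreviation "rkB \<equiv> bundle_rank B"

lemma charts_cover: "\<exists>c\<in>charts B. x \<in> chart_dom c"
  using smooth_vector_bundle unfolding smooth_vector_bundle_def by blast

context
  fixes c assumes c: "c \<in> charts B"
begin

lemma open_chart_dom: "open (chart_dom c)"
  using smooth_vector_bundle c unfolding smooth_vector_bundle_def by blast

lemma openin_chart_image: "openin (top_of_set {x. \<forall>i\<ge>dimB. x i = 0}) (chart_coord c ` chart_dom c)"
  using smooth_vector_bundle c unfolding smooth_vector_bundle_def Euclidean_space_eq by blast

lemma chart_coord_zero: "x \<in> chart_dom c \<Longrightarrow> i \<ge> dimB \<Longrightarrow> chart_coord c x i = 0"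
  using openin_subset[OF openin_chart_image] by auto

lemma chart_homeo:
  "homeomorphic_map (top_of_set (chart_dom c)) (top_of_set (chart_coord c ` chart_dom c)) (chart_coord c)"
proof -
  have "homeomorphic_map (top_of_set (chart_dom c))
     (subtopology (Euclidean_space dimB) (chart_coord c ` chart_dom c)) (chart_coord c)"
    using smooth_vector_bundle c unfolding smooth_vector_bundle_def by blast
  moreover have "{x. \<forall>i\<ge>dimB. x i = 0} \<inter> chart_coord c ` chart_dom c = chart_coord c ` chart_dom c"
    using openin_subset[OF openin_chart_image] by auto
  ultimately show ?thesis by (simp add: Euclidean_space_eq subtopology_subtopology)
qed

lemma inj_on_chart: "inj_on (chart_coord c) (chart_dom c)"
  using homeomorphic_imp_injective_map[OF chart_homeo] by simp

lemma continuous_on_chart: "continuous_on (chart_dom c) (chart_coord c)"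
  using homeomorphic_imp_continuous_map[OF chart_homeo] by (simp add: continuous_map_in_subtopology)

lemma continuous_on_chart_coord: "continuous_on (chart_dom c) (\<lambda>x. chart_coord c x i)"
  by (rule continuous_on_product_then_coordinatewise[OF continuous_on_chart])

lemma inv_chart [simp]: "x \<in> chart_dom c \<Longrightarrow> inv_into (chart_dom c) (chart_coord c) (chart_coord c x) = x"
  by (rule inv_into_f_f[OF inj_on_chart])

lemma continuous_on_inv_chart:
  "continuous_on (chart_coord c ` chart_dom c) (inv_into (chart_dom c) (chart_coord c))"
proof -
  from chart_homeo obtain g where g: "homeomorphic_maps (top_of_set (chart_dom c)) (top_of_set (chart_coord c ` chart_dom c)) (chart_coord c) g"
    by (auto simp: homeomorphic_map_maps)
  then have "continuous_on (chart_coord c ` chart_dom c) g"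
    by (auto simp: homeomorphic_maps_def continuous_map_in_subtopology)
  moreover have "g z = inv_into (chart_dom c) (chart_coord c) z" if "z \<in> chart_coord c ` chart_dom c" for z
    using g that by (auto simp: homeomorphic_maps_def)
  ultimately show ?thesis by (simp cong: continuous_on_cong)
qed

text \<open>Analysis in a chart takes place in such boxes: coordinates may be changed one at a time
  without leaving the domain on which \<open>inv_into\<close> is a genuine inverse.\<close>

lemma chart_box:
  assumes W: "open W" "W \<subseteq> chart_dom c" "x \<in> W"
  shows "\<exists>\<delta>>0. \<forall>z\<in>box_around dimB (chart_coord c x) \<delta>.
    inv_into (chart_dom c) (chart_coord c) z \<in> W \<and>
    chart_coord c (inv_into (chart_dom c) (chart_coord c) z) = z"
proof -
  have "openin (top_of_set (chart_dom c)) W"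
    using W by (simp add: openin_open_eq open_chart_dom)
  then have "openin (top_of_set (chart_coord c ` chart_dom c)) (chart_coord c ` W)"
    using homeomorphic_imp_open_map[OF chart_homeo] by (auto simp: open_map_def)
  then have "openin (top_of_set {x. \<forall>i\<ge>dimB. x i = 0}) (chart_coord c ` W)"
    using openin_chart_image openin_trans by blast
  then obtain T where T: "open T" "chart_coord c ` W = {x. \<forall>i\<ge>dimB. x i = 0} \<inter> T"
    by (auto simp: openin_open)
  then have "chart_coord c x \<in> T" using W by auto
  then obtain \<delta> where \<delta>: "\<delta> > 0" "box_around dimB (chart_coord c x) \<delta> \<subseteq> T"
    using open_contains_box[OF T(1)] by blast
  have "inv_into (chart_dom c) (chart_coord c) z \<in> W \<and>
      chart_coord c (inv_into (chart_dom c) (chart_coord c) z) = z"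
    if z: "z \<in> box_around dimB (chart_coord c x) \<delta>" for z
  proof -
    have "z \<in> chart_coord c ` W"
      unfolding T(2) using z \<delta>(2) chart_coord_zero W by (auto simp: box_around_def)
    then obtain y where "y \<in> W" "z = chart_coord c y" by blast
    then show ?thesis using W(2) by auto
  qed
  then show ?thesis using \<delta>(1) by blast
qed

lemma coord_line_same [simp]: "x \<in> chart_dom c \<Longrightarrow> coord_line c i x (chart_coord c x i) = x"
  by (simp add: coord_line_def)

text \<open>Far from the point the values of \<open>coord_line\<close> are unspecified. Derivatives
  depend only on its germ, which stays in any given neighbourhood.\<close>

lemma coord_line_near:
  assumes W: "open W" "W \<subseteq> chart_dom c" "x \<in> W" and i: "i < dimB"
  shows "\<forall>\<^sub>F t in nhds (chart_coord c x i).
    coord_line c i x t \<in> W \<and> chart_coord c (coord_line c i x t) = (chart_coord c x)(i := t)"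
proof -
  obtain \<delta> where \<delta>: "\<delta> > 0" "\<And>z. z \<in> box_around dimB (chart_coord c x) \<delta> \<Longrightarrow>
      inv_into (chart_dom c) (chart_coord c) z \<in> W \<and>
      chart_coord c (inv_into (chart_dom c) (chart_coord c) z) = z"
    using chart_box[OF W] by blast
  have "\<forall>\<^sub>F t in nhds (chart_coord c x i). \<bar>t - chart_coord c x i\<bar> < \<delta>"
    unfolding eventually_nhds_metric using \<delta>(1) by (auto simp: dist_real_def)
  then show ?thesis
  proof eventually_elim
    case (elim t)
    then have "(chart_coord c x)(i := t) \<in> box_around dimB (chart_coord c x) \<delta>"
      using i \<delta>(1) by (auto simp: box_around_def)
    then show ?case using \<delta>(2) by (simp add: coord_line_def)
  qed
qed

end

section \<open>Partial derivatives and functions of finite differentiability class\<close>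

definition has_partial :: "('m, 'v) bundle_chart \<Rightarrow> nat \<Rightarrow> ('m \<Rightarrow> real) \<Rightarrow> real \<Rightarrow> 'm \<Rightarrow> bool" where
  "has_partial c i f D x \<longleftrightarrow>
     ((\<lambda>t. f (coord_line c i x t)) has_field_derivative D) (at (chart_coord c x i))"

lemma has_partial_imp: "has_partial c i f D x \<Longrightarrow> chart_partial c i f x = D"
  by (simp add: has_partial_def chart_partial_def DERIV_imp_deriv)

lemma has_partial_iff_differentiable:
  "has_partial c i f (chart_partial c i f x) x \<longleftrightarrow>
     (\<lambda>t. f (coord_line c i x t)) differentiable (at (chart_coord c x i))"
  by (simp add: has_partial_def chart_partial_def DERIV_deriv_iff_real_differentiable)

lemma has_partial_cong:
  assumes "c \<in> charts B" "open W" "W \<subseteq> chart_dom c" "x \<in> W" "i < dimB"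
    and "\<And>y. y \<in> W \<Longrightarrow> f y = g y"
  shows "has_partial c i f D x \<longleftrightarrow> has_partial c i g D x"
proof -
  have "\<forall>\<^sub>F t in nhds (chart_coord c x i). f (coord_line c i x t) = g (coord_line c i x t)"
    using coord_line_near[OF assms(1-5)] by eventually_elim (use assms(6) in auto)
  then show ?thesis unfolding has_partial_def by (intro DERIV_cong_ev) auto
qed

lemma has_partial_const: "has_partial c i (\<lambda>x. a) 0 x"
  by (simp add: has_partial_def)

lemma has_partial_add:
  "has_partial c i f D x \<Longrightarrow> has_partial c i g E x \<Longrightarrow> has_partial c i (\<lambda>x. f x + g x) (D + E) x"
  by (simp add: has_partial_def DERIV_add)

lemma has_partial_mult:
  assumes "c \<in> charts B" "x \<in> chart_dom c" "has_partial c i f D x" "has_partial c i g E x"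
  shows "has_partial c i (\<lambda>x. f x * g x) (D * g x + f x * E) x"
  using DERIV_mult[OF assms(3,4)[unfolded has_partial_def]] assms(1,2)
  by (simp add: has_partial_def mult.commute add.commute)

lemma has_partial_sum:
  "(\<And>k. k \<in> K \<Longrightarrow> has_partial c i (f k) (D k) x) \<Longrightarrow> has_partial c i (\<lambda>x. \<Sum>k\<in>K. f k x) (\<Sum>k\<in>K. D k) x"
  by (simp add: has_partial_def DERIV_sum)

lemma has_partial_coord:
  assumes "c \<in> charts B" "x \<in> chart_dom c" "i < dimB"
  shows "has_partial c i (\<lambda>y. chart_coord c y j) (if i = j then 1 else 0) x"
proof -
  have "\<forall>\<^sub>F t in nhds (chart_coord c x i). (if i = j then t else chart_coord c x j) =
      chart_coord c (coord_line c i x t) j"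
    using coord_line_near[OF assms(1) open_chart_dom[OF assms(1)] order_refl assms(2,3)]
    by eventually_elim auto
  moreover have "((\<lambda>t. if i = j then t else chart_coord c x j) has_field_derivative (if i = j then 1 else 0))
      (at (chart_coord c x i))"
    by auto
  ultimately show ?thesis unfolding has_partial_def
    by (subst DERIV_cong_ev[OF refl _ refl, symmetric]) auto
qed

text \<open>Class \<open>C^k\<close> on \<open>W\<close>, by recursion, so that closure properties
  follow by induction on \<open>k\<close>. The derivative is quantified existentially: any formula
  that is correct on \<open>W\<close> may serve for it, without identifying it with
  \<open>chart_partial\<close> off \<open>W\<close>.\<close>

fun cdiff :: "nat \<Rightarrow> ('m, 'v) bundle_chart \<Rightarrow> 'm set \<Rightarrow> ('m \<Rightarrow> real) \<Rightarrow> bool" where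
  "cdiff 0 c W f \<longleftrightarrow> continuous_on W f"
| "cdiff (Suc k) c W f \<longleftrightarrow> continuous_on W f \<and>
     (\<forall>i<dimB. \<exists>g. (\<forall>x\<in>W. has_partial c i f (g x) x) \<and> cdiff k c W g)"

lemma cdiff_continuous: "cdiff k c W f \<Longrightarrow> continuous_on W f"
  by (cases k) auto

lemma cdiff_SucD: "cdiff (Suc k) c W f \<Longrightarrow> cdiff k c W f"
proof (induction k arbitrary: f)
  case (Suc k)
  show ?case unfolding cdiff.simps(2)[of k]
    using Suc.prems[unfolded cdiff.simps(2)[of "Suc k"]] Suc.IH by blast
qed auto

lemma cdiff_subset: "cdiff k c W f \<Longrightarrow> V \<subseteq> W \<Longrightarrow> cdiff k c V f"
proof (induction k arbitrary: f)
  case (Suc k)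
  show ?case unfolding cdiff.simps(2)
  proof (intro conjI allI impI)
    show "continuous_on V f" using Suc.prems continuous_on_subset by auto
    fix i assume "i < dimB"
    then obtain g where "\<forall>x\<in>W. has_partial c i f (g x) x" "cdiff k c W g" using Suc.prems by auto
    then show "\<exists>g. (\<forall>x\<in>V. has_partial c i f (g x) x) \<and> cdiff k c V g"
      using Suc.IH Suc.prems(2) by blast
  qed
qed (auto intro: continuous_on_subset)

lemma cdiff_const: "cdiff k c W (\<lambda>x. a)"
  by (induction k arbitrary: a) (auto intro!: exI[of _ "\<lambda>x. 0"] has_partial_const)

lemma cdiff_add: "cdiff k c W f \<Longrightarrow> cdiff k c W g \<Longrightarrow> cdiff k c W (\<lambda>x. f x + g x)"
proof (induction k arbitrary: f g)
  case (Suc k)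
  show ?case unfolding cdiff.simps
  proof (intro conjI allI impI)
    show "continuous_on W (\<lambda>x. f x + g x)" using Suc.prems by (auto intro: continuous_intros)
    fix i assume "i < dimB"
    then obtain f' g' where "\<forall>x\<in>W. has_partial c i f (f' x) x" "cdiff k c W f'"
      "\<forall>x\<in>W. has_partial c i g (g' x) x" "cdiff k c W g'" using Suc.prems by auto metis
    then show "\<exists>h. (\<forall>x\<in>W. has_partial c i (\<lambda>x. f x + g x) (h x) x) \<and> cdiff k c W h"
      by (intro exI[of _ "\<lambda>x. f' x + g' x"]) (auto intro: Suc.IH has_partial_add)
  qed
qed (auto intro: continuous_intros)

lemma cdiff_sum: "(\<And>k. k \<in> K \<Longrightarrow> cdiff m c W (f k)) \<Longrightarrow> cdiff m c W (\<lambda>x. \<Sum>k\<in>K. f k x)"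
  by (induction K rule: infinite_finite_induct) (auto intro: cdiff_const cdiff_add)

context
  fixes c W assumes c: "c \<in> charts B" and W: "open W" "W \<subseteq> chart_dom c"
begin

text \<open>Openness of \<open>W\<close> enters here: near a point of \<open>W\<close> the
  coordinate lines stay in \<open>W\<close>, so the partial derivatives see only values on
  \<open>W\<close>.\<close>

lemma cdiff_cong:
  assumes "\<And>y. y \<in> W \<Longrightarrow> f y = g y"
  shows "cdiff k c W f \<longleftrightarrow> cdiff k c W g"
proof -
  have "continuous_on W f \<longleftrightarrow> continuous_on W g" by (rule continuous_on_cong) (use assms in auto)
  moreover have "has_partial c i f D x \<longleftrightarrow> has_partial c i g D x" if "x \<in> W" "i < dimB" for x D i
    by (rule has_partial_cong[OF c W that]) (use assms in auto)
  ultimately show ?thesis by (cases k) auto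
qed

lemma cdiff_mult: "cdiff k c W f \<Longrightarrow> cdiff k c W g \<Longrightarrow> cdiff k c W (\<lambda>x. f x * g x)"
proof (induction k arbitrary: f g)
  case (Suc k)
  show ?case unfolding cdiff.simps
  proof (intro conjI allI impI)
    show "continuous_on W (\<lambda>x. f x * g x)" using Suc.prems by (auto intro: continuous_intros)
    fix i assume "i < dimB"
    then obtain f' g' where *: "\<forall>x\<in>W. has_partial c i f (f' x) x" "cdiff k c W f'"
      "\<forall>x\<in>W. has_partial c i g (g' x) x" "cdiff k c W g'" using Suc.prems by auto metis
    have "cdiff k c W f" "cdiff k c W g" using Suc.prems cdiff_SucD by blast+
    with * show "\<exists>h. (\<forall>x\<in>W. has_partial c i (\<lambda>x. f x * g x) (h x) x) \<and> cdiff k c W h"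
      using W c by (intro exI[of _ "\<lambda>x. f' x * g x + f x * g' x"])
        (auto intro!: has_partial_mult cdiff_add Suc.IH)
  qed
qed (auto intro: continuous_intros)

lemma cdiff_prod: "(\<And>k. k \<in> K \<Longrightarrow> cdiff m c W (f k)) \<Longrightarrow> cdiff m c W (\<lambda>x. \<Prod>k\<in>K. f k x)"
  by (induction K rule: infinite_finite_induct) (auto intro: cdiff_const cdiff_mult)

lemma cdiff_chart_partial:
  assumes "cdiff (Suc k) c W f" "i < dimB"
  shows "cdiff k c W (chart_partial c i f)" "x \<in> W \<Longrightarrow> has_partial c i f (chart_partial c i f x) x"
proof -
  obtain g where g: "\<forall>x\<in>W. has_partial c i f (g x) x" "cdiff k c W g" using assms by auto
  then have "chart_partial c i f x = g x" if "x \<in> W" for x using has_partial_imp that by blast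
  then show "cdiff k c W (chart_partial c i f)" "x \<in> W \<Longrightarrow> has_partial c i f (chart_partial c i f x) x"
    using g cdiff_cong[of "chart_partial c i f" g k] by auto
qed

lemma smooth_on_chart_iff: "smooth_on_chart dimB c W f \<longleftrightarrow> (\<forall>k. cdiff k c W f)"
proof
  have "cdiff k c W f" if "smooth_on_chart dimB c W f" for k
    using that
  proof (induction k arbitrary: f)
    case 0
    then show ?case unfolding smooth_on_chart_def by (auto dest!: spec[of _ "[]"])
  next
    case (Suc k)
    have 0: "continuous_on W f" "\<And>i x. i < dimB \<Longrightarrow> x \<in> W \<Longrightarrow> has_partial c i f (chart_partial c i f x) x"
      unfolding has_partial_iff_differentiable
      using Suc.prems unfolding smooth_on_chart_def by (auto dest!: spec[of _ "[]"])
    have "smooth_on_chart dimB c W (chart_partial c i f)" if "i < dimB" for i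
      unfolding smooth_on_chart_def
    proof (intro allI impI)
      \<comment> \<open>\<open>foldr\<close> applies the last index of a list first; a further
        derivative of the \<open>i\<close>-th partial therefore belongs to the list
        \<open>js @ [i]\<close>.\<close>
      fix js assume "set js \<subseteq> {..<dimB}"
      then show "continuous_on W (foldr (chart_partial c) js (chart_partial c i f)) \<and>
        (\<forall>ia<dimB. \<forall>x\<in>W. (\<lambda>t. foldr (chart_partial c) js (chart_partial c i f) (coord_line c ia x t))
          differentiable at (chart_coord c x ia))"
        using Suc.prems[unfolded smooth_on_chart_def, rule_format, of "js @ [i]"] that by simp
    qed
    then show ?case using 0 Suc.IH unfolding cdiff.simps by blast
  qed
  then show "smooth_on_chart dimB c W f \<Longrightarrow> \<forall>k. cdiff k c W f" by blast
next
  assume f: "\<forall>k. cdiff k c W f"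
  have "\<forall>k. cdiff k c W (foldr (chart_partial c) js f)" if "set js \<subseteq> {..<dimB}" for js
    using that
  proof (induction js)
    case (Cons i js)
    then show ?case using cdiff_chart_partial(1)[of _ _ i] by (auto simp del: cdiff.simps)
  qed (use f in auto)
  then show "smooth_on_chart dimB c W f"
    unfolding smooth_on_chart_def has_partial_iff_differentiable[symmetric]
    using cdiff_continuous cdiff_chart_partial(2) by (metis (full_types))
qed

end

end

context smooth_bundle
begin

section \<open>Chain rule, change of charts, symmetry of second derivatives and bump
  functions\<close>

lemma chart_continuous_box:
  assumes c: "c \<in> charts B" and W: "open W" "W \<subseteq> chart_dom c" "x \<in> W"
    and g: "continuous_on W g" and \<epsilon>: "\<epsilon> > 0"
  shows "\<exists>\<eta>>0. \<forall>z\<in>box_around dimB (chart_coord c x) \<eta>.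
    \<bar>g (inv_into (chart_dom c) (chart_coord c) z) - (g x :: real)\<bar> < \<epsilon>"
proof -
  let ?V = "W \<inter> g -` ball (g x) \<epsilon>"
  have "open ?V" by (rule continuous_open_preimage[OF g W(1)]) simp
  moreover have "?V \<subseteq> chart_dom c" "x \<in> ?V" using W \<epsilon> by auto
  ultimately obtain \<eta> where "\<eta> > 0" "\<And>z. z \<in> box_around dimB (chart_coord c x) \<eta> \<Longrightarrow>
      inv_into (chart_dom c) (chart_coord c) z \<in> ?V"
    using chart_box[OF c, of ?V x] by blast
  then show ?thesis by (intro exI[of _ \<eta>]) (auto simp: dist_real_def abs_minus_commute)
qed

lemma has_partial_chain:
  assumes c: "c \<in> charts B" and d: "d \<in> charts B"
    and W: "open W" "W \<subseteq> chart_dom c" "W \<subseteq> chart_dom d" "x \<in> W" and i: "i < dimB"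
    and f: "cdiff 1 c W f"
    and D: "\<And>j. j < dimB \<Longrightarrow> has_partial d i (\<lambda>y. chart_coord c y j) (D j) x"
  shows "has_partial d i f (\<Sum>j<dimB. chart_partial c j f x * D j) x"
proof -
  let ?inv = "inv_into (chart_dom c) (chart_coord c)"
  \<comment> \<open>The coordinates with index at least \<open>dimB\<close> vanish on the chart, but
    off its domain they are unspecified. Replacing them by \<open>0\<close> satisfies the last
    premise of \<open>DERIV_chain_box\<close> for all \<open>t\<close>, also those for which the
    line has left the chart.\<close>
  let ?z = "\<lambda>t j. if j < dimB then chart_coord c (coord_line d i x t) j else 0"
  have xc: "x \<in> chart_dom c" "x \<in> chart_dom d" using W by auto
  obtain \<delta> where \<delta>: "\<delta> > 0" "\<And>z. z \<in> box_around dimB (chart_coord c x) \<delta> \<Longrightarrow>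
      ?inv z \<in> W \<and> chart_coord c (?inv z) = z"
    using chart_box[OF c W(1,2,4)] by blast
  have "((\<lambda>t. (f \<circ> ?inv) (?z t)) has_field_derivative
      (\<Sum>j<dimB. chart_partial c j f (?inv (chart_coord c x)) * D j)) (at (chart_coord d x i))"
  proof (rule DERIV_chain_box[where F = "f \<circ> ?inv" and z = ?z and z' = D and
        F' = "\<lambda>j z. chart_partial c j f (?inv z)", OF \<delta>(1)])
    fix j z assume j: "j < dimB" and z: "z \<in> box_around dimB (chart_coord c x) \<delta>"
    have "has_partial c j f (chart_partial c j f (?inv z)) (?inv z)"
      by (rule cdiff_chart_partial(2)[OF c W(1,2) f[unfolded One_nat_def] j]) (use \<delta>(2)[OF z] in auto)
    then show "((\<lambda>t. (f \<circ> ?inv) (z(j := t))) has_field_derivative chart_partial c j f (?inv z)) (at (z j))"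
      using \<delta>(2)[OF z] by (simp add: has_partial_def coord_line_def)
  next
    fix j and \<epsilon> :: real assume j: "j < dimB" and e: "\<epsilon> > 0"
    have "continuous_on W (chart_partial c j f)"
      using cdiff_chart_partial(1)[OF c W(1,2), of 0 f j] f j by simp
    from chart_continuous_box[OF c W(1,2,4) this e]
    show "\<exists>\<eta>>0. \<forall>z\<in>box_around dimB (chart_coord c x) \<eta>.
        \<bar>chart_partial c j f (?inv z) - chart_partial c j f (?inv (chart_coord c x))\<bar> < \<epsilon>"
      using xc by (simp add: c)
  next
    fix j assume "j < dimB"
    then show "((\<lambda>t. ?z t j) has_field_derivative D j) (at (chart_coord d x i))"
      using D[of j] by (simp add: has_partial_def)
  next
    show "?z (chart_coord d x i) = chart_coord c x"
      using xc chart_coord_zero[OF c xc(1)] by (auto simp: fun_eq_iff d)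
  next
    show "?z t j = chart_coord c x j" if "dimB \<le> j" for t j
      using that chart_coord_zero[OF c xc(1)] by simp
  qed
  moreover have "\<forall>\<^sub>F t in nhds (chart_coord d x i). (f \<circ> ?inv) (?z t) = f (coord_line d i x t)"
    using coord_line_near[OF d W(1,3,4) i]
  proof eventually_elim
    case (elim t)
    then have y: "coord_line d i x t \<in> chart_dom c" using W by auto
    then have "?z t = chart_coord c (coord_line d i x t)"
      using chart_coord_zero[OF c y] by (auto simp: fun_eq_iff)
    then show ?case using y by (simp add: c)
  qed
  ultimately show ?thesis unfolding has_partial_def
    using xc by (subst DERIV_cong_ev[OF refl _ refl, symmetric]) (auto simp: c)
qed

lemma cdiff_coord:
  assumes c: "c \<in> charts B" and d: "d \<in> charts B" and W: "open W" "W \<subseteq> chart_dom c" "W \<subseteq> chart_dom d"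
    and i: "i < dimB"
  shows "cdiff k c W (\<lambda>y. chart_coord d y i)"
proof -
  have o: "open (chart_dom c \<inter> chart_dom d)" using open_chart_dom c d by blast
  have "smooth_on_chart dimB c (chart_dom c \<inter> chart_dom d) (\<lambda>y. chart_coord d y i)"
    using smooth_vector_bundle c d i unfolding smooth_vector_bundle_def by blast
  then have "cdiff k c (chart_dom c \<inter> chart_dom d) (\<lambda>y. chart_coord d y i)"
    using smooth_on_chart_iff[OF c o] by auto
  then show ?thesis by (rule cdiff_subset) (use W in auto)
qed

text \<open>By the chain rule a partial derivative in \<open>d\<close> is a combination of those in
  \<open>c\<close>, with partial derivatives of the transition map as coefficients. The induction
  hypothesis carries the derivatives in \<open>c\<close> over to \<open>d\<close>.\<close>

lemma cdiff_change_chart: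
  assumes c: "c \<in> charts B" and d: "d \<in> charts B" and W: "open W" "W \<subseteq> chart_dom c" "W \<subseteq> chart_dom d"
  shows "cdiff k c W f \<Longrightarrow> cdiff k d W f"
proof (induction k arbitrary: f)
  case (Suc k)
  show ?case unfolding cdiff.simps
  proof (intro conjI allI impI)
    show "continuous_on W f" using Suc.prems by simp
    fix i assume i: "i < dimB"
    let ?g = "\<lambda>x. \<Sum>j<dimB. chart_partial c j f x * chart_partial d i (\<lambda>y. chart_coord c y j) x"
    have f1: "cdiff 1 c W f" using Suc.prems cdiff_continuous by fastforce
    have co: "cdiff m d W (\<lambda>y. chart_coord c y j)" if "j < dimB" for j m
      by (rule cdiff_coord[OF d c W(1,3,2) that])
    have "has_partial d i f (?g x) x" if x: "x \<in> W" for x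
      by (rule has_partial_chain[OF c d W x i f1])
        (rule cdiff_chart_partial(2)[OF d W(1,3) co i x])
    moreover have "cdiff k d W ?g"
    proof (rule cdiff_sum)
      fix j assume "j \<in> {..<dimB}"
      then have j: "j < dimB" by simp
      show "cdiff k d W (\<lambda>x. chart_partial c j f x * chart_partial d i (\<lambda>y. chart_coord c y j) x)"
        by (rule cdiff_mult[OF d W(1,3) Suc.IH[OF cdiff_chart_partial(1)[OF c W(1,2) Suc.prems j]]
              cdiff_chart_partial(1)[OF d W(1,3) co[OF j] i]])
    qed
    ultimately show "\<exists>g. (\<forall>x\<in>W. has_partial d i f (g x) x) \<and> cdiff k d W g"
      by (intro exI[of _ ?g] conjI ballI)
  qed
qed simp

lemma chart_partial_commute:
  assumes c: "c \<in> charts B" and W: "open W" "W \<subseteq> chart_dom c" "x \<in> W"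
    and f: "cdiff 2 c W f" and i: "i < dimB" and j: "j < dimB"
  shows "chart_partial c i (chart_partial c j f) x = chart_partial c j (chart_partial c i f) x"
proof (cases "i = j")
  case ne: False
  let ?inv = "inv_into (chart_dom c) (chart_coord c)"
  define z0 where "z0 = chart_coord c x"
  \<comment> \<open>The coordinate plane through \<open>x\<close> in the directions \<open>i\<close>
    and \<open>j\<close>, to which the two-variable statement is applied.\<close>
  define P where "P s t = ?inv (z0(i := s, j := t))" for s t
  have xc: "x \<in> chart_dom c" using W by auto
  have inbox: "z0(i := s, j := t) \<in> box_around dimB z0 \<delta>"
    if "\<bar>s - z0 i\<bar> < \<delta>" "\<bar>t - z0 j\<bar> < \<delta>" for s t \<delta>
    using that i j by (auto simp: box_around_def)
  obtain \<delta> where \<delta>: "\<delta> > 0" "\<And>z. z \<in> box_around dimB z0 \<delta> \<Longrightarrow>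
      ?inv z \<in> W \<and> chart_coord c (?inv z) = z"
    using chart_box[OF c W] unfolding z0_def by blast
  have P: "P s t \<in> W" "chart_coord c (P s t) = z0(i := s, j := t)"
    if "\<bar>s - z0 i\<bar> < \<delta>" "\<bar>t - z0 j\<bar> < \<delta>" for s t
    using \<delta>(2)[OF inbox[OF that]] by (auto simp: P_def)
  have P0: "P (z0 i) (z0 j) = x" using xc by (simp add: P_def z0_def c)
  have di: "((\<lambda>s. g (P s t)) has_field_derivative chart_partial c i g (P s t)) (at s)"
    if g: "cdiff 1 c W g" and st: "\<bar>s - z0 i\<bar> < \<delta>" "\<bar>t - z0 j\<bar> < \<delta>" for g s t
  proof -
    have "has_partial c i g (chart_partial c i g (P s t)) (P s t)"
      by (rule cdiff_chart_partial(2)[OF c W(1,2) g[unfolded One_nat_def] i]) (use P[OF st] in auto)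
    moreover have "coord_line c i (P s t) s' = P s' t" for s'
      unfolding coord_line_def P(2)[OF st] using ne by (simp add: P_def fun_upd_twist)
    ultimately show ?thesis using P(2)[OF st] ne by (simp add: has_partial_def)
  qed
  have dj: "((\<lambda>t. g (P s t)) has_field_derivative chart_partial c j g (P s t)) (at t)"
    if g: "cdiff 1 c W g" and st: "\<bar>s - z0 i\<bar> < \<delta>" "\<bar>t - z0 j\<bar> < \<delta>" for g s t
  proof -
    have "has_partial c j g (chart_partial c j g (P s t)) (P s t)"
      by (rule cdiff_chart_partial(2)[OF c W(1,2) g[unfolded One_nat_def] j]) (use P[OF st] in auto)
    moreover have "coord_line c j (P s t) t' = P s t'" for t'
      unfolding coord_line_def P(2)[OF st] by (simp add: P_def)
    ultimately show ?thesis using P(2)[OF st] by (simp add: has_partial_def)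
  qed
  have f2: "cdiff (Suc 1) c W f" using f by (simp add: numeral_2_eq_2)
  then have f1: "cdiff 1 c W f" by (rule cdiff_SucD)
  have p1: "cdiff 1 c W (chart_partial c k f)" if "k < dimB" for k
    by (rule cdiff_chart_partial(1)[OF c W(1,2) f2 that])
  have cont: "\<exists>\<eta>>0. \<forall>s t. \<bar>s - z0 i\<bar> < \<eta> \<longrightarrow> \<bar>t - z0 j\<bar> < \<eta> \<longrightarrow>
      \<bar>chart_partial c l (chart_partial c k f) (P s t) - chart_partial c l (chart_partial c k f) (P (z0 i) (z0 j))\<bar> < \<epsilon>"
    if "\<epsilon> > 0" "k < dimB" "l < dimB" for k l \<epsilon>
  proof -
    have "cdiff (Suc 0) c W (chart_partial c k f)" using p1[OF that(2)] by simp
    then have "continuous_on W (chart_partial c l (chart_partial c k f))"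
      using cdiff_chart_partial(1)[OF c W(1,2), of 0 "chart_partial c k f" l] that by simp
    from chart_continuous_box[OF c W this that(1)] obtain \<eta> where "\<eta> > 0"
      "\<And>z. z \<in> box_around dimB z0 \<eta> \<Longrightarrow>
       \<bar>chart_partial c l (chart_partial c k f) (?inv z) - chart_partial c l (chart_partial c k f) x\<bar> < \<epsilon>"
      unfolding z0_def by blast
    then show ?thesis unfolding P0 unfolding P_def using inbox by blast
  qed
  have "chart_partial c j (chart_partial c i f) (P (z0 i) (z0 j)) =
      chart_partial c i (chart_partial c j f) (P (z0 i) (z0 j))"
    by (rule mixed_partials_eq[where G = "\<lambda>s t. f (P s t)" and Gs = "\<lambda>s t. chart_partial c i f (P s t)"
          and Gt = "\<lambda>s t. chart_partial c j f (P s t)", OF \<delta>(1)])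
      (use di dj f1 p1 i j cont in auto)
  then show ?thesis by (simp add: P0)
qed simp

lemma cdiff_Un:
  assumes c: "c \<in> charts B" and V: "open V" "V \<subseteq> chart_dom c" and W: "open W" "W \<subseteq> chart_dom c"
  shows "cdiff k c V f \<Longrightarrow> cdiff k c W f \<Longrightarrow> cdiff k c (V \<union> W) f"
proof (induction k arbitrary: f)
  case 0
  then show ?case using V W by (auto intro: continuous_on_open_Un)
next
  case (Suc k)
  show ?case unfolding cdiff.simps
  proof (intro conjI allI impI)
    show "continuous_on (V \<union> W) f" using Suc.prems V W by (auto intro: continuous_on_open_Un)
    fix i assume i: "i < dimB"
    show "\<exists>g. (\<forall>x\<in>V \<union> W. has_partial c i f (g x) x) \<and> cdiff k c (V \<union> W) g"
      using cdiff_chart_partial[OF c V Suc.prems(1) i] cdiff_chart_partial[OF c W Suc.prems(2) i]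
      by (intro exI[of _ "chart_partial c i f"]) (auto intro: Suc.IH)
  qed
qed

text \<open>The domain of \<open>d\<close> is covered by the overlap and the complement of
  \<open>K\<close>, where the function is zero. Closedness of \<open>K\<close> in the whole manifold
  makes the second set open.\<close>

lemma cdiff_extend_zero:
  assumes c: "c \<in> charts B" and d: "d \<in> charts B" and K: "closed K" "K \<subseteq> chart_dom c"
    and f: "cdiff k d (chart_dom c \<inter> chart_dom d) f" "\<And>y. y \<notin> K \<Longrightarrow> f y = 0"
  shows "cdiff k d (chart_dom d) f"
proof -
  have o: "open (chart_dom c \<inter> chart_dom d)" "open (chart_dom d - K)"
    using open_chart_dom[OF c] open_chart_dom[OF d] K by auto
  have "cdiff k d (chart_dom d - K) f"
    by (subst cdiff_cong[OF d o(2), of f "\<lambda>x. 0"]) (use f(2) in \<open>auto intro: cdiff_const\<close>)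
  from cdiff_Un[OF d o(1) _ o(2) _ f(1) this]
  have "cdiff k d (chart_dom c \<inter> chart_dom d \<union> (chart_dom d - K)) f" by auto
  moreover have "chart_dom c \<inter> chart_dom d \<union> (chart_dom d - K) = chart_dom d" using K by auto
  ultimately show ?thesis by simp
qed

lemma cdiff_flat_exp:
  assumes c: "c \<in> charts B" and i: "i < dimB"
  shows "cdiff k c (chart_dom c) (\<lambda>y. flat_exp j (a + b * chart_coord c y i))"
proof (induction k arbitrary: j)
  have "continuous_on UNIV (flat_exp j)" for j
    by (intro continuous_at_imp_continuous_on ballI DERIV_isCont[OF DERIV_flat_exp])
  then have cont: "continuous_on (chart_dom c) (\<lambda>y. flat_exp j (a + b * chart_coord c y i))" for j
    by (rule continuous_on_compose2[of UNIV "flat_exp j"])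
      (auto intro!: continuous_intros continuous_on_chart_coord[OF c])
  {
    case 0
    show ?case using cont by simp
  next
    case (Suc k)
    show ?case unfolding cdiff.simps
    proof (intro conjI allI impI cont)
      fix l assume l: "l < dimB"
      let ?y = "\<lambda>x. a + b * chart_coord c x i"
      let ?g = "\<lambda>x. (if l = i then b else 0) * flat_exp (j + 2) (?y x) +
          (if l = i then - (b * real j) else 0) * flat_exp (j + 1) (?y x)"
      have "has_partial c l (\<lambda>y. flat_exp j (?y y)) (?g x) x" if x: "x \<in> chart_dom c" for x
      proof -
        have "has_partial c l ?y (b * (if l = i then 1 else 0)) x"
          using has_partial_add[OF has_partial_const[of c l a x]
              has_partial_mult[OF c x has_partial_const[of c l b x] has_partial_coord[OF c x l, of i]]]
          by simp
        then have "((\<lambda>t. flat_exp j (?y (coord_line c l x t))) has_field_derivative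
           (flat_exp (j + 2) (?y (coord_line c l x (chart_coord c x l))) -
            real j * flat_exp (j + 1) (?y (coord_line c l x (chart_coord c x l)))) * (b * (if l = i then 1 else 0)))
           (at (chart_coord c x l))"
          unfolding has_partial_def by (intro DERIV_chain2[OF DERIV_flat_exp])
        then show ?thesis using x c
          by (cases "l = i") (simp_all add: has_partial_def algebra_simps)
      qed
      moreover have "cdiff k c (chart_dom c) ?g"
        by (intro cdiff_add cdiff_mult[OF c open_chart_dom[OF c] order_refl] cdiff_const Suc)
      ultimately show "\<exists>g. (\<forall>x\<in>chart_dom c. has_partial c l (\<lambda>y. flat_exp j (?y y)) (g x) x) \<and>
          cdiff k c (chart_dom c) g" by (intro exI[of _ ?g] conjI ballI)
    qed
  }
qed

text \<open>The support is the preimage of a compact box, and a compact set is closed in the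
  manifold because the latter is Hausdorff. Closedness relative to the chart would not suffice for
  extending by zero.\<close>

lemma bump_function:
  assumes c: "c \<in> charts B" and x: "x \<in> chart_dom c"
  shows "\<exists>\<phi> K. closed K \<and> K \<subseteq> chart_dom c \<and> (\<forall>y. y \<notin> K \<longrightarrow> \<phi> y = 0) \<and>
    (\<forall>k. cdiff k c (chart_dom c) \<phi>) \<and> \<phi> x > 0"
proof -
  let ?inv = "inv_into (chart_dom c) (chart_coord c)"
  define z0 where "z0 = chart_coord c x"
  obtain \<delta> where \<delta>: "\<delta> > 0" "\<And>z. z \<in> box_around dimB z0 \<delta> \<Longrightarrow>
      ?inv z \<in> chart_dom c \<and> chart_coord c (?inv z) = z"
    using chart_box[OF c open_chart_dom[OF c] order_refl x] unfolding z0_def by blast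
  \<comment> \<open>Strictly smaller than \<delta>, so that the closed box of radius \<rho> lies in
    the open box of radius \<delta>.\<close>
  define \<rho> where "\<rho> = \<delta> / 2"
  have \<rho>: "0 < \<rho>" "\<rho> < \<delta>" using \<delta>(1) by (auto simp: \<rho>_def)
  define C where "C = (\<Pi>\<^sub>E i\<in>UNIV. if i < dimB then {z0 i - \<rho>..z0 i + \<rho>} else {z0 i})"
  have memC: "z \<in> C \<longleftrightarrow> (\<forall>i<dimB. \<bar>z i - z0 i\<bar> \<le> \<rho>) \<and> (\<forall>i\<ge>dimB. z i = z0 i)" for z
    by (auto simp: C_def PiE_iff abs_le_iff algebra_simps not_less split: if_splits)
  have C: "C \<subseteq> box_around dimB z0 \<delta>" using \<rho> by (fastforce simp: memC box_around_def)
  have "compactin (product_topology (\<lambda>i. euclidean) UNIV) C"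
    unfolding C_def by (subst compactin_PiE) auto
  then have "compact C" by (simp add: euclidean_product_topology)
  moreover have "C \<subseteq> chart_coord c ` chart_dom c"
  proof
    fix z assume "z \<in> C"
    then have "z \<in> box_around dimB z0 \<delta>" using C by blast
    from \<delta>(2)[OF this] show "z \<in> chart_coord c ` chart_dom c"
      by (intro image_eqI[of z "chart_coord c" "?inv z"]) auto
  qed
  then have "continuous_on C ?inv"
    by (rule continuous_on_subset[OF continuous_on_inv_chart[OF c]])
  ultimately have "compact (?inv ` C)" by (intro compact_continuous_image)
  then have 1: "closed (?inv ` C)" by (rule compact_imp_closed)
  have 2: "?inv ` C \<subseteq> chart_dom c" using C \<delta>(2) by blast
  \<comment> \<open>The \<open>i\<close>-th factor is positive exactly if the \<open>i\<close>-th
    coordinate of \<open>y\<close> differs from \<open>z0 i\<close> by less than \<rho>. For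
    \<open>dimB = 0\<close> the product is empty and the function is \<open>1\<close> on the
    chart.\<close>
  define \<psi> where "\<psi> y = (\<Prod>i<dimB. flat_exp 0 ((\<rho> - z0 i) + 1 * chart_coord c y i) *
      flat_exp 0 ((\<rho> + z0 i) + (- 1) * chart_coord c y i))" for y
  define \<phi> where "\<phi> y = (if y \<in> chart_dom c then \<psi> y else 0)" for y
  have "\<phi> y = 0" if "y \<notin> ?inv ` C" for y
  proof (cases "y \<in> chart_dom c")
    case True
    have "?inv (chart_coord c y) = y" using True c by simp
    then have "chart_coord c y \<notin> C" using that by (metis image_eqI)
    moreover have "\<forall>i\<ge>dimB. chart_coord c y i = z0 i"
      using chart_coord_zero[OF c] True x by (simp add: z0_def)
    ultimately obtain i where i: "i < dimB" "\<not> \<bar>chart_coord c y i - z0 i\<bar> \<le> \<rho>" by (auto simp: memC)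
    then have "flat_exp 0 ((\<rho> - z0 i) + 1 * chart_coord c y i) *
      flat_exp 0 ((\<rho> + z0 i) + (- 1) * chart_coord c y i) = 0"
      by (auto simp: flat_exp_def)
    then have "\<psi> y = 0" unfolding \<psi>_def using i(1) by (intro prod_zero) auto
    then show ?thesis by (simp add: \<phi>_def)
  qed (simp add: \<phi>_def)
  moreover have "cdiff k c (chart_dom c) \<phi>" for k
  proof (subst cdiff_cong[OF c open_chart_dom[OF c] order_refl, of \<phi> \<psi>])
    show "cdiff k c (chart_dom c) \<psi>" unfolding \<psi>_def
      by (intro cdiff_prod[OF c open_chart_dom[OF c] order_refl]
          cdiff_mult[OF c open_chart_dom[OF c] order_refl] cdiff_flat_exp[OF c]) auto
  qed (simp add: \<phi>_def)
  moreover have "\<phi> x > 0" using x \<rho>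
    by (auto simp: \<phi>_def \<psi>_def z0_def intro!: zero_less_power mult_pos_pos flat_exp_pos)
  ultimately show ?thesis using 1 2 by blast
qed

end

section \<open>Frames, transition matrices and sections\<close>

lemma representation_sum_basis:
  fixes e :: "nat \<Rightarrow> 'w::real_vector"
  assumes "inj_on e {..<r}" "independent (e ` {..<r})" "\<alpha> < r"
  shows "representation (e ` {..<r}) (\<Sum>\<beta><r. a \<beta> *\<^sub>R e \<beta>) (e \<alpha>) = a \<alpha>"
proof -
  have s: "e \<beta> \<in> span (e ` {..<r})" if "\<beta> < r" for \<beta> using that by (auto intro: span_base)
  have "representation (e ` {..<r}) (\<Sum>\<beta><r. a \<beta> *\<^sub>R e \<beta>) (e \<alpha>) =
      (\<Sum>\<beta><r. a \<beta> * representation (e ` {..<r}) (e \<beta>) (e \<alpha>))"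
    using assms(2) s by (subst representation_sum)
      (auto intro: span_scale simp: representation_scale)
  also have "\<dots> = (\<Sum>\<beta><r. if \<beta> = \<alpha> then a \<beta> else 0)"
    by (rule sum.cong) (use assms in \<open>auto simp: representation_basis inj_on_eq_iff\<close>)
  finally show ?thesis using assms(3) by simp
qed

text \<open>Applied to the dual frame, with evaluations at the frame vectors as the forms
  \<open>\<phi> \<alpha>\<close>. It shows that the coframe is a frame in the charts of the dual
  bundle.\<close>

lemma independent_biorthogonal:
  fixes e :: "nat \<Rightarrow> 'w::real_vector" and \<phi> :: "nat \<Rightarrow> 'w \<Rightarrow> real"
  assumes \<phi>: "\<And>\<alpha>. \<alpha> < r \<Longrightarrow> linear (\<phi> \<alpha>)"
    and d: "\<And>\<alpha> \<beta>. \<alpha> < r \<Longrightarrow> \<beta> < r \<Longrightarrow> \<phi> \<alpha> (e \<beta>) = (if \<alpha> = \<beta> then 1 else 0)"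
  shows "inj_on e {..<r}" "independent (e ` {..<r})"
proof -
  show inj: "inj_on e {..<r}"
  proof (rule inj_onI)
    fix \<alpha> \<beta> assume "\<alpha> \<in> {..<r}" "\<beta> \<in> {..<r}" "e \<alpha> = e \<beta>"
    then show "\<alpha> = \<beta>" using d[of \<alpha> \<alpha>] d[of \<alpha> \<beta>] by (auto split: if_splits)
  qed
  show "independent (e ` {..<r})"
  proof (rule independent_if_scalars_zero)
    fix f x assume 0: "(\<Sum>x\<in>e ` {..<r}. f x *\<^sub>R x) = 0" and "x \<in> e ` {..<r}"
    then obtain \<alpha> where \<alpha>: "\<alpha> < r" "x = e \<alpha>" by auto
    have "0 = \<phi> \<alpha> (\<Sum>x\<in>e ` {..<r}. f x *\<^sub>R x)" using 0 linear_0[OF \<phi>[OF \<alpha>(1)]] by simp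
    also have "\<dots> = (\<Sum>\<beta><r. f (e \<beta>) * \<phi> \<alpha> (e \<beta>))"
      by (simp add: sum.reindex[OF inj] linear_sum[OF \<phi>[OF \<alpha>(1)]] linear_scale[OF \<phi>[OF \<alpha>(1)]])
    also have "\<dots> = (\<Sum>\<beta><r. if \<alpha> = \<beta> then f (e \<beta>) else 0)"
      by (rule sum.cong) (use d \<alpha> in auto)
    finally show "f x = 0" using \<alpha> by simp
  qed simp
qed

text \<open>The charts of the dual bundle differ from those of the bundle in their frames only,
  which smoothness of functions does not see.\<close>

lemma smooth_on_chart_frame [simp]:
  "smooth_on_chart n \<lparr>chart_dom = chart_dom c, chart_coord = chart_coord c, chart_frame = f\<rparr> W g =
   smooth_on_chart n c W g"
proof -
  let ?c = "\<lparr>chart_dom = chart_dom c, chart_coord = chart_coord c, chart_frame = f\<rparr>"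
  have l: "coord_line ?c i x t = coord_line c i x t" for i x t by (simp add: coord_line_def)
  then have "chart_partial ?c = chart_partial c" by (simp add: chart_partial_def fun_eq_iff)
  then show ?thesis unfolding smooth_on_chart_def l by simp
qed

text \<open>The coefficient of the odd generator number \<open>s\<close> in the function of the section \<open>u\<close>.\<close>

definition scomp :: "('m, 'v::real_vector) vbundle \<Rightarrow> ('m \<Rightarrow> 'v \<times> ('v \<Rightarrow> real)) \<Rightarrow>
    ('m, 'v) bundle_chart \<Rightarrow> nat \<Rightarrow> 'm \<Rightarrow> real" where
  "scomp B u c s x = (if even s then snd (u x) (chart_frame c (s div 2) x)
     else coframe (bundle_rank B) c (s div 2) x (fst (u x)))"

text \<open>The matrix expressing the odd generators of the chart \<open>d\<close> in terms of those of \<open>c\<close>.\<close>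

definition trans_mat :: "('m, 'v::real_vector) vbundle \<Rightarrow> ('m, 'v) bundle_chart \<Rightarrow> ('m, 'v) bundle_chart \<Rightarrow>
    'm \<Rightarrow> nat \<Rightarrow> nat \<Rightarrow> real" where
  "trans_mat B c d x t s =
     (if even t \<and> even s then coframe (bundle_rank B) d (s div 2) x (chart_frame c (t div 2) x)
      else if \<not> even t \<and> \<not> even s then coframe (bundle_rank B) c (t div 2) x (chart_frame d (s div 2) x)
      else 0)"

lemma sum_even_odd: "(\<Sum>s<2 * r. f s) = (\<Sum>\<alpha><r. f (2 * \<alpha>) + f (2 * \<alpha> + 1))"
  for f :: "nat \<Rightarrow> 'a::comm_monoid_add"
  by (induction r) (simp_all add: algebra_simps)

context smooth_bundle
begin

abbreviation "dimR \<equiv> 2 * rkB"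
abbreviation "cofr c \<alpha> x \<equiv> coframe rkB c \<alpha> x"

context
  fixes c x assumes c: "c \<in> charts B" and x: "x \<in> chart_dom c"
begin

lemma frame_facts:
  "inj_on (\<lambda>\<alpha>. chart_frame c \<alpha> x) {..<rkB}"
  "independent ((\<lambda>\<alpha>. chart_frame c \<alpha> x) ` {..<rkB})"
  "span ((\<lambda>\<alpha>. chart_frame c \<alpha> x) ` {..<rkB}) = fibre B x"
  using smooth_vector_bundle c x unfolding smooth_vector_bundle_def by blast+

lemma fibre_subspace: "subspace (fibre B x)"
  using frame_facts(3) subspace_span by metis

lemma frame_in_fibre: "\<alpha> < rkB \<Longrightarrow> chart_frame c \<alpha> x \<in> fibre B x"
  using frame_facts(3) by (auto intro: span_base)

lemma coframe_expand: "v \<in> fibre B x \<Longrightarrow> (\<Sum>\<alpha><rkB. cofr c \<alpha> x v *\<^sub>R chart_frame c \<alpha> x) = v"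
  using sum_representation_eq[OF frame_facts(2), of v "(\<lambda>\<alpha>. chart_frame c \<alpha> x) ` {..<rkB}"] frame_facts
  by (simp add: coframe_def sum.reindex[OF frame_facts(1)])

lemma coframe_sum: "\<alpha> < rkB \<Longrightarrow> cofr c \<alpha> x (\<Sum>\<beta><rkB. a \<beta> *\<^sub>R chart_frame c \<beta> x) = a \<alpha>"
  unfolding coframe_def by (rule representation_sum_basis[OF frame_facts(1,2)])

lemma coframe_frame: "\<alpha> < rkB \<Longrightarrow> \<beta> < rkB \<Longrightarrow> cofr c \<alpha> x (chart_frame c \<beta> x) = (if \<alpha> = \<beta> then 1 else 0)"
  unfolding coframe_def using frame_facts
  by (auto simp: representation_basis dest: inj_onD)

lemma coframe_add: "v \<in> fibre B x \<Longrightarrow> w \<in> fibre B x \<Longrightarrow> cofr c \<alpha> x (v + w) = cofr c \<alpha> x v + cofr c \<alpha> x w"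
  unfolding coframe_def using frame_facts by (auto simp: representation_add)

lemma coframe_scaleR: "v \<in> fibre B x \<Longrightarrow> cofr c \<alpha> x (a *\<^sub>R v) = a * cofr c \<alpha> x v"
  unfolding coframe_def using frame_facts by (auto simp: representation_scale)

lemma coframe_outside: "v \<notin> fibre B x \<Longrightarrow> cofr c \<alpha> x v = 0"
  unfolding coframe_def using frame_facts(3) by (simp add: representation_def)

lemma coframe_dual: "cofr c \<alpha> x \<in> dual_space (fibre B x)"
  unfolding dual_space_def by (auto simp: coframe_add coframe_scaleR coframe_outside)

text \<open>An identity of functions on the whole of the ambient space: both sides are extended by
  \<open>0\<close> outside the fibre.\<close>

lemma dual_expand:
  assumes "\<xi> \<in> dual_space (fibre B x)"
  shows "\<xi> = (\<Sum>\<alpha><rkB. \<xi> (chart_frame c \<alpha> x) *\<^sub>R cofr c \<alpha> x)"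
proof
  fix v
  have add: "\<xi> (v + w) = \<xi> v + \<xi> w" if "v \<in> fibre B x" "w \<in> fibre B x" for v w
    using assms that by (auto simp: dual_space_def)
  have scale: "\<xi> (a *\<^sub>R v) = a * \<xi> v" if "v \<in> fibre B x" for v a
    using assms that by (auto simp: dual_space_def)
  have z: "\<xi> 0 = 0" using scale[of 0 0] subspace_0[OF fibre_subspace] by simp
  have sum: "\<xi> (\<Sum>\<alpha>\<in>I. f \<alpha>) = (\<Sum>\<alpha>\<in>I. \<xi> (f \<alpha>))" if "\<And>\<alpha>. \<alpha> \<in> I \<Longrightarrow> f \<alpha> \<in> fibre B x" for f and I :: "nat set"
    using that by (induction I rule: infinite_finite_induct)
      (auto simp: z add subspace_sum[OF fibre_subspace])
  show "\<xi> v = (\<Sum>\<alpha><rkB. \<xi> (chart_frame c \<alpha> x) *\<^sub>R cofr c \<alpha> x) v"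
  proof (cases "v \<in> fibre B x")
    case True
    have "\<xi> v = \<xi> (\<Sum>\<alpha><rkB. cofr c \<alpha> x v *\<^sub>R chart_frame c \<alpha> x)" by (simp add: coframe_expand True)
    also have "\<dots> = (\<Sum>\<alpha><rkB. cofr c \<alpha> x v * \<xi> (chart_frame c \<alpha> x))"
      using frame_in_fibre by (subst sum) (auto intro!: sum.cong subspace_scale[OF fibre_subspace] simp: scale)
    finally show ?thesis by (simp add: sum_fun_apply scaleR_fun_def mult.commute)
  next
    case False
    then show ?thesis using assms by (simp add: sum_fun_apply scaleR_fun_def coframe_outside dual_space_def)
  qed
qed

lemma linear_eval: "linear (\<lambda>\<xi> :: 'v \<Rightarrow> real. \<xi> v)"
  by (rule linearI) (auto simp: scaleR_fun_def)

lemma coframe_dual_chart: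
  assumes "\<xi> \<in> dual_space (fibre B x)" "\<alpha> < rkB"
  shows "coframe rkB \<lparr>chart_dom = chart_dom c, chart_coord = chart_coord c, chart_frame = coframe rkB c\<rparr> \<alpha> x \<xi> =
    \<xi> (chart_frame c \<alpha> x)"
proof -
  have i: "inj_on (\<lambda>\<alpha>. cofr c \<alpha> x) {..<rkB}" "independent ((\<lambda>\<alpha>. cofr c \<alpha> x) ` {..<rkB})"
    using independent_biorthogonal[of rkB "\<lambda>\<alpha> \<xi>. \<xi> (chart_frame c \<alpha> x)" "\<lambda>\<alpha>. cofr c \<alpha> x"]
    by (auto simp: linear_eval coframe_frame)
  show ?thesis unfolding coframe_def[of rkB "bundle_chart.make _ _ _"] coframe_def[of rkB "\<lparr>chart_dom = _, chart_coord = _, chart_frame = _\<rparr>"]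
    by (subst dual_expand[OF assms(1)]) (simp add: representation_sum_basis[OF i assms(2)])
qed

lemma dual_space_sum: "(\<Sum>\<alpha><rkB. a \<alpha> *\<^sub>R cofr c \<alpha> x) \<in> dual_space (fibre B x)"
  by (auto simp: dual_space_def sum_fun_apply scaleR_fun_def coframe_add coframe_scaleR coframe_outside
      sum.distrib sum_distrib_left algebra_simps)

end

lemma cdiff_trans_mat:
  assumes c: "c \<in> charts B" and d: "d \<in> charts B" and "t < dimR" "s < dimR"
  shows "cdiff k c (chart_dom c \<inter> chart_dom d) (\<lambda>x. trans_mat B c d x t s)"
proof -
  have o: "open (chart_dom c \<inter> chart_dom d)" using open_chart_dom c d by blast
  have *: "cdiff k c (chart_dom c \<inter> chart_dom d) (\<lambda>x. cofr d \<alpha> x (chart_frame c \<beta> x))"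
    if "c \<in> charts B" "d \<in> charts B" "\<alpha> < rkB" "\<beta> < rkB" for c d \<alpha> \<beta>
  proof -
    have o: "open (chart_dom c \<inter> chart_dom d)" using open_chart_dom that by blast
    have "smooth_on_chart dimB c (chart_dom c \<inter> chart_dom d) (\<lambda>x. cofr d \<alpha> x (chart_frame c \<beta> x))"
      using smooth_vector_bundle that unfolding smooth_vector_bundle_def by blast
    then show ?thesis using smooth_on_chart_iff[OF that(1) o] by auto
  qed
  have h: "t div 2 < rkB" "s div 2 < rkB" using assms by auto
  have "cdiff k d (chart_dom c \<inter> chart_dom d) (\<lambda>x. cofr c (t div 2) x (chart_frame d (s div 2) x))"
    using *[OF d c h] by (simp add: Int_commute)
  then have "cdiff k c (chart_dom c \<inter> chart_dom d) (\<lambda>x. cofr c (t div 2) x (chart_frame d (s div 2) x))"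
    by (rule cdiff_change_chart[OF d c o, rotated 2]) auto
  then show ?thesis using *[OF c d h(2,1)]
    by (cases "even t"; cases "even s"; simp add: trans_mat_def cdiff_const)
qed

text \<open>Invariance of the pairing of \<tau> with \<theta>: the two blocks of the matrix are
  inverse transposes of each other, and \<open>dual_no\<close> exchanges the blocks.\<close>

lemma trans_mat_dual: "trans_mat B c d x (dual_no t) (dual_no s) = trans_mat B d c x s t"
proof -
  have "dual_no s div 2 = s div 2" "even (dual_no s) \<longleftrightarrow> \<not> even s" for s
    by (auto simp: dual_no_def elim: oddE)
  then show ?thesis by (auto simp: trans_mat_def)
qed

context
  fixes c d x assumes c: "c \<in> charts B" and d: "d \<in> charts B"
    and x: "x \<in> chart_dom c" "x \<in> chart_dom d"
begin

lemma coframe_trans: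
  assumes "v \<in> fibre B x" "\<alpha> < rkB"
  shows "(\<Sum>\<beta><rkB. cofr c \<alpha> x (chart_frame d \<beta> x) * cofr d \<beta> x v) = cofr c \<alpha> x v"
proof -
  have "v = (\<Sum>\<beta><rkB. cofr d \<beta> x v *\<^sub>R chart_frame d \<beta> x)" using coframe_expand[OF d x(2) assms(1)] by simp
  also have "\<dots> = (\<Sum>\<beta><rkB. cofr d \<beta> x v *\<^sub>R (\<Sum>\<gamma><rkB. cofr c \<gamma> x (chart_frame d \<beta> x) *\<^sub>R chart_frame c \<gamma> x))"
    by (intro sum.cong) (auto simp: coframe_expand[OF c x(1)] frame_in_fibre[OF d x(2)])
  also have "\<dots> = (\<Sum>\<gamma><rkB. (\<Sum>\<beta><rkB. cofr d \<beta> x v * cofr c \<gamma> x (chart_frame d \<beta> x)) *\<^sub>R chart_frame c \<gamma> x)"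
    unfolding scaleR_sum_right scaleR_sum_left scaleR_scaleR by (rule sum.swap)
  finally have v: "v = (\<Sum>\<gamma><rkB. (\<Sum>\<beta><rkB. cofr d \<beta> x v * cofr c \<gamma> x (chart_frame d \<beta> x)) *\<^sub>R chart_frame c \<gamma> x)" .
  have "cofr c \<alpha> x v = (\<Sum>\<beta><rkB. cofr d \<beta> x v * cofr c \<alpha> x (chart_frame d \<beta> x))"
    using arg_cong[OF v, of "cofr c \<alpha> x"] unfolding coframe_sum[OF c x(1) assms(2)] .
  then show ?thesis by (simp add: mult.commute)
qed

lemma trans_mat_inverse:
  assumes "t < dimR" "u < dimR"
  shows "(\<Sum>s<dimR. trans_mat B c d x t s * trans_mat B d c x s u) = (if t = u then 1 else 0)"
proof -
  have h: "t div 2 < rkB" "u div 2 < rkB" using assms by auto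
  have e: "(\<Sum>\<alpha><rkB. cofr d \<alpha> x (chart_frame c (t div 2) x) * cofr c (u div 2) x (chart_frame d \<alpha> x)) =
      (if u div 2 = t div 2 then 1 else 0)"
    using coframe_trans[OF frame_in_fibre[OF c x(1) h(1)] h(2)] coframe_frame[OF c x(1) h(2,1)]
    by (simp add: mult.commute)
  have o: "(\<Sum>\<alpha><rkB. cofr c (t div 2) x (chart_frame d \<alpha> x) * cofr d \<alpha> x (chart_frame c (u div 2) x)) =
      (if t div 2 = u div 2 then 1 else 0)"
    using coframe_trans[OF frame_in_fibre[OF c x(1) h(2)] h(1)] coframe_frame[OF c x(1) h] by simp
  show ?thesis
  proof (cases "even t = even u")
    case True
    then have "t div 2 = u div 2 \<longleftrightarrow> t = u" by presburger
    then show ?thesis using True e o unfolding sum_even_odd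
      by (cases "even t") (simp_all add: trans_mat_def eq_commute[of u t] eq_commute[of "u div 2"])
  next
    case False
    then have "t \<noteq> u" by auto
    then show ?thesis using False unfolding sum_even_odd
      by (cases "even t") (simp_all add: trans_mat_def)
  qed
qed

lemma comp_trans:
  assumes "fst (u x) \<in> fibre B x" "snd (u x) \<in> dual_space (fibre B x)" "t < dimR"
  shows "scomp B u c t x = (\<Sum>s<dimR. trans_mat B c d x t s * scomp B u d s x)"
proof -
  have h: "t div 2 < rkB" using assms by auto
  have "snd (u x) (chart_frame c (t div 2) x) =
    (\<Sum>\<alpha><rkB. snd (u x) (chart_frame d \<alpha> x) * cofr d \<alpha> x (chart_frame c (t div 2) x))"
    by (subst dual_expand[OF d x(2) assms(2)]) (simp add: sum_fun_apply scaleR_fun_def)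
  then show ?thesis using coframe_trans[OF assms(1) h] unfolding sum_even_odd
    by (simp add: trans_mat_def scomp_def mult.commute)
qed

lemma change_odd_trans_mat:
  assumes "s < dimR"
  shows "change_odd rkB c d x s = coef (\<Sum>t<dimR. trans_mat B c d x t s *\<^sub>R og t)"
proof -
  have 1: "coef (\<Sum>i\<in>I. f i) = (\<Sum>i\<in>I. coef (f i))" for f :: "nat \<Rightarrow> gpoly" and I
    by (rule ext) (simp add: coef_sum sum_fun_apply)
  have 2: "coef (a *\<^sub>R og t) = a *\<^sub>R sodd t" for a t
    by (simp add: scaleR_gpoly.rep_eq og.rep_eq)
  show ?thesis unfolding 1 2
    by (simp add: sum_even_odd change_odd_def trans_mat_def tau_no_def theta_no_def)
qed

end

lemma double_sections_iff:
  "u \<in> double_sections B \<longleftrightarrow>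
     (\<forall>x. fst (u x) \<in> fibre B x \<and> snd (u x) \<in> dual_space (fibre B x)) \<and>
     (\<forall>c\<in>charts B. \<forall>s<dimR. \<forall>k. cdiff k c (chart_dom c) (scomp B u c s))"
proof -
  have *: "smooth_on_chart dimB c (chart_dom c) f \<longleftrightarrow> (\<forall>k. cdiff k c (chart_dom c) f)" if "c \<in> charts B" for c f
    by (rule smooth_on_chart_iff[OF that open_chart_dom[OF that] order_refl])
  have cg: "cdiff k c (chart_dom c) (\<lambda>x. coframe rkB \<lparr>chart_dom = chart_dom c, chart_coord = chart_coord c,
        chart_frame = coframe rkB c\<rparr> \<alpha> x (snd (u x))) \<longleftrightarrow> cdiff k c (chart_dom c) (\<lambda>x. snd (u x) (chart_frame c \<alpha> x))"
    if "c \<in> charts B" "\<forall>x. snd (u x) \<in> dual_space (fibre B x)" "\<alpha> < rkB" for c k \<alpha>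
    by (rule cdiff_cong[OF that(1) open_chart_dom[OF that(1)] order_refl])
      (use that coframe_dual_chart[OF that(1)] in auto)
  have sp: "(\<forall>s<dimR. P s) \<longleftrightarrow> (\<forall>\<alpha><rkB. P (2 * \<alpha>) \<and> P (2 * \<alpha> + 1))" for P
  proof
    assume h: "\<forall>\<alpha><rkB. P (2 * \<alpha>) \<and> P (2 * \<alpha> + 1)"
    show "\<forall>s<dimR. P s"
    proof (intro allI impI)
      fix s assume "s < dimR"
      then have "s div 2 < rkB" by auto
      moreover have "s = 2 * (s div 2) \<or> s = 2 * (s div 2) + 1" by presburger
      ultimately show "P s" using h by metis
    qed
  qed auto
  have c1: "scomp B u c (2 * \<alpha>) = (\<lambda>x. snd (u x) (chart_frame c \<alpha> x))"
    "scomp B u c (2 * \<alpha> + 1) = (\<lambda>x. cofr c \<alpha> x (fst (u x)))" for c \<alpha>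
    by (simp_all add: scomp_def fun_eq_iff)
  show ?thesis
    unfolding double_sections_def sections_def dual_bundle_def sp c1
    by (auto simp: * cg simp del: cdiff.simps)
qed

lemma gfun_of_section_comp:
  assumes "c \<in> charts B" "x \<in> chart_dom c"
  shows "gfun_of_section B u c x = coef (\<Sum>s<dimR. scomp B u c s x *\<^sub>R og s)"
proof -
  have 1: "coef (\<Sum>i\<in>I. f i) = (\<Sum>i\<in>I. coef (f i))" for f :: "nat \<Rightarrow> gpoly" and I
    by (rule ext) (simp add: coef_sum sum_fun_apply)
  have 2: "coef (a *\<^sub>R og t) = a *\<^sub>R sodd t" for a t
    by (simp add: scaleR_gpoly.rep_eq og.rep_eq)
  show ?thesis unfolding 1 2 using assms
    by (simp add: sum_even_odd gfun_of_section_def scomp_def tau_no_def theta_no_def add.commute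
        del: plus_fun_apply)
qed

text \<open>Gluing of local components. The section is assembled from one chart chosen at each
  point, and the transformation rule makes all other charts agree with this choice. The last two
  clauses detect sections that lie in one of the two summands.\<close>

lemma section_of_family:
  assumes smooth: "\<And>c s k. c \<in> charts B \<Longrightarrow> s < dimR \<Longrightarrow> cdiff k c (chart_dom c) (w c s)"
    and trans: "\<And>c d x t. c \<in> charts B \<Longrightarrow> d \<in> charts B \<Longrightarrow> x \<in> chart_dom c \<Longrightarrow> x \<in> chart_dom d \<Longrightarrow> t < dimR \<Longrightarrow>
      w c t x = (\<Sum>s<dimR. trans_mat B c d x t s * w d s x)"
  shows "\<exists>u\<in>double_sections B. (\<forall>c\<in>charts B. \<forall>x\<in>chart_dom c. \<forall>s<dimR. scomp B u c s x = w c s x) \<and>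
    ((\<forall>c\<in>charts B. \<forall>x\<in>chart_dom c. \<forall>s<dimR. even s \<longrightarrow> w c s x = 0) \<longrightarrow> (\<forall>x. snd (u x) = 0)) \<and>
    ((\<forall>c\<in>charts B. \<forall>x\<in>chart_dom c. \<forall>s<dimR. \<not> even s \<longrightarrow> w c s x = 0) \<longrightarrow> (\<forall>x. fst (u x) = 0))"
proof -
  obtain k where k: "\<And>x. k x \<in> charts B" "\<And>x. x \<in> chart_dom (k x)" using charts_cover by metis
  define u where "u x = (\<Sum>\<alpha><rkB. w (k x) (2 * \<alpha> + 1) x *\<^sub>R chart_frame (k x) \<alpha> x,
      \<Sum>\<alpha><rkB. w (k x) (2 * \<alpha>) x *\<^sub>R cofr (k x) \<alpha> x)" for x
  have u: "fst (u x) \<in> fibre B x" "snd (u x) \<in> dual_space (fibre B x)" for x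
    using frame_in_fibre[OF k] dual_space_sum[OF k]
    by (auto simp: u_def intro!: subspace_sum[OF fibre_subspace[OF k]] subspace_scale[OF fibre_subspace[OF k]])
  have k1: "scomp B u (k x) s x = w (k x) s x" if "s < dimR" for s x
  proof -
    have h: "s div 2 < rkB" using that by auto
    have "(\<Sum>\<alpha><rkB. w (k x) (2 * \<alpha>) x * cofr (k x) \<alpha> x (chart_frame (k x) (s div 2) x)) = w (k x) (2 * (s div 2)) x"
    proof -
      have "(\<Sum>\<alpha><rkB. w (k x) (2 * \<alpha>) x * cofr (k x) \<alpha> x (chart_frame (k x) (s div 2) x)) =
        (\<Sum>\<alpha><rkB. if s div 2 = \<alpha> then w (k x) (2 * \<alpha>) x else 0)"
        by (rule sum.cong) (use coframe_frame[OF k _ h] in auto)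
      then show ?thesis using h by simp
    qed
    then show ?thesis using h
      by (cases "even s") (simp_all add: scomp_def u_def coframe_sum[OF k h] sum_fun_apply scaleR_fun_def)
  qed
  have cw: "scomp B u c s x = w c s x" if "c \<in> charts B" "x \<in> chart_dom c" "s < dimR" for c x s
    using comp_trans[where u = u, OF that(1) k(1)[of x] that(2) k(2)[of x] u[of x] that(3)]
      trans[OF that(1) k(1)[of x] that(2) k(2)[of x] that(3)]
    by (simp add: k1)
  have "cdiff m c (chart_dom c) (scomp B u c s)" if "c \<in> charts B" "s < dimR" for c s m
    using cdiff_cong[OF that(1) open_chart_dom[OF that(1)] order_refl, of "scomp B u c s" "w c s"]
      smooth[OF that] cw[OF that(1) _ that(2)] by blast
  then have 1: "u \<in> double_sections B" using u by (simp add: double_sections_iff)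
  have 2: "snd (u x) = 0" if "\<forall>c\<in>charts B. \<forall>x\<in>chart_dom c. \<forall>s<dimR. even s \<longrightarrow> w c s x = 0" for x
    using that k by (simp add: u_def)
  have 3: "fst (u x) = 0" if "\<forall>c\<in>charts B. \<forall>x\<in>chart_dom c. \<forall>s<dimR. \<not> even s \<longrightarrow> w c s x = 0" for x
    using that k by (simp add: u_def)
  show ?thesis
    by (intro bexI[OF _ 1] conjI impI allI ballI) (simp_all only: 2 3 cw)
qed

end

section \<open>Local expressions of functions on the graded manifold\<close>

lift_definition gmon :: "monom \<Rightarrow> gpoly" is "\<lambda>k. if finite (fst k) then smonom k else 0"
  by (auto simp: is_gpoly_smonom is_gpoly_zero)

lemma coef_gmon: "coef (gmon k) l = (if finite (fst k) \<and> l = k then 1 else 0)"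
  by transfer (simp add: smonom_def)

lemma gpoly_eqI: "(\<And>S m. coef a (S, m) = coef b (S, m)) \<Longrightarrow> a = b"
  unfolding coef_inject[symmetric] by (rule ext) auto

lemma gpoly_expand:
  assumes "finite K" "\<And>k. coef a k \<noteq> 0 \<Longrightarrow> k \<in> K"
  shows "a = (\<Sum>k\<in>K. coef a k *\<^sub>R gmon k)"
proof (rule gpoly_eqI)
  fix S m
  have "infinite S \<Longrightarrow> coef a (S, m) = 0" using coef_finite by blast
  then have "(\<Sum>k\<in>K. coef a k * coef (gmon k) (S, m)) = (\<Sum>k\<in>K. if (S, m) = k then coef a (S, m) else 0)"
    by (intro sum.cong) (auto simp: coef_gmon)
  also have "\<dots> = coef a (S, m)" using assms by (auto simp: sum.delta')
  finally show "coef a (S, m) = coef (\<Sum>k\<in>K. coef a k *\<^sub>R gmon k) (S, m)"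
    by (simp add: coef_sum coef_scaleR)
qed

lemma og_eq_gmon: "og s = gmon ({s}, {#})"
  by transfer (simp add: sodd_def)

lemma og_og_eq_gmon: "s < t \<Longrightarrow> og s * og t = gmon ({s, t}, {#})"
proof (rule gpoly_eqI)
  fix S m assume st: "s < t"
  have *: "coef (og s * og t) (S, m) = (if s \<in> S then (- 1) ^ card {u\<in>S. u < s} * coef (og t) (S - {s}, m) else 0)"
    by (rule coef_og)
  show "coef (og s * og t) (S, m) = coef (gmon ({s, t}, {#})) (S, m)"
  proof (cases "s \<in> S \<and> S - {s} = {t} \<and> m = {#}")
    case True
    then have S: "S = {s, t}" by auto
    then have e: "{u \<in> S. u < s} = {}" using st by auto
    have "coef (og s * og t) (S, m) = 1" unfolding * e using True by (simp add: og_eq_gmon coef_gmon)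
    then show ?thesis using True by (simp add: S coef_gmon)
  next
    case False
    then have "\<not> ((S, m) = ({s, t}, {#}))" using st by auto
    then show ?thesis unfolding * using False by (auto simp: og_eq_gmon coef_gmon)
  qed
qed

lemma linI:
  assumes "\<And>S m. coef a (S, m) \<noteq> 0 \<Longrightarrow> card S = 1 \<and> m = {#}"
  shows "a \<in> lin"
proof -
  have "a = (\<Sum>k\<in>{k. coef a k \<noteq> 0}. coef a k *\<^sub>R gmon k)" by (rule gpoly_expand) auto
  also have "\<dots> \<in> lin" unfolding lin_def
  proof (intro span_sum span_scale)
    fix k assume k: "k \<in> {k. coef a k \<noteq> 0}"
    obtain S m where "k = (S, m)" by fastforce
    with k assms obtain s where "k = ({s}, {#})" by (auto simp: card_1_singleton_iff)
    then have "gmon k = og s" by (simp add: og_eq_gmon)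
    then show "gmon k \<in> span (range og)" by (auto intro: span_base)
  qed
  finally show ?thesis .
qed

lemma quadI:
  assumes "\<And>S m. coef a (S, m) \<noteq> 0 \<Longrightarrow> card S = 2 \<and> m = {#}"
  shows "a \<in> quad"
proof -
  have "a = (\<Sum>k\<in>{k. coef a k \<noteq> 0}. coef a k *\<^sub>R gmon k)" by (rule gpoly_expand) auto
  also have "\<dots> \<in> quad" unfolding quad_def
  proof (intro span_sum span_scale)
    fix k assume k: "k \<in> {k. coef a k \<noteq> 0}"
    obtain S m where S: "k = (S, m)" by fastforce
    then have "card S = 2" "m = {#}" using k assms[of S m] by auto
    then obtain s t where "k = ({s, t}, {#})" "s \<noteq> t" using S card_2_iff[of S] by auto
    then obtain s t where "k = ({s, t}, {#})" "s < t"
      by (metis insert_commute linorder_neqE_nat)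
    then have "gmon k = og s * og t" by (simp add: og_og_eq_gmon)
    then show "gmon k \<in> span {og s * og t | s t. True}" by (auto intro: span_base)
  qed
  finally show ?thesis .
qed

lemma quad_coef: "a \<in> quad \<Longrightarrow> coef a (S, m) \<noteq> 0 \<Longrightarrow> card S = 2 \<and> m = {#}"
proof (rule ccontr)
  assume a: "a \<in> quad" and nz: "coef a (S, m) \<noteq> 0" and n: "\<not> (card S = 2 \<and> m = {#})"
  have 1: "coef (og s * og t) (S, m) = 0" if "s < t" for s t
    using n that by (auto simp: og_og_eq_gmon coef_gmon)
  have 2: "coef (og s * og t) (S, m) = 0" for s t
  proof -
    have "coef (og s * og s) (S, m) = 0"
      using odd_anticomm[of s s] by (metis coef_zero eq_neg_iff_add_eq_0 scaleR_2 scaleR_eq_0_iff zero_neq_numeral)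
    then show ?thesis using 1[of s t] 1[of t s] odd_anticomm[of s t]
      by (cases s t rule: linorder_cases) (auto simp: coef_uminus)
  qed
  have "coef a (S, m) = 0" using a unfolding quad_def
    by (induction rule: span_induct_alt) (auto simp: coef_zero coef_plus coef_scaleR 2)
  then show False using nz by simp
qed

section \<open>Calculus of polynomial-valued functions in one chart\<close>

context smooth_bundle
begin

text \<open>Finitely many monomials suffice for the whole chart. Every rule for polynomial-valued
  functions is then a finite sum of rules for their coefficients.\<close>

definition lfun :: "('m, 'v) bundle_chart \<Rightarrow> ('m \<Rightarrow> gpoly) \<Rightarrow> bool" where
  "lfun c f \<longleftrightarrow> (\<exists>K. finite K \<and> (\<forall>y\<in>chart_dom c. \<forall>l. coef (f y) l \<noteq> 0 \<longrightarrow> l \<in> K)) \<and>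
     (\<forall>k l. cdiff k c (chart_dom c) (\<lambda>y. coef (f y) l))"

definition D :: "('m, 'v) bundle_chart \<Rightarrow> nat \<Rightarrow> ('m \<Rightarrow> gpoly) \<Rightarrow> 'm \<Rightarrow> gpoly" where
  "D c i f x = Abs_gpoly (partial_x c i (\<lambda>y. coef (f y)) x)"

definition has_D :: "('m, 'v) bundle_chart \<Rightarrow> nat \<Rightarrow> ('m \<Rightarrow> gpoly) \<Rightarrow> gpoly \<Rightarrow> 'm \<Rightarrow> bool" where
  "has_D c i f g x \<longleftrightarrow> (\<forall>l. has_partial c i (\<lambda>y. coef (f y) l) (coef g l) x)"

lemma has_D_imp: "has_D c i f g x \<Longrightarrow> D c i f x = g"
proof -
  assume "has_D c i f g x"
  then have "partial_x c i (\<lambda>y. coef (f y)) x = coef g"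
    by (auto simp: has_D_def partial_x_def fun_eq_iff intro: has_partial_imp)
  then show ?thesis by (simp add: D_def coef_inverse)
qed

lemma has_D_add: "has_D c i f f' x \<Longrightarrow> has_D c i g g' x \<Longrightarrow> has_D c i (\<lambda>y. f y + g y) (f' + g') x"
  by (simp add: has_D_def coef_plus has_partial_add)

lemma has_D_sum: "(\<And>k. k \<in> K \<Longrightarrow> has_D c i (f k) (f' k) x) \<Longrightarrow> has_D c i (\<lambda>y. \<Sum>k\<in>K. f k y) (\<Sum>k\<in>K. f' k) x"
  by (simp add: has_D_def coef_sum has_partial_sum)

context
  fixes c assumes c: "c \<in> charts B"
begin

lemmas c_open = open_chart_dom[OF c] order_refl

lemma has_D_const_scaleR:
  assumes "x \<in> chart_dom c" "has_partial c i a a' x"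
  shows "has_D c i (\<lambda>y. a y *\<^sub>R m) (a' *\<^sub>R m) x"
  unfolding has_D_def coef_scaleR
proof
  fix l
  show "has_partial c i (\<lambda>y. a y * coef m l) (a' * coef m l) x"
    using has_partial_mult[OF c assms has_partial_const[of c i "coef m l" x]] by simp
qed

lemma has_D_cong:
  assumes "x \<in> chart_dom c" "i < dimB" "\<And>y. y \<in> chart_dom c \<Longrightarrow> f y = g y"
  shows "has_D c i f h x \<longleftrightarrow> has_D c i g h x"
  unfolding has_D_def
  using has_partial_cong[OF c c_open assms(1,2), of "\<lambda>y. coef (f y) _" "\<lambda>y. coef (g y) _"] assms(3) by simp

lemma D_cong:
  assumes "x \<in> chart_dom c" "i < dimB" "\<And>y. y \<in> chart_dom c \<Longrightarrow> f y = g y"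
  shows "D c i f x = D c i g x"
proof -
  have "chart_partial c i (\<lambda>y. coef (f y) l) x = chart_partial c i (\<lambda>y. coef (g y) l) x" for l
  proof -
    have "\<forall>\<^sub>F t in nhds (chart_coord c x i). coef (f (coord_line c i x t)) l = coef (g (coord_line c i x t)) l"
      using coord_line_near[OF c c_open assms(1,2)] by eventually_elim (use assms(3) in auto)
    then show ?thesis unfolding chart_partial_def by (rule deriv_cong_ev) simp
  qed
  then show ?thesis by (simp add: D_def partial_x_def)
qed

lemma lfun_cong:
  assumes "\<And>y. y \<in> chart_dom c \<Longrightarrow> f y = g y"
  shows "lfun c f \<longleftrightarrow> lfun c g"
  unfolding lfun_def using assms cdiff_cong[OF c c_open, of "\<lambda>y. coef (f y) _" "\<lambda>y. coef (g y) _"] by simp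

lemma lfun_scaleR_const:
  assumes "\<And>k. cdiff k c (chart_dom c) a"
  shows "lfun c (\<lambda>y. a y *\<^sub>R m)"
  unfolding lfun_def coef_scaleR
  using assms by (auto intro!: exI[of _ "{k. coef m k \<noteq> 0}"] cdiff_mult[OF c c_open] cdiff_const)

lemma lfun_const: "lfun c (\<lambda>y. m)"
  using lfun_scaleR_const[of "\<lambda>y. 1" m] cdiff_const by simp

lemma lfun_add: "lfun c f \<Longrightarrow> lfun c g \<Longrightarrow> lfun c (\<lambda>y. f y + g y)"
proof -
  assume f: "lfun c f" and g: "lfun c g"
  then obtain K L where "finite K" "finite L" "\<forall>y\<in>chart_dom c. \<forall>l. coef (f y) l \<noteq> 0 \<longrightarrow> l \<in> K"
    "\<forall>y\<in>chart_dom c. \<forall>l. coef (g y) l \<noteq> 0 \<longrightarrow> l \<in> L" unfolding lfun_def by blast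
  then show ?thesis using f g unfolding lfun_def coef_plus
    by (intro conjI exI[of _ "K \<union> L"]) (auto intro: cdiff_add, metis add.right_neutral)
qed

lemma lfun_sum: "(\<And>k. k \<in> K \<Longrightarrow> lfun c (f k)) \<Longrightarrow> lfun c (\<lambda>y. \<Sum>k\<in>K. f k y)"
  by (induction K rule: infinite_finite_induct) (auto intro: lfun_const lfun_add)

lemma lfun_expand:
  assumes "lfun c f"
  obtains K where "finite K" "\<And>y. y \<in> chart_dom c \<Longrightarrow> f y = (\<Sum>k\<in>K. coef (f y) k *\<^sub>R gmon k)"
  using assms gpoly_expand unfolding lfun_def by metis

lemma lfun_cdiff: "lfun c f \<Longrightarrow> cdiff k c (chart_dom c) (\<lambda>y. coef (f y) l)"
  unfolding lfun_def by blast

lemma lfun_has_partial: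
  "lfun c f \<Longrightarrow> x \<in> chart_dom c \<Longrightarrow> i < dimB \<Longrightarrow>
    has_partial c i (\<lambda>y. coef (f y) l) (chart_partial c i (\<lambda>y. coef (f y) l) x) x"
  using cdiff_chart_partial(2)[OF c c_open lfun_cdiff[of f "Suc 0"]] by blast

lemma has_D_expand:
  assumes f: "lfun c f" and K: "\<And>y. y \<in> chart_dom c \<Longrightarrow> f y = (\<Sum>k\<in>K. coef (f y) k *\<^sub>R gmon k)"
    and x: "x \<in> chart_dom c" "i < dimB"
  shows "has_D c i f (\<Sum>k\<in>K. chart_partial c i (\<lambda>y. coef (f y) k) x *\<^sub>R gmon k) x"
proof -
  have "has_D c i (\<lambda>y. \<Sum>k\<in>K. coef (f y) k *\<^sub>R gmon k) (\<Sum>k\<in>K. chart_partial c i (\<lambda>y. coef (f y) k) x *\<^sub>R gmon k) x"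
    by (intro has_D_sum has_D_const_scaleR x lfun_has_partial f)
  then show ?thesis
    by - (rule has_D_cong[of x i f "\<lambda>y. \<Sum>k\<in>K. coef (f y) k *\<^sub>R gmon k", THEN iffD2, OF x], erule K, assumption)
qed

lemma has_D_lfun:
  assumes "lfun c f" "x \<in> chart_dom c" "i < dimB"
  shows "has_D c i f (D c i f x) x"
proof -
  obtain K where K: "\<And>y. y \<in> chart_dom c \<Longrightarrow> f y = (\<Sum>k\<in>K. coef (f y) k *\<^sub>R gmon k)"
    using lfun_expand[OF assms(1)] by metis
  from has_D_expand[OF assms(1) K assms(2,3)] show ?thesis using has_D_imp by fastforce
qed

lemma coef_D:
  assumes "lfun c f" "x \<in> chart_dom c" "i < dimB"
  shows "coef (D c i f x) l = chart_partial c i (\<lambda>y. coef (f y) l) x"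
proof -
  have "has_partial c i (\<lambda>y. coef (f y) l) (coef (D c i f x) l) x"
    using has_D_lfun[OF assms] unfolding has_D_def by blast
  then show ?thesis by (simp add: has_partial_imp)
qed

lemma lfun_D:
  assumes f: "lfun c f" and i: "i < dimB"
  shows "lfun c (D c i f)"
proof -
  obtain K where K: "finite K" "\<And>y. y \<in> chart_dom c \<Longrightarrow> f y = (\<Sum>k\<in>K. coef (f y) k *\<^sub>R gmon k)"
    using lfun_expand[OF f] by metis
  have e: "D c i f y = (\<Sum>k\<in>K. chart_partial c i (\<lambda>y. coef (f y) k) y *\<^sub>R gmon k)" if "y \<in> chart_dom c" for y
    by (rule has_D_imp[OF has_D_expand[OF f K(2) that i]])
  have "cdiff m c (chart_dom c) (chart_partial c i (\<lambda>y. coef (f y) k))" for m k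
    by (rule cdiff_chart_partial(1)[OF c c_open lfun_cdiff[OF f] i])
  then have "lfun c (\<lambda>y. \<Sum>k\<in>K. chart_partial c i (\<lambda>y. coef (f y) k) y *\<^sub>R gmon k)"
    by (intro lfun_sum lfun_scaleR_const)
  then show ?thesis
    by - (rule lfun_cong[of "D c i f" "\<lambda>y. \<Sum>k\<in>K. chart_partial c i (\<lambda>y. coef (f y) k) y *\<^sub>R gmon k", THEN iffD2], erule e, assumption)
qed

lemma
  assumes f: "lfun c f" and T: "linear T"
  shows lfun_linear: "lfun c (\<lambda>y. T (f y))"
    and D_linear: "x \<in> chart_dom c \<Longrightarrow> i < dimB \<Longrightarrow> D c i (\<lambda>y. T (f y)) x = T (D c i f x)"
proof -
  obtain K where K: "finite K" "\<And>y. y \<in> chart_dom c \<Longrightarrow> f y = (\<Sum>k\<in>K. coef (f y) k *\<^sub>R gmon k)"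
    using lfun_expand[OF f] by metis
  have TS: "T (\<Sum>k\<in>K. a k *\<^sub>R gmon k) = (\<Sum>k\<in>K. a k *\<^sub>R T (gmon k))" for a
    by (simp add: linear_sum[OF T] linear_scale[OF T])
  have Tf: "T (f y) = (\<Sum>k\<in>K. coef (f y) k *\<^sub>R T (gmon k))" if "y \<in> chart_dom c" for y
    using arg_cong[OF K(2)[OF that], of T] unfolding TS .
  have "lfun c (\<lambda>y. \<Sum>k\<in>K. coef (f y) k *\<^sub>R T (gmon k))"
    by (intro lfun_sum lfun_scaleR_const lfun_cdiff f)
  then show "lfun c (\<lambda>y. T (f y))"
    by - (rule lfun_cong[of "\<lambda>y. T (f y)" "\<lambda>y. \<Sum>k\<in>K. coef (f y) k *\<^sub>R T (gmon k)", THEN iffD2], erule Tf, assumption)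
  assume x: "x \<in> chart_dom c" "i < dimB"
  have "has_D c i (\<lambda>y. \<Sum>k\<in>K. coef (f y) k *\<^sub>R T (gmon k))
      (\<Sum>k\<in>K. chart_partial c i (\<lambda>y. coef (f y) k) x *\<^sub>R T (gmon k)) x"
    by (intro has_D_sum has_D_const_scaleR x lfun_has_partial f)
  then have "has_D c i (\<lambda>y. T (f y)) (\<Sum>k\<in>K. chart_partial c i (\<lambda>y. coef (f y) k) x *\<^sub>R T (gmon k)) x"
    by - (rule has_D_cong[of x i "\<lambda>y. T (f y)" "\<lambda>y. \<Sum>k\<in>K. coef (f y) k *\<^sub>R T (gmon k)", THEN iffD2, OF x], erule Tf, assumption)
  moreover have "D c i f x = (\<Sum>k\<in>K. chart_partial c i (\<lambda>y. coef (f y) k) x *\<^sub>R gmon k)"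
    by (rule has_D_imp[OF has_D_expand[OF f K(2) x]])
  ultimately show "D c i (\<lambda>y. T (f y)) x = T (D c i f x)"
    using TS has_D_imp by simp
qed

lemma
  assumes f: "lfun c f" and g: "lfun c g"
  shows lfun_mult: "lfun c (\<lambda>y. f y * g y)"
    and D_mult: "x \<in> chart_dom c \<Longrightarrow> i < dimB \<Longrightarrow> D c i (\<lambda>y. f y * g y) x = D c i f x * g x + f x * D c i g x"
proof -
  obtain K where K: "finite K" "\<And>y. y \<in> chart_dom c \<Longrightarrow> f y = (\<Sum>k\<in>K. coef (f y) k *\<^sub>R gmon k)"
    using lfun_expand[OF f] by metis
  obtain L where L: "finite L" "\<And>y. y \<in> chart_dom c \<Longrightarrow> g y = (\<Sum>k\<in>L. coef (g y) k *\<^sub>R gmon k)"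
    using lfun_expand[OF g] by metis
  have SS: "(\<Sum>k\<in>K. a k *\<^sub>R gmon k) * (\<Sum>l\<in>L. b l *\<^sub>R gmon l) = (\<Sum>k\<in>K. \<Sum>l\<in>L. (a k * b l) *\<^sub>R (gmon k * gmon l))" for a b
    by (simp add: sum_product scaleR_sum_right) (simp add: mult.commute)
  have fg: "f y * g y = (\<Sum>k\<in>K. \<Sum>l\<in>L. (coef (f y) k * coef (g y) l) *\<^sub>R (gmon k * gmon l))" if "y \<in> chart_dom c" for y
    using arg_cong2[OF K(2)[OF that] L(2)[OF that], of "(*)"] unfolding SS .
  have "lfun c (\<lambda>y. \<Sum>k\<in>K. \<Sum>l\<in>L. (coef (f y) k * coef (g y) l) *\<^sub>R (gmon k * gmon l))"
    by (intro lfun_sum lfun_scaleR_const cdiff_mult[OF c c_open] lfun_cdiff f g)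
  then show "lfun c (\<lambda>y. f y * g y)"
    by - (rule lfun_cong[of "\<lambda>y. f y * g y" "\<lambda>y. \<Sum>k\<in>K. \<Sum>l\<in>L. (coef (f y) k * coef (g y) l) *\<^sub>R (gmon k * gmon l)",
          THEN iffD2], erule fg, assumption)
  assume x: "x \<in> chart_dom c" "i < dimB"
  let ?f = "\<lambda>k. chart_partial c i (\<lambda>y. coef (f y) k) x" and ?g = "\<lambda>k. chart_partial c i (\<lambda>y. coef (g y) k) x"
  have "has_D c i (\<lambda>y. \<Sum>k\<in>K. \<Sum>l\<in>L. (coef (f y) k * coef (g y) l) *\<^sub>R (gmon k * gmon l))
      (\<Sum>k\<in>K. \<Sum>l\<in>L. (?f k * coef (g x) l + coef (f x) k * ?g l) *\<^sub>R (gmon k * gmon l)) x"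
    by (intro has_D_sum has_D_const_scaleR x has_partial_mult[OF c] lfun_has_partial f g)
  then have "has_D c i (\<lambda>y. f y * g y)
      (\<Sum>k\<in>K. \<Sum>l\<in>L. (?f k * coef (g x) l + coef (f x) k * ?g l) *\<^sub>R (gmon k * gmon l)) x"
    by - (rule has_D_cong[of x i "\<lambda>y. f y * g y"
          "\<lambda>y. \<Sum>k\<in>K. \<Sum>l\<in>L. (coef (f y) k * coef (g y) l) *\<^sub>R (gmon k * gmon l)", THEN iffD2, OF x], erule fg, assumption)
  moreover have "(\<Sum>k\<in>K. \<Sum>l\<in>L. (?f k * coef (g x) l + coef (f x) k * ?g l) *\<^sub>R (gmon k * gmon l)) =
      D c i f x * g x + f x * D c i g x"
  proof -
    have df: "D c i f x = (\<Sum>k\<in>K. ?f k *\<^sub>R gmon k)"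
      by (rule has_D_imp[OF has_D_expand[OF f K(2) x]])
    have dg: "D c i g x = (\<Sum>k\<in>L. ?g k *\<^sub>R gmon k)"
      by (rule has_D_imp[OF has_D_expand[OF g L(2) x]])
    have "D c i f x * g x = (\<Sum>k\<in>K. \<Sum>l\<in>L. (?f k * coef (g x) l) *\<^sub>R (gmon k * gmon l))"
      using arg_cong2[OF df L(2)[OF x(1)], of "(*)"] unfolding SS .
    moreover have "f x * D c i g x = (\<Sum>k\<in>K. \<Sum>l\<in>L. (coef (f x) k * ?g l) *\<^sub>R (gmon k * gmon l))"
      using arg_cong2[OF K(2)[OF x(1)] dg, of "(*)"] unfolding SS .
    ultimately show ?thesis by (simp add: scaleR_add_left sum.distrib)
  qed
  ultimately show "D c i (\<lambda>y. f y * g y) x = D c i f x * g x + f x * D c i g x"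
    using has_D_imp by simp
qed

lemma linear_ops: "linear (dl s)" "linear (dp i)" "linear ginv"
  by (auto intro!: linearI)

lemma D_sum:
  assumes "\<And>k. k \<in> K \<Longrightarrow> lfun c (f k)" "x \<in> chart_dom c" "i < dimB"
  shows "D c i (\<lambda>y. \<Sum>k\<in>K. f k y) x = (\<Sum>k\<in>K. D c i (f k) x)"
  by (rule has_D_imp) (intro has_D_sum has_D_lfun assms)

lemma D_add:
  assumes "lfun c f" "lfun c g" "x \<in> chart_dom c" "i < dimB"
  shows "D c i (\<lambda>y. f y + g y) x = D c i f x + D c i g x"
  by (rule has_D_imp) (intro has_D_add has_D_lfun assms)

lemma D_commute:
  assumes f: "lfun c f" and x: "x \<in> chart_dom c" and ij: "i < dimB" "j < dimB"
  shows "D c i (D c j f) x = D c j (D c i f) x"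
proof (rule gpoly_eqI)
  fix S m
  have *: "coef (D c i (D c j f) x) (S, m) = chart_partial c i (chart_partial c j (\<lambda>y. coef (f y) (S, m))) x"
    if ij: "i < dimB" "j < dimB" for i j
  proof -
    have "has_D c i (D c j f) (D c i (D c j f) x) x" by (intro has_D_lfun lfun_D f ij x)
    then have "has_partial c i (\<lambda>y. coef (D c j f y) (S, m)) (coef (D c i (D c j f) x) (S, m)) x"
      by (simp add: has_D_def)
    then have "has_partial c i (chart_partial c j (\<lambda>y. coef (f y) (S, m))) (coef (D c i (D c j f) x) (S, m)) x"
      by - (rule has_partial_cong[of c _ x i "\<lambda>y. coef (D c j f y) (S, m)"
          "chart_partial c j (\<lambda>y. coef (f y) (S, m))", THEN iffD1, OF c c_open x ij(1)], erule coef_D[OF f _ ij(2)], assumption)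
    then show ?thesis using has_partial_imp by metis
  qed
  show "coef (D c i (D c j f) x) (S, m) = coef (D c j (D c i f) x) (S, m)"
    unfolding *[OF ij] *[OF ij(2,1)]
    by (rule chart_partial_commute[OF c c_open x lfun_cdiff[OF f] ij])
qed

lemma coef_D_zero:
  assumes f: "lfun c f" and x: "x \<in> chart_dom c" "i < dimB" and "\<And>y. y \<in> chart_dom c \<Longrightarrow> coef (f y) l = 0"
  shows "coef (D c i f x) l = 0"
proof -
  have "has_partial c i (\<lambda>y. coef (f y) l) 0 x"
    by (rule has_partial_cong[of c _ x i "\<lambda>y. coef (f y) l" "\<lambda>y. 0", THEN iffD2, OF c c_open x _ has_partial_const]) (rule assms(4))
  then show ?thesis using coef_D[OF f x] has_partial_imp by metis
qed

lemma D_quad: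
  assumes f: "lfun c f" "\<And>y. y \<in> chart_dom c \<Longrightarrow> f y \<in> quad" and x: "x \<in> chart_dom c" "i < dimB"
  shows "D c i f x \<in> quad"
  by (rule quadI) (metis coef_D_zero[OF f(1) x] f(2) quad_coef)

definition bb :: "('m \<Rightarrow> gpoly) \<Rightarrow> ('m \<Rightarrow> gpoly) \<Rightarrow> 'm \<Rightarrow> gpoly" where
  "bb a b x = brk dimB dimR (a x) (\<lambda>i. D c i a x) (b x) (\<lambda>i. D c i b x)"

lemma lfun_minus: "lfun c f \<Longrightarrow> lfun c g \<Longrightarrow> lfun c (\<lambda>y. f y - g y)"
  using lfun_add[of f "\<lambda>y. - 1 *\<^sub>R g y"] lfun_linear[of g "\<lambda>a. - 1 *\<^sub>R a"]
  by (simp add: linearI)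

lemma lfun_bb:
  assumes "lfun c a" "lfun c b"
  shows "lfun c (bb a b)"
  unfolding bb_def[abs_def] brk_def
  by (intro lfun_add lfun_sum lfun_minus lfun_mult lfun_D assms lfun_linear[OF _ linear_ops(1)]
      lfun_linear[OF _ linear_ops(2)] lfun_linear[OF _ linear_ops(3)]) auto

lemma bb_ad:
  assumes "x \<in> chart_dom c" "\<And>i. dp i (N x) = 0"
  shows "bb N a x = ad dimB dimR (N x) (\<lambda>i. D c i N x) (a x)"
  unfolding bb_def by (rule brk_eq_ad) (use assms in auto)

text \<open>The derivative along the base falls on \<open>a\<close> or on the coefficients of the
  Hamiltonian field of \<open>N\<close>. The second summand is the commutator term that appears in
  \<open>ad_brk\<close>.\<close>

lemma D_bb_quad:
  assumes N: "lfun c N" "\<And>y i. y \<in> chart_dom c \<Longrightarrow> dp i (N y) = 0" and a: "lfun c a"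
    and x: "x \<in> chart_dom c" "i < dimB"
  shows "D c i (bb N a) x = ad dimB dimR (N x) (\<lambda>i. D c i N x) (D c i a x) +
    ad dimB dimR (D c i N x) (\<lambda>j. D c i (D c j N) x) (a x)"
proof -
  note lf = N(1) a lfun_D[OF N(1)] lfun_linear[OF _ linear_ops(1)] lfun_linear[OF _ linear_ops(2)]
    lfun_linear[OF _ linear_ops(3)]
  have "D c i (bb N a) x = D c i (\<lambda>y. ad dimB dimR (N y) (\<lambda>i. D c i N y) (a y)) x"
    by (rule D_cong[OF x]) (use bb_ad N(2) in auto)
  also have "\<dots> = (\<Sum>j<dimB. D c i (\<lambda>y. D c j N y * dp j (a y)) x) +
      (\<Sum>s<dimR. D c i (\<lambda>y. ginv (dl (dual_no s) (N y)) * dl s (a y)) x)"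
    unfolding ad_def by (subst D_add, (intro lfun_sum lfun_mult lf x; simp)+) ((subst D_sum, (intro lfun_mult lf x; simp)+)+, rule refl)
  also have "(\<Sum>j<dimB. D c i (\<lambda>y. D c j N y * dp j (a y)) x) =
      (\<Sum>j<dimB. D c i (D c j N) x * dp j (a x) + D c j N x * dp j (D c i a x))"
    by (rule sum.cong[OF refl])
      (simp add: D_mult[OF lfun_D[OF N(1)] lfun_linear[OF a linear_ops(2)] x] D_linear[OF a linear_ops(2) x])
  also have "(\<Sum>s<dimR. D c i (\<lambda>y. ginv (dl (dual_no s) (N y)) * dl s (a y)) x) =
      (\<Sum>s<dimR. ginv (dl (dual_no s) (D c i N x)) * dl s (a x) + ginv (dl (dual_no s) (N x)) * dl s (D c i a x))"
    by (rule sum.cong[OF refl])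
      (simp add: D_mult[OF lfun_linear[OF lfun_linear[OF N(1) linear_ops(1)] linear_ops(3)] lfun_linear[OF a linear_ops(1)] x]
        D_linear[OF lfun_linear[OF N(1) linear_ops(1)] linear_ops(3) x] D_linear[OF N(1) linear_ops(1) x] D_linear[OF a linear_ops(1) x])
  finally show ?thesis by (simp add: ad_def sum.distrib algebra_simps)
qed

text \<open>The pointwise identity \<open>ad_brk\<close> with the first and second derivatives of
  \<open>N\<close> at \<open>x\<close> as \<open>q'\<close> and \<open>q''\<close>. Their symmetry
  is that of second partial derivatives.\<close>

lemma bb_jacobi:
  assumes N: "lfun c N" "\<And>y. y \<in> chart_dom c \<Longrightarrow> N y \<in> quad" and a: "lfun c a" and b: "lfun c b"
    and x: "x \<in> chart_dom c"
  shows "bb N (bb a b) x = bb (bb N a) b x + bb a (bb N b) x"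
proof -
  have N0: "dp i (N y) = 0" if "y \<in> chart_dom c" for y i using quadD(3)[OF N(2)[OF that]] .
  have q: "D c i N y \<in> quad" if "i < dimB" "y \<in> chart_dom c" for i y by (rule D_quad[OF N that(2,1)])
  have "bb N (bb a b) x = ad dimB dimR (N x) (\<lambda>i. D c i N x) (brk dimB dimR (a x) (\<lambda>i. D c i a x) (b x) (\<lambda>i. D c i b x))"
    unfolding bb_ad[of x N, OF x N0[OF x]] by (simp add: bb_def)
  also have "\<dots> = brk dimB dimR (bb N a x) (\<lambda>i. ad dimB dimR (N x) (\<lambda>i. D c i N x) (D c i a x) +
        ad dimB dimR (D c i N x) (\<lambda>j. D c i (D c j N) x) (a x)) (b x) (\<lambda>i. D c i b x) +
      brk dimB dimR (a x) (\<lambda>i. D c i a x) (bb N b x) (\<lambda>i. ad dimB dimR (N x) (\<lambda>i. D c i N x) (D c i b x) +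
        ad dimB dimR (D c i N x) (\<lambda>j. D c i (D c j N) x) (b x))"
    unfolding bb_ad[of x N, OF x N0[OF x]]
    by (rule ad_brk) (use N x q D_commute[OF N(1) x] D_quad[OF lfun_D[OF N(1)] q x] in auto)
  also have "\<dots> = bb (bb N a) b x + bb a (bb N b) x"
    unfolding bb_def[of "bb N a"] bb_def[of a "bb N b"]
    by (simp add: brk_def D_bb_quad[OF N(1) N0 a x] D_bb_quad[OF N(1) N0 b x])
  finally show ?thesis .
qed

end

end

section \<open>Homogeneous polynomials in the generators of a chart\<close>

definition homog :: "nat \<Rightarrow> nat \<Rightarrow> nat \<Rightarrow> gpoly \<Rightarrow> bool" where
  "homog R n k a \<longleftrightarrow> (\<forall>S m. coef a (S, m) \<noteq> 0 \<longrightarrow>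
     S \<subseteq> {..<R} \<and> set_mset m \<subseteq> {..<n} \<and> card S + 2 * size m = k)"

lemma homogD:
  assumes "homog R n k a" "coef a (S, m) \<noteq> 0"
  shows "S \<subseteq> {..<R}" "set_mset m \<subseteq> {..<n}" "card S + 2 * size m = k"
  using assms by (auto simp: homog_def)

lemma finite_homog_keys:
  "finite {(S, m). S \<subseteq> {..<R :: nat} \<and> set_mset m \<subseteq> {..<n :: nat} \<and> card S + 2 * size m = k}"
proof -
  have "{(S, m). S \<subseteq> {..<R} \<and> set_mset m \<subseteq> {..<n} \<and> card S + 2 * size m = k} \<subseteq>
      Pow {..<R} \<times> mset ` {xs. set xs \<subseteq> {..<n} \<and> length xs \<le> k}" (is "_ \<subseteq> ?K")
  proof
    fix p assume "p \<in> {(S, m). S \<subseteq> {..<R} \<and> set_mset m \<subseteq> {..<n} \<and> card S + 2 * size m = k}"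
    then obtain S m where p: "p = (S, m)"
      and *: "S \<subseteq> {..<R}" "set_mset m \<subseteq> {..<n}" "card S + 2 * size m = k" by blast
    obtain xs where "mset xs = m" using ex_mset by blast
    then have "m = mset xs" "set xs \<subseteq> {..<n}" "length xs \<le> k" using * by auto
    then show "p \<in> ?K" using * p by blast
  qed
  then show ?thesis by (rule finite_subset) (simp add: finite_lists_length_le)
qed

lemma homog_zero [simp]: "homog R n k 0"
  by (simp add: homog_def coef_zero)

lemma homog_add: "homog R n k a \<Longrightarrow> homog R n k b \<Longrightarrow> homog R n k (a + b)"
  unfolding homog_def coef_plus by (metis add.right_neutral)

lemma homog_scaleR: "homog R n k a \<Longrightarrow> homog R n k (x *\<^sub>R a)"
  unfolding homog_def coef_scaleR by (metis mult_zero_right)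

lemma homog_sum: "(\<And>i. i \<in> I \<Longrightarrow> homog R n k (f i)) \<Longrightarrow> homog R n k (sum f I)"
  by (induction I rule: infinite_finite_induct) (auto intro: homog_add)

lemma homog_mult:
  assumes "homog R n j a" "homog R n k b"
  shows "homog R n (j + k) (a * b)"
  unfolding homog_def
proof (intro allI impI)
  fix S m assume nz: "coef (a * b) (S, m) \<noteq> 0"
  then have f: "finite S" using coef_finite by blast
  have "(\<Sum>T\<in>Pow S. \<Sum>l\<in>{l. l \<subseteq># m}. shuffle_sign T (S - T) * coef a (T, l) * coef b (S - T, m - l)) \<noteq> 0"
    using nz by (simp add: times_gpoly.rep_eq smult_def)
  then obtain T where T: "T \<in> Pow S" and
    "(\<Sum>l\<in>{l. l \<subseteq># m}. shuffle_sign T (S - T) * coef a (T, l) * coef b (S - T, m - l)) \<noteq> 0"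
    by (rule sum.not_neutral_contains_not_neutral)
  then obtain l where "l \<in> {l. l \<subseteq># m}" "shuffle_sign T (S - T) * coef a (T, l) * coef b (S - T, m - l) \<noteq> 0"
    by (elim sum.not_neutral_contains_not_neutral)
  then have l: "l \<subseteq># m" and ab: "coef a (T, l) \<noteq> 0" "coef b (S - T, m - l) \<noteq> 0" by auto
  have "S = T \<union> (S - T)" using T by auto
  have "card S = card T + card (S - T)" using T f by (simp add: card_Diff_subset card_mono finite_subset)
  moreover have m: "m = l + (m - l)" using l by simp
  then have "size m = size l + size (m - l)" by (metis size_union)
  moreover have "set_mset m = set_mset l \<union> set_mset (m - l)" using m by (metis set_mset_union)
  ultimately show "S \<subseteq> {..<R} \<and> set_mset m \<subseteq> {..<n} \<and> card S + 2 * size m = j + k"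
    using homogD[OF assms(1) ab(1)] homogD[OF assms(2) ab(2)] \<open>S = T \<union> (S - T)\<close> by auto
qed

lemma coef_dl: "coef (dl s a) (S, m) = (if s \<in> S then 0 else (- 1) ^ card {t\<in>S. t < s} * coef a (insert s S, m))"
  by transfer (simp add: lderiv_def)

lemma coef_dp: "coef (dp i a) (S, m) = real (count m i + 1) * coef a (S, add_mset i m)"
  by transfer (simp add: pderiv_p_def)

lemma coef_ginv: "coef (ginv a) (S, m) = (- 1) ^ card S * coef a (S, m)"
  by transfer (simp add: grading_inv_def)

lemma homog_ginv: "homog R n k a \<Longrightarrow> homog R n k (ginv a)"
  by (auto simp: homog_def coef_ginv)

lemma homog_dl: "homog R n (Suc k) a \<Longrightarrow> homog R n k (dl s a)"
  unfolding homog_def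
proof (intro allI impI)
  fix S m assume h: "\<forall>S m. coef a (S, m) \<noteq> 0 \<longrightarrow> S \<subseteq> {..<R} \<and> set_mset m \<subseteq> {..<n} \<and> card S + 2 * size m = Suc k"
    and nz: "coef (dl s a) (S, m) \<noteq> 0"
  then have s: "s \<notin> S" "coef a (insert s S, m) \<noteq> 0" by (auto simp: coef_dl split: if_splits)
  have "finite (insert s S)" by (rule coef_finite[OF s(2)])
  then show "S \<subseteq> {..<R} \<and> set_mset m \<subseteq> {..<n} \<and> card S + 2 * size m = k" using s h by fastforce
qed

lemma homog_dp: "homog R n (k + 2) a \<Longrightarrow> homog R n k (dp i a)"
  unfolding homog_def by (fastforce simp: coef_dp)

lemma homog_dp_zero:
  assumes "homog R n k a" "k < 2"
  shows "dp i a = 0"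
proof (rule gpoly_eqI)
  fix S m
  have "coef a (S, add_mset i m) = 0" using homogD(3)[OF assms(1), of S "add_mset i m"] assms(2) by force
  then show "coef (dp i a) (S, m) = coef 0 (S, m)" by (simp add: coef_dp coef_zero)
qed

lemma homog_ad:
  assumes "homog R n (Suc j) q" "\<And>i. i < n \<Longrightarrow> homog R n (Suc j) (q' i)" "homog R n (Suc k) z"
  shows "homog R n (j + k) (ad n R q q' z)"
proof -
  \<comment> \<open>For \<open>k = 0\<close> the degree of \<open>dp i z\<close> would be negative,
    but then \<open>z\<close> has degree 1 and contains no momenta, so the term is zero.\<close>
  have "homog R n (j + k) (q' i * dp i z)" if "i < n" for i
  proof (cases k)
    case 0
    then show ?thesis using homog_dp_zero[OF assms(3)] by simp
  next
    case (Suc l)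
    then have "homog R n (Suc j + l) (q' i * dp i z)"
      using assms that by (intro homog_mult homog_dp) auto
    then show ?thesis using Suc by simp
  qed
  moreover have "homog R n (j + k) (ginv (dl t q) * dl s z)" for s t
    by (intro homog_mult homog_ginv homog_dl assms)
  ultimately show ?thesis unfolding ad_def by (intro homog_add homog_sum) auto
qed

lemma homog1_lin: "homog R n 1 a \<Longrightarrow> a \<in> lin"
proof (rule linI)
  fix S m assume "homog R n 1 a" "coef a (S, m) \<noteq> 0"
  then have "card S + 2 * size m = 1" by (rule homogD(3))
  then show "card S = 1 \<and> m = {#}" by (cases "size m") auto
qed

section \<open>Global functions as compatible families of local expressions\<close>

context smooth_bundle
begin

definition val :: "('m, 'v) gfun \<Rightarrow> ('m, 'v) bundle_chart \<Rightarrow> 'm \<Rightarrow> gpoly" where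
  "val a c x = Abs_gpoly (a c x)"

abbreviation "homogB k a \<equiv> homog dimR dimB k a"

lemma tau_theta_range: "tau_no ` {..<rkB} \<union> theta_no ` {..<rkB} = {..<dimR}"
proof
  show "{..<dimR} \<subseteq> tau_no ` {..<rkB} \<union> theta_no ` {..<rkB}"
  proof
    fix s assume "s \<in> {..<dimR}"
    then have "s div 2 \<in> {..<rkB}" by auto
    moreover have "s = tau_no (s div 2) \<or> s = theta_no (s div 2)"
      unfolding tau_no_def theta_no_def by presburger
    ultimately show "s \<in> tau_no ` {..<rkB} \<union> theta_no ` {..<rkB}" by blast
  qed
qed (auto simp: tau_no_def theta_no_def)

lemma gfunsD:
  assumes "a \<in> gfuns B k" "a c x (S, m) \<noteq> 0"
  shows "c \<in> charts B" "x \<in> chart_dom c" "S \<subseteq> {..<dimR}" "set_mset m \<subseteq> {..<dimB}" "card S + 2 * size m = k"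
  using assms unfolding gfuns_def tau_theta_range by blast+

lemma coef_val: "a \<in> gfuns B k \<Longrightarrow> coef (val a c x) = a c x"
proof -
  assume a: "a \<in> gfuns B k"
  have "is_gpoly (a c x)"
  proof (rule is_gpolyI[OF finite_homog_keys[of dimR dimB k]])
    fix S m assume "a c x (S, m) \<noteq> 0"
    from gfunsD(3-5)[OF a this] show "(S, m) \<in> {(S, m). S \<subseteq> {..<dimR} \<and> set_mset m \<subseteq> {..<dimB} \<and>
        card S + 2 * size m = k} \<and> finite S" by (auto intro: finite_subset)
  qed
  then show ?thesis by (simp add: val_def Abs_gpoly_inverse)
qed

lemma homog_val:
  assumes a: "a \<in> gfuns B k"
  shows "homogB k (val a c x)"
  unfolding homog_def coef_val[OF a] using gfunsD(3-5)[OF a] by blast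

text \<open>A fixed degree in finitely many generators leaves only finitely many monomials.\<close>

lemma lfunI:
  assumes "\<And>y. y \<in> chart_dom c \<Longrightarrow> homogB k (f y)" "\<And>k l. cdiff k c (chart_dom c) (\<lambda>y. coef (f y) l)"
  shows "lfun c f"
  unfolding lfun_def using assms
  by (intro conjI exI[of _ "{(S, m). S \<subseteq> {..<dimR} \<and> set_mset m \<subseteq> {..<dimB} \<and> card S + 2 * size m = k}"]
      finite_homog_keys) (auto simp: homog_def)

lemma lfun_val:
  assumes "a \<in> gfuns B k" "c \<in> charts B"
  shows "lfun c (val a c)"
proof (rule lfunI)
  show "homogB k (val a c y)" for y by (rule homog_val[OF assms(1)])
  have "smooth_on_chart dimB c (chart_dom c) (\<lambda>x. a c x l)" for l
    using assms unfolding gfuns_def by blast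
  then show "cdiff m c (chart_dom c) (\<lambda>y. coef (val a c y) l)" for m l
    unfolding coef_val[OF assms(1)] smooth_on_chart_iff[OF assms(2) open_chart_dom[OF assms(2)] order_refl]
    by (rule spec)
qed

lemma coef_plus_fun: "coef (a + b) = coef a + coef b"
  by (simp add: plus_gpoly.rep_eq)

lemma coef_sum_fun: "coef (\<Sum>i\<in>I. f i) = (\<Sum>i\<in>I. coef (f i))"
  by (rule ext) (simp add: coef_sum sum_fun_apply)

text \<open>The sum over the pairs \<tau>, \<theta> becomes one sum over all odd generators
  \<open>s\<close> with partner \<open>dual_no s\<close>, and the right derivatives become
  \<open>ginv\<close> of left ones.\<close>

lemma big_bracket_bb:
  assumes c: "c \<in> charts B" and x: "x \<in> chart_dom c"
    and a: "lfun c f" "\<And>y. y \<in> chart_dom c \<Longrightarrow> a c y = coef (f y)"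
    and b: "lfun c g" "\<And>y. y \<in> chart_dom c \<Longrightarrow> b c y = coef (g y)"
  shows "big_bracket B a b c x = coef (bb c f g x)"
proof -
  have p: "partial_x c i (h c) x = coef (D c i k x)"
    if "lfun c k" "\<And>y. y \<in> chart_dom c \<Longrightarrow> h c y = coef (k y)" "i < dimB" for h k i
  proof -
    have "chart_partial c i (\<lambda>y. h c y l) x = coef (D c i k x) l" for l
    proof -
      have "has_partial c i (\<lambda>y. coef (k y) l) (coef (D c i k x) l) x"
        using has_D_lfun[OF c that(1) x that(3)] unfolding has_D_def by blast
      then have "has_partial c i (\<lambda>y. h c y l) (coef (D c i k x) l) x"
        using has_partial_cong[OF c c_open[OF c] x that(3), of "\<lambda>y. h c y l" "\<lambda>y. coef (k y) l"] that(2) by simp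
      then show ?thesis by (rule has_partial_imp)
    qed
    then show ?thesis by (simp add: partial_x_def)
  qed
  have "coef (bb c f g x) =
     (\<Sum>i<dimB. coef (D c i f x) \<odot> pderiv_p i (coef (g x)) - pderiv_p i (coef (f x)) \<odot> coef (D c i g x)) +
     (\<Sum>s<dimR. rderiv s (coef (f x)) \<odot> lderiv (dual_no s) (coef (g x)))"
    unfolding bb_def[OF c] brk_def coef_plus_fun coef_sum_fun dr_eq[symmetric]
    by (simp only: minus_gpoly.rep_eq times_gpoly.rep_eq dp.rep_eq dl.rep_eq dr.rep_eq)
  also have "(\<Sum>s<dimR. rderiv s (coef (f x)) \<odot> lderiv (dual_no s) (coef (g x))) =
     (\<Sum>\<alpha><rkB. rderiv (tau_no \<alpha>) (coef (f x)) \<odot> lderiv (theta_no \<alpha>) (coef (g x)) +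
       rderiv (theta_no \<alpha>) (coef (f x)) \<odot> lderiv (tau_no \<alpha>) (coef (g x)))"
    unfolding sum_even_odd by (rule sum.cong) (simp_all add: tau_no_def theta_no_def dual_no_def)
  also have "(\<Sum>i<dimB. coef (D c i f x) \<odot> pderiv_p i (coef (g x)) - pderiv_p i (coef (f x)) \<odot> coef (D c i g x)) =
     (\<Sum>i<dimB. partial_x c i (a c) x \<odot> pderiv_p i (b c x) - pderiv_p i (a c x) \<odot> partial_x c i (b c) x)"
    by (rule sum.cong) (simp_all only: lessThan_iff p[of f a, OF a] p[of g b, OF b] a(2)[OF x] b(2)[OF x])
  finally show ?thesis using c x by (simp only: big_bracket_def a(2)[OF x] b(2)[OF x] simp_thms if_True)
qed

lemma big_bracket_outside: "\<not> (c \<in> charts B \<and> x \<in> chart_dom c) \<Longrightarrow> big_bracket B a b c x = 0"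
  by (simp only: big_bracket_def if_False)

text \<open>The coefficients \<open>g\<^sup>-\<^sup>1 \<partial>g\<close> occurring in \<^const>\<open>change_p\<close>.\<close>

definition christ :: "('m, 'v) bundle_chart \<Rightarrow> ('m, 'v) bundle_chart \<Rightarrow> 'm \<Rightarrow> nat \<Rightarrow> nat \<Rightarrow> nat \<Rightarrow> real" where
  "christ c d x j \<beta> \<alpha> = (\<Sum>\<gamma><rkB. cofr c \<beta> x (chart_frame d \<gamma> x) *
     chart_partial c j (\<lambda>y. cofr d \<gamma> y (chart_frame c \<alpha> y)) x)"

definition chp :: "('m, 'v) bundle_chart \<Rightarrow> ('m, 'v) bundle_chart \<Rightarrow> 'm \<Rightarrow> nat \<Rightarrow> gpoly" where
  "chp c d x i = (\<Sum>j<dimB. chart_partial d i (\<lambda>y. chart_coord c y j) x *\<^sub>R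
     (mg j + (\<Sum>\<alpha><rkB. \<Sum>\<beta><rkB. christ c d x j \<beta> \<alpha> *\<^sub>R (og (2 * \<alpha>) * og (2 * \<beta> + 1)))))"

definition cho :: "('m, 'v) bundle_chart \<Rightarrow> ('m, 'v) bundle_chart \<Rightarrow> 'm \<Rightarrow> nat \<Rightarrow> gpoly" where
  "cho c d x s = (\<Sum>t<dimR. trans_mat B c d x t s *\<^sub>R og t)"

definition tsub :: "('m, 'v) bundle_chart \<Rightarrow> ('m, 'v) bundle_chart \<Rightarrow> 'm \<Rightarrow> gpoly \<Rightarrow> gpoly" where
  "tsub c d x = gsub (restrict_gens dimR (cho c d x)) (restrict_gens dimB (chp c d x))"

lemma change_p_chp: "change_p dimB rkB c d x i = coef (chp c d x i)"
  unfolding chp_def change_p_def coef_sum_fun scaleR_gpoly.rep_eq coef_plus_fun times_gpoly.rep_eq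
    mg.rep_eq og.rep_eq tau_no_def theta_no_def christ_def by (rule refl)

lemma ssubst_tsub:
  assumes "c \<in> charts B" "d \<in> charts B" "x \<in> chart_dom c" "x \<in> chart_dom d" and a: "homogB k a"
  shows "ssubst (change_odd rkB c d x) (change_p dimB rkB c d x) (coef a) = coef (tsub c d x a)"
proof -
  have g: "gens_in dimR dimB a" using a by (auto simp: gens_in_def homog_def)
  have P: "change_p dimB rkB c d x = (\<lambda>i. coef (chp c d x i))" by (rule ext) (rule change_p_chp)
  have "(\<lambda>s. change_odd rkB c d x s) s = coef (cho c d x s)" if "s < dimR" for s
    unfolding cho_def by (rule change_odd_trans_mat[OF assms(1-4) that])
  then have "ssubst (change_odd rkB c d x) (\<lambda>i. coef (chp c d x i)) (coef a) =
      ssubst (\<lambda>s. coef (cho c d x s)) (\<lambda>i. coef (chp c d x i)) (coef a)"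
    unfolding ssubst_def
  proof (intro sum.cong refl, clarify)
    fix S m assume nz: "coef a (S, m) \<noteq> 0"
    assume e: "\<And>s. s < dimR \<Longrightarrow> change_odd rkB c d x s = coef (cho c d x s)"
    have "set (sorted_list_of_set S) \<subseteq> {..<dimR}" using homogD(1)[OF a nz] coef_finite[OF nz] by simp
    then have "map (change_odd rkB c d x) (sorted_list_of_set S) = map (\<lambda>s. coef (cho c d x s)) (sorted_list_of_set S)"
      using e by (intro map_cong) auto
    then show "coef a (S, m) *\<^sub>R (foldr (\<odot>) (map (change_odd rkB c d x) (sorted_list_of_set S)) sone \<odot>
        foldr (\<odot>) (map (\<lambda>i. coef (chp c d x i)) (sorted_list_of_multiset m)) sone) =
      coef a (S, m) *\<^sub>R (foldr (\<odot>) (map (\<lambda>s. coef (cho c d x s)) (sorted_list_of_set S)) sone \<odot>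
        foldr (\<odot>) (map (\<lambda>i. coef (chp c d x i)) (sorted_list_of_multiset m)) sone)" by (simp only:)
  qed
  also have "\<dots> = coef (tsub c d x a)" unfolding tsub_def by (rule ssubst_coef[OF g])
  finally show ?thesis unfolding P .
qed

lemma val_trans:
  assumes a: "a \<in> gfuns B k" and cd: "c \<in> charts B" "d \<in> charts B" "x \<in> chart_dom c" "x \<in> chart_dom d"
  shows "val a c x = tsub c d x (val a d x)"
proof -
  have "a c x = ssubst (change_odd rkB c d x) (change_p dimB rkB c d x) (a d x)"
    using a cd unfolding gfuns_def by blast
  then show ?thesis
    unfolding coef_inject[symmetric] coef_val[OF a] ssubst_tsub[OF cd homog_val[OF a], symmetric] .
qed

definition gfun_of :: "(('m, 'v) bundle_chart \<Rightarrow> 'm \<Rightarrow> gpoly) \<Rightarrow> ('m, 'v) gfun" where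
  "gfun_of f = (\<lambda>c x. if c \<in> charts B \<and> x \<in> chart_dom c then coef (f c x) else 0)"

lemma gfun_of_in_gfuns:
  assumes h: "\<And>c x. c \<in> charts B \<Longrightarrow> x \<in> chart_dom c \<Longrightarrow> homogB k (f c x)"
    and l: "\<And>c. c \<in> charts B \<Longrightarrow> lfun c (f c)"
    and t: "\<And>c d x. c \<in> charts B \<Longrightarrow> d \<in> charts B \<Longrightarrow> x \<in> chart_dom c \<Longrightarrow> x \<in> chart_dom d \<Longrightarrow>
      f c x = tsub c d x (f d x)"
  shows "gfun_of f \<in> gfuns B k"
  unfolding gfuns_def mem_Collect_eq tau_theta_range
proof (intro conjI allI impI ballI)
  fix c x S m assume "gfun_of f c x (S, m) \<noteq> 0"
  then have 1: "c \<in> charts B" "x \<in> chart_dom c" "coef (f c x) (S, m) \<noteq> 0"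
    by (auto simp: gfun_of_def split: if_splits)
  then show "c \<in> charts B" "x \<in> chart_dom c" by auto
  show "S \<subseteq> {..<dimR}" "set_mset m \<subseteq> {..<dimB}" "card S + 2 * size m = k"
    using homogD[OF h[OF 1(1,2)] 1(3)] .
next
  fix c k' assume c: "c \<in> charts B"
  have "cdiff k c (chart_dom c) (\<lambda>x. gfun_of f c x k')" for k
    by (subst cdiff_cong[OF c c_open[OF c], of _ "\<lambda>x. coef (f c x) k'"])
      (use c lfun_cdiff[OF c l[OF c]] in \<open>auto simp: gfun_of_def\<close>)
  then show "smooth_on_chart dimB c (chart_dom c) (\<lambda>x. gfun_of f c x k')"
    using smooth_on_chart_iff[OF c c_open[OF c]] by blast
next
  fix c d x assume cd: "c \<in> charts B" "d \<in> charts B" and "x \<in> chart_dom c \<inter> chart_dom d"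
  then have x: "x \<in> chart_dom c" "x \<in> chart_dom d" by auto
  show "gfun_of f c x = ssubst (change_odd rkB c d x) (change_p dimB rkB c d x) (gfun_of f d x)"
    using t[OF cd x] ssubst_tsub[OF cd x h[OF cd(2) x(2)]] cd x by (simp add: gfun_of_def)
qed

lemma val_gfun_of: "c \<in> charts B \<Longrightarrow> x \<in> chart_dom c \<Longrightarrow> val (gfun_of f) c x = f c x"
  by (simp add: val_def gfun_of_def coef_inverse)

lemma gfun_of_val:
  assumes "a \<in> gfuns B k"
  shows "gfun_of (val a) = a"
proof (intro ext)
  fix c x l
  show "gfun_of (val a) c x l = a c x l"
  proof (cases "c \<in> charts B \<and> x \<in> chart_dom c")
    case False
    obtain S m where "l = (S, m)" by fastforce
    then have "a c x l = 0" using False gfunsD(1,2)[OF assms, of c x S m] by blast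
    then show ?thesis using False by (auto simp: gfun_of_def)
  qed (simp add: gfun_of_def coef_val[OF assms])
qed

end

section \<open>The action of sections\<close>

text \<open>Unlike in \<open>lin\<close> and \<open>quad\<close>, only generators of the chart occur
  here. Homogeneity in the sense of \<open>homog\<close>, and with it nondegeneracy, requires this
  restriction.\<close>

definition linR :: "nat \<Rightarrow> gpoly set" where "linR R = span (og ` {..<R})"
definition quadR :: "nat \<Rightarrow> gpoly set" where "quadR R = span {og s * og t | s t. s < R \<and> t < R}"

lemma linR_lin: "a \<in> linR R \<Longrightarrow> a \<in> lin"
  unfolding linR_def lin_def using span_mono[of "og ` {..<R}" "range og"] by blast

lemma quadR_quad: "a \<in> quadR R \<Longrightarrow> a \<in> quad"
  unfolding quadR_def quad_def
  using span_mono[of "{og s * og t | s t. s < R \<and> t < R}" "{og s * og t | s t. True}"] by blast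

lemma linR_closed:
  "0 \<in> linR R" "a \<in> linR R \<Longrightarrow> b \<in> linR R \<Longrightarrow> a + b \<in> linR R" "a \<in> linR R \<Longrightarrow> x *\<^sub>R a \<in> linR R"
  "a \<in> linR R \<Longrightarrow> - a \<in> linR R" "a \<in> linR R \<Longrightarrow> b \<in> linR R \<Longrightarrow> a - b \<in> linR R"
  "s < R \<Longrightarrow> og s \<in> linR R" "(\<And>i. i \<in> I \<Longrightarrow> f i \<in> linR R) \<Longrightarrow> sum f I \<in> linR R"
  unfolding linR_def by (auto intro: span_zero span_add span_scale span_neg span_diff span_base span_sum)

lemma quadR_closed:
  "0 \<in> quadR R" "a \<in> quadR R \<Longrightarrow> b \<in> quadR R \<Longrightarrow> a + b \<in> quadR R" "a \<in> quadR R \<Longrightarrow> x *\<^sub>R a \<in> quadR R"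
  "a \<in> quadR R \<Longrightarrow> b \<in> quadR R \<Longrightarrow> a - b \<in> quadR R"
  "s < R \<Longrightarrow> t < R \<Longrightarrow> og s * og t \<in> quadR R" "(\<And>i. i \<in> I \<Longrightarrow> f i \<in> quadR R) \<Longrightarrow> sum f I \<in> quadR R"
  unfolding quadR_def by (auto intro: span_zero span_add span_scale span_diff span_base span_sum)

lemma linR_induct [consumes 1, case_names zero add]:
  assumes "z \<in> linR R" "P 0" "\<And>c s y. s < R \<Longrightarrow> P y \<Longrightarrow> P (c *\<^sub>R og s + y)"
  shows "P z"
  using assms(1) unfolding linR_def by (induction rule: span_induct_alt) (use assms(2,3) in auto)

lemma quadR_induct [consumes 1, case_names zero add]:
  assumes "z \<in> quadR R" "P 0" "\<And>c s t y. s < R \<Longrightarrow> t < R \<Longrightarrow> P y \<Longrightarrow> P (c *\<^sub>R (og s * og t) + y)"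
  shows "P z"
  using assms(1) unfolding quadR_def by (induction rule: span_induct_alt) (use assms(2,3) in auto)

lemma linR_mult: "a \<in> linR R \<Longrightarrow> b \<in> linR R \<Longrightarrow> a * b \<in> quadR R"
proof (induction a rule: linR_induct)
  case (add c s y)
  have "og s * b \<in> quadR R" using add(3)
    by (induction b rule: linR_induct) (auto simp: distrib_left intro: quadR_closed add(1))
  then show ?case using add by (auto simp: distrib_right intro: quadR_closed)
qed (auto intro: quadR_closed)

lemma ginv_linR: "a \<in> linR R \<Longrightarrow> ginv a \<in> linR R"
  by (induction rule: linR_induct) (auto intro!: linR_closed)

lemma dl_quadR: "a \<in> quadR R \<Longrightarrow> dl s a \<in> linR R"
  by (induction rule: quadR_induct) (auto simp: dl_odd intro!: linR_closed)

lemma homog_og: "s < R \<Longrightarrow> homog R n 1 (og s)"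
  by (auto simp: homog_def og_eq_gmon coef_gmon split: if_splits)

lemma homog_linR: "a \<in> linR R \<Longrightarrow> homog R n 1 a"
  by (induction rule: linR_induct) (auto intro!: homog_add homog_scaleR homog_og[unfolded One_nat_def])

lemma homog_quadR: "a \<in> quadR R \<Longrightarrow> homog R n 2 a"
proof (induction rule: quadR_induct)
  case (add c s t y)
  then show ?case using homog_mult[OF homog_og homog_og, of s R t n]
    by (auto intro!: homog_add homog_scaleR simp: numeral_2_eq_2)
qed simp

text \<open>In positive degree each monomial contains some generator, and the derivative with
  respect to it recovers the coefficient up to a nonzero factor.\<close>

lemma dl_zero_imp:
  assumes h: "homog R n k a" and p: "\<And>i. i < n \<Longrightarrow> dp i a = 0" and d: "\<And>s. s < R \<Longrightarrow> dl s a = 0" and "k > 0"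
  shows "a = 0"
proof (rule gpoly_eqI)
  fix S m
  have "coef a (S, m) = 0"
  proof (rule ccontr)
    assume nz: "coef a (S, m) \<noteq> 0"
    note hd = homogD[OF h nz]
    show False
    proof (cases "m = {#}")
      case True
      then obtain s where s: "s \<in> S" using hd(3) \<open>k > 0\<close> by fastforce
      then have "coef (dl s a) (S - {s}, m) = (- 1) ^ card {t \<in> S - {s}. t < s} * coef a (S, m)"
        by (simp add: coef_dl insert_absorb)
      moreover have "dl s a = 0" using d s hd(1) by auto
      ultimately show False using nz by (simp add: coef_zero)
    next
      case False
      then obtain i m' where m: "m = add_mset i m'" by (meson multiset_cases)
      then have "i < n" using hd(2) by auto
      have "coef (dp i a) (S, m') = real (count m' i + 1) * coef a (S, m)" by (simp add: coef_dp m)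
      then show False using nz p[OF \<open>i < n\<close>] by (simp add: coef_zero)
    qed
  qed
  then show "coef a (S, m) = coef 0 (S, m)" by (simp add: coef_zero)
qed

lemma ad_gen:
  assumes "even R"
  shows "ad n R q q' (og s) = (if s < R then ginv (dl (dual_no s) q) else 0)"
    "ad n R q q' (mg i) = (if i < n then q' i else 0)"
proof -
  have 1: "ginv (dl (dual_no t) q) * (if t = s then 1 else 0) = (if s = t then ginv (dl (dual_no t) q) else 0)" for t
    by simp
  have 2: "q' j * (if j = i then 1 else 0) = (if i = j then q' j else 0)" for j
    by simp
  show "ad n R q q' (og s) = (if s < R then ginv (dl (dual_no s) q) else 0)"
    by (simp add: ad_def 1 del: mult_cancel_left)
  show "ad n R q q' (mg i) = (if i < n then q' i else 0)"
    by (simp add: ad_def 2)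
qed

lemma ad_linR:
  assumes "even R" "q \<in> quadR R" "z \<in> linR R"
  shows "ad n R q q' z \<in> linR R"
  using assms(3)
proof (induction z rule: linR_induct)
  case (add c s y)
  have "ad n R q q' (og s) \<in> linR R"
    using assms(1,2) by (auto simp: ad_gen intro: ginv_linR dl_quadR linR_closed)
  then show ?case using add by (auto simp: ad_linear intro!: linR_closed)
qed (auto simp: ad_linear intro: linR_closed)

lemma ad_quadR:
  assumes "even R" "q \<in> quadR R" "\<And>i. i < n \<Longrightarrow> q' i \<in> quadR R" "z \<in> quadR R"
  shows "ad n R q q' z \<in> quadR R"
  using assms(4)
proof (induction z rule: quadR_induct)
  case (add c s t y)
  have "ad n R q q' (og s * og t) = ad n R q q' (og s) * og t + og s * ad n R q q' (og t)"
    by (rule ad_quad_mult) (use assms quadR_quad in auto)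
  also have "\<dots> \<in> quadR R"
    by (intro quadR_closed linR_mult linR_closed ad_linR assms add)
  finally show ?case using add by (auto simp: ad_linear intro!: quadR_closed)
qed (auto simp: ad_linear intro: quadR_closed)

context smooth_bundle
begin

lemma even_dimR: "even dimR" by simp

lemma restrict_cho_linR: "restrict_gens dimR (cho c d x) s \<in> linR dimR"
  by (auto simp: restrict_gens_def cho_def intro!: linR_closed)

lemma restrict_cho_ac:
  "restrict_gens dimR (cho c d x) s * restrict_gens dimR (cho c d x) t =
   - (restrict_gens dimR (cho c d x) t * restrict_gens dimR (cho c d x) s)"
  using linD(1)[OF linR_lin[OF restrict_cho_linR]] linD(2)[OF linR_lin[OF restrict_cho_linR]]
  by (metis mult_minus_left)

lemma restrict_cho_ginv:
  "ginv (restrict_gens dimR (cho c d x) s) = - restrict_gens dimR (cho c d x) s"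
  by (rule linD(2)[OF linR_lin[OF restrict_cho_linR]])

text \<open>The form \<open>g\<^sup>-\<^sup>1 \<partial>g\<close> of the flat connection for which
  the frame of \<open>d\<close> is parallel, relative to the frame of \<open>c\<close>, written as a
  quadratic function.\<close>

definition chq :: "('m, 'v) bundle_chart \<Rightarrow> ('m, 'v) bundle_chart \<Rightarrow> 'm \<Rightarrow> nat \<Rightarrow> gpoly" where
  "chq c d x j = (\<Sum>\<alpha><rkB. \<Sum>\<beta><rkB. christ c d x j \<beta> \<alpha> *\<^sub>R (og (2 * \<alpha>) * og (2 * \<beta> + 1)))"

lemma chq_quadR: "chq c d x j \<in> quadR dimR"
  unfolding chq_def by (intro quadR_closed) auto

lemma chp_chq: "chp c d x i = (\<Sum>j<dimB. chart_partial d i (\<lambda>y. chart_coord c y j) x *\<^sub>R (mg j + chq c d x j))"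
  by (simp add: chp_def chq_def)

lemma chp_central: "restrict_gens dimB (chp c d x) i * z = z * restrict_gens dimB (chp c d x) i"
proof -
  have "(mg j + chq c d x j) * z = z * (mg j + chq c d x j)" for j
    using quadD(1)[OF quadR_quad[OF chq_quadR]] mom_comm by (simp add: distrib_left distrib_right)
  then show ?thesis by (simp add: restrict_gens_def chp_chq sum_distrib_left sum_distrib_right)
qed

lemma chp_ginv: "ginv (restrict_gens dimB (chp c d x) i) = restrict_gens dimB (chp c d x) i"
  using quadD(2)[OF quadR_quad[OF chq_quadR]] by (simp add: restrict_gens_def chp_chq ginv_sum)

lemma tsub_simps:
  "tsub c d x 1 = 1" "tsub c d x 0 = 0"
  "tsub c d x (a + b) = tsub c d x a + tsub c d x b"
  "tsub c d x (r *\<^sub>R a) = r *\<^sub>R tsub c d x a"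
  "tsub c d x (sum f I) = (\<Sum>i\<in>I. tsub c d x (f i))"
  "tsub c d x (og s) = (if s < dimR then cho c d x s else 0)"
  "tsub c d x (mg i) = (if i < dimB then chp c d x i else 0)"
  "tsub c d x (og s * a) = (if s < dimR then cho c d x s * tsub c d x a else 0)"
proof -
  note og = gsub_og[where G = "restrict_gens dimR (cho c d x)", OF restrict_cho_ac]
  note mg = gsub_mg[where P = "restrict_gens dimB (chp c d x)", OF chp_central]
  show "tsub c d x 1 = 1" "tsub c d x 0 = 0"
    "tsub c d x (a + b) = tsub c d x a + tsub c d x b"
    "tsub c d x (r *\<^sub>R a) = r *\<^sub>R tsub c d x a"
    "tsub c d x (sum f I) = (\<Sum>i\<in>I. tsub c d x (f i))"
    by (simp_all add: tsub_def gsub_one gsub_add gsub_scaleR gsub_sum)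
  show "tsub c d x (og s) = (if s < dimR then cho c d x s else 0)"
    using og[of _ s 1] by (simp add: tsub_def gsub_one restrict_gens_def)
  show "tsub c d x (mg i) = (if i < dimB then chp c d x i else 0)"
    using mg[of _ i 1] by (simp add: tsub_def gsub_one restrict_gens_def)
  show "tsub c d x (og s * a) = (if s < dimR then cho c d x s * tsub c d x a else 0)"
    using og[of _ s a] by (simp add: tsub_def restrict_gens_def)
qed

lemma tsub_diff: "tsub c d x (a - b) = tsub c d x a - tsub c d x b"
  using tsub_simps(3)[of c d x "a - b" b] by simp

lemma tsub_uminus: "tsub c d x (- a) = - tsub c d x a"
  using tsub_diff[of c d x 0 a] tsub_simps(2) by simp

lemma cho_linR: "cho c d x s \<in> linR dimR"
  by (auto simp: cho_def intro!: linR_closed)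

lemma tsub_quadR: "z \<in> quadR dimR \<Longrightarrow> tsub c d x z \<in> quadR dimR"
  by (induction rule: quadR_induct) (auto simp: tsub_simps intro!: quadR_closed(1-4) linR_mult cho_linR)

definition sec :: "('m \<Rightarrow> 'v \<times> ('v \<Rightarrow> real)) \<Rightarrow> ('m, 'v) bundle_chart \<Rightarrow> 'm \<Rightarrow> gpoly" where
  "sec u c x = (\<Sum>s<dimR. scomp B u c s x *\<^sub>R og s)"

abbreviation ad_sec :: "('m \<Rightarrow> 'v \<times> ('v \<Rightarrow> real)) \<Rightarrow> ('m, 'v) bundle_chart \<Rightarrow> 'm \<Rightarrow> gpoly \<Rightarrow> gpoly" where
  "ad_sec u c x \<equiv> ad dimB dimR (sec u c x) (\<lambda>i. D c i (sec u c) x)"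

lemma sec_linR: "sec u c x \<in> linR dimR"
  by (auto simp: sec_def intro!: linR_closed)

lemma dl_sec: "dl s (sec u c x) = (if s < dimR then scomp B u c s x *\<^sub>R 1 else 0)"
proof -
  have "scomp B u c t x *\<^sub>R (if s = t then 1 else 0) = (if s = t then scomp B u c s x *\<^sub>R (1::gpoly) else 0)" for t
    by simp
  then show ?thesis by (simp add: sec_def dl_sum)
qed

context
  fixes u assumes u: "u \<in> double_sections B"
begin

lemma sec_fibre: "fst (u x) \<in> fibre B x" "snd (u x) \<in> dual_space (fibre B x)"
  using u by (auto simp: double_sections_iff)

lemma cdiff_scomp: "c \<in> charts B \<Longrightarrow> s < dimR \<Longrightarrow> cdiff k c (chart_dom c) (scomp B u c s)"
  using u unfolding double_sections_iff by blast

lemma lfun_sec: "c \<in> charts B \<Longrightarrow> lfun c (sec u c)"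
  unfolding sec_def[abs_def] by (intro lfun_sum lfun_scaleR_const cdiff_scomp) auto

lemma has_partial_scomp:
  "c \<in> charts B \<Longrightarrow> s < dimR \<Longrightarrow> x \<in> chart_dom c \<Longrightarrow> i < dimB \<Longrightarrow>
    has_partial c i (scomp B u c s) (chart_partial c i (scomp B u c s) x) x"
  using cdiff_chart_partial(2)[OF _ c_open cdiff_scomp[of c s "Suc 0"]] by blast

lemma D_sec:
  assumes "c \<in> charts B" "x \<in> chart_dom c" "i < dimB"
  shows "D c i (sec u c) x = (\<Sum>s<dimR. chart_partial c i (scomp B u c s) x *\<^sub>R og s)"
  unfolding sec_def[abs_def]
  by (intro has_D_imp[OF has_D_sum] has_D_const_scaleR has_partial_scomp assms) auto

lemma D_sec_linR: "c \<in> charts B \<Longrightarrow> x \<in> chart_dom c \<Longrightarrow> i < dimB \<Longrightarrow> D c i (sec u c) x \<in> linR dimR"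
  by (auto simp: D_sec intro!: linR_closed)

section \<open>Invariance of the bracket with a section under coordinate changes\<close>

context
  fixes c d x assumes c: "c \<in> charts B" and d: "d \<in> charts B" and x: "x \<in> chart_dom c" "x \<in> chart_dom d"
begin

lemma scomp_change: "t < dimR \<Longrightarrow> scomp B u c t x = (\<Sum>s<dimR. trans_mat B c d x t s * scomp B u d s x)"
  by (rule comp_trans[where u = u, OF c d x sec_fibre])

lemma overlap: "open (chart_dom c \<inter> chart_dom d)" "chart_dom c \<inter> chart_dom d \<subseteq> chart_dom c"
  "chart_dom c \<inter> chart_dom d \<subseteq> chart_dom d" "x \<in> chart_dom c \<inter> chart_dom d"
  using open_chart_dom c d x by auto

lemma has_partial_trans_mat:
  assumes "j < dimB" "s < dimR" "t < dimR"
  shows "has_partial c j (\<lambda>y. trans_mat B d c y s t) (chart_partial c j (\<lambda>y. trans_mat B d c y s t) x) x"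
    "has_partial c j (\<lambda>y. trans_mat B c d y s t) (chart_partial c j (\<lambda>y. trans_mat B c d y s t) x) x"
proof -
  have 1: "cdiff (Suc 0) c (chart_dom c \<inter> chart_dom d) (\<lambda>y. trans_mat B c d y s t)"
    by (rule cdiff_trans_mat[OF c d assms(2,3)])
  have "cdiff (Suc 0) d (chart_dom c \<inter> chart_dom d) (\<lambda>y. trans_mat B d c y s t)"
    using cdiff_trans_mat[OF d c assms(2,3)] by (simp only: Int_commute)
  then have 2: "cdiff (Suc 0) c (chart_dom c \<inter> chart_dom d) (\<lambda>y. trans_mat B d c y s t)"
    by (rule cdiff_change_chart[OF d c overlap(1,3,2)])
  show "has_partial c j (\<lambda>y. trans_mat B d c y s t) (chart_partial c j (\<lambda>y. trans_mat B d c y s t) x) x"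
    by (rule cdiff_chart_partial(2)[OF c overlap(1,2) 2 assms(1) overlap(4)])
  show "has_partial c j (\<lambda>y. trans_mat B c d y s t) (chart_partial c j (\<lambda>y. trans_mat B c d y s t) x) x"
    by (rule cdiff_chart_partial(2)[OF c overlap(1,2) 1 assms(1) overlap(4)])
qed

text \<open>The same flat connection on \<open>A \<oplus> A\<^sup>*\<close>, acting on the
  components of sections. Its blocks are \<open>christ\<close> on the components along
  \<open>A\<close> and minus the transpose of \<open>christ\<close> on the others.\<close>

definition conn :: "nat \<Rightarrow> nat \<Rightarrow> nat \<Rightarrow> real" where
  "conn j t s' = (\<Sum>s<dimR. trans_mat B c d x t s * chart_partial c j (\<lambda>y. trans_mat B d c y s s') x)"

lemma chart_partial_zero: "chart_partial c j (\<lambda>y. 0) x = 0"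
  using has_partial_imp[OF has_partial_const] .

lemma conn_parity: "even t \<noteq> even s' \<Longrightarrow> conn j t s' = 0"
  unfolding conn_def by (rule sum.neutral) (auto simp: trans_mat_def chart_partial_zero)

lemma conn_odd: "conn j (2 * \<beta> + 1) (2 * \<alpha> + 1) = christ c d x j \<beta> \<alpha>"
  unfolding conn_def christ_def sum_even_odd by (rule sum.cong) (simp_all add: trans_mat_def)

text \<open>Differentiating the relation that the product of the matrix with its inverse is constant
  moves the derivative from one factor to the other, with a sign.\<close>

lemma conn_even:
  assumes j: "j < dimB" and ab: "\<alpha> < rkB" "\<beta> < rkB"
  shows "conn j (2 * \<alpha>) (2 * \<beta>) = - christ c d x j \<beta> \<alpha>"
proof -
  have ab': "2 * \<alpha> < dimR" "2 * \<beta> < dimR" using ab by auto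
  let ?f = "\<lambda>y. \<Sum>s<dimR. trans_mat B c d y (2 * \<alpha>) s * trans_mat B d c y s (2 * \<beta>)"
  have "has_partial c j ?f (\<Sum>s<dimR. chart_partial c j (\<lambda>y. trans_mat B c d y (2 * \<alpha>) s) x * trans_mat B d c x s (2 * \<beta>) +
      trans_mat B c d x (2 * \<alpha>) s * chart_partial c j (\<lambda>y. trans_mat B d c y s (2 * \<beta>)) x) x"
    by (intro has_partial_sum has_partial_mult[OF c x(1)] has_partial_trans_mat j ab') auto
  moreover have "has_partial c j ?f 0 x"
  proof -
    have e: "?f y = (if 2 * \<alpha> = 2 * \<beta> then 1 else 0)" if "y \<in> chart_dom c \<inter> chart_dom d" for y
      by (rule trans_mat_inverse[OF c d _ _ ab']) (use that in auto)
    show ?thesis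
      by (rule has_partial_cong[OF c overlap(1,2,4) j, of ?f "\<lambda>y. if 2 * \<alpha> = 2 * \<beta> then 1 else 0",
            THEN iffD2, OF _ has_partial_const]) (rule e)
  qed
  ultimately have "(\<Sum>s<dimR. chart_partial c j (\<lambda>y. trans_mat B c d y (2 * \<alpha>) s) x * trans_mat B d c x s (2 * \<beta>) +
      trans_mat B c d x (2 * \<alpha>) s * chart_partial c j (\<lambda>y. trans_mat B d c y s (2 * \<beta>)) x) = 0"
    unfolding has_partial_def by (rule DERIV_unique)
  moreover have "(\<Sum>s<dimR. chart_partial c j (\<lambda>y. trans_mat B c d y (2 * \<alpha>) s) x * trans_mat B d c x s (2 * \<beta>)) =
      christ c d x j \<beta> \<alpha>"
    unfolding christ_def sum_even_odd by (rule sum.cong) (simp_all add: trans_mat_def chart_partial_zero)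
  ultimately show ?thesis by (simp add: conn_def sum.distrib)
qed

text \<open>The covariant derivative for which the frame of \<open>d\<close> is parallel, computed
  in both frames: in \<open>c\<close> the connection form appears, in \<open>d\<close> it is the
  plain partial derivative.\<close>

lemma partial_scomp_change:
  assumes j: "j < dimB" and t: "t < dimR"
  shows "chart_partial c j (scomp B u c t) x + (\<Sum>s<dimR. conn j t s * scomp B u c s x) =
    (\<Sum>s<dimR. trans_mat B c d x t s * chart_partial c j (scomp B u d s) x)"
proof -
  let ?M' = "\<lambda>s s'. chart_partial c j (\<lambda>y. trans_mat B d c y s s') x"
  have e: "chart_partial c j (scomp B u d s) x =
      (\<Sum>s'<dimR. ?M' s s' * scomp B u c s' x + trans_mat B d c x s s' * chart_partial c j (scomp B u c s') x)"
    if s: "s < dimR" for s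
  proof -
    let ?f = "\<lambda>y. \<Sum>s'<dimR. trans_mat B d c y s s' * scomp B u c s' y"
    have "has_partial c j ?f (\<Sum>s'<dimR. ?M' s s' * scomp B u c s' x + trans_mat B d c x s s' * chart_partial c j (scomp B u c s') x) x"
      by (intro has_partial_sum has_partial_mult[OF c x(1)] has_partial_trans_mat has_partial_scomp c x j s) auto
    moreover have e: "scomp B u d s y = ?f y" if "y \<in> chart_dom c \<inter> chart_dom d" for y
      by (rule comp_trans[where u = u, OF d c _ _ sec_fibre s]) (use that in auto)
    have "has_partial c j (scomp B u d s) D' x \<longleftrightarrow> has_partial c j ?f D' x" for D'
      by (rule has_partial_cong[OF c overlap(1,2,4) j]) (rule e)
    ultimately have "has_partial c j (scomp B u d s)
        (\<Sum>s'<dimR. ?M' s s' * scomp B u c s' x + trans_mat B d c x s s' * chart_partial c j (scomp B u c s') x) x"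
      by (simp only:)
    then show ?thesis by (rule has_partial_imp)
  qed
  have "(\<Sum>s<dimR. trans_mat B c d x t s * chart_partial c j (scomp B u d s) x) =
    (\<Sum>s<dimR. \<Sum>s'<dimR. trans_mat B c d x t s * ?M' s s' * scomp B u c s' x) +
    (\<Sum>s<dimR. \<Sum>s'<dimR. trans_mat B c d x t s * trans_mat B d c x s s' * chart_partial c j (scomp B u c s') x)"
    by (simp add: e sum_distrib_left distrib_left sum.distrib mult.assoc)
  also have "(\<Sum>s<dimR. \<Sum>s'<dimR. trans_mat B c d x t s * ?M' s s' * scomp B u c s' x) =
      (\<Sum>s'<dimR. conn j t s' * scomp B u c s' x)"
    unfolding conn_def sum_distrib_right by (rule sum.swap)
  also have "(\<Sum>s<dimR. \<Sum>s'<dimR. trans_mat B c d x t s * trans_mat B d c x s s' * chart_partial c j (scomp B u c s') x) =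
      (\<Sum>s'<dimR. (\<Sum>s<dimR. trans_mat B c d x t s * trans_mat B d c x s s') * chart_partial c j (scomp B u c s') x)"
    unfolding sum_distrib_right by (rule sum.swap)
  also have "\<dots> = (\<Sum>s'<dimR. if t = s' then chart_partial c j (scomp B u c s') x else 0)"
    by (rule sum.cong) (use trans_mat_inverse[OF c d x t] in auto)
  also have "\<dots> = chart_partial c j (scomp B u c t) x" using t by simp
  finally show ?thesis by simp
qed

lemma partial_scomp_chain:
  assumes i: "i < dimB" and s: "s < dimR"
  shows "chart_partial d i (scomp B u d s) x =
    (\<Sum>j<dimB. chart_partial c j (scomp B u d s) x * chart_partial d i (\<lambda>y. chart_coord c y j) x)"
proof (rule has_partial_imp, rule has_partial_chain[OF c d overlap i])
  have "cdiff 1 d (chart_dom c \<inter> chart_dom d) (scomp B u d s)"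
    by (rule cdiff_subset[OF cdiff_scomp[OF d s]]) simp
  then show "cdiff 1 c (chart_dom c \<inter> chart_dom d) (scomp B u d s)"
    by (rule cdiff_change_chart[OF d c overlap(1,3,2)])
  fix j assume "j < dimB"
  then have "cdiff (Suc 0) d (chart_dom c \<inter> chart_dom d) (\<lambda>y. chart_coord c y j)"
    by (rule cdiff_coord[OF d c overlap(1,3,2)])
  then show "has_partial d i (\<lambda>y. chart_coord c y j) (chart_partial d i (\<lambda>y. chart_coord c y j) x) x"
    by (rule cdiff_chart_partial(2)[OF d overlap(1,3) _ i overlap(4)])
qed

lemma ad_sec_og: "ad_sec u c x (og s) = (if s < dimR then scomp B u c (dual_no s) x *\<^sub>R 1 else 0)"
  by (simp add: ad_gen dl_sec)

text \<open>The quadratic function \<open>chq\<close> acts on sections as the connection form. This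
  is the origin of the quadratic term in the transformation of the momenta.\<close>

lemma ad_sec_chq:
  assumes j: "j < dimB"
  shows "ad_sec u c x (chq c d x j) = (\<Sum>t<dimR. (\<Sum>s<dimR. conn j t s * scomp B u c s x) *\<^sub>R og t)"
proof -
  have l: "sec u c x \<in> lin" "\<And>i. i < dimB \<Longrightarrow> D c i (sec u c) x \<in> lin"
    by (auto intro: linR_lin sec_linR D_sec_linR[OF c x(1)])
  have og: "ad_sec u c x (og (2 * \<alpha>) * og (2 * \<beta> + 1)) =
      scomp B u c (2 * \<alpha> + 1) x *\<^sub>R og (2 * \<beta> + 1) - scomp B u c (2 * \<beta>) x *\<^sub>R og (2 * \<alpha>)"
    if "\<alpha> < rkB" "\<beta> < rkB" for \<alpha> \<beta>
  proof -
    have "ad_sec u c x (og (2 * \<alpha>) * og (2 * \<beta> + 1)) = ad_sec u c x (og (2 * \<alpha>)) * og (2 * \<beta> + 1) +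
        ginv (og (2 * \<alpha>)) * ad_sec u c x (og (2 * \<beta> + 1))"
      by (rule ad_lin_mult) (use l in auto)
    then show ?thesis using that by (simp add: ad_sec_og dual_no_def)
  qed
  have 1: "(\<Sum>s<dimR. conn j (2 * \<alpha>) s * scomp B u c s x) = (\<Sum>\<beta><rkB. - christ c d x j \<beta> \<alpha> * scomp B u c (2 * \<beta>) x)"
    if "\<alpha> < rkB" for \<alpha>
    unfolding sum_even_odd by (rule sum.cong) (use that j in \<open>auto simp: conn_even conn_parity\<close>)
  have 2: "(\<Sum>s<dimR. conn j (2 * \<beta> + 1) s * scomp B u c s x) = (\<Sum>\<alpha><rkB. christ c d x j \<beta> \<alpha> * scomp B u c (2 * \<alpha> + 1) x)"
    for \<beta>
    unfolding sum_even_odd conn_odd by (rule sum.cong) (auto simp: conn_parity)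
  have split: "(\<Sum>t<dimR. g t *\<^sub>R og t) = (\<Sum>\<alpha><rkB. g (2 * \<alpha>) *\<^sub>R og (2 * \<alpha>)) + (\<Sum>\<beta><rkB. g (2 * \<beta> + 1) *\<^sub>R og (2 * \<beta> + 1))"
    for g by (simp add: sum_even_odd[of "\<lambda>t. g t *\<^sub>R og t"] sum.distrib)
  have "(\<Sum>t<dimR. (\<Sum>s<dimR. conn j t s * scomp B u c s x) *\<^sub>R og t) =
      (\<Sum>\<alpha><rkB. (\<Sum>\<beta><rkB. - christ c d x j \<beta> \<alpha> * scomp B u c (2 * \<beta>) x) *\<^sub>R og (2 * \<alpha>)) +
      (\<Sum>\<beta><rkB. (\<Sum>\<alpha><rkB. christ c d x j \<beta> \<alpha> * scomp B u c (2 * \<alpha> + 1) x) *\<^sub>R og (2 * \<beta> + 1))"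
    unfolding split by (intro arg_cong2[where f = "(+)"] sum.cong) (simp_all only: 1 2 lessThan_iff)
  also have "(\<Sum>\<beta><rkB. (\<Sum>\<alpha><rkB. christ c d x j \<beta> \<alpha> * scomp B u c (2 * \<alpha> + 1) x) *\<^sub>R og (2 * \<beta> + 1)) =
      (\<Sum>\<alpha><rkB. \<Sum>\<beta><rkB. (christ c d x j \<beta> \<alpha> * scomp B u c (2 * \<alpha> + 1) x) *\<^sub>R og (2 * \<beta> + 1))"
    unfolding scaleR_sum_left by (rule sum.swap)
  finally have r: "(\<Sum>t<dimR. (\<Sum>s<dimR. conn j t s * scomp B u c s x) *\<^sub>R og t) =
      (\<Sum>\<alpha><rkB. \<Sum>\<beta><rkB. (christ c d x j \<beta> \<alpha> * scomp B u c (2 * \<alpha> + 1) x) *\<^sub>R og (2 * \<beta> + 1) -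
        (christ c d x j \<beta> \<alpha> * scomp B u c (2 * \<beta>) x) *\<^sub>R og (2 * \<alpha>))"
    by (simp add: scaleR_sum_left sum_subtractf sum_negf)
  show ?thesis unfolding r chq_def ad_sum ad_linear(5)
    by (intro sum.cong refl) (simp only: og lessThan_iff scaleR_diff_right scaleR_scaleR)
qed

text \<open>The bracket of a section with a momentum differentiates its components. The quadratic
  term replaces the frame of \<open>c\<close> by that of \<open>d\<close>, and the chain rule
  replaces the coordinate directions of \<open>c\<close> by those of \<open>d\<close>.\<close>

lemma ad_sec_chp:
  assumes i: "i < dimB"
  shows "ad_sec u c x (chp c d x i) = tsub c d x (D d i (sec u d) x)"
proof -
  let ?J = "\<lambda>j. chart_partial d i (\<lambda>y. chart_coord c y j) x"
  have "ad_sec u c x (mg j + chq c d x j) =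
      (\<Sum>t<dimR. (\<Sum>s<dimR. trans_mat B c d x t s * chart_partial c j (scomp B u d s) x) *\<^sub>R og t)"
    if j: "j < dimB" for j
    unfolding ad_linear ad_sec_chq[OF j] ad_gen[OF even_dimR]
    using j D_sec[OF c x(1) j] partial_scomp_change[OF j, symmetric]
    by (simp add: scaleR_add_left sum.distrib)
  then have "ad_sec u c x (chp c d x i) = (\<Sum>j<dimB. ?J j *\<^sub>R
      (\<Sum>t<dimR. (\<Sum>s<dimR. trans_mat B c d x t s * chart_partial c j (scomp B u d s) x) *\<^sub>R og t))"
    by (simp add: chp_chq ad_sum ad_linear)
  also have "\<dots> = (\<Sum>j<dimB. \<Sum>t<dimR. \<Sum>s<dimR.
      (?J j * (trans_mat B c d x t s * chart_partial c j (scomp B u d s) x)) *\<^sub>R og t)"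
    by (simp add: scaleR_sum_right scaleR_sum_left)
  also have "\<dots> = (\<Sum>j<dimB. \<Sum>s<dimR. \<Sum>t<dimR.
      (?J j * (trans_mat B c d x t s * chart_partial c j (scomp B u d s) x)) *\<^sub>R og t)"
    by (rule sum.cong[OF refl], rule sum.swap)
  also have "\<dots> = (\<Sum>s<dimR. \<Sum>j<dimB. \<Sum>t<dimR.
      (?J j * (trans_mat B c d x t s * chart_partial c j (scomp B u d s) x)) *\<^sub>R og t)"
    by (rule sum.swap)
  also have "\<dots> = (\<Sum>s<dimR. chart_partial d i (scomp B u d s) x *\<^sub>R cho c d x s)"
  proof (rule sum.cong[OF refl])
    fix s assume "s \<in> {..<dimR}"
    then have s: "s < dimR" by simp
    show "(\<Sum>j<dimB. \<Sum>t<dimR. (?J j * (trans_mat B c d x t s * chart_partial c j (scomp B u d s) x)) *\<^sub>R og t) =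
        chart_partial d i (scomp B u d s) x *\<^sub>R cho c d x s"
      unfolding partial_scomp_chain[OF i s] scaleR_sum_left[of _ "{..<dimB}"]
      by (simp add: cho_def scaleR_sum_right mult_ac)
  qed
  also have "\<dots> = tsub c d x (D d i (sec u d) x)"
    by (simp add: D_sec[OF d x(2) i] tsub_simps)
  finally show ?thesis .
qed

lemma ad_sec_cho:
  assumes s: "s < dimR"
  shows "ad_sec u c x (cho c d x s) = scomp B u d (dual_no s) x *\<^sub>R 1"
proof -
  have "ad_sec u c x (cho c d x s) = (\<Sum>t<dimR. (trans_mat B c d x t s * scomp B u c (dual_no t) x) *\<^sub>R 1)"
    unfolding cho_def ad_sum ad_linear ad_sec_og by (rule sum.cong) auto
  also have "\<dots> = (\<Sum>t<dimR. trans_mat B d c x (dual_no s) (dual_no t) * scomp B u c (dual_no t) x) *\<^sub>R 1"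
    by (simp add: scaleR_sum_left trans_mat_dual)
  also have "(\<Sum>t<dimR. trans_mat B d c x (dual_no s) (dual_no t) * scomp B u c (dual_no t) x) =
      (\<Sum>t<dimR. trans_mat B d c x (dual_no s) t * scomp B u c t x)"
    by (rule sum_dual_no[OF even_dimR])
  also have "\<dots> = scomp B u d (dual_no s) x"
    by (rule comp_trans[where u = u, OF d c x(2,1) sec_fibre, symmetric]) (simp add: s)
  finally show ?thesis .
qed

text \<open>Both composites are odd derivations along \<open>tsub\<close>, and the images of the
  generators have been compared. Only here is the effect of the transition functions computed by
  hand; for \<open>N\<close> it is deduced from this lemma by nondegeneracy.\<close>

lemma ad_sec_tsub: "ad_sec u c x (tsub c d x z) = tsub c d x (ad_sec u d x z)"
  unfolding tsub_def
proof (rule gsub_odd_derivation[where D = "ad_sec u c x" and E = "ad_sec u d x"])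
  have l: "sec u c x \<in> lin" "\<And>i. i < dimB \<Longrightarrow> D c i (sec u c) x \<in> lin"
    "sec u d x \<in> lin" "\<And>i. i < dimB \<Longrightarrow> D d i (sec u d) x \<in> lin"
    by (auto intro: linR_lin sec_linR D_sec_linR[OF c x(1)] D_sec_linR[OF d x(2)])
  show "ad_sec u c x (a * b) = ad_sec u c x a * b + ginv a * ad_sec u c x b"
    "ad_sec u d x (a * b) = ad_sec u d x a * b + ginv a * ad_sec u d x b" for a b
    by (rule ad_lin_mult; use l in auto)+
  fix s
  have "ad_sec u d x (og s) = (if s < dimR then scomp B u d (dual_no s) x *\<^sub>R 1 else 0)"
    by (simp add: ad_gen dl_sec)
  then show "ad_sec u c x (restrict_gens dimR (cho c d x) s) =
      gsub (restrict_gens dimR (cho c d x)) (restrict_gens dimB (chp c d x)) (ad_sec u d x (og s))"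
    using ad_sec_cho by (simp add: restrict_gens_def ad_linear gsub_scaleR gsub_one)
  show "ad_sec u c x (restrict_gens dimB (chp c d x) i) =
      gsub (restrict_gens dimR (cho c d x)) (restrict_gens dimB (chp c d x)) (ad_sec u d x (mg i))" for i
    using ad_sec_chp[unfolded tsub_def] by (simp add: restrict_gens_def ad_linear ad_gen)
qed (simp_all only: ad_linear chp_central[symmetric] chp_ginv restrict_cho_ginv, rule restrict_cho_ac)

lemma sec_tsub: "sec u c x = tsub c d x (sec u d x)"
proof -
  have "tsub c d x (sec u d x) = (\<Sum>s<dimR. \<Sum>t<dimR. (trans_mat B c d x t s * scomp B u d s x) *\<^sub>R og t)"
    by (simp add: sec_def tsub_simps cho_def scaleR_sum_right mult.commute)
  also have "\<dots> = (\<Sum>t<dimR. \<Sum>s<dimR. (trans_mat B c d x t s * scomp B u d s x) *\<^sub>R og t)"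
    by (rule sum.swap)
  also have "\<dots> = sec u c x" by (simp add: sec_def scomp_change scaleR_sum_left)
  finally show ?thesis ..
qed

end

end

end

lemma homog0_scalar: "homog R n 0 a \<Longrightarrow> a = coef a ({}, {#}) *\<^sub>R 1"
proof (rule gpoly_eqI)
  fix S m assume h: "homog R n 0 a"
  show "coef a (S, m) = coef (coef a ({}, {#}) *\<^sub>R 1) (S, m)"
  proof (cases "coef a (S, m) = 0")
    case False
    then have "S = {}" "m = {#}" using homogD(3)[OF h False] coef_finite[OF False] by auto
    then show ?thesis by (simp add: coef_scaleR coef_one)
  next
    case True
    then show ?thesis by (auto simp: coef_scaleR coef_one)
  qed
qed

section \<open>Bump sections and nondegeneracy\<close>

context smooth_bundle
begin

lemma coframe_zero: "c \<in> charts B \<Longrightarrow> x \<in> chart_dom c \<Longrightarrow> cofr c \<alpha> x 0 = 0"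
  using coframe_scaleR[of c x 0 \<alpha> 0] subspace_0[OF fibre_subspace] by simp

lemma trans_mat_triple:
  assumes c: "c \<in> charts B" "x \<in> chart_dom c" and d: "d \<in> charts B" "x \<in> chart_dom d"
    and e: "e \<in> charts B" "x \<in> chart_dom e" and ts: "t < dimR" "s < dimR"
  shows "trans_mat B c e x t s = (\<Sum>w<dimR. trans_mat B c d x t w * trans_mat B d e x w s)"
proof -
  \<comment> \<open>A single vector or covector, the frame element of \<open>e\<close> with number
    \<open>s\<close>; its components in another chart form a column of the transition matrix. At one
    point \<open>comp_trans\<close> asks for no smoothness.\<close>
  let ?u = "\<lambda>y. (if even s then 0 else chart_frame e (s div 2) x, if even s then cofr e (s div 2) x else 0)"
  have h: "s div 2 < rkB" using ts by auto
  have *: "scomp B ?u d w x = trans_mat B d e x w s" if "d \<in> charts B" "x \<in> chart_dom d" for d w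
    using that by (auto simp: scomp_def trans_mat_def coframe_zero)
  have f: "fst (?u x) \<in> fibre B x" using h subspace_0[OF fibre_subspace[OF e]] frame_in_fibre[OF e] by auto
  have g: "snd (?u x) \<in> dual_space (fibre B x)" using coframe_dual[OF e] by (auto simp: dual_space_def)
  show ?thesis
    using comp_trans[where u = ?u, OF c(1) d(1) c(2) d(2) f g ts(1)] unfolding *[OF c] *[OF d] .
qed

lemma trans_mat_self:
  assumes "c \<in> charts B" "x \<in> chart_dom c" "t < dimR" "s < dimR"
  shows "trans_mat B c c x t s = (if t = s then 1 else 0)"
proof -
  have h: "t div 2 < rkB" "s div 2 < rkB" using assms by auto
  have "even t = even s \<Longrightarrow> t div 2 = s div 2 \<longleftrightarrow> t = s" by presburger
  then show ?thesis using coframe_frame[OF assms(1,2) h] coframe_frame[OF assms(1,2) h(2,1)]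
    by (cases "even t"; cases "even s") (auto simp: trans_mat_def)
qed

text \<open>The element number \<open>s0\<close> of the frame or dual frame, multiplied by
  \<open>f\<close> and extended by zero. Its components in another chart are the corresponding
  column of the transition matrix.\<close>

lemma section_of_bump:
  assumes c: "c \<in> charts B" and K: "closed K" "K \<subseteq> chart_dom c"
    and f: "\<And>y. y \<notin> K \<Longrightarrow> f y = 0" "\<And>k. cdiff k c (chart_dom c) f" and s0: "s0 < dimR"
  shows "\<exists>u\<in>double_sections B. (\<forall>y\<in>chart_dom c. \<forall>s<dimR. scomp B u c s y = (if s = s0 then f y else 0)) \<and>
    (\<not> even s0 \<longrightarrow> (\<forall>y. snd (u y) = 0)) \<and> (even s0 \<longrightarrow> (\<forall>y. fst (u y) = 0))"
proof -
  define w where "w d t y = (if y \<in> chart_dom c then f y * trans_mat B d c y t s0 else 0)" for d t y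
  have ex: "\<exists>u\<in>double_sections B. (\<forall>c\<in>charts B. \<forall>x\<in>chart_dom c. \<forall>s<dimR. scomp B u c s x = w c s x) \<and>
    ((\<forall>c\<in>charts B. \<forall>x\<in>chart_dom c. \<forall>s<dimR. even s \<longrightarrow> w c s x = 0) \<longrightarrow> (\<forall>x. snd (u x) = 0)) \<and>
    ((\<forall>c\<in>charts B. \<forall>x\<in>chart_dom c. \<forall>s<dimR. \<not> even s \<longrightarrow> w c s x = 0) \<longrightarrow> (\<forall>x. fst (u x) = 0))"
  proof (rule section_of_family)
    fix d t k assume d: "d \<in> charts B" and t: "t < dimR"
    have o: "open (chart_dom c \<inter> chart_dom d)" using open_chart_dom c d by blast
    have f': "cdiff k d (chart_dom c \<inter> chart_dom d) f"
      by (rule cdiff_change_chart[OF c d o]) (auto intro: cdiff_subset[OF f(2)])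
    have m': "cdiff k d (chart_dom c \<inter> chart_dom d) (\<lambda>y. trans_mat B d c y t s0)"
      using cdiff_trans_mat[OF d c t s0] by (simp only: Int_commute)
    have "cdiff k d (chart_dom c \<inter> chart_dom d) (\<lambda>y. f y * trans_mat B d c y t s0)"
      by (rule cdiff_mult[OF d o _ f' m']) simp
    then have "cdiff k d (chart_dom c \<inter> chart_dom d) (w d t)"
      by (subst cdiff_cong[OF d o, of _ "\<lambda>y. f y * trans_mat B d c y t s0"]) (auto simp: w_def)
    then show "cdiff k d (chart_dom d) (w d t)"
      by (rule cdiff_extend_zero[OF c d K]) (simp add: w_def f(1))
  next
    fix c' d x t assume "c' \<in> charts B" "d \<in> charts B" "x \<in> chart_dom c'" "x \<in> chart_dom d" "t < dimR"
    then show "w c' t x = (\<Sum>s<dimR. trans_mat B c' d x t s * w d s x)"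
      using trans_mat_triple[of c' x d c t s0] c s0
      by (cases "x \<in> chart_dom c") (simp_all add: w_def sum_distrib_left mult_ac)
  qed
  then obtain u where u: "u \<in> double_sections B" "\<And>c x s. c \<in> charts B \<Longrightarrow> x \<in> chart_dom c \<Longrightarrow> s < dimR \<Longrightarrow> scomp B u c s x = w c s x"
    "(\<forall>c\<in>charts B. \<forall>x\<in>chart_dom c. \<forall>s<dimR. even s \<longrightarrow> w c s x = 0) \<longrightarrow> (\<forall>x. snd (u x) = 0)"
    "(\<forall>c\<in>charts B. \<forall>x\<in>chart_dom c. \<forall>s<dimR. \<not> even s \<longrightarrow> w c s x = 0) \<longrightarrow> (\<forall>x. fst (u x) = 0)"
    by blast
  have "scomp B u c s y = (if s = s0 then f y else 0)" if "y \<in> chart_dom c" "s < dimR" for y s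
    using u(2)[OF c that] trans_mat_self[OF c that(1) that(2) s0] that(1) by (simp add: w_def)
  moreover have "\<not> even s0 \<Longrightarrow> \<forall>y. snd (u y) = 0" using u(3) by (auto simp: w_def trans_mat_def)
  moreover have "even s0 \<Longrightarrow> \<forall>y. fst (u y) = 0" using u(4) by (auto simp: w_def trans_mat_def)
  ultimately show ?thesis using u(1) by (intro bexI[of _ u]) auto
qed

text \<open>The sections of \<open>A\<close> for \<open>p = False\<close> and those of \<open>A\<^sup>*\<close> for \<open>p = True\<close>, so that the odd generators in
  the function of such a section have numbers of parity \<open>p\<close>.\<close>

definition half_sections :: "bool \<Rightarrow> ('m \<Rightarrow> 'v \<times> ('v \<Rightarrow> real)) set" where
  "half_sections p = {u \<in> double_sections B. if p then \<forall>x. fst (u x) = 0 else \<forall>x. snd (u x) = 0}"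

context
  fixes c x assumes c: "c \<in> charts B" and x: "x \<in> chart_dom c"
begin

lemma section_with_value:
  assumes s0: "s0 < dimR"
  shows "\<exists>u\<in>half_sections (even s0). \<exists>\<kappa>. \<kappa> \<noteq> 0 \<and> (\<forall>s<dimR. scomp B u c s x = (if s = s0 then \<kappa> else 0))"
proof -
  obtain \<phi> K where K: "closed K" "K \<subseteq> chart_dom c" "\<And>y. y \<notin> K \<Longrightarrow> \<phi> y = 0"
    "\<And>k. cdiff k c (chart_dom c) \<phi>" "\<phi> x > 0" using bump_function[OF c x] by blast
  obtain u where "u \<in> double_sections B"
    "\<forall>y\<in>chart_dom c. \<forall>s<dimR. scomp B u c s y = (if s = s0 then \<phi> y else 0)"
    "\<not> even s0 \<longrightarrow> (\<forall>y. snd (u y) = 0)" "even s0 \<longrightarrow> (\<forall>y. fst (u y) = 0)"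
    using section_of_bump[OF c K(1-4) s0] by blast
  then show ?thesis using K(5) x
    by (intro bexI[of _ u] exI[of _ "\<phi> x"]) (auto simp: half_sections_def)
qed

lemma section_with_derivative:
  assumes s0: "s0 < dimR" and j: "j < dimB"
  shows "\<exists>u\<in>half_sections (even s0). \<exists>\<kappa>. \<kappa> \<noteq> 0 \<and> (\<forall>s<dimR. scomp B u c s x = 0) \<and>
    (\<forall>s<dimR. \<forall>i<dimB. chart_partial c i (scomp B u c s) x = (if s = s0 \<and> i = j then \<kappa> else 0))"
proof -
  obtain \<phi> K where K: "closed K" "K \<subseteq> chart_dom c" "\<And>y. y \<notin> K \<Longrightarrow> \<phi> y = 0"
    "\<And>k. cdiff k c (chart_dom c) \<phi>" "\<phi> x > 0" using bump_function[OF c x] by blast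
  \<comment> \<open>The second factor vanishes at \<open>x\<close> and has derivative
    \<open>1\<close> in the direction \<open>j\<close> only. At \<open>x\<close> the product
    therefore has value \<open>0\<close> and derivative \<phi> in that direction; the derivatives of
    \<phi> do not contribute.\<close>
  define f where "f y = \<phi> y * (- chart_coord c x j + chart_coord c y j)" for y
  have f: "cdiff k c (chart_dom c) f" for k unfolding f_def
    by (intro cdiff_mult[OF c c_open[OF c]] cdiff_add cdiff_const K(4) cdiff_coord[OF c c c_open[OF c] order_refl j])
  have df: "has_partial c i f (if i = j then \<phi> x else 0) x" if i: "i < dimB" for i
  proof -
    have p: "has_partial c i \<phi> (chart_partial c i \<phi> x) x"
      by (rule cdiff_chart_partial(2)[OF c c_open[OF c] K(4)[of "Suc 0"] i x])
    have "has_partial c i f (chart_partial c i \<phi> x * (- chart_coord c x j + chart_coord c x j) +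
        \<phi> x * (0 + (if i = j then 1 else 0))) x"
      unfolding f_def by (intro has_partial_mult[OF c x p] has_partial_add has_partial_const has_partial_coord c x i)
    then show ?thesis by (cases "i = j") simp_all
  qed
  obtain u where u: "u \<in> double_sections B"
    "\<And>y s. y \<in> chart_dom c \<Longrightarrow> s < dimR \<Longrightarrow> scomp B u c s y = (if s = s0 then f y else 0)"
    "\<not> even s0 \<longrightarrow> (\<forall>y. snd (u y) = 0)" "even s0 \<longrightarrow> (\<forall>y. fst (u y) = 0)"
    using section_of_bump[OF c K(1,2) _ f s0] K(3) unfolding f_def by (metis (no_types, lifting) mult_zero_left)
  have "chart_partial c i (scomp B u c s) x = (if s = s0 \<and> i = j then \<phi> x else 0)" if "s < dimR" "i < dimB" for s i
  proof -
    have "has_partial c i (\<lambda>y. if s = s0 then f y else 0) (if s = s0 \<and> i = j then \<phi> x else 0) x"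
      using df[OF that(2)] has_partial_const[of c i 0 x] by (cases "s = s0") auto
    moreover have "has_partial c i (scomp B u c s) D' x \<longleftrightarrow> has_partial c i (\<lambda>y. if s = s0 then f y else 0) D' x" for D'
      by (rule has_partial_cong[OF c c_open[OF c] x that(2)]) (rule u(2)[OF _ that(1)])
    ultimately have "has_partial c i (scomp B u c s) (if s = s0 \<and> i = j then \<phi> x else 0) x" by (simp only:)
    then show ?thesis by (rule has_partial_imp)
  qed
  moreover have "scomp B u c s x = 0" if "s < dimR" for s using u(2)[OF x that] by (simp add: f_def)
  ultimately show ?thesis using K(5) u(1,3,4)
    by (intro bexI[of _ u] exI[of _ "\<phi> x"]) (auto simp: half_sections_def)
qed

lemma ad_sec_expand:
  "ad_sec u c x z = (\<Sum>i<dimB. D c i (sec u c) x * dp i z) + (\<Sum>s<dimR. scomp B u c (dual_no s) x *\<^sub>R dl s z)"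
  unfolding ad_def by (intro arg_cong2[where f = "(+)"] sum.cong) (simp_all add: dl_sec)

lemma ad_sec_value:
  assumes "s0 < dimR" "\<And>s. s < dimR \<Longrightarrow> scomp B u c s x = (if s = s0 then \<kappa> else 0)"
  shows "ad_sec u c x z = (\<Sum>i<dimB. D c i (sec u c) x * dp i z) + \<kappa> *\<^sub>R dl (dual_no s0) z"
proof -
  have "(\<Sum>s<dimR. scomp B u c (dual_no s) x *\<^sub>R dl s z) = (\<Sum>s<dimR. scomp B u c (dual_no (dual_no s)) x *\<^sub>R dl (dual_no s) z)"
    using sum_dual_no[OF even_dimR, of "\<lambda>s. scomp B u c (dual_no s) x *\<^sub>R dl s z"] by simp
  also have "\<dots> = (\<Sum>s<dimR. if s = s0 then \<kappa> *\<^sub>R dl (dual_no s) z else 0)"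
    by (rule sum.cong) (auto simp: assms(2))
  also have "\<dots> = \<kappa> *\<^sub>R dl (dual_no s0) z" using assms(1) by simp
  finally show ?thesis by (simp add: ad_sec_expand)
qed

lemma ad_sec_derivative:
  assumes u: "u \<in> double_sections B" and "s0 < dimR" "j < dimB" "\<And>s. s < dimR \<Longrightarrow> scomp B u c s x = 0"
    and d: "\<And>s i. s < dimR \<Longrightarrow> i < dimB \<Longrightarrow> chart_partial c i (scomp B u c s) x = (if s = s0 \<and> i = j then \<kappa> else 0)"
  shows "ad_sec u c x z = \<kappa> *\<^sub>R (og s0 * dp j z)"
proof -
  have "D c i (sec u c) x = (if i = j then \<kappa> *\<^sub>R og s0 else 0)" if i: "i < dimB" for i
  proof -
    have "D c i (sec u c) x = (\<Sum>s<dimR. if s = s0 then (if i = j then \<kappa> *\<^sub>R og s0 else 0) else 0)"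
      unfolding D_sec[OF u c x i] by (rule sum.cong) (auto simp: d i)
    then show ?thesis using assms(2) by simp
  qed
  then have "(\<Sum>i<dimB. D c i (sec u c) x * dp i z) = (\<Sum>i<dimB. if i = j then \<kappa> *\<^sub>R (og s0 * dp j z) else 0)"
    by (intro sum.cong) auto
  moreover have "(\<Sum>s<dimR. scomp B u c (dual_no s) x *\<^sub>R dl s z) = 0"
    using assms(4) by (intro sum.neutral) auto
  ultimately show ?thesis using assms(3) by (simp add: ad_sec_expand)
qed

lemma half_double: "u \<in> half_sections p \<Longrightarrow> u \<in> double_sections B"
  by (simp add: half_sections_def)

lemma nondegenerate_no_momenta:
  assumes h: "homogB k z" "k > 0" and p: "\<And>i. i < dimB \<Longrightarrow> dp i z = 0"
    and ad: "\<And>u. u \<in> double_sections B \<Longrightarrow> ad_sec u c x z = 0"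
  shows "z = 0"
proof (rule dl_zero_imp[OF h(1) p _ h(2)])
  fix s assume "s < dimR"
  then have s: "dual_no s < dimR" by simp
  obtain u \<kappa> where u: "u \<in> half_sections (even (dual_no s))" "\<kappa> \<noteq> 0"
    "\<And>t. t < dimR \<Longrightarrow> scomp B u c t x = (if t = dual_no s then \<kappa> else 0)"
    using section_with_value[OF s] by blast
  have "\<kappa> *\<^sub>R dl s z = 0" using ad[OF half_double[OF u(1)]] ad_sec_value[OF s u(3), of z] p by simp
  then show "dl s z = 0" using u(2) by simp
qed

lemma og_mult_scalar_zero:
  assumes "homogB 0 a" "og s * a = 0"
  shows "a = 0"
proof -
  have "dl s (og s * a) + og s * dl s a = a" by (simp add: dl_odd)
  moreover have "dl s a = 0"
    using homog0_scalar[OF assms(1)] by (metis dl_linear(5) dl_one scaleR_zero_right)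
  ultimately show ?thesis using assms(2) by simp
qed

text \<open>Momenta are detected by a section that vanishes at \<open>x\<close> but has a nonzero
  derivative there. Such a section exists only in positive rank.\<close>

lemma nondegenerate_2:
  assumes h: "homogB 2 z" and r: "rkB > 0"
    and ad: "\<And>u. u \<in> double_sections B \<Longrightarrow> ad_sec u c x z = 0"
  shows "z = 0"
proof (rule nondegenerate_no_momenta[OF h _ _ ad])
  fix j assume j: "j < dimB"
  have s0: "0 < dimR" using r by simp
  obtain u \<kappa> where u: "u \<in> half_sections (even (0::nat))" "\<kappa> \<noteq> 0"
    "\<And>s. s < dimR \<Longrightarrow> scomp B u c s x = 0"
    "\<And>s i. s < dimR \<Longrightarrow> i < dimB \<Longrightarrow> chart_partial c i (scomp B u c s) x = (if s = 0 \<and> i = j then \<kappa> else 0)"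
    using section_with_derivative[OF s0 j] by blast
  have "\<kappa> *\<^sub>R (og 0 * dp j z) = 0"
    using ad[OF half_double[OF u(1)]] ad_sec_derivative[OF half_double[OF u(1)] s0 j u(3,4)] by simp
  then have "og 0 * dp j z = 0" using u(2) by simp
  moreover have "homogB 0 (dp j z)" using homog_dp[of dimR dimB 0 z j] h by (simp add: numeral_2_eq_2)
  ultimately show "dp j z = 0" by (rule og_mult_scalar_zero[rotated])
qed simp

text \<open>By the shape condition each monomial contains two odd generators of parity
  \<open>p\<close>, or one of them and a momentum. Sections with generators of the opposite parity
  differentiate exactly these, so two brackets reach every coefficient.\<close>

lemma nondegenerate_3:
  assumes h: "homogB 3 z"
    and shape: "\<And>S m. coef z (S, m) \<noteq> 0 \<Longrightarrow>
      (\<exists>t i. even t = p \<and> S = {t} \<and> m = {#i#}) \<or> (\<exists>t t'. t \<noteq> t' \<and> even t = p \<and> even t' = p \<and> t \<in> S \<and> t' \<in> S \<and> m = {#})"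
    and ad: "\<And>u v. u \<in> half_sections (\<not> p) \<Longrightarrow> v \<in> half_sections (\<not> p) \<Longrightarrow> ad_sec v c x (ad_sec u c x z) = 0"
  shows "z = 0"
proof -
  have par: "even (dual_no t) \<longleftrightarrow> \<not> even t" for t by (auto simp: dual_no_def elim: oddE)
  have val: "\<exists>u\<in>half_sections (\<not> p). \<exists>\<kappa>. \<kappa> \<noteq> 0 \<and>
      (\<forall>z. ad_sec u c x z = (\<Sum>i<dimB. D c i (sec u c) x * dp i z) + \<kappa> *\<^sub>R dl t z)"
    if t: "t < dimR" "even t = p" for t
  proof -
    have s: "dual_no t < dimR" using t by simp
    obtain u \<kappa> where u: "u \<in> half_sections (even (dual_no t))" "\<kappa> \<noteq> 0"
      "\<And>s. s < dimR \<Longrightarrow> scomp B u c s x = (if s = dual_no t then \<kappa> else 0)"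
      using section_with_value[OF s] by blast
    then show ?thesis using ad_sec_value[OF s u(3)] t(2) par by (intro bexI[of _ u] exI[of _ \<kappa>]) auto
  qed
  have dpdp: "dp j (dp i z) = 0" for i j
  proof -
    have "homogB (1 + 2) z" using h by (simp add: numeral_3_eq_3)
    from homog_dp[OF this] show ?thesis by (rule homog_dp_zero) simp
  qed
  \<comment> \<open>The first section has a nonzero value at \<open>x\<close>; the second vanishes
    there, so that only its derivative acts and picks out one momentum. The unknown derivatives of
    the first section drop out, since in degree 3 no monomial has two momenta.\<close>
  have dpdl: "dp j (dl t z) = 0" if t: "t < dimR" "even t = p" and j: "j < dimB" for t j
  proof -
    obtain u \<kappa> where u: "u \<in> half_sections (\<not> p)" "\<kappa> \<noteq> 0"
      "\<And>z. ad_sec u c x z = (\<Sum>i<dimB. D c i (sec u c) x * dp i z) + \<kappa> *\<^sub>R dl t z" using val[OF t] by blast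
    have s: "dual_no t < dimR" using t by simp
    obtain v \<nu> where v: "v \<in> half_sections (even (dual_no t))" "\<nu> \<noteq> 0"
      "\<And>s. s < dimR \<Longrightarrow> scomp B v c s x = 0"
      "\<And>s i. s < dimR \<Longrightarrow> i < dimB \<Longrightarrow> chart_partial c i (scomp B v c s) x = (if s = dual_no t \<and> i = j then \<nu> else 0)"
      using section_with_derivative[OF s j] by blast
    have v': "v \<in> half_sections (\<not> p)" using v(1) par t by simp
    have "\<nu> *\<^sub>R (og (dual_no t) * dp j (ad_sec u c x z)) = 0"
      using ad[OF u(1) v'] ad_sec_derivative[OF half_double[OF v(1)] s j v(3,4)] by simp
    then have "og (dual_no t) * dp j (ad_sec u c x z) = 0" using v(2) by simp
    moreover have "dp j (D c i (sec u c) x * dp i z) = 0" if "i < dimB" for i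
      using linD(3)[OF linR_lin[OF D_sec_linR[OF half_double[OF u(1)] c x that]]] by (simp add: dp_mult dpdp)
    then have "dp j (ad_sec u c x z) = \<kappa> *\<^sub>R dp j (dl t z)" by (simp add: u(3) dp_sum)
    ultimately have "og (dual_no t) * dp j (dl t z) = 0" using u(2) by simp
    moreover have "homogB 0 (dp j (dl t z))"
    proof -
      have "homogB 2 (dl t z)" using h by (intro homog_dl) (simp add: numeral_3_eq_3 numeral_2_eq_2)
      then show ?thesis using homog_dp[of dimR dimB 0 "dl t z" j] by (simp add: numeral_2_eq_2)
    qed
    ultimately show ?thesis by (rule og_mult_scalar_zero[rotated])
  qed
  have nop: "coef z ({t}, {#j#}) = 0" if "even t = p" for t j
  proof (rule ccontr)
    assume nz: "coef z ({t}, {#j#}) \<noteq> 0"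
    then have "t < dimR" "j < dimB" using homogD(1,2)[OF h nz] by auto
    then have "coef (dp j (dl t z)) ({}, {#}) = 0" using dpdl that by (simp add: coef_zero)
    then show False using nz by (simp add: coef_dp coef_dl)
  qed
  have dpz: "dp i z = 0" for i
  proof (rule gpoly_eqI)
    fix S m
    have "coef z (S, add_mset i m) = 0"
      using shape[of S "add_mset i m"] nop by fastforce
    then show "coef (dp i z) (S, m) = coef 0 (S, m)" by (simp add: coef_dp coef_zero)
  qed
  \<comment> \<open>With the momenta gone, the unspecified derivatives of the sections no longer
    contribute, and only their values at \<open>x\<close> remain.\<close>
  have dldl: "dl t' (dl t z) = 0" if t: "t < dimR" "even t = p" and t': "t' < dimR" "even t' = p" for t t'
  proof -
    obtain u \<kappa> where u: "u \<in> half_sections (\<not> p)" "\<kappa> \<noteq> 0"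
      "\<And>z. ad_sec u c x z = (\<Sum>i<dimB. D c i (sec u c) x * dp i z) + \<kappa> *\<^sub>R dl t z" using val[OF t] by blast
    obtain v \<nu> where v: "v \<in> half_sections (\<not> p)" "\<nu> \<noteq> 0"
      "\<And>z. ad_sec v c x z = (\<Sum>i<dimB. D c i (sec v c) x * dp i z) + \<nu> *\<^sub>R dl t' z" using val[OF t'] by blast
    have "ad_sec v c x (ad_sec u c x z) = \<nu> *\<^sub>R \<kappa> *\<^sub>R dl t' (dl t z)"
      by (simp add: u(3) v(3) dpz dl_dp[symmetric])
    then show ?thesis using ad[OF u(1) v(1)] u(2) v(2) by simp
  qed
  show ?thesis
  proof (rule gpoly_eqI)
    fix S m
    have "coef z (S, m) = 0"
    proof (rule ccontr)
      assume nz: "coef z (S, m) \<noteq> 0"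
      then obtain t t' where t: "t \<noteq> t'" "even t = p" "even t' = p" "t \<in> S" "t' \<in> S"
        using shape[OF nz] nop by blast
      have "t < dimR" "t' < dimR" using homogD(1)[OF h nz] t by auto
      then have "coef (dl t' (dl t z)) (S - {t} - {t'}, m) = 0" using dldl t by (simp add: coef_zero)
      moreover have i: "insert t' (S - {t} - {t'}) = S - {t}" "insert t (S - {t}) = S" using t by auto
      have n: "t' \<notin> S - {t} - {t'}" "t \<notin> S - {t}" by auto
      have "coef (dl t' (dl t z)) (S - {t} - {t'}, m) \<noteq> 0"
        unfolding coef_dl[of t' "dl t z"] i if_not_P[OF n(1)]
        unfolding coef_dl[of t z] i if_not_P[OF n(2)] using nz by simp
      ultimately show False by contradiction
    qed
    then show "coef z (S, m) = coef 0 (S, m)" by (simp add: coef_zero)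
  qed
qed

end

end

section \<open>The function of an endomorphism\<close>

locale smooth_bundle_endo = smooth_bundle B
  for B :: "('m::{second_countable_topology, t2_space}, 'v::real_vector) vbundle" +
  fixes N :: "'m \<Rightarrow> 'v \<Rightarrow> 'v"
  assumes endo: "bundle_endomorphism B N"
begin

definition nco :: "('m, 'v) bundle_chart \<Rightarrow> nat \<Rightarrow> nat \<Rightarrow> 'm \<Rightarrow> real" where
  "nco c \<alpha> \<beta> x = cofr c \<alpha> x (N x (chart_frame c \<beta> x))"

definition Nv :: "('m, 'v) bundle_chart \<Rightarrow> 'm \<Rightarrow> gpoly" where
  "Nv c x = (\<Sum>\<alpha><rkB. \<Sum>\<beta><rkB. nco c \<alpha> \<beta> x *\<^sub>R (og (2 * \<beta>) * og (2 * \<alpha> + 1)))"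

definition Nsec :: "('m \<Rightarrow> 'v \<times> ('v \<Rightarrow> real)) \<Rightarrow> 'm \<Rightarrow> 'v \<times> ('v \<Rightarrow> real)" where
  "Nsec u = (\<lambda>x. double_endo B N x (u x))"

lemma cdiff_nco:
  assumes "c \<in> charts B" "\<alpha> < rkB" "\<beta> < rkB"
  shows "cdiff k c (chart_dom c) (nco c \<alpha> \<beta>)"
proof -
  have "smooth_on_chart dimB c (chart_dom c) (\<lambda>x. cofr c \<alpha> x (N x (chart_frame c \<beta> x)))"
    using endo assms unfolding bundle_endomorphism_def by blast
  then show ?thesis unfolding smooth_on_chart_iff[OF assms(1) c_open[OF assms(1)]] nco_def[abs_def] by (rule spec)
qed

lemma Nv_quadR: "Nv c x \<in> quadR dimR"
  unfolding Nv_def by (intro quadR_closed) auto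

lemma lfun_Nv: "c \<in> charts B \<Longrightarrow> lfun c (Nv c)"
  unfolding Nv_def[abs_def] by (intro lfun_sum lfun_scaleR_const cdiff_nco) auto

lemma D_Nv_quadR:
  assumes "c \<in> charts B" "x \<in> chart_dom c" "i < dimB"
  shows "D c i (Nv c) x \<in> quadR dimR"
proof -
  have "has_partial c i (nco c \<alpha> \<beta>) (chart_partial c i (nco c \<alpha> \<beta>) x) x" if "\<alpha> < rkB" "\<beta> < rkB" for \<alpha> \<beta>
    by (rule cdiff_chart_partial(2)[OF assms(1) c_open[OF assms(1)] cdiff_nco[OF assms(1) that, of "Suc 0"] assms(3,2)])
  then have "D c i (Nv c) x = (\<Sum>\<alpha><rkB. \<Sum>\<beta><rkB. chart_partial c i (nco c \<alpha> \<beta>) x *\<^sub>R (og (2 * \<beta>) * og (2 * \<alpha> + 1)))"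
    unfolding Nv_def[abs_def]
    by (intro has_D_imp[OF has_D_sum] has_D_sum has_D_const_scaleR assms) auto
  also have "\<dots> \<in> quadR dimR" by (intro quadR_closed) auto
  finally show ?thesis .
qed

lemma endo_fibre: "v \<in> fibre B x \<Longrightarrow> N x v \<in> fibre B x"
  using endo by (auto simp: bundle_endomorphism_def)

lemma endo_sum:
  assumes "\<And>i. i \<in> I \<Longrightarrow> f i \<in> fibre B x" "subspace (fibre B x)"
  shows "N x (\<Sum>i\<in>I. a i *\<^sub>R f i) = (\<Sum>i\<in>I. a i *\<^sub>R N x (f i))"
  using assms(1)
proof (induction I rule: infinite_finite_induct)
  have "N x (0 *\<^sub>R 0) = 0 *\<^sub>R N x 0"
    using endo subspace_0[OF assms(2)] unfolding bundle_endomorphism_def by blast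
  then have z: "N x 0 = 0" by simp
  { case empty show ?case using z by simp }
  { case (infinite I) then show ?case using z by simp }
  case (insert i I)
  have "a i *\<^sub>R f i \<in> fibre B x" "(\<Sum>i\<in>I. a i *\<^sub>R f i) \<in> fibre B x"
    using insert.prems assms(2) by (auto intro!: subspace_sum subspace_scale)
  then have "N x (a i *\<^sub>R f i + (\<Sum>i\<in>I. a i *\<^sub>R f i)) = N x (a i *\<^sub>R f i) + N x (\<Sum>i\<in>I. a i *\<^sub>R f i)"
    using endo unfolding bundle_endomorphism_def by blast
  moreover have "N x (a i *\<^sub>R f i) = a i *\<^sub>R N x (f i)"
    using endo insert.prems unfolding bundle_endomorphism_def by blast
  ultimately show ?case using insert by simp
qed

context
  fixes u assumes u: "u \<in> double_sections B"
begin

lemma scomp_Nsec: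
  assumes c: "c \<in> charts B" "x \<in> chart_dom c"
  shows "\<alpha> < rkB \<Longrightarrow> scomp B (Nsec u) c (2 * \<alpha> + 1) x = (\<Sum>\<beta><rkB. nco c \<alpha> \<beta> x * scomp B u c (2 * \<beta> + 1) x)"
    "\<beta> < rkB \<Longrightarrow> scomp B (Nsec u) c (2 * \<beta>) x = - (\<Sum>\<alpha><rkB. nco c \<alpha> \<beta> x * scomp B u c (2 * \<alpha>) x)"
proof -
  note sf = sec_fibre[OF u, of x]
  note fs = fibre_subspace[OF c]
  note ff = frame_in_fibre[OF c]
  assume a: "\<alpha> < rkB"
  have "N x (fst (u x)) = N x (\<Sum>\<beta><rkB. cofr c \<beta> x (fst (u x)) *\<^sub>R chart_frame c \<beta> x)"
    by (simp add: coframe_expand[OF c sf(1)])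
  also have "\<dots> = (\<Sum>\<beta><rkB. cofr c \<beta> x (fst (u x)) *\<^sub>R N x (chart_frame c \<beta> x))"
    by (rule endo_sum) (use ff fs in auto)
  also have "\<dots> = (\<Sum>\<beta><rkB. cofr c \<beta> x (fst (u x)) *\<^sub>R (\<Sum>\<gamma><rkB. nco c \<gamma> \<beta> x *\<^sub>R chart_frame c \<gamma> x))"
    unfolding nco_def by (intro sum.cong refl) (simp add: coframe_expand[OF c] endo_fibre ff)
  also have "\<dots> = (\<Sum>\<gamma><rkB. (\<Sum>\<beta><rkB. nco c \<gamma> \<beta> x * cofr c \<beta> x (fst (u x))) *\<^sub>R chart_frame c \<gamma> x)"
    unfolding scaleR_sum_right scaleR_sum_left scaleR_scaleR by (subst sum.swap) (simp add: mult.commute)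
  finally have "cofr c \<alpha> x (N x (fst (u x))) = (\<Sum>\<beta><rkB. nco c \<alpha> \<beta> x * cofr c \<beta> x (fst (u x)))"
    using coframe_sum[OF c a] by (simp only:)
  then show "scomp B (Nsec u) c (2 * \<alpha> + 1) x = (\<Sum>\<beta><rkB. nco c \<alpha> \<beta> x * scomp B u c (2 * \<beta> + 1) x)"
    by (simp add: scomp_def Nsec_def double_endo_def)
next
  note sf = sec_fibre[OF u, of x]
  note ff = frame_in_fibre[OF c]
  assume b: "\<beta> < rkB"
  have "snd (u x) (N x (chart_frame c \<beta> x)) = (\<Sum>\<alpha><rkB. snd (u x) (chart_frame c \<alpha> x) * cofr c \<alpha> x (N x (chart_frame c \<beta> x)))"
    by (subst dual_expand[OF c sf(2)]) (simp add: sum_fun_apply scaleR_fun_def)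
  then show "scomp B (Nsec u) c (2 * \<beta>) x = - (\<Sum>\<alpha><rkB. nco c \<alpha> \<beta> x * scomp B u c (2 * \<alpha>) x)"
    using ff[OF b] by (simp add: scomp_def Nsec_def double_endo_def transpose_endo_def nco_def mult.commute)
qed

lemma Nsec_double_sections: "Nsec u \<in> double_sections B"
  unfolding double_sections_iff
proof (intro conjI allI ballI impI)
  fix x
  show "fst (Nsec u x) \<in> fibre B x"
    using endo_fibre sec_fibre[OF u] by (simp add: Nsec_def double_endo_def)
  obtain c where c: "c \<in> charts B" "x \<in> chart_dom c" using charts_cover by blast
  note fs = fibre_subspace[OF c]
  show "snd (Nsec u x) \<in> dual_space (fibre B x)"
    using endo sec_fibre(2)[OF u, of x] fs unfolding bundle_endomorphism_def
    by (simp add: dual_space_def Nsec_def double_endo_def transpose_endo_def subspace_add subspace_scale)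
next
  fix c s k assume c: "c \<in> charts B" and s: "s < dimR"
  have h: "s div 2 < rkB" using s by auto
  have sp: "s = 2 * (s div 2) \<or> s = 2 * (s div 2) + 1" by presburger
  show "cdiff k c (chart_dom c) (scomp B (Nsec u) c s)"
  proof (cases "s = 2 * (s div 2)")
    case True
    have "cdiff k c (chart_dom c) (\<lambda>x. \<Sum>\<alpha><rkB. - 1 * (nco c \<alpha> (s div 2) x * scomp B u c (2 * \<alpha>) x))"
      by (intro cdiff_sum cdiff_mult[OF c c_open[OF c]] cdiff_const cdiff_nco c cdiff_scomp[OF u]) (use h in auto)
    moreover have "scomp B (Nsec u) c s x = (\<Sum>\<alpha><rkB. - 1 * (nco c \<alpha> (s div 2) x * scomp B u c (2 * \<alpha>) x))"
      if "x \<in> chart_dom c" for x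
      by (subst True) (simp add: scomp_Nsec(2)[OF c that h] sum_negf)
    ultimately show ?thesis
      by (subst cdiff_cong[OF c c_open[OF c], where g = "\<lambda>x. \<Sum>\<alpha><rkB. - 1 * (nco c \<alpha> (s div 2) x * scomp B u c (2 * \<alpha>) x)"])
  next
    case False
    then have s': "s = 2 * (s div 2) + 1" using sp by blast
    have "cdiff k c (chart_dom c) (\<lambda>x. \<Sum>\<beta><rkB. nco c (s div 2) \<beta> x * scomp B u c (2 * \<beta> + 1) x)"
      by (intro cdiff_sum cdiff_mult[OF c c_open[OF c]] cdiff_nco c cdiff_scomp[OF u]) (use h in auto)
    moreover have "scomp B (Nsec u) c s x = (\<Sum>\<beta><rkB. nco c (s div 2) \<beta> x * scomp B u c (2 * \<beta> + 1) x)"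
      if "x \<in> chart_dom c" for x
      by (subst s') (rule scomp_Nsec(1)[OF c that h])
    ultimately show ?thesis
      by (subst cdiff_cong[OF c c_open[OF c], where g = "\<lambda>x. \<Sum>\<beta><rkB. nco c (s div 2) \<beta> x * scomp B u c (2 * \<beta> + 1) x"])
  qed
qed

end

lemma sec_split: "sec u c x = (\<Sum>\<alpha><rkB. scomp B u c (2 * \<alpha>) x *\<^sub>R og (2 * \<alpha>)) +
    (\<Sum>\<alpha><rkB. scomp B u c (2 * \<alpha> + 1) x *\<^sub>R og (2 * \<alpha> + 1))"
  unfolding sec_def sum_even_odd sum.distrib ..

lemma dl_Nv:
  "\<beta> < rkB \<Longrightarrow> dl (2 * \<beta>) (Nv c x) = (\<Sum>\<alpha><rkB. nco c \<alpha> \<beta> x *\<^sub>R og (2 * \<alpha> + 1))"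
  "\<alpha> < rkB \<Longrightarrow> dl (2 * \<alpha> + 1) (Nv c x) = - (\<Sum>\<beta><rkB. nco c \<alpha> \<beta> x *\<^sub>R og (2 * \<beta>))"
proof -
  assume b: "\<beta> < rkB"
  have e: "dl (2 * \<beta>) (og (2 * \<beta>') * og (2 * \<alpha> + 1)) = (if \<beta>' = \<beta> then og (2 * \<alpha> + 1) else 0)" for \<alpha> \<beta>'
  proof -
    have "2 * \<beta> \<noteq> 2 * \<alpha> + 1" by presburger
    then show ?thesis by (auto simp: dl_odd)
  qed
  have "dl (2 * \<beta>) (Nv c x) = (\<Sum>\<alpha><rkB. \<Sum>\<beta>'<rkB. if \<beta>' = \<beta> then nco c \<alpha> \<beta> x *\<^sub>R og (2 * \<alpha> + 1) else 0)"
    unfolding Nv_def dl_sum dl_linear(5) e by (intro sum.cong refl) auto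
  then show "dl (2 * \<beta>) (Nv c x) = (\<Sum>\<alpha><rkB. nco c \<alpha> \<beta> x *\<^sub>R og (2 * \<alpha> + 1))" using b by simp
next
  assume a: "\<alpha> < rkB"
  have e: "dl (2 * \<alpha> + 1) (og (2 * \<beta>) * og (2 * \<alpha>' + 1)) = (if \<alpha>' = \<alpha> then - og (2 * \<beta>) else 0)" for \<alpha>' \<beta>
  proof -
    have "2 * \<alpha> + 1 \<noteq> 2 * \<beta>" by presburger
    then show ?thesis by (auto simp: dl_odd)
  qed
  have "dl (2 * \<alpha> + 1) (Nv c x) = (\<Sum>\<alpha>'<rkB. if \<alpha>' = \<alpha> then - (\<Sum>\<beta><rkB. nco c \<alpha> \<beta> x *\<^sub>R og (2 * \<beta>)) else 0)"
    unfolding Nv_def dl_sum dl_linear(5) e by (intro sum.cong refl) (auto simp: sum_negf)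
  then show "dl (2 * \<alpha> + 1) (Nv c x) = - (\<Sum>\<beta><rkB. nco c \<alpha> \<beta> x *\<^sub>R og (2 * \<beta>))" using a by simp
qed

abbreviation adN :: "('m, 'v) bundle_chart \<Rightarrow> 'm \<Rightarrow> gpoly \<Rightarrow> gpoly" where
  "adN c x \<equiv> ad dimB dimR (Nv c x) (\<lambda>i. D c i (Nv c) x)"

text \<open>The relation that characterizes the function of the endomorphism, read in a chart:
  components along \<open>A\<close> are multiplied by the matrix of \<open>N\<close>, the others by
  minus its transpose.\<close>

lemma ad_sec_Nv:
  assumes u: "u \<in> double_sections B" and c: "c \<in> charts B" "x \<in> chart_dom c"
  shows "ad_sec u c x (Nv c x) = sec (Nsec u) c x"
proof -
  have "dp i (Nv c x) = 0" for i using quadD(3)[OF quadR_quad[OF Nv_quadR]] .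
  then have "ad_sec u c x (Nv c x) = (\<Sum>s<dimR. scomp B u c (dual_no s) x *\<^sub>R dl s (Nv c x))"
    by (simp add: ad_sec_expand[OF c])
  also have "\<dots> = (\<Sum>\<beta><rkB. scomp B u c (2 * \<beta> + 1) x *\<^sub>R dl (2 * \<beta>) (Nv c x)) +
      (\<Sum>\<alpha><rkB. scomp B u c (2 * \<alpha>) x *\<^sub>R dl (2 * \<alpha> + 1) (Nv c x))"
    unfolding sum_even_odd sum.distrib by (simp add: dual_no_def)
  also have "\<dots> = (\<Sum>\<beta><rkB. \<Sum>\<alpha><rkB. (nco c \<alpha> \<beta> x * scomp B u c (2 * \<beta> + 1) x) *\<^sub>R og (2 * \<alpha> + 1)) +
      (\<Sum>\<alpha><rkB. \<Sum>\<beta><rkB. (- (nco c \<alpha> \<beta> x * scomp B u c (2 * \<alpha>) x)) *\<^sub>R og (2 * \<beta>))"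
    by (intro arg_cong2[where f = "(+)"] sum.cong refl)
      (simp_all only: lessThan_iff dl_Nv scaleR_sum_right scaleR_scaleR scaleR_minus_right scaleR_minus_left
        sum_negf mult.commute[of "scomp B u c _ x"])
  also have "\<dots> = (\<Sum>\<alpha><rkB. \<Sum>\<beta><rkB. (nco c \<alpha> \<beta> x * scomp B u c (2 * \<beta> + 1) x) *\<^sub>R og (2 * \<alpha> + 1)) +
      (\<Sum>\<beta><rkB. \<Sum>\<alpha><rkB. (- (nco c \<alpha> \<beta> x * scomp B u c (2 * \<alpha>) x)) *\<^sub>R og (2 * \<beta>))"
    by (intro arg_cong2[where f = "(+)"]; rule sum.swap)
  also have "\<dots> = sec (Nsec u) c x"
    unfolding sec_split add.commute[of "\<Sum>\<alpha><rkB. scomp B (Nsec u) c (2 * \<alpha>) x *\<^sub>R og (2 * \<alpha>)"]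
    by (intro arg_cong2[where f = "(+)"] sum.cong refl)
      (simp_all only: scomp_Nsec[OF u c] lessThan_iff scaleR_sum_left sum_negf scaleR_minus_left)
  finally show ?thesis .
qed

text \<open>The antisymmetry \<open>{N, u} = - {u, N}\<close> for arguments of degrees 2 and 1. On
  sections \<open>adN\<close> is thus minus the endomorphism, a sign that recurs in the torsion
  computations.\<close>

lemma adN_sec:
  assumes u: "u \<in> double_sections B" and c: "c \<in> charts B" "x \<in> chart_dom c"
  shows "adN c x (sec u c x) = - sec (Nsec u) c x"
proof -
  have "ginv (dl t (Nv c x)) = - dl t (Nv c x)" for t
    using linD(2)[OF quadD(4)[OF quadR_quad[OF Nv_quadR]]] .
  moreover have "dp i (sec u c x) = 0" for i using linD(3)[OF linR_lin[OF sec_linR]] .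
  moreover have "(\<Sum>s<dimR. ginv (dl (dual_no s) (Nv c x)) * dl s (sec u c x)) =
      (\<Sum>s<dimR. - (scomp B u c s x *\<^sub>R dl (dual_no s) (Nv c x)))"
    by (rule sum.cong) (auto simp: dl_sec calculation(1))
  ultimately have "adN c x (sec u c x) = - (\<Sum>s<dimR. scomp B u c s x *\<^sub>R dl (dual_no s) (Nv c x))"
    unfolding ad_def by (simp add: sum_negf)
  also have "(\<Sum>s<dimR. scomp B u c s x *\<^sub>R dl (dual_no s) (Nv c x)) = (\<Sum>s<dimR. scomp B u c (dual_no s) x *\<^sub>R dl s (Nv c x))"
    using sum_dual_no[OF even_dimR, of "\<lambda>s. scomp B u c s x *\<^sub>R dl (dual_no s) (Nv c x)"] by simp
  also have "\<dots> = ad_sec u c x (Nv c x)"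
  proof -
    have "dp i (Nv c x) = 0" for i using quadD(3)[OF quadR_quad[OF Nv_quadR]] .
    then show ?thesis by (simp add: ad_sec_expand[OF c])
  qed
  finally show ?thesis using ad_sec_Nv[OF assms] by simp
qed

text \<open>The Jacobi identity \<open>{u, {N, z}} = {N, {u, z}} + {{u, N}, z}\<close>, where
  \<open>{u, N}\<close> is the image of the section under the endomorphism.\<close>

lemma ad_sec_adN:
  assumes u: "u \<in> double_sections B" and c: "c \<in> charts B" "x \<in> chart_dom c"
  shows "ad_sec u c x (adN c x z) = adN c x (ad_sec u c x z) + ad_sec (Nsec u) c x z"
proof -
  note nu = Nsec_double_sections[OF u]
  have p: "dp i (sec u c y) = 0" for u i y using linD(3)[OF linR_lin[OF sec_linR]] .
  have pn: "dp i (Nv c y) = 0" for i y using quadD(3)[OF quadR_quad[OF Nv_quadR]] .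
  have b: "bb c (Nv c) (sec u c) y = - sec (Nsec u) c y" if "y \<in> chart_dom c" for y
    using bb_ad[OF c(1) that, of "Nv c" "sec u c"] pn adN_sec[OF u c(1) that] by simp
  have Db: "adN c x (D c i (sec u c) x) + ad dimB dimR (D c i (Nv c) x) (\<lambda>j. D c i (D c j (Nv c)) x) (sec u c x) =
      - D c i (sec (Nsec u) c) x" if i: "i < dimB" for i
  proof -
    have "D c i (bb c (Nv c) (sec u c)) x = D c i (\<lambda>y. - sec (Nsec u) c y) x"
      by (rule D_cong[OF c i b])
    also have "\<dots> = - D c i (sec (Nsec u) c) x"
      by (rule D_linear[OF c(1) lfun_sec[OF nu c(1)] _ c(2) i]) (auto intro!: linearI)
    finally show ?thesis
      using D_bb_quad[OF c(1) lfun_Nv[OF c(1)] pn lfun_sec[OF u c(1)] c(2) i] by simp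
  qed
  \<comment> \<open>Neither the bracket with \<open>u\<close> nor that with \<open>N\<close>
    involves derivatives of \<open>z\<close> along the base, so \<open>0\<close> may stand for them
    in \<open>ad_brk\<close>.\<close>
  have "adN c x (ad_sec u c x z) = adN c x (brk dimB dimR (sec u c x) (\<lambda>i. D c i (sec u c) x) z (\<lambda>i. 0))"
    by (simp add: brk_eq_ad[OF even_dimR p])
  also have "\<dots> = brk dimB dimR (adN c x (sec u c x)) (\<lambda>i. adN c x (D c i (sec u c) x) +
        ad dimB dimR (D c i (Nv c) x) (\<lambda>j. D c i (D c j (Nv c)) x) (sec u c x)) z (\<lambda>i. 0) +
      brk dimB dimR (sec u c x) (\<lambda>i. D c i (sec u c) x) (adN c x z)
        (\<lambda>i. adN c x 0 + ad dimB dimR (D c i (Nv c) x) (\<lambda>j. D c i (D c j (Nv c)) x) z)"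
  proof (rule ad_brk[OF even_dimR])
    show "Nv c x \<in> quad" by (rule quadR_quad[OF Nv_quadR])
    show "D c i (Nv c) x \<in> quad" if "i < dimB" for i by (rule quadR_quad[OF D_Nv_quadR[OF c that]])
    show "D c i (D c j (Nv c)) x \<in> quad" if "i < dimB" "j < dimB" for i j
      by (rule D_quad[OF c(1) lfun_D[OF c(1) lfun_Nv[OF c(1)] that(2)] _ c(2) that(1)])
        (rule quadR_quad[OF D_Nv_quadR[OF c(1) _ that(2)]])
    show "D c i (D c j (Nv c)) x = D c j (D c i (Nv c)) x" if "i < dimB" "j < dimB" for i j
      by (rule D_commute[OF c(1) lfun_Nv[OF c(1)] c(2) that])
  qed
  also have "brk dimB dimR (sec u c x) (\<lambda>i. D c i (sec u c) x) (adN c x z)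
        (\<lambda>i. adN c x 0 + ad dimB dimR (D c i (Nv c) x) (\<lambda>j. D c i (D c j (Nv c)) x) z) = ad_sec u c x (adN c x z)"
    by (rule brk_eq_ad[OF even_dimR p])
  also have "brk dimB dimR (adN c x (sec u c x)) (\<lambda>i. adN c x (D c i (sec u c) x) +
        ad dimB dimR (D c i (Nv c) x) (\<lambda>j. D c i (D c j (Nv c)) x) (sec u c x)) z (\<lambda>i. 0) = - ad_sec (Nsec u) c x z"
  proof -
    have "(\<Sum>i<dimB. (adN c x (D c i (sec u c) x) +
        ad dimB dimR (D c i (Nv c) x) (\<lambda>j. D c i (D c j (Nv c)) x) (sec u c x)) * dp i z -
        dp i (- sec (Nsec u) c x) * 0) = (\<Sum>i<dimB. - (D c i (sec (Nsec u) c) x * dp i z))"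
      by (rule sum.cong) (simp_all only: lessThan_iff Db mult_zero_right diff_zero mult_minus_left)
    moreover have "(\<Sum>s<dimR. ginv (dl s (- sec (Nsec u) c x)) * dl (dual_no s) z) =
        (\<Sum>s<dimR. - (scomp B (Nsec u) c (dual_no (dual_no s)) x *\<^sub>R dl (dual_no s) z))"
      by (rule sum.cong) (auto simp: dl_sec)
    ultimately show ?thesis
      unfolding adN_sec[OF u c] brk_def ad_sec_expand[OF c]
      using sum_dual_no[OF even_dimR, of "\<lambda>s. scomp B (Nsec u) c (dual_no s) x *\<^sub>R dl s z"]
      by (simp add: sum_negf)
  qed
  finally show ?thesis by simp
qed

section \<open>Invariance of the bracket with the function of \<open>N\<close> under coordinate
  changes\<close>

context
  fixes c d x assumes c: "c \<in> charts B" and d: "d \<in> charts B" and x: "x \<in> chart_dom c" "x \<in> chart_dom d"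
begin

text \<open>The matrix of \<open>N\<close> need not be transformed: the two sides have the same
  bracket with each section \<open>u\<close>, namely the function of its image under the
  endomorphism, and they contain no momenta.\<close>

lemma Nv_tsub: "Nv c x = tsub c d x (Nv d x)"
proof -
  let ?W = "Nv c x - tsub c d x (Nv d x)"
  have W: "?W \<in> quadR dimR" by (intro quadR_closed Nv_quadR tsub_quadR)
  have "?W = 0"
  proof (rule nondegenerate_no_momenta[OF c x(1) homog_quadR[OF W]])
    show "dp i ?W = 0" for i by (rule quadD(3)[OF quadR_quad[OF W]])
    fix u assume u: "u \<in> double_sections B"
    show "ad_sec u c x ?W = 0"
      using ad_sec_Nv[OF u c x(1)] ad_sec_Nv[OF u d x(2)] sec_tsub[OF Nsec_double_sections[OF u] c d x]
      by (simp add: ad_linear ad_sec_tsub[OF u c d x])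
  qed simp
  then show ?thesis by simp
qed

lemma adN_tsub_sec:
  assumes u: "u \<in> double_sections B"
  shows "adN c x (tsub c d x (sec u d x)) = tsub c d x (adN d x (sec u d x))"
  by (simp add: sec_tsub[OF u c d x, symmetric] adN_sec[OF u c x(1)] adN_sec[OF u d x(2)] tsub_uminus
      sec_tsub[OF Nsec_double_sections[OF u] c d x])

text \<open>Every odd generator is, up to a nonzero factor, the value at \<open>x\<close> of a
  section, and for sections the claim is the invariance of \<open>Nsec\<close>.\<close>

lemma adN_tsub_linR: "z \<in> linR dimR \<Longrightarrow> adN c x (tsub c d x z) = tsub c d x (adN d x z)"
proof (induction z rule: linR_induct)
  case (add a s y)
  obtain u \<kappa> where u: "u \<in> half_sections (even s)" "\<kappa> \<noteq> 0"
    "\<And>t. t < dimR \<Longrightarrow> scomp B u d t x = (if t = s then \<kappa> else 0)"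
    using section_with_value[OF d x(2) add(1)] by blast
  have "sec u d x = (\<Sum>t<dimR. if t = s then \<kappa> *\<^sub>R og s else 0)"
    unfolding sec_def by (rule sum.cong) (auto simp: u(3))
  then have e: "sec u d x = \<kappa> *\<^sub>R og s" using add(1) by simp
  have "adN c x (tsub c d x (og s)) = tsub c d x (adN d x (og s))"
    using adN_tsub_sec[OF half_double[OF d x(2) u(1)]] u(2) unfolding e ad_linear tsub_simps(4) by simp
  then show ?case using add(2) by (simp only: ad_linear tsub_simps)
qed (simp add: ad_linear tsub_simps)

text \<open>A direct computation would have to differentiate the transformation rule of
  \<open>Nv\<close>. Since both sides are quadratic in the odd generators, it is enough to take
  brackets with sections; the Jacobi identity then reduces the claim to linear polynomials.\<close>

lemma adN_tsub_mg:
  assumes i: "i < dimB"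
  shows "adN c x (chp c d x i) = tsub c d x (D d i (Nv d) x)"
proof -
  let ?W = "adN c x (chp c d x i) - tsub c d x (D d i (Nv d) x)"
  have q: "Nv c x \<in> quadR dimR" "\<And>i. i < dimB \<Longrightarrow> D c i (Nv c) x \<in> quadR dimR"
    using Nv_quadR D_Nv_quadR[OF c x(1)] by auto
  have "adN c x (mg j + chq c d x j) \<in> quadR dimR" if "j < dimB" for j
    unfolding ad_linear ad_gen[OF even_dimR]
    using that q by (auto intro!: quadR_closed ad_quadR chq_quadR even_dimR)
  then have "adN c x (chp c d x i) \<in> quadR dimR"
    unfolding chp_chq ad_sum ad_linear(5) by (intro quadR_closed) auto
  then have W: "?W \<in> quadR dimR" by (intro quadR_closed tsub_quadR D_Nv_quadR d x i)
  have mgi: "adN d x (mg i) = D d i (Nv d) x" using i by (simp add: ad_gen)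
  have tmg: "tsub c d x (mg i) = chp c d x i" using i by (simp add: tsub_simps)
  have "?W = 0"
  proof (rule nondegenerate_no_momenta[OF c x(1) homog_quadR[OF W]])
    show "dp i ?W = 0" for i by (rule quadD(3)[OF quadR_quad[OF W]])
    fix u assume u: "u \<in> double_sections B"
    note nu = Nsec_double_sections[OF u]
    have smg: "ad_sec u d x (mg i) \<in> linR dimR" using i D_sec_linR[OF u d x(2) i] by (simp add: ad_gen)
    have "ad_sec u c x (adN c x (chp c d x i)) = adN c x (ad_sec u c x (tsub c d x (mg i))) + ad_sec (Nsec u) c x (tsub c d x (mg i))"
      unfolding ad_sec_adN[OF u c x(1)] tmg ..
    also have "\<dots> = tsub c d x (adN d x (ad_sec u d x (mg i)) + ad_sec (Nsec u) d x (mg i))"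
      unfolding ad_sec_tsub[OF u c d x] ad_sec_tsub[OF nu c d x] adN_tsub_linR[OF smg] tsub_simps(3) ..
    also have "\<dots> = tsub c d x (ad_sec u d x (D d i (Nv d) x))"
      unfolding ad_sec_adN[OF u d x(2), symmetric] mgi ..
    also have "\<dots> = ad_sec u c x (tsub c d x (D d i (Nv d) x))"
      by (rule ad_sec_tsub[OF u c d x, symmetric])
    finally show "ad_sec u c x ?W = 0" by (simp add: ad_linear)
  qed simp
  then show ?thesis by simp
qed

lemma adN_tsub: "adN c x (tsub c d x z) = tsub c d x (adN d x z)"
  unfolding tsub_def
proof (rule gsub_even_derivation[where D = "adN c x" and E = "adN d x"])
  have q: "Nv c x \<in> quad" "\<And>i. i < dimB \<Longrightarrow> D c i (Nv c) x \<in> quad"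
    "Nv d x \<in> quad" "\<And>i. i < dimB \<Longrightarrow> D d i (Nv d) x \<in> quad"
    by (auto intro: quadR_quad Nv_quadR D_Nv_quadR[OF c x(1)] D_Nv_quadR[OF d x(2)])
  show "adN c x (a * b) = adN c x a * b + a * adN c x b"
    "adN d x (a * b) = adN d x a * b + a * adN d x b" for a b
    by (rule ad_quad_mult; use q in auto)+
  show "adN c x (restrict_gens dimR (cho c d x) s) =
      gsub (restrict_gens dimR (cho c d x)) (restrict_gens dimB (chp c d x)) (adN d x (og s))" for s
  proof (cases "s < dimR")
    case True
    then show ?thesis using adN_tsub_linR[OF linR_closed(6)[OF True]]
      by (simp add: restrict_gens_def tsub_simps) (simp add: tsub_def restrict_gens_def[abs_def])
  next
    case False
    then show ?thesis by (simp add: restrict_gens_def[of _ _ s] ad_linear ad_gen)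
  qed
  show "adN c x (restrict_gens dimB (chp c d x) i) =
      gsub (restrict_gens dimR (cho c d x)) (restrict_gens dimB (chp c d x)) (adN d x (mg i))" for i
    using adN_tsub_mg[of i, unfolded tsub_def] by (simp add: restrict_gens_def[of _ _ i] ad_linear ad_gen)
qed (simp_all only: ad_linear chp_central[symmetric], rule restrict_cho_ac)

end

end

section \<open>Weights\<close>

text \<open>The weight counts the generators \<open>p\<^sub>i\<close> and the odd generators whose number has parity \<open>p\<close>:
  Lie algebroid structures on \<open>A\<close> (and on \<open>A\<^sup>*\<close>) are the functions of degree 3 and weight 2 for \<open>p = True\<close>
  (and for \<open>p = False\<close>).\<close>

definition weight :: "bool \<Rightarrow> nat \<Rightarrow> gpoly \<Rightarrow> bool" where
  "weight p k a \<longleftrightarrow> (\<forall>S m. coef a (S, m) \<noteq> 0 \<longrightarrow> card {s\<in>S. even s = p} + size m = k)"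

lemma weight_zero [simp]: "weight p k 0"
  by (simp add: weight_def coef_zero)

lemma weight_add: "weight p k a \<Longrightarrow> weight p k b \<Longrightarrow> weight p k (a + b)"
  unfolding weight_def coef_plus by (metis add.right_neutral)

lemma weight_scaleR: "weight p k a \<Longrightarrow> weight p k (x *\<^sub>R a)"
  unfolding weight_def coef_scaleR by (metis mult_zero_right)

lemma weight_sum: "(\<And>i. i \<in> I \<Longrightarrow> weight p k (f i)) \<Longrightarrow> weight p k (sum f I)"
  by (induction I rule: infinite_finite_induct) (auto intro: weight_add)

lemma weight_ginv: "weight p k a \<Longrightarrow> weight p k (ginv a)"
  by (auto simp: weight_def coef_ginv)

lemma weight_mult:
  assumes "weight p j a" "weight p k b"
  shows "weight p (j + k) (a * b)"
  unfolding weight_def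
proof (intro allI impI)
  fix S m assume nz: "coef (a * b) (S, m) \<noteq> 0"
  then have f: "finite S" using coef_finite by blast
  have "(\<Sum>T\<in>Pow S. \<Sum>l\<in>{l. l \<subseteq># m}. shuffle_sign T (S - T) * coef a (T, l) * coef b (S - T, m - l)) \<noteq> 0"
    using nz by (simp add: times_gpoly.rep_eq smult_def)
  then obtain T where T: "T \<in> Pow S" and
    "(\<Sum>l\<in>{l. l \<subseteq># m}. shuffle_sign T (S - T) * coef a (T, l) * coef b (S - T, m - l)) \<noteq> 0"
    by (rule sum.not_neutral_contains_not_neutral)
  then obtain l where "l \<in> {l. l \<subseteq># m}" "shuffle_sign T (S - T) * coef a (T, l) * coef b (S - T, m - l) \<noteq> 0"
    by (elim sum.not_neutral_contains_not_neutral)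
  then have l: "l \<subseteq># m" and ab: "coef a (T, l) \<noteq> 0" "coef b (S - T, m - l) \<noteq> 0" by auto
  have "{s\<in>S. even s = p} = {s\<in>T. even s = p} \<union> {s\<in>S - T. even s = p}" using T by auto
  then have "card {s\<in>S. even s = p} = card ({s\<in>T. even s = p} \<union> {s\<in>S - T. even s = p})"
    by (rule arg_cong)
  also have "\<dots> = card {s\<in>T. even s = p} + card {s\<in>S - T. even s = p}"
    by (rule card_Un_disjoint) (use f finite_subset[OF _ f, of T] T in auto)
  finally have "card {s\<in>S. even s = p} = card {s\<in>T. even s = p} + card {s\<in>S - T. even s = p}" .
  moreover have "m = l + (m - l)" using l by simp
  then have "size m = size l + size (m - l)" by (metis size_union)
  moreover have "card {s\<in>T. even s = p} + size l = j" "card {s\<in>S - T. even s = p} + size (m - l) = k"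
    using assms ab unfolding weight_def by blast+
  ultimately show "card {s\<in>S. even s = p} + size m = j + k" by linarith
qed

lemma weight_dp: "weight p (Suc k) a \<Longrightarrow> weight p k (dp i a)"
  unfolding weight_def by (fastforce simp: coef_dp)

lemma weight_dp_zero: "weight p 0 a \<Longrightarrow> dp i a = 0"
proof (rule gpoly_eqI)
  fix S m assume w: "weight p 0 a"
  have "coef a (S, add_mset i m) = 0"
  proof (rule ccontr)
    assume "coef a (S, add_mset i m) \<noteq> 0"
    then have "card {s\<in>S. even s = p} + size (add_mset i m) = 0" using w unfolding weight_def by blast
    then show False by simp
  qed
  then show "coef (dp i a) (S, m) = coef 0 (S, m)" by (simp add: coef_dp coef_zero)
qed

lemma weight_dl:
  assumes w: "weight p (if even t = p then Suc k else k) a"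
  shows "weight p k (dl t a)"
  unfolding weight_def
proof (intro allI impI)
  fix S m assume "coef (dl t a) (S, m) \<noteq> 0"
  then have t: "t \<notin> S" "coef a (insert t S, m) \<noteq> 0" by (auto simp: coef_dl split: if_splits)
  have f: "finite S" using coef_finite[OF t(2)] by simp
  have c: "card {s\<in>insert t S. even s = p} + size m = (if even t = p then Suc k else k)"
    using w t(2) unfolding weight_def by blast
  have "{s\<in>insert t S. even s = p} = (if even t = p then insert t {s\<in>S. even s = p} else {s\<in>S. even s = p})"
    by auto
  then have "card {s\<in>insert t S. even s = p} = (if even t = p then Suc (card {s\<in>S. even s = p}) else card {s\<in>S. even s = p})"
    using f t(1) by simp
  then show "card {s\<in>S. even s = p} + size m = k" using c by (auto split: if_splits)
qed

lemma weight_dl_zero: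
  assumes w: "weight p 0 a" and t: "even t = p"
  shows "dl t a = 0"
proof (rule gpoly_eqI)
  fix S m
  have "coef a (insert t S, m) = 0"
  proof (rule ccontr)
    assume nz: "coef a (insert t S, m) \<noteq> 0"
    then have c: "card {s\<in>insert t S. even s = p} + size m = 0" using w unfolding weight_def by blast
    have f: "finite {s\<in>insert t S. even s = p}" using coef_finite[OF nz] by simp
    have "{s\<in>insert t S. even s = p} = {}" using c unfolding add_is_0 card_0_eq[OF f] by blast
    then show False using t by blast
  qed
  then show "coef (dl t a) (S, m) = coef 0 (S, m)" by (simp add: coef_dl coef_zero)
qed

lemma weight_og: "weight p (if even s = p then 1 else 0) (og s)"
proof -
  have "{t \<in> {s}. even t = p} = (if even s = p then {s} else {})" by auto
  then show ?thesis by (auto simp: weight_def og_eq_gmon coef_gmon split: if_splits)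
qed

lemma dual_no_even: "even (dual_no t) \<longleftrightarrow> \<not> even t"
  by (auto simp: dual_no_def elim: oddE)

text \<open>A bracket lowers the total weight by one, because the momenta and exactly one generator
  of each dual pair are counted. Functions of weight 1, such as that of \<open>N\<close>, therefore
  preserve the weight of the other argument.\<close>

lemma weight_ad_same:
  assumes q: "weight p 1 q" "\<And>i. i < n \<Longrightarrow> weight p 1 (q' i)" and z: "weight p k z"
  shows "weight p k (ad n R q q' z)"
proof -
  have "weight p k (q' i * dp i z)" if "i < n" for i
  proof (cases k)
    case 0
    then show ?thesis using weight_dp_zero z by simp
  next
    case (Suc l)
    then have "weight p (1 + l) (q' i * dp i z)" using z q(2)[OF that] by (intro weight_mult weight_dp) auto
    then show ?thesis using Suc by simp
  qed
  moreover have "weight p k (ginv (dl (dual_no s) q) * dl s z)" for s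
  proof (cases "even s = p")
    case True
    show ?thesis
    proof (cases k)
      case 0
      then show ?thesis using weight_dl_zero z True by simp
    next
      case (Suc l)
      have "weight p 1 (dl (dual_no s) q)" by (rule weight_dl) (use q(1) True dual_no_even in auto)
      moreover have "weight p l (dl s z)" by (rule weight_dl) (use z True Suc in auto)
      ultimately have "weight p (1 + l) (ginv (dl (dual_no s) q) * dl s z)" by (intro weight_mult weight_ginv)
      then show ?thesis using Suc by simp
    qed
  next
    case False
    have "weight p 0 (dl (dual_no s) q)" by (rule weight_dl) (use q(1) False dual_no_even in auto)
    moreover have "weight p k (dl s z)" by (rule weight_dl) (use z False in auto)
    ultimately have "weight p (0 + k) (ginv (dl (dual_no s) q) * dl s z)" by (intro weight_mult weight_ginv)
    then show ?thesis by simp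
  qed
  ultimately show ?thesis unfolding ad_def by (intro weight_add weight_sum) auto
qed

text \<open>For the sections whose generators are not counted: they have weight 0 and remove one
  counted generator from \<open>z\<close>.\<close>

lemma weight_ad_lower:
  assumes q: "weight p 0 q" "\<And>i. i < n \<Longrightarrow> weight p 0 (q' i)" and z: "weight p (Suc k) z"
  shows "weight p k (ad n R q q' z)"
proof -
  have "weight p (0 + k) (q' i * dp i z)" if "i < n" for i
    using z q(2)[OF that] by (intro weight_mult weight_dp)
  moreover have "weight p k (ginv (dl (dual_no s) q) * dl s z)" for s
  proof (cases "even s = p")
    case True
    have "weight p 0 (dl (dual_no s) q)" by (rule weight_dl) (use q(1) True dual_no_even in auto)
    moreover have "weight p k (dl s z)" by (rule weight_dl) (use z True in auto)
    ultimately have "weight p (0 + k) (ginv (dl (dual_no s) q) * dl s z)" by (intro weight_mult weight_ginv)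
    then show ?thesis by simp
  next
    case False
    then have "dl (dual_no s) q = 0" using weight_dl_zero[OF q(1)] dual_no_even by simp
    then show ?thesis by simp
  qed
  ultimately show ?thesis unfolding ad_def by (intro weight_add weight_sum) auto
qed

text \<open>Degree 3 allows at most one momentum; the weight then determines how many of the odd
  generators have parity \<open>p\<close>.\<close>

lemma weight_2_shape:
  assumes h: "homog R n 3 a" and w: "weight p 2 a" and nz: "coef a (S, m) \<noteq> 0"
  shows "(\<exists>t i. even t = p \<and> S = {t} \<and> m = {#i#}) \<or>
    (\<exists>t t' u. t \<noteq> t' \<and> even t = p \<and> even t' = p \<and> even u \<noteq> p \<and> S = {t, t', u} \<and> m = {#})"
proof -
  have f: "finite S" by (rule coef_finite[OF nz])
  have c: "card S + 2 * size m = 3" by (rule homogD(3)[OF h nz])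
  have d: "card {s\<in>S. even s = p} + size m = 2" using w nz unfolding weight_def by blast
  have s: "size m = 0 \<or> size m = 1" using c by linarith
  show ?thesis
  proof (cases "size m = 0")
    case True
    then have "card S = 3" "card {s\<in>S. even s = p} = 2" "m = {#}" using c d by auto
    then obtain t t' where t: "{s\<in>S. even s = p} = {t, t'}" "t \<noteq> t'" by (auto simp: card_2_iff)
    have "card (S - {s\<in>S. even s = p}) = 1"
      using \<open>card S = 3\<close> \<open>card {s\<in>S. even s = p} = 2\<close> f by (subst card_Diff_subset) auto
    then obtain u where u: "S - {s\<in>S. even s = p} = {u}" by (auto simp: card_1_singleton_iff)
    have "S = {t, t', u}" using t(1) u by blast
    moreover have "even t = p" "even t' = p" "even u \<noteq> p" using t(1) u by blast+
    ultimately show ?thesis using t(2) \<open>m = {#}\<close> by blast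
  next
    case False
    then have "card S = 1" "card {s\<in>S. even s = p} = 1" and m1: "size m = 1" using s c d by auto
    then obtain t where "S = {t}" by (auto simp: card_1_singleton_iff)
    moreover have "even t = p"
    proof (rule ccontr)
      assume "even t \<noteq> p"
      then have e: "{s\<in>S. even s = p} = {}" using \<open>S = {t}\<close> by auto
      show False using \<open>card {s\<in>S. even s = p} = 1\<close> unfolding e by simp
    qed
    moreover obtain i where "m = {#i#}" using m1 size_1_singleton_mset by blast
    ultimately show ?thesis by blast
  qed
qed

lemma homog_3_odd: "homog R n 3 a \<Longrightarrow> ginv a = - a"
proof (rule gpoly_eqI)
  fix S m assume h: "homog R n 3 a"
  show "coef (ginv a) (S, m) = coef (- a) (S, m)"
  proof (cases "coef a (S, m) = 0")
    case False
    have "\<not> even (card S)" using homogD(3)[OF h False] by presburger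
    then show ?thesis by (simp add: coef_ginv coef_uminus)
  qed (simp add: coef_ginv coef_uminus)
qed

lemma mult_odd: "ginv b = - b \<Longrightarrow> a * b = b * ginv a"
proof (induction a rule: gpoly_induct)
  case (odd s a)
  have "og s * a * b = og s * (b * ginv a)" using odd by (simp add: mult.assoc)
  also have "\<dots> = - (b * (og s * ginv a))"
    using odd_comm[of s b] odd.prems by (simp add: mult.assoc[symmetric])
  finally show ?case by (simp add: ginv_odd)
next
  case (mom i a)
  then show ?case using mom_comm[of i b] by (simp add: ginv_mom mult.assoc) (simp add: mult.assoc[symmetric])
qed (simp_all add: algebra_simps)

lemma mult_even: "ginv b = b \<Longrightarrow> a * b = b * a"
proof (induction a rule: gpoly_induct)
  case (odd s a)
  then show ?case using odd_comm[of s b] by (simp add: mult.assoc) (simp add: mult.assoc[symmetric])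
next
  case (mom i a)
  then show ?case using mom_comm[of i b] by (simp add: mult.assoc) (simp add: mult.assoc[symmetric])
qed (simp_all add: algebra_simps)

text \<open>Two odd arguments make the sign in the graded antisymmetry positive. This identifies the
  cross terms in the bracket of a sum of degree 3 functions with itself.\<close>

lemma brk_commute:
  assumes R: "even R" and o: "ginv a = - a" "ginv b = - b"
    "\<And>i. i < n \<Longrightarrow> ginv (a' i) = - a' i" "\<And>i. i < n \<Longrightarrow> ginv (b' i) = - b' i"
  shows "brk n R a a' b b' = brk n R b b' a a'"
proof -
  have e: "ginv (dl s a) = dl s a" "ginv (dl s b) = dl s b" for s
    using dl_ginv[of s a] dl_ginv[of s b] o by simp_all
  have d: "ginv (dp i a) = - dp i a" "ginv (dp i b) = - dp i b" for i
    using dp_ginv[of i a] dp_ginv[of i b] o by simp_all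
  have "(\<Sum>s<R. ginv (dl s a) * dl (dual_no s) b) = (\<Sum>s<R. ginv (dl (dual_no s) b) * dl (dual_no (dual_no s)) a)"
    using mult_even[OF e(2)] by (simp add: e)
  also have "\<dots> = (\<Sum>s<R. ginv (dl s b) * dl (dual_no s) a)"
    by (rule sum_dual_no[OF R])
  finally have 1: "(\<Sum>s<R. ginv (dl s a) * dl (dual_no s) b) = (\<Sum>s<R. ginv (dl s b) * dl (dual_no s) a)" .
  have "a' i * dp i b - dp i a * b' i = b' i * dp i a - dp i b * a' i" if "i < n" for i
    using mult_odd[OF d(2), of "a' i" i] mult_odd[OF o(4)[OF that], of "dp i a"] o(3)[OF that] d(1) by simp
  then show ?thesis unfolding brk_def 1 by simp
qed

section \<open>Linearity of the bracket, and brackets of global functions with sections\<close>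

context smooth_bundle
begin

lemma homog_D:
  assumes c: "c \<in> charts B" and f: "lfun c f" "\<And>y. y \<in> chart_dom c \<Longrightarrow> homogB k (f y)"
    and x: "x \<in> chart_dom c" "i < dimB"
  shows "homogB k (D c i f x)"
  unfolding homog_def using coef_D_zero[OF c f(1) x] f(2) unfolding homog_def by blast

lemma weight_D:
  assumes c: "c \<in> charts B" and f: "lfun c f" "\<And>y. y \<in> chart_dom c \<Longrightarrow> weight p k (f y)"
    and x: "x \<in> chart_dom c" "i < dimB"
  shows "weight p k (D c i f x)"
  unfolding weight_def using coef_D_zero[OF c f(1) x] f(2) unfolding weight_def by blast

lemma bb_cong:
  assumes c: "c \<in> charts B" and x: "x \<in> chart_dom c"
    and "\<And>y. y \<in> chart_dom c \<Longrightarrow> f y = f' y" "\<And>y. y \<in> chart_dom c \<Longrightarrow> g y = g' y"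
  shows "bb c f g x = bb c f' g' x"
proof -
  have "D c i f x = D c i f' x" "D c i g x = D c i g' x" if "i < dimB" for i
    using D_cong[OF c x that] assms(3,4) by blast+
  then show ?thesis using assms(3,4) x by (simp add: bb_def[OF c] brk_def)
qed

lemma bb_scaleR:
  assumes c: "c \<in> charts B" and x: "x \<in> chart_dom c" and f: "lfun c f" and g: "lfun c g"
  shows "bb c (\<lambda>y. a *\<^sub>R f y) g x = a *\<^sub>R bb c f g x" "bb c f (\<lambda>y. a *\<^sub>R g y) x = a *\<^sub>R bb c f g x"
proof -
  have l: "linear (\<lambda>z :: gpoly. a *\<^sub>R z)" by (auto intro!: linearI simp: scaleR_add_right)
  have "D c i (\<lambda>y. a *\<^sub>R f y) x = a *\<^sub>R D c i f x" "D c i (\<lambda>y. a *\<^sub>R g y) x = a *\<^sub>R D c i g x" if "i < dimB" for i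
    using D_linear[OF c f l x that] D_linear[OF c g l x that] .
  then show "bb c (\<lambda>y. a *\<^sub>R f y) g x = a *\<^sub>R bb c f g x" "bb c f (\<lambda>y. a *\<^sub>R g y) x = a *\<^sub>R bb c f g x"
    by (simp_all add: bb_def[OF c] brk_def scaleR_add_right scaleR_sum_right scaleR_diff_right)
qed

lemma bb_add:
  assumes c: "c \<in> charts B" and x: "x \<in> chart_dom c" and f: "lfun c f" "lfun c f'" and g: "lfun c g" "lfun c g'"
  shows "bb c (\<lambda>y. f y + f' y) (\<lambda>y. g y + g' y) x = bb c f g x + bb c f g' x + bb c f' g x + bb c f' g' x"
proof -
  have "D c i (\<lambda>y. f y + f' y) x = D c i f x + D c i f' x" "D c i (\<lambda>y. g y + g' y) x = D c i g x + D c i g' x"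
    if "i < dimB" for i using D_add[OF c f x that] D_add[OF c g x that] .
  then show ?thesis
    by (simp add: bb_def[OF c] brk_def algebra_simps sum.distrib sum_subtractf)
qed

lemma bb_commute:
  assumes c: "c \<in> charts B" and x: "x \<in> chart_dom c" and f: "lfun c f" and g: "lfun c g"
    and h: "\<And>y. y \<in> chart_dom c \<Longrightarrow> homogB 3 (f y)" "\<And>y. y \<in> chart_dom c \<Longrightarrow> homogB 3 (g y)"
  shows "bb c f g x = bb c g f x"
  unfolding bb_def[OF c]
  by (rule brk_commute[OF even_dimR])
    (auto intro!: homog_3_odd homog_D[OF c] f g h x)

lemma gfun_add:
  assumes "a \<in> gfuns B k" "b \<in> gfuns B k"
  shows "a + b = gfun_of (\<lambda>c x. val a c x + val b c x)" "a + b \<in> gfuns B k"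
proof -
  show 1: "a + b = gfun_of (\<lambda>c x. val a c x + val b c x)"
  proof (intro ext)
    fix c x l
    have "a = gfun_of (val a)" "b = gfun_of (val b)" using gfun_of_val assms by auto
    then have "(a + b) c x l = gfun_of (val a) c x l + gfun_of (val b) c x l" by (metis plus_fun_apply)
    then show "(a + b) c x l = gfun_of (\<lambda>c x. val a c x + val b c x) c x l"
      by (simp add: gfun_of_def coef_plus)
  qed
  show "a + b \<in> gfuns B k" unfolding 1
  proof (rule gfun_of_in_gfuns)
    show "homogB k (val a c x + val b c x)" for c x by (intro homog_add homog_val assms)
    show "lfun c (\<lambda>x. val a c x + val b c x)" if "c \<in> charts B" for c
      by (intro lfun_add that lfun_val[OF assms(1)] lfun_val[OF assms(2)])
    show "val a c x + val b c x = tsub c d x (val a d x + val b d x)"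
      if "c \<in> charts B" "d \<in> charts B" "x \<in> chart_dom c" "x \<in> chart_dom d" for c d x
      unfolding tsub_simps(3) val_trans[OF assms(1) that, symmetric] val_trans[OF assms(2) that, symmetric] ..
  qed
qed

lemma gfun_of_section_sec:
  "gfun_of_section B u = gfun_of (sec u)"
proof (intro ext)
  fix c x l
  show "gfun_of_section B u c x l = gfun_of (sec u) c x l"
  proof (cases "c \<in> charts B \<and> x \<in> chart_dom c")
    case True
    then show ?thesis by (simp add: gfun_of_section_comp gfun_of_def sec_def)
  next
    case False
    then show ?thesis by (auto simp: gfun_of_section_def gfun_of_def)
  qed
qed

lemma gfun_ofD: "c \<in> charts B \<Longrightarrow> x \<in> chart_dom c \<Longrightarrow> gfun_of f c x = coef (f c x)"
  by (simp add: gfun_of_def)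

lemma gfun_of_cong:
  "(\<And>c x. c \<in> charts B \<Longrightarrow> x \<in> chart_dom c \<Longrightarrow> f c x = g c x) \<Longrightarrow> gfun_of f = gfun_of g"
  by (auto simp: gfun_of_def fun_eq_iff)

lemma gfun_of_inject: "gfun_of f = gfun_of g \<Longrightarrow> c \<in> charts B \<Longrightarrow> x \<in> chart_dom c \<Longrightarrow> f c x = g c x"
  by (metis gfun_ofD coef_inject)

lemma big_bracket_gfun_of:
  assumes "\<And>c. c \<in> charts B \<Longrightarrow> lfun c (f c)" "\<And>c. c \<in> charts B \<Longrightarrow> lfun c (g c)"
  shows "big_bracket B (gfun_of f) (gfun_of g) = gfun_of (\<lambda>c. bb c (f c) (g c))"
proof (intro ext)
  fix c x l
  show "big_bracket B (gfun_of f) (gfun_of g) c x l = gfun_of (\<lambda>c. bb c (f c) (g c)) c x l"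
  proof (cases "c \<in> charts B \<and> x \<in> chart_dom c")
    case True
    then have "big_bracket B (gfun_of f) (gfun_of g) c x = coef (bb c (f c) (g c) x)"
      by (intro big_bracket_bb assms) (auto simp: gfun_ofD)
    then show ?thesis using True by (simp add: gfun_ofD)
  next
    case False
    then show ?thesis by (auto simp: big_bracket_outside gfun_of_def)
  qed
qed

lemma big_bracket_section:
  assumes u: "u \<in> double_sections B" and a: "a \<in> gfuns B (Suc k)"
  shows "big_bracket B (gfun_of_section B u) a = gfun_of (\<lambda>c x. ad_sec u c x (val a c x))"
    "big_bracket B (gfun_of_section B u) a \<in> gfuns B k"
proof -
  have b: "bb c (sec u c) (val a c) x = ad_sec u c x (val a c x)" if "c \<in> charts B" "x \<in> chart_dom c" for c x
    by (rule bb_ad[OF that]) (rule linD(3)[OF linR_lin[OF sec_linR]])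
  have "big_bracket B (gfun_of_section B u) (gfun_of (val a)) = gfun_of (\<lambda>c. bb c (sec u c) (val a c))"
    unfolding gfun_of_section_sec by (intro big_bracket_gfun_of lfun_sec u lfun_val[OF a])
  also have "\<dots> = gfun_of (\<lambda>c x. ad_sec u c x (val a c x))"
    by (rule gfun_of_cong) (rule b)
  finally show 1: "big_bracket B (gfun_of_section B u) a = gfun_of (\<lambda>c x. ad_sec u c x (val a c x))"
    unfolding gfun_of_val[OF a] .
  show "big_bracket B (gfun_of_section B u) a \<in> gfuns B k" unfolding 1
  proof (rule gfun_of_in_gfuns)
    fix c assume c: "c \<in> charts B"
    show "homogB k (ad_sec u c x (val a c x))" if x: "x \<in> chart_dom c" for x
      using homog_ad[of dimR dimB 0 "sec u c x" "\<lambda>i. D c i (sec u c) x" k "val a c x"]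
        homog_val[OF a] homog_linR[OF sec_linR] homog_linR[OF D_sec_linR[OF u c x]] by simp
    have "lfun c (bb c (sec u c) (val a c))" by (intro lfun_bb c lfun_sec u lfun_val[OF a])
    then show "lfun c (\<lambda>x. ad_sec u c x (val a c x))"
      using lfun_cong[OF c, of "bb c (sec u c) (val a c)" "\<lambda>x. ad_sec u c x (val a c x)"] b[OF c] by simp
    fix d x assume d: "d \<in> charts B" and x: "x \<in> chart_dom c" "x \<in> chart_dom d"
    show "ad_sec u c x (val a c x) = tsub c d x (ad_sec u d x (val a d x))"
      unfolding val_trans[OF a c d x] by (rule ad_sec_tsub[OF u c d x])
  qed
qed

text \<open>The antisymmetry \<open>{a, v} = - {v, a}\<close>. Since \<open>a\<close> may contain
  momenta, the bracket is not covered by \<open>ad\<close> with \<open>a\<close> as first argument;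
  but in degree 2 the derivatives with respect to momenta are scalars and commute with
  everything.\<close>

lemma big_bracket_2_section:
  assumes v: "v \<in> double_sections B" and a: "a \<in> gfuns B 2"
  shows "big_bracket B a (gfun_of_section B v) = gfun_of (\<lambda>c x. - ad_sec v c x (val a c x))"
proof -
  have b: "bb c (val a c) (sec v c) x = - ad_sec v c x (val a c x)" if c: "c \<in> charts B" "x \<in> chart_dom c" for c x
  proof -
    have h: "homogB 2 (val a c x)" by (rule homog_val[OF a])
    have l: "ginv (dl s (val a c x)) = - dl s (val a c x)" for s
      by (rule linD(2)[OF homog1_lin[of dimR dimB]]) (use homog_dl[of dimR dimB 1] h in \<open>simp add: numeral_2_eq_2\<close>)
    have s: "dp i (val a c x) * z = z * dp i (val a c x)" for i z
    proof -
      have "homogB 0 (dp i (val a c x))" using homog_dp[of dimR dimB 0 "val a c x" i] h by (simp add: numeral_2_eq_2)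
      from homog0_scalar[OF this] show ?thesis by (metis mult_scaleR_left mult_scaleR_right mult_1 mult_1_right)
    qed
    have p: "dp i (sec v c x) = 0" for i by (rule linD(3)[OF linR_lin[OF sec_linR]])
    have "(\<Sum>s<dimR. ginv (dl s (val a c x)) * dl (dual_no s) (sec v c x)) =
        (\<Sum>s<dimR. - (scomp B v c (dual_no s) x *\<^sub>R dl s (val a c x)))"
      by (rule sum.cong) (auto simp: dl_sec l)
    moreover have "(\<Sum>i<dimB. D c i (val a c) x * dp i (sec v c x) - dp i (val a c x) * D c i (sec v c) x) =
        (\<Sum>i<dimB. - (D c i (sec v c) x * dp i (val a c x)))"
      by (rule sum.cong) (auto simp: p s)
    ultimately show ?thesis unfolding bb_def[OF c(1)] brk_def ad_sec_expand[OF c] by (simp add: sum_negf)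
  qed
  have "big_bracket B (gfun_of (val a)) (gfun_of_section B v) = gfun_of (\<lambda>c. bb c (val a c) (sec v c))"
    unfolding gfun_of_section_sec by (intro big_bracket_gfun_of lfun_sec v lfun_val[OF a])
  also have "\<dots> = gfun_of (\<lambda>c x. - ad_sec v c x (val a c x))" by (rule gfun_of_cong) (rule b)
  finally show ?thesis unfolding gfun_of_val[OF a] .
qed

text \<open>In degree 1 only single odd generators occur, and weight 0 excludes those of parity
  \<open>p\<close>. The coefficients transform like the components of a section and are
  glued.\<close>

lemma section_of_gfun:
  assumes a: "a \<in> gfuns B 1" and w: "\<And>c x. c \<in> charts B \<Longrightarrow> x \<in> chart_dom c \<Longrightarrow> weight p 0 (val a c x)"
  shows "\<exists>u\<in>half_sections (\<not> p). gfun_of_section B u = a"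
proof -
  define w where "w c s x = coef (val a c x) ({s}, {#})" for c s x
  have ex: "val a c x = (\<Sum>s<dimR. w c s x *\<^sub>R og s)" if "c \<in> charts B" "x \<in> chart_dom c" for c x
  proof (rule gpoly_eqI)
    fix S m
    have "(\<Sum>s<dimR. w c s x * coef (og s) (S, m)) = coef (val a c x) (S, m)"
    proof (cases "\<exists>s<dimR. S = {s} \<and> m = {#}")
      case True
      then obtain s where s: "s < dimR" "S = {s}" "m = {#}" by blast
      have "(\<Sum>t<dimR. w c t x * coef (og t) (S, m)) = (\<Sum>t<dimR. if t = s then w c s x else 0)"
        by (rule sum.cong) (auto simp: s og_eq_gmon coef_gmon)
      then show ?thesis using s by (simp add: w_def)
    next
      case False
      have "coef (val a c x) (S, m) = 0"
      proof (rule ccontr)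
        assume nz: "coef (val a c x) (S, m) \<noteq> 0"
        note h = homogD[OF homog_val[OF a] nz]
        have "card S = 1" "m = {#}" using h(3) by (cases "size m"; simp)+
        then show False using False h(1) by (auto simp: card_1_singleton_iff)
      qed
      moreover have "(\<Sum>s<dimR. w c s x * coef (og s) (S, m)) = 0"
        by (rule sum.neutral) (use False in \<open>auto simp: og_eq_gmon coef_gmon\<close>)
      ultimately show ?thesis by simp
    qed
    then show "coef (val a c x) (S, m) = coef (\<Sum>s<dimR. w c s x *\<^sub>R og s) (S, m)"
      by (simp add: coef_sum coef_scaleR)
  qed
  have coef_lin: "coef (\<Sum>s<dimR. f s *\<^sub>R og s) ({t}, {#}) = f t" if "t < dimR" for f t
  proof -
    have "(\<Sum>s<dimR. f s * coef (og s) ({t}, {#})) = (\<Sum>s<dimR. if s = t then f t else 0)"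
      by (rule sum.cong) (auto simp: og_eq_gmon coef_gmon)
    then show ?thesis using that by (simp add: coef_sum coef_scaleR)
  qed
  have e: "\<exists>u\<in>double_sections B. (\<forall>c\<in>charts B. \<forall>x\<in>chart_dom c. \<forall>s<dimR. scomp B u c s x = w c s x) \<and>
    ((\<forall>c\<in>charts B. \<forall>x\<in>chart_dom c. \<forall>s<dimR. even s \<longrightarrow> w c s x = 0) \<longrightarrow> (\<forall>x. snd (u x) = 0)) \<and>
    ((\<forall>c\<in>charts B. \<forall>x\<in>chart_dom c. \<forall>s<dimR. \<not> even s \<longrightarrow> w c s x = 0) \<longrightarrow> (\<forall>x. fst (u x) = 0))"
  proof (rule section_of_family)
    show "cdiff k c (chart_dom c) (w c s)" if "c \<in> charts B" for c s k
      unfolding w_def by (rule lfun_cdiff[OF that lfun_val[OF a that]])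
    fix c d x t assume cd: "c \<in> charts B" "d \<in> charts B" "x \<in> chart_dom c" "x \<in> chart_dom d" and t: "t < dimR"
    have "val a c x = (\<Sum>s<dimR. w d s x *\<^sub>R cho c d x s)"
      unfolding val_trans[OF a cd] ex[OF cd(2,4)] by (simp add: tsub_simps)
    also have "\<dots> = (\<Sum>s<dimR. \<Sum>t<dimR. (trans_mat B c d x t s * w d s x) *\<^sub>R og t)"
      by (simp add: cho_def scaleR_sum_right mult.commute)
    also have "\<dots> = (\<Sum>t<dimR. \<Sum>s<dimR. (trans_mat B c d x t s * w d s x) *\<^sub>R og t)"
      by (rule sum.swap)
    also have "\<dots> = (\<Sum>t<dimR. (\<Sum>s<dimR. trans_mat B c d x t s * w d s x) *\<^sub>R og t)"
      by (simp add: scaleR_sum_left)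
    finally have v: "val a c x = (\<Sum>t<dimR. (\<Sum>s<dimR. trans_mat B c d x t s * w d s x) *\<^sub>R og t)" .
    show "w c t x = (\<Sum>s<dimR. trans_mat B c d x t s * w d s x)"
      unfolding w_def[of c t x] v by (rule coef_lin[OF t])
  qed
  have z: "w c s x = 0" if "c \<in> charts B" "x \<in> chart_dom c" "even s = p" for c x s
  proof (rule ccontr)
    assume "w c s x \<noteq> 0"
    then have c: "card {t\<in>{s}. even t = p} + size {#} = 0"
      using w[OF that(1,2)] unfolding weight_def w_def by blast
    have e: "{t\<in>{s}. even t = p} = {s}" using that(3) by auto
    show False using c unfolding e by simp
  qed
  obtain u where u: "u \<in> double_sections B" "\<And>c x s. c \<in> charts B \<Longrightarrow> x \<in> chart_dom c \<Longrightarrow> s < dimR \<Longrightarrow> scomp B u c s x = w c s x"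
    "(\<forall>c\<in>charts B. \<forall>x\<in>chart_dom c. \<forall>s<dimR. even s \<longrightarrow> w c s x = 0) \<longrightarrow> (\<forall>x. snd (u x) = 0)"
    "(\<forall>c\<in>charts B. \<forall>x\<in>chart_dom c. \<forall>s<dimR. \<not> even s \<longrightarrow> w c s x = 0) \<longrightarrow> (\<forall>x. fst (u x) = 0)"
    using e by blast
  have "u \<in> half_sections (\<not> p)"
    using u(1,3,4) z by (cases p) (auto simp: half_sections_def)
  moreover have "gfun_of_section B u = gfun_of (val a)"
    unfolding gfun_of_section_sec by (rule gfun_of_cong) (simp add: sec_def u(2) ex)
  ultimately show ?thesis unfolding gfun_of_val[OF a] by blast
qed

end

section \<open>Brackets of sections and torsion\<close>

context smooth_bundle
begin

context
  fixes u v and a b :: real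
  assumes u: "u \<in> double_sections B" and v: "v \<in> double_sections B"
begin

lemma scomp_lincomb:
  assumes "c \<in> charts B" "x \<in> chart_dom c"
  shows "scomp B (\<lambda>x. a *\<^sub>R u x + b *\<^sub>R v x) c s x = a * scomp B u c s x + b * scomp B v c s x"
  using sec_fibre(1)[OF u, of x] sec_fibre(1)[OF v, of x] fibre_subspace[OF assms]
  by (auto simp: scomp_def scaleR_fun_def coframe_add[OF assms] coframe_scaleR[OF assms] subspace_scale)

lemma double_sections_lincomb: "(\<lambda>x. a *\<^sub>R u x + b *\<^sub>R v x) \<in> double_sections B"
  unfolding double_sections_iff
proof (intro conjI allI ballI impI)
  fix x
  obtain c where c: "c \<in> charts B" "x \<in> chart_dom c" using charts_cover by blast
  note fs = fibre_subspace[OF c]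
  show "fst (a *\<^sub>R u x + b *\<^sub>R v x) \<in> fibre B x"
    using sec_fibre(1)[OF u, of x] sec_fibre(1)[OF v, of x] by (simp add: subspace_add[OF fs] subspace_scale[OF fs])
  show "snd (a *\<^sub>R u x + b *\<^sub>R v x) \<in> dual_space (fibre B x)"
    using sec_fibre(2)[OF u, of x] sec_fibre(2)[OF v, of x]
    by (simp add: dual_space_def scaleR_fun_def algebra_simps)
next
  fix c s k assume c: "c \<in> charts B" and s: "s < dimR"
  have "cdiff k c (chart_dom c) (\<lambda>x. a * scomp B u c s x + b * scomp B v c s x)"
    by (intro cdiff_add cdiff_mult[OF c c_open[OF c]] cdiff_const cdiff_scomp[OF u c s] cdiff_scomp[OF v c s])
  then show "cdiff k c (chart_dom c) (scomp B (\<lambda>x. a *\<^sub>R u x + b *\<^sub>R v x) c s)"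
    by (subst cdiff_cong[OF c c_open[OF c], where g = "\<lambda>x. a * scomp B u c s x + b * scomp B v c s x"])
      (simp add: scomp_lincomb[OF c])
qed

lemma sec_lincomb:
  assumes "c \<in> charts B" "x \<in> chart_dom c"
  shows "sec (\<lambda>x. a *\<^sub>R u x + b *\<^sub>R v x) c x = a *\<^sub>R sec u c x + b *\<^sub>R sec v c x"
  unfolding sec_def scomp_lincomb[OF assms] by (simp add: scaleR_add_left sum.distrib scaleR_sum_right)

end

lemma half_sections_lincomb:
  assumes "u \<in> half_sections p" "v \<in> half_sections p"
  shows "(\<lambda>x. a *\<^sub>R u x + b *\<^sub>R v x) \<in> half_sections p"
  using assms double_sections_lincomb[of u v a b] by (auto simp: half_sections_def)

lemma double_sections_half: "u \<in> half_sections p \<Longrightarrow> u \<in> double_sections B"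
  by (simp add: half_sections_def)

lemma ad_sec_scale:
  assumes c: "c \<in> charts B" and x: "x \<in> chart_dom c" and v: "v \<in> double_sections B"
    and e: "\<And>y. y \<in> chart_dom c \<Longrightarrow> sec u c y = a *\<^sub>R sec v c y"
  shows "ad_sec u c x z = a *\<^sub>R ad_sec v c x z"
proof -
  have l: "linear (\<lambda>z :: gpoly. a *\<^sub>R z)" by (auto intro!: linearI simp: scaleR_add_right)
  have "D c i (sec u c) x = a *\<^sub>R D c i (sec v c) x" if "i < dimB" for i
    using D_cong[OF c x that e] D_linear[OF c lfun_sec[OF v c] l x that] by simp
  then show ?thesis by (simp add: ad_def e[OF x] scaleR_add_right scaleR_sum_right)
qed

lemma sec_eqD:
  assumes u: "u \<in> double_sections B" and v: "v \<in> double_sections B"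
    and e: "gfun_of_section B u = gfun_of_section B v"
  shows "u = v"
proof
  fix x
  obtain c where c: "c \<in> charts B" "x \<in> chart_dom c" using charts_cover by blast
  have s: "sec u c x = sec v c x"
    using gfun_of_inject[OF e[unfolded gfun_of_section_sec] c] .
  have sc: "scomp B u c t x = scomp B v c t x" if "t < dimR" for t
  proof -
    have "scomp B u c t x *\<^sub>R (1 :: gpoly) = scomp B v c t x *\<^sub>R 1"
      using arg_cong[OF s, of "dl t"] that by (simp add: dl_sec)
    then show ?thesis by simp
  qed
  have "cofr c \<alpha> x (fst (u x)) = cofr c \<alpha> x (fst (v x))" "snd (u x) (chart_frame c \<alpha> x) = snd (v x) (chart_frame c \<alpha> x)"
    if "\<alpha> < rkB" for \<alpha> using sc[of "2 * \<alpha> + 1"] sc[of "2 * \<alpha>"] that by (simp_all add: scomp_def)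
  then have "(\<Sum>\<alpha><rkB. cofr c \<alpha> x (fst (u x)) *\<^sub>R chart_frame c \<alpha> x) = (\<Sum>\<alpha><rkB. cofr c \<alpha> x (fst (v x)) *\<^sub>R chart_frame c \<alpha> x)"
    "(\<Sum>\<alpha><rkB. snd (u x) (chart_frame c \<alpha> x) *\<^sub>R cofr c \<alpha> x) = (\<Sum>\<alpha><rkB. snd (v x) (chart_frame c \<alpha> x) *\<^sub>R cofr c \<alpha> x)"
    by (auto intro: sum.cong)
  then have "fst (u x) = fst (v x)" "snd (u x) = snd (v x)"
    unfolding coframe_expand[OF c sec_fibre(1)[OF u]] coframe_expand[OF c sec_fibre(1)[OF v]]
      dual_expand[OF c sec_fibre(2)[OF u], symmetric] dual_expand[OF c sec_fibre(2)[OF v], symmetric] .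
  then show "u x = v x" by (rule prod_eqI)
qed

lemma scomp_half:
  assumes "u \<in> half_sections (\<not> p)" "even s = p" "c \<in> charts B" "x \<in> chart_dom c"
  shows "scomp B u c s x = 0"
  using assms by (auto simp: scomp_def half_sections_def coframe_zero)

lemma weight_sec:
  assumes "u \<in> half_sections (\<not> p)" "c \<in> charts B" "x \<in> chart_dom c"
  shows "weight p 0 (sec u c x)"
  unfolding sec_def
proof (rule weight_sum)
  fix s
  show "weight p 0 (scomp B u c s x *\<^sub>R og s)"
    using scomp_half[OF assms(1) _ assms(2,3), of s] weight_og[of p s] by (cases "even s = p") (auto intro: weight_scaleR)
qed

lemma weight_ad_sec:
  assumes u: "u \<in> half_sections (\<not> p)" and c: "c \<in> charts B" "x \<in> chart_dom c" and z: "weight p (Suc k) z"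
  shows "weight p k (ad_sec u c x z)"
proof (rule weight_ad_lower[OF weight_sec[OF u c] _ z])
  fix i assume "i < dimB"
  then show "weight p 0 (D c i (sec u c) x)"
    by (intro weight_D[OF c(1) lfun_sec[OF double_sections_half[OF u] c(1)] _ c(2)] weight_sec[OF u c(1)])
qed

text \<open>The derived bracket for sections of \<open>A\<close> (\<open>p = True\<close>) and of
  the dual bundle (\<open>p = False\<close>) at once; values in the sum of the two bundles allow one
  type for both. Only existence matters for \<open>SOME\<close>; uniqueness enters in the comparison
  with the two Lie brackets.\<close>

definition lbr :: "bool \<Rightarrow> ('m, 'v) gfun \<Rightarrow> ('m \<Rightarrow> 'v \<times> ('v \<Rightarrow> real)) \<Rightarrow> ('m \<Rightarrow> 'v \<times> ('v \<Rightarrow> real)) \<Rightarrow>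
    'm \<Rightarrow> 'v \<times> ('v \<Rightarrow> real)" where
  "lbr p \<mu> X Y = (SOME Z. Z \<in> half_sections (\<not> p) \<and>
     gfun_of_section B Z = big_bracket B (big_bracket B (gfun_of_section B X) \<mu>) (gfun_of_section B Y))"

context
  fixes p \<mu>
  assumes \<mu>: "\<mu> \<in> gfuns B 3"
    and wt: "\<forall>c\<in>charts B. \<forall>x\<in>chart_dom c. weight p 2 (val \<mu> c x)"
begin

lemma lbr:
  assumes X: "X \<in> half_sections (\<not> p)" and Y: "Y \<in> half_sections (\<not> p)"
  shows "lbr p \<mu> X Y \<in> half_sections (\<not> p)"
    "gfun_of_section B (lbr p \<mu> X Y) = big_bracket B (big_bracket B (gfun_of_section B X) \<mu>) (gfun_of_section B Y)"
    "c \<in> charts B \<Longrightarrow> x \<in> chart_dom c \<Longrightarrow> sec (lbr p \<mu> X Y) c x = - ad_sec Y c x (ad_sec X c x (val \<mu> c x))"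
proof -
  note XD = double_sections_half[OF X] and YD = double_sections_half[OF Y]
  have \<mu>': "\<mu> \<in> gfuns B (Suc 2)" using \<mu> by (simp add: numeral_3_eq_3 numeral_2_eq_2)
  let ?a = "big_bracket B (gfun_of_section B X) \<mu>"
  have a: "?a \<in> gfuns B 2" by (rule big_bracket_section(2)[OF XD \<mu>'])
  have a': "?a \<in> gfuns B (Suc 1)" using a by (simp add: numeral_2_eq_2)
  have va: "val ?a c x = ad_sec X c x (val \<mu> c x)" if "c \<in> charts B" "x \<in> chart_dom c" for c x
    unfolding big_bracket_section(1)[OF XD \<mu>'] by (rule val_gfun_of[OF that])
  have b: "big_bracket B (gfun_of_section B Y) ?a \<in> gfuns B 1" by (rule big_bracket_section(2)[OF YD a'])
  have vb: "val (big_bracket B (gfun_of_section B Y) ?a) c x = ad_sec Y c x (ad_sec X c x (val \<mu> c x))"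
    if "c \<in> charts B" "x \<in> chart_dom c" for c x
    unfolding big_bracket_section(1)[OF YD a'] val_gfun_of[OF that] va[OF that] ..
  have w0: "weight p 0 (val (big_bracket B (gfun_of_section B Y) ?a) c x)" if "c \<in> charts B" "x \<in> chart_dom c" for c x
    unfolding vb[OF that]
    by (intro weight_ad_sec X Y that) (use wt[rule_format, OF that] in \<open>simp add: numeral_2_eq_2\<close>)
  have "\<exists>Z\<in>half_sections (\<not> p). gfun_of_section B Z = big_bracket B (gfun_of_section B Y) ?a"
    by (rule section_of_gfun[OF b]) (rule w0)
  then obtain Z where Z: "Z \<in> half_sections (\<not> p)"
    "gfun_of_section B Z = big_bracket B (gfun_of_section B Y) ?a" by (elim bexE) (rule that)
  have "gfun_of (sec Z) = gfun_of (val (big_bracket B (gfun_of_section B Y) ?a))"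
    unfolding gfun_of_val[OF b] gfun_of_section_sec[symmetric] by (rule Z(2))
  note gZ = gfun_of_inject[OF this]
  have sZ: "sec Z c x = ad_sec Y c x (ad_sec X c x (val \<mu> c x))" if "c \<in> charts B" "x \<in> chart_dom c" for c x
    unfolding gZ[OF that] by (rule vb[OF that])
  \<comment> \<open>This is \<open>- Z\<close>, in the form of a linear combination to which the
    closure lemmas apply. The sign comes from exchanging the function of degree 2 with
    \<open>Y\<close>.\<close>
  let ?Z = "\<lambda>x. (- 1) *\<^sub>R Z x + 0 *\<^sub>R Z x"
  have 1: "?Z \<in> half_sections (\<not> p)" by (rule half_sections_lincomb[OF Z(1) Z(1)])
  have 2: "sec ?Z c x = - ad_sec Y c x (ad_sec X c x (val \<mu> c x))" if "c \<in> charts B" "x \<in> chart_dom c" for c x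
    using sec_lincomb[OF double_sections_half[OF Z(1)] double_sections_half[OF Z(1)] that, of "- 1" 0] sZ[OF that] by simp
  have bb: "big_bracket B ?a (gfun_of_section B Y) = gfun_of (\<lambda>c x. - ad_sec Y c x (ad_sec X c x (val \<mu> c x)))"
    unfolding big_bracket_2_section[OF YD a] by (rule gfun_of_cong) (simp add: va)
  have "gfun_of_section B ?Z = big_bracket B ?a (gfun_of_section B Y)"
    unfolding gfun_of_section_sec[of ?Z] bb by (rule gfun_of_cong) (rule 2)
  with 1 have ex: "\<exists>Z. Z \<in> half_sections (\<not> p) \<and> gfun_of_section B Z = big_bracket B ?a (gfun_of_section B Y)"
    by blast
  from someI_ex[OF ex] show L: "lbr p \<mu> X Y \<in> half_sections (\<not> p)"
    "gfun_of_section B (lbr p \<mu> X Y) = big_bracket B ?a (gfun_of_section B Y)"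
    unfolding lbr_def by blast+
  show "sec (lbr p \<mu> X Y) c x = - ad_sec Y c x (ad_sec X c x (val \<mu> c x))" if "c \<in> charts B" "x \<in> chart_dom c"
    by (rule gfun_of_inject[OF L(2)[unfolded gfun_of_section_sec[of "lbr p \<mu> X Y"] bb] that])
qed

end

end

context smooth_bundle_endo
begin

lemma endo_zero: "N x 0 = 0"
proof -
  obtain c where c: "c \<in> charts B" "x \<in> chart_dom c" using charts_cover by blast
  have "N x (0 *\<^sub>R 0) = 0 *\<^sub>R N x 0"
    using endo subspace_0[OF fibre_subspace[OF c]] unfolding bundle_endomorphism_def by blast
  then show ?thesis by simp
qed

lemma Nsec_half: "X \<in> half_sections p \<Longrightarrow> Nsec X \<in> half_sections p"
  using Nsec_double_sections[of X]
  by (auto simp: half_sections_def Nsec_def double_endo_def endo_zero transpose_endo_def fun_eq_iff)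

lemma Nsec_lincomb:
  assumes "X \<in> double_sections B" "Y \<in> double_sections B"
  shows "Nsec (\<lambda>x. a *\<^sub>R X x + b *\<^sub>R Y x) = (\<lambda>x. a *\<^sub>R Nsec X x + b *\<^sub>R Nsec Y x)"
proof
  fix x
  obtain c where c: "c \<in> charts B" "x \<in> chart_dom c" using charts_cover by blast
  note f = sec_fibre(1)[OF assms(1), of x] sec_fibre(1)[OF assms(2), of x]
  have g: "a *\<^sub>R fst (X x) \<in> fibre B x" "b *\<^sub>R fst (Y x) \<in> fibre B x"
    using f subspace_scale[OF fibre_subspace[OF c]] by auto
  have "N x (a *\<^sub>R fst (X x) + b *\<^sub>R fst (Y x)) = N x (a *\<^sub>R fst (X x)) + N x (b *\<^sub>R fst (Y x))"
    using endo g unfolding bundle_endomorphism_def by blast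
  moreover have "N x (a *\<^sub>R fst (X x)) = a *\<^sub>R N x (fst (X x))" "N x (b *\<^sub>R fst (Y x)) = b *\<^sub>R N x (fst (Y x))"
    using endo f unfolding bundle_endomorphism_def by blast+
  ultimately show "Nsec (\<lambda>x. a *\<^sub>R X x + b *\<^sub>R Y x) x = a *\<^sub>R Nsec X x + b *\<^sub>R Nsec Y x"
    by (auto simp: Nsec_def double_endo_def transpose_endo_def prod_eq_iff fun_eq_iff scaleR_fun_def algebra_simps)
qed

lemma homog_adN: "c \<in> charts B \<Longrightarrow> x \<in> chart_dom c \<Longrightarrow> homogB (Suc k) z \<Longrightarrow> homogB (Suc k) (adN c x z)"
  using homog_ad[of dimR dimB 1 "Nv c x" "\<lambda>i. D c i (Nv c) x" k z]
    homog_quadR[OF Nv_quadR] homog_quadR[OF D_Nv_quadR] by (simp add: numeral_2_eq_2)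

lemma weight_Nv: "weight q 1 (Nv c x)"
proof -
  have "weight q 1 (og (2 * \<beta>) * og (2 * \<alpha> + 1))" for \<alpha> \<beta>
    using weight_mult[OF weight_og[of q "2 * \<beta>"] weight_og[of q "2 * \<alpha> + 1"]] by (cases q) simp_all
  then show ?thesis unfolding Nv_def by (intro weight_sum weight_scaleR)
qed

lemma weight_adN:
  assumes c: "c \<in> charts B" "x \<in> chart_dom c" and z: "weight q k z"
  shows "weight q k (adN c x z)"
  by (rule weight_ad_same[OF weight_Nv _ z]) (rule weight_D[OF c(1) lfun_Nv[OF c(1)] weight_Nv c(2)])

context
  fixes p \<mu>
  assumes \<mu>: "\<mu> \<in> gfuns B 3"
    and wt: "\<forall>c\<in>charts B. \<forall>x\<in>chart_dom c. weight p 2 (val \<mu> c x)"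
begin

text \<open>The premise \<open>tors\<close> is the vanishing of the torsion, transported to
  functions: the derived bracket is minus the double bracket \<open>ad_sec\<close>, and
  \<open>N\<close> acts on sections as \<open>- adN\<close>. Moving \<open>X\<close> and
  \<open>Y\<close> past both copies of \<open>adN\<close> produces the torsion twice, and terms
  containing the square of \<open>N\<close> that cancel.\<close>

lemma adN_square_core:
  assumes c: "c \<in> charts B" and x: "x \<in> chart_dom c"
    and sq: "\<And>X y. X \<in> half_sections (\<not> p) \<Longrightarrow> y \<in> chart_dom c \<Longrightarrow> sec (Nsec (Nsec X)) c y = l *\<^sub>R sec X c y"
    and tors: "\<And>X Y. X \<in> half_sections (\<not> p) \<Longrightarrow> Y \<in> half_sections (\<not> p) \<Longrightarrow>
      ad_sec (Nsec Y) c x (ad_sec (Nsec X) c x (val \<mu> c x)) =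
      - adN c x (ad_sec Y c x (ad_sec (Nsec X) c x (val \<mu> c x))) - adN c x (ad_sec (Nsec Y) c x (ad_sec X c x (val \<mu> c x)))
      - adN c x (adN c x (ad_sec Y c x (ad_sec X c x (val \<mu> c x))))"
  shows "adN c x (adN c x (val \<mu> c x)) = l *\<^sub>R val \<mu> c x"
proof -
  let ?M = "val \<mu> c x" and ?E = "adN c x"
  let ?z = "?E (?E ?M) + (- l) *\<^sub>R ?M"
  have hM: "homogB 3 ?M" by (rule homog_val[OF \<mu>])
  have hE: "homogB 3 (?E z)" if "homogB 3 z" for z
    using homog_adN[OF c x, of 2 z] that by (simp add: numeral_3_eq_3 numeral_2_eq_2)
  have hz: "homogB 3 ?z" by (intro homog_add homog_scaleR hE hM)
  have wz: "weight p 2 ?z" by (intro weight_add weight_scaleR weight_adN c x wt[rule_format])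
  have "?z = 0"
  proof (rule nondegenerate_3[OF c x hz, of p])
    fix S m assume "coef ?z (S, m) \<noteq> 0"
    from weight_2_shape[OF hz wz this]
    show "(\<exists>t i. even t = p \<and> S = {t} \<and> m = {#i#}) \<or>
        (\<exists>t t'. t \<noteq> t' \<and> even t = p \<and> even t' = p \<and> t \<in> S \<and> t' \<in> S \<and> m = {#})" by blast
  next
    fix X Y assume X: "X \<in> half_sections (\<not> p)" and Y: "Y \<in> half_sections (\<not> p)"
    note XD = double_sections_half[OF X] and YD = double_sections_half[OF Y]
    note NX = Nsec_double_sections[OF XD] and NY = Nsec_double_sections[OF YD]
    have NNX: "ad_sec (Nsec (Nsec X)) c x z = l *\<^sub>R ad_sec X c x z" for z
      by (rule ad_sec_scale[OF c x XD sq[OF X]])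
    have NNY: "ad_sec (Nsec (Nsec Y)) c x z = l *\<^sub>R ad_sec Y c x z" for z
      by (rule ad_sec_scale[OF c x YD sq[OF Y]])
    define b where "b U V = ad_sec V c x (ad_sec U c x ?M)" for U V
    \<comment> \<open>A derived bracket is itself a section of the same half, so the assumption on
      the square of \<open>N\<close> applies to it.\<close>
    have EEb: "?E (?E (b X Y)) = l *\<^sub>R b X Y"
    proof -
      have Z: "lbr p \<mu> X Y \<in> half_sections (\<not> p)" by (rule lbr(1)[OF \<mu> wt X Y])
      have s: "sec (lbr p \<mu> X Y) c x = - b X Y" unfolding b_def by (rule lbr(3)[OF \<mu> wt X Y c x])
      note ZD = double_sections_half[OF Z]
      have "?E (?E (sec (lbr p \<mu> X Y) c x)) = l *\<^sub>R sec (lbr p \<mu> X Y) c x"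
        by (simp add: adN_sec[OF ZD c x] adN_sec[OF Nsec_double_sections[OF ZD] c x] ad_linear sq[OF Z x])
      then show ?thesis unfolding s by (simp add: ad_linear)
    qed
    have 1: "ad_sec X c x (?E (?E ?M)) = ?E (?E (ad_sec X c x ?M)) + 2 *\<^sub>R ?E (ad_sec (Nsec X) c x ?M) + l *\<^sub>R ad_sec X c x ?M"
      by (simp add: ad_sec_adN[OF XD c x] ad_sec_adN[OF NX c x] ad_linear NNX scaleR_2)
    have 2: "ad_sec Y c x (?E (?E (ad_sec X c x ?M))) = ?E (?E (b X Y)) + 2 *\<^sub>R ?E (b X (Nsec Y)) + l *\<^sub>R b X Y"
      by (simp add: b_def ad_sec_adN[OF YD c x] ad_sec_adN[OF NY c x] ad_linear NNY scaleR_2)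
    have 3: "ad_sec Y c x (?E (ad_sec (Nsec X) c x ?M)) = ?E (b (Nsec X) Y) + b (Nsec X) (Nsec Y)"
      by (simp add: b_def ad_sec_adN[OF YD c x])
    have t: "b (Nsec X) (Nsec Y) = - ?E (b (Nsec X) Y) - ?E (b X (Nsec Y)) - l *\<^sub>R b X Y"
      unfolding EEb[symmetric] unfolding b_def by (rule tors[OF X Y])
    have "ad_sec Y c x (ad_sec X c x ?z) = ad_sec Y c x (?E (?E (ad_sec X c x ?M))) +
        2 *\<^sub>R ad_sec Y c x (?E (ad_sec (Nsec X) c x ?M)) + l *\<^sub>R b X Y - l *\<^sub>R b X Y"
      by (simp add: 1 ad_linear b_def)
    also have "\<dots> = 0" unfolding 2 3 t EEb scaleR_2 by simp
    finally show "ad_sec Y c x (ad_sec X c x ?z) = 0" .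
  qed
  then show ?thesis by (simp add: eq_neg_iff_add_eq_0[symmetric])
qed

text \<open>The case of the factor \<open>0\<close>, where \<open>N\<close> does not determine the
  cps structure. Every term of the torsion identity is zero, and the constant is
  \<open>0\<close>.\<close>

lemma adN_square_zero:
  assumes c: "c \<in> charts B" and x: "x \<in> chart_dom c"
    and N0: "\<And>X. X \<in> half_sections (\<not> p) \<Longrightarrow> Nsec X = (\<lambda>x. 0)"
  shows "adN c x (adN c x (val \<mu> c x)) = 0 *\<^sub>R val \<mu> c x"
proof (rule adN_square_core[OF c x])
  have s0: "sec (Nsec X) c y = 0" if "X \<in> half_sections (\<not> p)" "y \<in> chart_dom c" for X y
    unfolding N0[OF that(1)] sec_def scomp_def by (intro sum.neutral ballI) (use c that(2) in \<open>simp add: coframe_zero\<close>)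
  show "sec (Nsec (Nsec X)) c y = 0 *\<^sub>R sec X c y" if "X \<in> half_sections (\<not> p)" "y \<in> chart_dom c" for X y
    using s0[OF Nsec_half[OF that(1)] that(2)] by simp
  fix X Y assume X: "X \<in> half_sections (\<not> p)" and Y: "Y \<in> half_sections (\<not> p)"
  have a0: "ad_sec (Nsec X) c x z = 0" if X: "X \<in> half_sections (\<not> p)" for X z
    using ad_sec_scale[OF c x double_sections_half[OF X], of "Nsec X" 0 z] s0[OF X] by simp
  have "adN c x (sec (lbr p \<mu> X Y) c x) = 0"
    using adN_sec[OF double_sections_half[OF lbr(1)[OF \<mu> wt X Y]] c x] s0[OF lbr(1)[OF \<mu> wt X Y] x] by simp
  then have "adN c x (ad_sec Y c x (ad_sec X c x (val \<mu> c x))) = 0"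
    unfolding lbr(3)[OF \<mu> wt X Y c x] by (simp add: ad_linear)
  then show "ad_sec (Nsec Y) c x (ad_sec (Nsec X) c x (val \<mu> c x)) =
      - adN c x (ad_sec Y c x (ad_sec (Nsec X) c x (val \<mu> c x))) - adN c x (ad_sec (Nsec Y) c x (ad_sec X c x (val \<mu> c x)))
      - adN c x (adN c x (ad_sec Y c x (ad_sec X c x (val \<mu> c x))))"
    by (simp add: a0 X Y ad_linear)
qed

text \<open>The torsion is quadratic in the endomorphism, so it scales by \<open>a\<^sup>2\<close>,
  as does the square. Division by \<open>a\<close> expresses the action of \<open>P'\<close> through
  \<open>Nsec\<close>, for which membership in the half and the bracket identities are
  available.\<close>

lemma adN_square_half:
  fixes P' :: "'m \<Rightarrow> 'v \<times> ('v \<Rightarrow> real) \<Rightarrow> 'v \<times> ('v \<Rightarrow> real)"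
  assumes c: "c \<in> charts B" and x: "x \<in> chart_dom c" and a: "a \<noteq> 0"
    and i: "\<And>X x. X \<in> half_sections (\<not> p) \<Longrightarrow> Nsec X x = a *\<^sub>R P' x (X x)"
    and ii: "\<And>X Y x. X \<in> half_sections (\<not> p) \<Longrightarrow> Y \<in> half_sections (\<not> p) \<Longrightarrow>
      (\<lambda>x. P' x (X x)) \<in> half_sections (\<not> p) \<Longrightarrow> (\<lambda>x. P' x (Y x)) \<in> half_sections (\<not> p) \<Longrightarrow>
      lbr p \<mu> (\<lambda>x. P' x (X x)) (\<lambda>x. P' x (Y x)) x =
      P' x (lbr p \<mu> (\<lambda>x. P' x (X x)) Y x + lbr p \<mu> X (\<lambda>x. P' x (Y x)) x - P' x (lbr p \<mu> X Y x))"
    and iii: "\<And>X x. X \<in> half_sections (\<not> p) \<Longrightarrow> P' x (P' x (X x)) = e *\<^sub>R X x"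
  shows "adN c x (adN c x (val \<mu> c x)) = (a\<^sup>2 * e) *\<^sub>R val \<mu> c x"
proof (rule adN_square_core[OF c x])
  define P where "P X = (\<lambda>x. P' x (X x))" for X
  have P': "P X = (\<lambda>x. (1 / a) *\<^sub>R Nsec X x + 0 *\<^sub>R Nsec X x)" if "X \<in> half_sections (\<not> p)" for X
    using a i[OF that] by (simp add: P_def fun_eq_iff)
  have PH: "P X \<in> half_sections (\<not> p)" if "X \<in> half_sections (\<not> p)" for X
    unfolding P'[OF that] by (intro half_sections_lincomb Nsec_half that)
  have secP: "sec (P X) c y = (1 / a) *\<^sub>R sec (Nsec X) c y" if "X \<in> half_sections (\<not> p)" "y \<in> chart_dom c" for X y
    using sec_lincomb[OF Nsec_double_sections Nsec_double_sections c that(2), of X X "1 / a" 0] double_sections_half[OF that(1)]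
    unfolding P'[OF that(1)] by simp
  have secN: "sec (Nsec X) c y = a *\<^sub>R sec (P X) c y" if "X \<in> half_sections (\<not> p)" "y \<in> chart_dom c" for X y
    using secP[OF that] a by simp
  show "sec (Nsec (Nsec X)) c y = (a\<^sup>2 * e) *\<^sub>R sec X c y" if X: "X \<in> half_sections (\<not> p)" and y: "y \<in> chart_dom c" for X y
  proof -
    have "Nsec (Nsec X) z = (a\<^sup>2 * e) *\<^sub>R X z" for z
    proof -
      have "(1 / a) *\<^sub>R Nsec (P X) z = e *\<^sub>R X z"
        using iii[OF X, of z] i[OF PH[OF X], of z] a by (simp add: P_def)
      moreover have "Nsec (P X) z = (1 / a) *\<^sub>R Nsec (Nsec X) z"
        unfolding P'[OF X]
        using Nsec_lincomb[OF Nsec_double_sections Nsec_double_sections, of X X "1 / a" 0] double_sections_half[OF X]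
        by simp
      ultimately have "(1 / a) *\<^sub>R (1 / a) *\<^sub>R Nsec (Nsec X) z = e *\<^sub>R X z" by simp
      then have "a\<^sup>2 *\<^sub>R (1 / a) *\<^sub>R (1 / a) *\<^sub>R Nsec (Nsec X) z = (a\<^sup>2 * e) *\<^sub>R X z" by simp
      then show ?thesis using a by (simp add: power2_eq_square)
    qed
    then have "Nsec (Nsec X) = (\<lambda>z. (a\<^sup>2 * e) *\<^sub>R X z + 0 *\<^sub>R X z)" by auto
    then show ?thesis using sec_lincomb[OF double_sections_half[OF X] double_sections_half[OF X] c y, of "a\<^sup>2 * e" 0] by simp
  qed
  fix X Y assume X: "X \<in> half_sections (\<not> p)" and Y: "Y \<in> half_sections (\<not> p)"
  let ?E = "adN c x"
  define b where "b U V = ad_sec V c x (ad_sec U c x (val \<mu> c x))" for U V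
  note PX = PH[OF X] and PY = PH[OF Y]
  have aN: "ad_sec (Nsec U) c x z = a *\<^sub>R ad_sec (P U) c x z" if "U \<in> half_sections (\<not> p)" for U z
    by (rule ad_sec_scale[OF c x double_sections_half[OF PH[OF that]] secN[OF that]])
  have sb: "sec (lbr p \<mu> U V) c x = - b U V" "lbr p \<mu> U V \<in> half_sections (\<not> p)"
    if "U \<in> half_sections (\<not> p)" "V \<in> half_sections (\<not> p)" for U V
    unfolding b_def using lbr(1)[OF \<mu> wt that] lbr(3)[OF \<mu> wt that c x] by auto
  let ?Z1 = "lbr p \<mu> (P X) Y" and ?Z2 = "lbr p \<mu> X (P Y)" and ?Z3 = "lbr p \<mu> X Y"
  \<comment> \<open>The argument of the outer \<open>P\<close> in the torsion identity, arranged as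
    a linear combination of sections of the same half.\<close>
  let ?W = "\<lambda>y. 1 *\<^sub>R (1 *\<^sub>R ?Z1 y + 1 *\<^sub>R ?Z2 y) + (- 1) *\<^sub>R P ?Z3 y"
  note H = sb(2)[OF PX Y] sb(2)[OF X PY] PH[OF sb(2)[OF X Y]]
  have H12: "(\<lambda>y. 1 *\<^sub>R ?Z1 y + 1 *\<^sub>R ?Z2 y) \<in> half_sections (\<not> p)"
    by (rule half_sections_lincomb[OF H(1,2)])
  have W: "?W \<in> half_sections (\<not> p)" by (rule half_sections_lincomb[OF H12 H(3)])
  have "lbr p \<mu> (P X) (P Y) = P ?W"
    unfolding P_def ii[OF X Y PX[unfolded P_def] PY[unfolded P_def], THEN ext] by simp
  then have "- b (P X) (P Y) = (1 / a) *\<^sub>R sec (Nsec ?W) c x"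
    using sb(1)[OF PX PY] secP[OF W x] by simp
  also have "sec (Nsec ?W) c x = - ?E (sec ?W c x)"
    using adN_sec[OF double_sections_half[OF W] c x] by (simp only: minus_minus)
  also have "sec ?W c x = - b (P X) Y - b X (P Y) - (1 / a) *\<^sub>R sec (Nsec ?Z3) c x"
    unfolding sec_lincomb[OF double_sections_half[OF H12] double_sections_half[OF H(3)] c x]
      sec_lincomb[OF double_sections_half[OF H(1)] double_sections_half[OF H(2)] c x]
      sb(1)[OF PX Y] sb(1)[OF X PY] secP[OF sb(2)[OF X Y] x] by simp
  also have "sec (Nsec ?Z3) c x = ?E (b X Y)"
    using adN_sec[OF double_sections_half[OF sb(2)[OF X Y]] c x] sb(1)[OF X Y] by (simp add: ad_linear)
  finally have "- b (P X) (P Y) = (1 / a) *\<^sub>R (?E (b (P X) Y) + ?E (b X (P Y)) + (1 / a) *\<^sub>R ?E (?E (b X Y)))"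
    by (simp add: ad_linear)
  then have bPP: "b (P X) (P Y) = - ((1 / a) *\<^sub>R (?E (b (P X) Y) + ?E (b X (P Y)) + (1 / a) *\<^sub>R ?E (?E (b X Y))))"
    by (rule minus_equation_iff[THEN iffD1, THEN sym])
  have "a\<^sup>2 *\<^sub>R b (P X) (P Y) = - a *\<^sub>R ?E (b (P X) Y) - a *\<^sub>R ?E (b X (P Y)) - ?E (?E (b X Y))"
    unfolding bPP using a by (simp add: power2_eq_square scaleR_add_right scaleR_diff_right)
  then show "ad_sec (Nsec Y) c x (ad_sec (Nsec X) c x (val \<mu> c x)) =
      - ?E (ad_sec Y c x (ad_sec (Nsec X) c x (val \<mu> c x))) - ?E (ad_sec (Nsec Y) c x (ad_sec X c x (val \<mu> c x)))
      - ?E (?E (ad_sec Y c x (ad_sec X c x (val \<mu> c x))))"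
    unfolding b_def by (simp add: aN[OF X] aN[OF Y] ad_linear power2_eq_square)
qed

end

end

section \<open>Lie algebroid structures in terms of weights\<close>

context smooth_bundle
begin

lemma zero_double_sections: "(\<lambda>x. (0, 0)) \<in> double_sections B"
proof -
  obtain u where u: "u \<in> double_sections B" "\<And>x. snd (u x) = 0" "\<And>x. fst (u x) = 0"
    using section_of_family[of "\<lambda>_ _ _. 0"] cdiff_const by auto
  have "u = (\<lambda>x. (0, 0))" by (rule ext) (use u in \<open>auto simp: prod_eq_iff\<close>)
  then show ?thesis using u(1) by simp
qed

lemma half_sections_vec: "(\<lambda>x. (X x, 0)) \<in> half_sections False \<longleftrightarrow> X \<in> sections B"
  using zero_double_sections by (simp add: half_sections_def double_sections_def)

lemma half_sections_covec: "(\<lambda>x. (0, \<xi> x)) \<in> half_sections True \<longleftrightarrow> \<xi> \<in> sections (dual_bundle B)"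
  using zero_double_sections by (simp add: half_sections_def double_sections_def)

lemma half_sections_eq:
  "X \<in> half_sections False \<Longrightarrow> (\<lambda>x. (fst (X x), 0)) = X"
  "X \<in> half_sections True \<Longrightarrow> (\<lambda>x. (0, snd (X x))) = X"
  by (auto simp: half_sections_def fun_eq_iff prod_eq_iff)

lemma sections_half:
  "X \<in> half_sections False \<Longrightarrow> (\<lambda>x. fst (X x)) \<in> sections B"
  "X \<in> half_sections True \<Longrightarrow> (\<lambda>x. snd (X x)) \<in> sections (dual_bundle B)"
  by (auto simp: half_sections_def double_sections_def)

text \<open>The definite description is unique because a section is determined by its function, as
  in \<open>sec_eqD\<close>.\<close>

lemma lie_bracket_lbr:
  assumes \<mu>: "\<mu> \<in> gfuns B 3" and wt: "\<forall>c\<in>charts B. \<forall>x\<in>chart_dom c. weight True 2 (val \<mu> c x)"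
    and X: "X \<in> half_sections False" and Y: "Y \<in> half_sections False"
  shows "lie_bracket B \<mu> (\<lambda>x. fst (X x)) (\<lambda>x. fst (Y x)) = (\<lambda>x. fst (lbr True \<mu> X Y x))"
proof -
  note L = lbr[where p = True, unfolded not_True_eq_False, OF \<mu> wt X Y]
  show ?thesis
    unfolding lie_bracket_def gfun_of_vec_def half_sections_eq(1)[OF X] half_sections_eq(1)[OF Y]
  proof (rule the_equality, intro conjI)
    show "(\<lambda>x. fst (lbr True \<mu> X Y x)) \<in> sections B" by (rule sections_half(1)[OF L(1)])
    show "gfun_of_section B (\<lambda>x. (fst (lbr True \<mu> X Y x), 0)) =
        big_bracket B (big_bracket B (gfun_of_section B X) \<mu>) (gfun_of_section B Y)"
      unfolding half_sections_eq(1)[OF L(1)] by (rule L(2))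
  next
    fix Z assume Z: "Z \<in> sections B \<and> gfun_of_section B (\<lambda>x. (Z x, 0)) =
      big_bracket B (big_bracket B (gfun_of_section B X) \<mu>) (gfun_of_section B Y)"
    have e: "(\<lambda>x. (Z x, 0)) = lbr True \<mu> X Y"
      by (rule sec_eqD) (use Z L(2) double_sections_half[OF L(1)] double_sections_half[OF half_sections_vec[THEN iffD2]] in auto)
    show "Z = (\<lambda>x. fst (lbr True \<mu> X Y x))" unfolding e[symmetric] by simp
  qed
qed

lemma dual_lie_bracket_lbr:
  assumes \<mu>: "\<mu> \<in> gfuns B 3" and wt: "\<forall>c\<in>charts B. \<forall>x\<in>chart_dom c. weight False 2 (val \<mu> c x)"
    and X: "X \<in> half_sections True" and Y: "Y \<in> half_sections True"
  shows "dual_lie_bracket B \<mu> (\<lambda>x. snd (X x)) (\<lambda>x. snd (Y x)) = (\<lambda>x. snd (lbr False \<mu> X Y x))"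
proof -
  note L = lbr[where p = False, unfolded not_False_eq_True, OF \<mu> wt X Y]
  show ?thesis
    unfolding dual_lie_bracket_def gfun_of_covec_def half_sections_eq(2)[OF X] half_sections_eq(2)[OF Y]
  proof (rule the_equality, intro conjI)
    show "(\<lambda>x. snd (lbr False \<mu> X Y x)) \<in> sections (dual_bundle B)" by (rule sections_half(2)[OF L(1)])
    show "gfun_of_section B (\<lambda>x. (0, snd (lbr False \<mu> X Y x))) =
        big_bracket B (big_bracket B (gfun_of_section B X) \<mu>) (gfun_of_section B Y)"
      unfolding half_sections_eq(2)[OF L(1)] by (rule L(2))
  next
    fix Z assume Z: "Z \<in> sections (dual_bundle B) \<and> gfun_of_section B (\<lambda>x. (0, Z x)) =
      big_bracket B (big_bracket B (gfun_of_section B X) \<mu>) (gfun_of_section B Y)"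
    have e: "(\<lambda>x. (0, Z x)) = lbr False \<mu> X Y"
      by (rule sec_eqD) (use Z L(2) double_sections_half[OF L(1)] double_sections_half[OF half_sections_covec[THEN iffD2]] in auto)
    show "Z = (\<lambda>x. snd (lbr False \<mu> X Y x))" unfolding e[symmetric] by simp
  qed
qed

text \<open>The list of admissible monomials is replaced by a weight, which the bracket with
  \<open>N\<close> visibly preserves.\<close>

lemma lie_algebroid_iff:
  "lie_algebroid B \<mu> \<longleftrightarrow> \<mu> \<in> gfuns B 3 \<and>
     (\<forall>c\<in>charts B. \<forall>x\<in>chart_dom c. weight True 2 (val \<mu> c x)) \<and> big_bracket B \<mu> \<mu> = 0"
proof -
  have "(\<forall>c x k. \<mu> c x k \<noteq> 0 \<longrightarrow> (\<exists>\<alpha> i. k = ({tau_no \<alpha>}, {#i#})) \<or>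
      (\<exists>\<alpha> \<beta> \<gamma>. k = ({tau_no \<alpha>, tau_no \<beta>, theta_no \<gamma>}, {#}))) \<longleftrightarrow>
    (\<forall>c\<in>charts B. \<forall>x\<in>chart_dom c. weight True 2 (val \<mu> c x))" (is "?L \<longleftrightarrow> ?R") if \<mu>: "\<mu> \<in> gfuns B 3"
  proof
    assume L: ?L
    show ?R
    proof (intro ballI, unfold weight_def, intro allI impI)
      fix c x S m assume nz: "coef (val \<mu> c x) (S, m) \<noteq> 0"
      have d: "card S + 2 * size m = 3" by (rule homogD(3)[OF homog_val[OF \<mu>] nz])
      have "\<mu> c x (S, m) \<noteq> 0" using nz unfolding coef_val[OF \<mu>] .
      with L have "(\<exists>\<alpha> i. (S, m) = ({tau_no \<alpha>}, {#i#})) \<or>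
        (\<exists>\<alpha> \<beta> \<gamma>. (S, m) = ({tau_no \<alpha>, tau_no \<beta>, theta_no \<gamma>}, {#}))" by (elim allE impE)
      then show "card {s \<in> S. even s = True} + size m = 2"
      proof (elim disjE exE)
        fix \<alpha> i assume e: "(S, m) = ({tau_no \<alpha>}, {#i#})"
        then have "{s \<in> S. even s = True} = {tau_no \<alpha>}" by (auto simp: tau_no_def)
        then show ?thesis using e by simp
      next
        fix \<alpha> \<beta> \<gamma> assume e: "(S, m) = ({tau_no \<alpha>, tau_no \<beta>, theta_no \<gamma>}, {#})"
        then have "{s \<in> S. even s = True} = {tau_no \<alpha>, tau_no \<beta>}" by (auto simp: tau_no_def theta_no_def)
        \<comment> \<open>Equal indices would leave a set of two generators, contrary to degree
          3.\<close>
        moreover have "tau_no \<alpha> \<noteq> tau_no \<beta>"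
          using d e by (auto simp: card_insert_if split: if_splits)
        ultimately show ?thesis using e by simp
      qed
    qed
  next
    assume R: ?R
    show ?L
    proof (intro allI impI)
      fix c x and k :: monom assume nz: "\<mu> c x k \<noteq> 0"
      obtain S m where k: "k = (S, m)" by (cases k)
      have cx: "c \<in> charts B" "x \<in> chart_dom c" using gfunsD(1,2)[OF \<mu>] nz unfolding k by blast+
      have nz': "coef (val \<mu> c x) (S, m) \<noteq> 0" using nz unfolding coef_val[OF \<mu>] k .
      from weight_2_shape[OF homog_val[OF \<mu>] R[rule_format, OF cx] nz']
      show "(\<exists>\<alpha> i. k = ({tau_no \<alpha>}, {#i#})) \<or> (\<exists>\<alpha> \<beta> \<gamma>. k = ({tau_no \<alpha>, tau_no \<beta>, theta_no \<gamma>}, {#}))"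
      proof (elim disjE exE conjE)
        fix t i assume "even t = True" "S = {t}" "m = {#i#}"
        then have "k = ({tau_no (t div 2)}, {#i#})" by (simp add: k tau_no_def theta_no_def)
        then show ?thesis by blast
      next
        fix t t' u assume "even t = True" "even t' = True" "even u \<noteq> True" "S = {t, t', u}" "m = {#}"
        then have "k = ({tau_no (t div 2), tau_no (t' div 2), theta_no (u div 2)}, {#})"
          by (simp add: k tau_no_def theta_no_def)
        then show ?thesis by blast
      qed
    qed
  qed
  then show ?thesis unfolding lie_algebroid_def by blast
qed

lemma dual_lie_algebroid_iff:
  "dual_lie_algebroid B \<mu> \<longleftrightarrow> \<mu> \<in> gfuns B 3 \<and>
     (\<forall>c\<in>charts B. \<forall>x\<in>chart_dom c. weight False 2 (val \<mu> c x)) \<and> big_bracket B \<mu> \<mu> = 0"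
proof -
  have "(\<forall>c x k. \<mu> c x k \<noteq> 0 \<longrightarrow> (\<exists>\<alpha> i. k = ({theta_no \<alpha>}, {#i#})) \<or>
      (\<exists>\<alpha> \<beta> \<gamma>. k = ({theta_no \<alpha>, theta_no \<beta>, tau_no \<gamma>}, {#}))) \<longleftrightarrow>
    (\<forall>c\<in>charts B. \<forall>x\<in>chart_dom c. weight False 2 (val \<mu> c x))" (is "?L \<longleftrightarrow> ?R") if \<mu>: "\<mu> \<in> gfuns B 3"
  proof
    assume L: ?L
    show ?R
    proof (intro ballI, unfold weight_def, intro allI impI)
      fix c x S m assume nz: "coef (val \<mu> c x) (S, m) \<noteq> 0"
      have d: "card S + 2 * size m = 3" by (rule homogD(3)[OF homog_val[OF \<mu>] nz])
      have "\<mu> c x (S, m) \<noteq> 0" using nz unfolding coef_val[OF \<mu>] .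
      with L have "(\<exists>\<alpha> i. (S, m) = ({theta_no \<alpha>}, {#i#})) \<or>
        (\<exists>\<alpha> \<beta> \<gamma>. (S, m) = ({theta_no \<alpha>, theta_no \<beta>, tau_no \<gamma>}, {#}))" by (elim allE impE)
      then show "card {s \<in> S. even s = False} + size m = 2"
      proof (elim disjE exE)
        fix \<alpha> i assume e: "(S, m) = ({theta_no \<alpha>}, {#i#})"
        then have "{s \<in> S. even s = False} = {theta_no \<alpha>}" by (auto simp: theta_no_def)
        then show ?thesis using e by simp
      next
        fix \<alpha> \<beta> \<gamma> assume e: "(S, m) = ({theta_no \<alpha>, theta_no \<beta>, tau_no \<gamma>}, {#})"
        then have "{s \<in> S. even s = False} = {theta_no \<alpha>, theta_no \<beta>}" by (auto simp: tau_no_def theta_no_def)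
        moreover have "theta_no \<alpha> \<noteq> theta_no \<beta>"
          using d e by (auto simp: card_insert_if split: if_splits)
        ultimately show ?thesis using e by simp
      qed
    qed
  next
    assume R: ?R
    show ?L
    proof (intro allI impI)
      fix c x and k :: monom assume nz: "\<mu> c x k \<noteq> 0"
      obtain S m where k: "k = (S, m)" by (cases k)
      have cx: "c \<in> charts B" "x \<in> chart_dom c" using gfunsD(1,2)[OF \<mu>] nz unfolding k by blast+
      have nz': "coef (val \<mu> c x) (S, m) \<noteq> 0" using nz unfolding coef_val[OF \<mu>] k .
      from weight_2_shape[OF homog_val[OF \<mu>] R[rule_format, OF cx] nz']
      show "(\<exists>\<alpha> i. k = ({theta_no \<alpha>}, {#i#})) \<or> (\<exists>\<alpha> \<beta> \<gamma>. k = ({theta_no \<alpha>, theta_no \<beta>, tau_no \<gamma>}, {#}))"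
      proof (elim disjE exE conjE)
        fix t i assume "even t = False" "S = {t}" "m = {#i#}"
        then have "k = ({theta_no (t div 2)}, {#i#})" by (simp add: k tau_no_def theta_no_def)
        then show ?thesis by blast
      next
        fix t t' u assume "even t = False" "even t' = False" "even u \<noteq> False" "S = {t, t', u}" "m = {#}"
        then have "k = ({theta_no (t div 2), theta_no (t' div 2), tau_no (u div 2)}, {#})"
          by (simp add: k tau_no_def theta_no_def)
        then show ?thesis by blast
      qed
    qed
  qed
  then show ?thesis unfolding dual_lie_algebroid_def by blast
qed

text \<open>In rank 0 all sections vanish and \<^const>\<open>tilde\<close> is a \<open>THE\<close> without uniqueness, so this case is separate.\<close>

lemma rank_0_lie_algebroid:
  assumes "rkB = 0" and "lie_algebroid B \<mu> \<or> dual_lie_algebroid B \<mu>"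
  shows "\<mu> = 0"
proof (intro ext)
  fix c x and k :: monom
  obtain S m where k: "k = (S, m)" by (cases k)
  have \<mu>: "\<mu> \<in> gfuns B 3" using assms(2) by (auto simp: lie_algebroid_def dual_lie_algebroid_def)
  show "\<mu> c x k = 0 c x k"
  proof (rule ccontr)
    assume "\<mu> c x k \<noteq> 0 c x k"
    then have nz: "\<mu> c x (S, m) \<noteq> 0" by (simp add: k)
    have "S \<subseteq> {}" using gfunsD(3)[OF \<mu> nz] assms(1) by simp
    moreover have "S \<noteq> {}"
      using assms(2) nz unfolding lie_algebroid_def dual_lie_algebroid_def by blast
    ultimately show False by blast
  qed
qed

lemma smult_zero: "a \<odot> 0 = 0" "0 \<odot> a = 0"
  by (auto simp: smult_def fun_eq_iff)

lemma big_bracket_zero: "big_bracket B a 0 = 0"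
proof (intro ext)
  fix c :: "('m, 'v) bundle_chart" and x k
  have "partial_x c i (0 c) x = 0" for i by (simp add: partial_x_def chart_partial_def fun_eq_iff)
  moreover have "pderiv_p i 0 = 0" "lderiv i 0 = 0" for i by (auto simp: pderiv_p_def lderiv_def fun_eq_iff)
  ultimately show "big_bracket B a 0 c x k = 0 c x k"
    by (simp add: big_bracket_def smult_zero)
qed

end

section \<open>The deformed structures\<close>

context smooth_bundle_endo
begin

lemma gfun_of_Nv: "gfun_of Nv \<in> gfuns B 2"
  by (rule gfun_of_in_gfuns) (auto intro: homog_quadR[OF Nv_quadR] lfun_Nv Nv_tsub)

text \<open>Existence is \<open>ad_sec_Nv\<close>. A competitor may a priori contain momenta, and
  excluding it by \<open>nondegenerate_2\<close> takes positive rank.\<close>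

lemma tilde_double_endo:
  assumes r: "rkB > 0"
  shows "tilde B (double_endo B N) = gfun_of Nv"
  unfolding tilde_def
proof (rule the_equality, intro conjI ballI)
  have Suc1: "(2 :: nat) = Suc 1" by simp
  show "gfun_of Nv \<in> gfuns B 2" by (rule gfun_of_Nv)
  show *: "gfun_of_section B (\<lambda>x. double_endo B N x (u x)) = big_bracket B (gfun_of_section B u) (gfun_of Nv)"
    if u: "u \<in> double_sections B" for u
  proof -
    have "big_bracket B (gfun_of_section B u) (gfun_of Nv) = gfun_of (\<lambda>c x. ad_sec u c x (val (gfun_of Nv) c x))"
      by (rule big_bracket_section(1)[OF u gfun_of_Nv[unfolded Suc1]])
    also have "\<dots> = gfun_of (sec (Nsec u))"
      by (rule gfun_of_cong) (simp only: val_gfun_of ad_sec_Nv[OF u])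
    finally show ?thesis unfolding gfun_of_section_sec Nsec_def by (rule sym)
  qed
  fix a assume "a \<in> gfuns B 2 \<and> (\<forall>u\<in>double_sections B.
    gfun_of_section B (\<lambda>x. double_endo B N x (u x)) = big_bracket B (gfun_of_section B u) a)"
  then have a: "a \<in> gfuns B 2" and e: "\<And>u. u \<in> double_sections B \<Longrightarrow>
    gfun_of_section B (\<lambda>x. double_endo B N x (u x)) = big_bracket B (gfun_of_section B u) a" by blast+
  have "val a c x = Nv c x" if c: "c \<in> charts B" "x \<in> chart_dom c" for c x
  proof -
    have "val a c x - Nv c x = 0"
    proof (rule nondegenerate_2[OF c _ r])
      show "homogB 2 (val a c x - Nv c x)"
        using homog_add[OF homog_val[OF a] homog_scaleR[OF homog_quadR[OF Nv_quadR]], of c x "- 1" c x] by simp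
      fix u assume u: "u \<in> double_sections B"
      have "gfun_of (\<lambda>c x. ad_sec u c x (val a c x)) = gfun_of (sec (Nsec u))"
        unfolding big_bracket_section(1)[OF u a[unfolded Suc1], symmetric] gfun_of_section_sec[symmetric] Nsec_def
        by (rule e[OF u, symmetric])
      from gfun_of_inject[OF this c] show "ad_sec u c x (val a c x - Nv c x) = 0"
        by (simp add: ad_linear ad_sec_Nv[OF u c])
    qed
    then show ?thesis by simp
  qed
  then have "gfun_of (val a) = gfun_of Nv" by (rule gfun_of_cong)
  then show "a = gfun_of Nv" unfolding gfun_of_val[OF a] .
qed

lemma bb_Nv:
  assumes c: "c \<in> charts B" "x \<in> chart_dom c"
  shows "bb c (Nv c) f x = adN c x (f x)"
  by (rule bb_ad[OF c]) (rule quadD(3)[OF quadR_quad[OF Nv_quadR]])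

lemma lfun_adN:
  assumes c: "c \<in> charts B" and f: "lfun c f"
  shows "lfun c (\<lambda>x. adN c x (f x))"
  by (rule lfun_cong[OF c, of "bb c (Nv c) f" "\<lambda>x. adN c x (f x)", THEN iffD1,
      OF bb_Nv[OF c] lfun_bb[OF c lfun_Nv[OF c] f]])

lemma big_bracket_Nv:
  assumes a: "a \<in> gfuns B (Suc k)"
  shows "big_bracket B (gfun_of Nv) a = gfun_of (\<lambda>c x. adN c x (val a c x))"
    "big_bracket B (gfun_of Nv) a \<in> gfuns B (Suc k)"
proof -
  have "big_bracket B (gfun_of Nv) (gfun_of (val a)) = gfun_of (\<lambda>c. bb c (Nv c) (val a c))"
    by (rule big_bracket_gfun_of[OF lfun_Nv lfun_val[OF a]])
  also have "\<dots> = gfun_of (\<lambda>c x. adN c x (val a c x))"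
    by (rule gfun_of_cong) (rule bb_Nv)
  finally show 1: "big_bracket B (gfun_of Nv) a = gfun_of (\<lambda>c x. adN c x (val a c x))"
    unfolding gfun_of_val[OF a] .
  show "big_bracket B (gfun_of Nv) a \<in> gfuns B (Suc k)"
    unfolding 1
  proof (rule gfun_of_in_gfuns)
    show "homogB (Suc k) (adN c x (val a c x))" if "c \<in> charts B" "x \<in> chart_dom c" for c x
      by (rule homog_adN[OF that homog_val[OF a]])
    show "lfun c (\<lambda>x. adN c x (val a c x))" if "c \<in> charts B" for c
      by (rule lfun_adN[OF that lfun_val[OF a that]])
    fix c d x assume c: "c \<in> charts B" and d: "d \<in> charts B" and x: "x \<in> chart_dom c" "x \<in> chart_dom d"
    show "adN c x (val a c x) = tsub c d x (adN d x (val a d x))"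
      unfolding val_trans[OF a c d x] by (rule adN_tsub[OF c d x])
  qed
qed

lemma bb_eq_0:
  assumes ab: "big_bracket B a b = 0" and a: "a \<in> gfuns B k" and b: "b \<in> gfuns B l"
    and c: "c \<in> charts B" "x \<in> chart_dom c"
  shows "bb c (val a c) (val b c) x = 0"
proof -
  have "gfun_of (\<lambda>c. bb c (val a c) (val b c)) = big_bracket B (gfun_of (val a)) (gfun_of (val b))"
    by (rule big_bracket_gfun_of[OF lfun_val[OF a] lfun_val[OF b], symmetric])
  also have "\<dots> = gfun_of (\<lambda>c x. 0)"
    unfolding gfun_of_val[OF a] gfun_of_val[OF b] ab by (simp add: gfun_of_def fun_eq_iff coef_zero)
  finally show ?thesis by (rule gfun_of_inject[OF _ c])
qed

lemma bracket_adN_zero: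
  assumes f: "f \<in> gfuns B 3" and g: "g \<in> gfuns B 3" and fg: "big_bracket B f g = 0"
    and l: "\<And>c x. c \<in> charts B \<Longrightarrow> x \<in> chart_dom c \<Longrightarrow> adN c x (adN c x (val f c x)) = l *\<^sub>R val f c x"
    and m: "\<And>c x. c \<in> charts B \<Longrightarrow> x \<in> chart_dom c \<Longrightarrow> adN c x (adN c x (val g c x)) = m *\<^sub>R val g c x"
  shows "big_bracket B (big_bracket B (gfun_of Nv) f) (big_bracket B (gfun_of Nv) g) = 0"
proof -
  have Suc2: "(3 :: nat) = Suc 2" by simp
  have zero: "gfun_of (\<lambda>c x. 0) = 0" by (simp add: gfun_of_def fun_eq_iff coef_zero)
  define F where "F c x = adN c x (val f c x)" for c x
  define G where "G c x = adN c x (val g c x)" for c x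
  have lf: "lfun c (val f c)" "lfun c (val g c)" "lfun c (F c)" "lfun c (G c)" if "c \<in> charts B" for c
    unfolding F_def G_def using that by (auto intro: lfun_val[OF f] lfun_val[OF g] lfun_adN)
  have e: "big_bracket B (big_bracket B (gfun_of Nv) f) (big_bracket B (gfun_of Nv) g) = gfun_of (\<lambda>c. bb c (F c) (G c))"
    unfolding big_bracket_Nv(1)[OF f[unfolded Suc2]] big_bracket_Nv(1)[OF g[unfolded Suc2]] F_def[symmetric] G_def[symmetric]
    by (rule big_bracket_gfun_of[OF lf(3,4)])
  note fg0 = bb_eq_0[OF fg f g]
  have "bb c (F c) (G c) x = 0" if c: "c \<in> charts B" and x: "x \<in> chart_dom c" for c x
  proof -
    let ?f = "val f c" and ?g = "val g c" and ?F = "F c" and ?G = "G c"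
    have jac: "adN c y (bb c a b y) = bb c (\<lambda>y. adN c y (a y)) b y + bb c a (\<lambda>y. adN c y (b y)) y"
      if y: "y \<in> chart_dom c" and ab: "lfun c a" "lfun c b" for y a b
    proof -
      have "adN c y (bb c a b y) = bb c (Nv c) (bb c a b) y" by (rule bb_Nv[OF c y, symmetric])
      also have "\<dots> = bb c (bb c (Nv c) a) b y + bb c a (bb c (Nv c) b) y"
        by (rule bb_jacobi[OF c lfun_Nv[OF c] quadR_quad[OF Nv_quadR] ab y])
      also have "bb c (bb c (Nv c) a) b y = bb c (\<lambda>y. adN c y (a y)) b y"
        by (rule bb_cong[OF c y]) (auto intro: bb_Nv[OF c])
      also have "bb c a (bb c (Nv c) b) y = bb c a (\<lambda>y. adN c y (b y)) y"
        by (rule bb_cong[OF c y]) (auto intro: bb_Nv[OF c])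
      finally show ?thesis .
    qed
    \<comment> \<open>Since \<open>adN\<close> acts on single polynomials, the vanishing of the
      bracket at the point \<open>x\<close> is enough to conclude that its image is zero.\<close>
    have 1: "bb c ?F ?g x + bb c ?f ?G x = 0"
      using jac[OF x lf(1,2)[OF c]] fg0[OF c x] unfolding F_def G_def by (simp add: ad_linear)
    have "bb c (\<lambda>y. adN c y (?F y)) ?g x = bb c (\<lambda>y. l *\<^sub>R ?f y) ?g x"
      by (rule bb_cong[OF c x]) (auto simp: F_def l[OF c])
    then have 2: "adN c x (bb c ?F ?g x) = bb c ?F ?G x"
      using jac[OF x lf(3,2)[OF c]] bb_scaleR(1)[OF c x lf(1,2)[OF c], of l] fg0[OF c x]
      by (simp add: G_def[symmetric])
    have "bb c ?f (\<lambda>y. adN c y (?G y)) x = bb c ?f (\<lambda>y. m *\<^sub>R ?g y) x"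
      by (rule bb_cong[OF c x]) (auto simp: G_def m[OF c])
    then have 3: "adN c x (bb c ?f ?G x) = bb c ?F ?G x"
      using jac[OF x lf(1,4)[OF c]] bb_scaleR(2)[OF c x lf(1,2)[OF c], of m] fg0[OF c x]
      by (simp add: F_def[symmetric])
    have "bb c ?F ?G x + bb c ?F ?G x = adN c x (bb c ?F ?g x + bb c ?f ?G x)"
      unfolding ad_linear 2 3 ..
    also have "\<dots> = 0" unfolding 1 by (rule ad_linear)
    finally have "2 *\<^sub>R bb c ?F ?G x = 0" unfolding scaleR_2 .
    then show ?thesis by simp
  qed
  then have "gfun_of (\<lambda>c. bb c (F c) (G c)) = gfun_of (\<lambda>c x. 0)" by (rule gfun_of_cong)
  then show ?thesis unfolding e zero .
qed

lemma big_bracket_Nv_weight: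
  assumes a: "a \<in> gfuns B 3" and w: "\<forall>c\<in>charts B. \<forall>x\<in>chart_dom c. weight p 2 (val a c x)"
  shows "\<forall>c\<in>charts B. \<forall>x\<in>chart_dom c. weight p 2 (val (big_bracket B (gfun_of Nv) a) c x)"
proof (intro ballI)
  fix c x assume c: "c \<in> charts B" "x \<in> chart_dom c"
  have a': "a \<in> gfuns B (Suc 2)" using a by simp
  show "weight p 2 (val (big_bracket B (gfun_of Nv) a) c x)"
    unfolding big_bracket_Nv(1)[OF a'] val_gfun_of[OF c]
    by (rule weight_adN[OF c w[rule_format, OF c]])
qed

lemma adN_square_cps:
  assumes \<mu>: "lie_algebroid B \<mu>" and P: "cps B (lie_bracket B \<mu>) P" "proportional B N P"
  shows "\<exists>l. \<forall>c\<in>charts B. \<forall>x\<in>chart_dom c. adN c x (adN c x (val \<mu> c x)) = l *\<^sub>R val \<mu> c x"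
proof -
  have g: "\<mu> \<in> gfuns B 3" and w: "\<forall>c\<in>charts B. \<forall>x\<in>chart_dom c. weight True 2 (val \<mu> c x)"
    using \<mu> unfolding lie_algebroid_iff by blast+
  obtain e where e: "\<And>x v. v \<in> fibre B x \<Longrightarrow> P x (P x v) = e *\<^sub>R v"
    using P(1) unfolding cps_def almost_cps_def by blast
  obtain a where a: "\<And>x v. v \<in> fibre B x \<Longrightarrow> N x v = a *\<^sub>R P x v"
    using P(2) unfolding proportional_def by blast
  \<comment> \<open>Sections of \<open>A\<close> are treated as pairs with second entry
    \<open>0\<close>; on these \<open>double_endo\<close> reduces to its block
    \<open>N\<close>.\<close>
  define P' where "P' x w = (P x (fst w), 0 :: 'v \<Rightarrow> real)" for x and w :: "'v \<times> ('v \<Rightarrow> real)"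
  have i: "Nsec X x = a *\<^sub>R P' x (X x)" if X: "X \<in> half_sections False" for X x
  proof -
    have "snd (X x) = 0" using X by (simp add: half_sections_def)
    moreover have "N x (fst (X x)) = a *\<^sub>R P x (fst (X x))"
      by (rule a[OF sec_fibre(1)[OF double_sections_half[OF X]]])
    ultimately show ?thesis
      by (simp add: Nsec_def double_endo_def P'_def transpose_endo_def fun_eq_iff)
  qed
  have ii: "lbr True \<mu> (\<lambda>x. P' x (X x)) (\<lambda>x. P' x (Y x)) x =
      P' x (lbr True \<mu> (\<lambda>x. P' x (X x)) Y x + lbr True \<mu> X (\<lambda>x. P' x (Y x)) x - P' x (lbr True \<mu> X Y x))"
    if X: "X \<in> half_sections False" and Y: "Y \<in> half_sections False"
      and PX: "(\<lambda>x. P' x (X x)) \<in> half_sections False" and PY: "(\<lambda>x. P' x (Y x)) \<in> half_sections False" for X Y x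
  proof -
    have "torsion (lie_bracket B \<mu>) P (\<lambda>x. fst (X x)) (\<lambda>x. fst (Y x)) x = 0"
      using P(1) sections_half(1)[OF X] sections_half(1)[OF Y] unfolding cps_def by blast
    moreover note L = lie_bracket_lbr[OF g w]
    have "lie_bracket B \<mu> (\<lambda>x. P x (fst (X x))) (\<lambda>x. P x (fst (Y x))) = (\<lambda>x. fst (lbr True \<mu> (\<lambda>x. P' x (X x)) (\<lambda>x. P' x (Y x)) x))"
      "lie_bracket B \<mu> (\<lambda>x. P x (fst (X x))) (\<lambda>x. fst (Y x)) = (\<lambda>x. fst (lbr True \<mu> (\<lambda>x. P' x (X x)) Y x))"
      "lie_bracket B \<mu> (\<lambda>x. fst (X x)) (\<lambda>x. P x (fst (Y x))) = (\<lambda>x. fst (lbr True \<mu> X (\<lambda>x. P' x (Y x)) x))"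
      "lie_bracket B \<mu> (\<lambda>x. fst (X x)) (\<lambda>x. fst (Y x)) = (\<lambda>x. fst (lbr True \<mu> X Y x))"
      using L[OF PX PY] L[OF PX Y] L[OF X PY] L[OF X Y] by (simp_all add: P'_def)
    ultimately have "fst (lbr True \<mu> (\<lambda>x. P' x (X x)) (\<lambda>x. P' x (Y x)) x) =
      P x (fst (lbr True \<mu> (\<lambda>x. P' x (X x)) Y x) + fst (lbr True \<mu> X (\<lambda>x. P' x (Y x)) x) - P x (fst (lbr True \<mu> X Y x)))"
      by (simp add: torsion_def Let_def)
    moreover have "snd (lbr True \<mu> (\<lambda>x. P' x (X x)) (\<lambda>x. P' x (Y x)) x) = 0"
      using lbr(1)[where p = True, unfolded not_True_eq_False, OF g w PX PY] by (simp add: half_sections_def)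
    ultimately show ?thesis by (simp add: P'_def prod_eq_iff)
  qed
  have iii: "P' x (P' x (X x)) = e *\<^sub>R X x" if X: "X \<in> half_sections False" for X x
    using e[OF sec_fibre(1)[OF double_sections_half[OF X]]] X
    by (simp add: P'_def half_sections_def prod_eq_iff)
  show ?thesis
  proof (cases "a = 0")
    case True
    then have "Nsec X = (\<lambda>x. 0)" if "X \<in> half_sections False" for X using i[OF that] by auto
    then show ?thesis using adN_square_zero[where p = True, unfolded not_True_eq_False, OF g w] by blast
  next
    case False
    have "adN c x (adN c x (val \<mu> c x)) = (a\<^sup>2 * e) *\<^sub>R val \<mu> c x" if c: "c \<in> charts B" "x \<in> chart_dom c" for c x
      by (rule adN_square_half[where p = True and P' = P' and e = e, unfolded not_True_eq_False, OF g w c False])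
        (rule i ii iii, assumption+)+
    then show ?thesis by blast
  qed
qed

lemma adN_square_dual_cps:
  assumes \<mu>: "dual_lie_algebroid B \<mu>" and P: "cps (dual_bundle B) (dual_lie_bracket B \<mu>) P"
    "proportional (dual_bundle B) (transpose_endo B N) P"
  shows "\<exists>l. \<forall>c\<in>charts B. \<forall>x\<in>chart_dom c. adN c x (adN c x (val \<mu> c x)) = l *\<^sub>R val \<mu> c x"
proof -
  have fd: "fibre (dual_bundle B) x = dual_space (fibre B x)" for x by (simp add: dual_bundle_def)
  have g: "\<mu> \<in> gfuns B 3" and w: "\<forall>c\<in>charts B. \<forall>x\<in>chart_dom c. weight False 2 (val \<mu> c x)"
    using \<mu> unfolding dual_lie_algebroid_iff by blast+
  obtain e where e: "\<And>x v. v \<in> dual_space (fibre B x) \<Longrightarrow> P x (P x v) = e *\<^sub>R v"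
    using P(1) unfolding cps_def almost_cps_def fd by blast
  obtain a where a: "\<And>x v. v \<in> dual_space (fibre B x) \<Longrightarrow> transpose_endo B N x v = a *\<^sub>R P x v"
    using P(2) unfolding proportional_def fd by blast
  define P' where "P' x w = (0 :: 'v, P x (snd w))" for x and w :: "'v \<times> ('v \<Rightarrow> real)"
  \<comment> \<open>The lower block of \<open>double_endo\<close> is minus the transpose, whence the
    factor \<open>- a\<close>; its sign disappears in the square.\<close>
  have i: "Nsec X x = (- a) *\<^sub>R P' x (X x)" if X: "X \<in> half_sections True" for X x
  proof -
    have "fst (X x) = 0" using X by (simp add: half_sections_def)
    moreover have "transpose_endo B N x (snd (X x)) = a *\<^sub>R P x (snd (X x))"
      by (rule a[OF sec_fibre(2)[OF double_sections_half[OF X]]])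
    ultimately show ?thesis
      by (simp add: Nsec_def double_endo_def P'_def endo_zero)
  qed
  have ii: "lbr False \<mu> (\<lambda>x. P' x (X x)) (\<lambda>x. P' x (Y x)) x =
      P' x (lbr False \<mu> (\<lambda>x. P' x (X x)) Y x + lbr False \<mu> X (\<lambda>x. P' x (Y x)) x - P' x (lbr False \<mu> X Y x))"
    if X: "X \<in> half_sections True" and Y: "Y \<in> half_sections True"
      and PX: "(\<lambda>x. P' x (X x)) \<in> half_sections True" and PY: "(\<lambda>x. P' x (Y x)) \<in> half_sections True" for X Y x
  proof -
    have "torsion (dual_lie_bracket B \<mu>) P (\<lambda>x. snd (X x)) (\<lambda>x. snd (Y x)) x = 0"
      using P(1) sections_half(2)[OF X] sections_half(2)[OF Y] unfolding cps_def by blast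
    moreover note L = dual_lie_bracket_lbr[OF g w]
    have "dual_lie_bracket B \<mu> (\<lambda>x. P x (snd (X x))) (\<lambda>x. P x (snd (Y x))) = (\<lambda>x. snd (lbr False \<mu> (\<lambda>x. P' x (X x)) (\<lambda>x. P' x (Y x)) x))"
      "dual_lie_bracket B \<mu> (\<lambda>x. P x (snd (X x))) (\<lambda>x. snd (Y x)) = (\<lambda>x. snd (lbr False \<mu> (\<lambda>x. P' x (X x)) Y x))"
      "dual_lie_bracket B \<mu> (\<lambda>x. snd (X x)) (\<lambda>x. P x (snd (Y x))) = (\<lambda>x. snd (lbr False \<mu> X (\<lambda>x. P' x (Y x)) x))"
      "dual_lie_bracket B \<mu> (\<lambda>x. snd (X x)) (\<lambda>x. snd (Y x)) = (\<lambda>x. snd (lbr False \<mu> X Y x))"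
      using L[OF PX PY] L[OF PX Y] L[OF X PY] L[OF X Y] by (simp_all add: P'_def)
    ultimately have "snd (lbr False \<mu> (\<lambda>x. P' x (X x)) (\<lambda>x. P' x (Y x)) x) =
      P x (snd (lbr False \<mu> (\<lambda>x. P' x (X x)) Y x) + snd (lbr False \<mu> X (\<lambda>x. P' x (Y x)) x) - P x (snd (lbr False \<mu> X Y x)))"
      by (simp add: torsion_def Let_def)
    moreover have "fst (lbr False \<mu> (\<lambda>x. P' x (X x)) (\<lambda>x. P' x (Y x)) x) = 0"
      using lbr(1)[where p = False, unfolded not_False_eq_True, OF g w PX PY] by (simp add: half_sections_def)
    ultimately show ?thesis by (simp add: P'_def prod_eq_iff)
  qed
  have iii: "P' x (P' x (X x)) = e *\<^sub>R X x" if X: "X \<in> half_sections True" for X x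
    using e[OF sec_fibre(2)[OF double_sections_half[OF X]]] X
    by (simp add: P'_def half_sections_def prod_eq_iff)
  show ?thesis
  proof (cases "- a = 0")
    case True
    then have "Nsec X = (\<lambda>x. 0)" if "X \<in> half_sections True" for X using i[OF that] by auto
    then show ?thesis using adN_square_zero[where p = False, unfolded not_False_eq_True, OF g w] by blast
  next
    case False
    have "adN c x (adN c x (val \<mu> c x)) = ((- a)\<^sup>2 * e) *\<^sub>R val \<mu> c x" if c: "c \<in> charts B" "x \<in> chart_dom c" for c x
      by (rule adN_square_half[where p = False and P' = P' and e = e, unfolded not_False_eq_True, OF g w c False])
        (rule i ii iii, assumption+)+
    then show ?thesis by blast
  qed
qed

lemma deformed_bialgebroid:
  assumes L: "lie_bialgebroid B \<mu> \<gamma>"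
    and P: "cps B (lie_bracket B \<mu>) P" "proportional B N P"
    and Q: "cps (dual_bundle B) (dual_lie_bracket B \<gamma>) Q" "proportional (dual_bundle B) (transpose_endo B N) Q"
  shows "lie_bialgebroid B (big_bracket B (gfun_of Nv) \<mu>) (big_bracket B (gfun_of Nv) \<gamma>)"
    "courant_algebroid B (big_bracket B (gfun_of Nv) (\<mu> + \<gamma>))"
    "big_bracket B (gfun_of Nv) \<mu> + big_bracket B (gfun_of Nv) \<gamma> = big_bracket B (gfun_of Nv) (\<mu> + \<gamma>)"
proof -
  let ?n = "gfun_of Nv"
  have lm: "lie_algebroid B \<mu>" and lg: "dual_lie_algebroid B \<gamma>" and mg: "big_bracket B \<mu> \<gamma> = 0"
    using L unfolding lie_bialgebroid_def by blast+
  have m: "\<mu> \<in> gfuns B 3" and wm: "\<forall>c\<in>charts B. \<forall>x\<in>chart_dom c. weight True 2 (val \<mu> c x)"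
    and mm: "big_bracket B \<mu> \<mu> = 0" using lm unfolding lie_algebroid_iff by blast+
  have g: "\<gamma> \<in> gfuns B 3" and wg: "\<forall>c\<in>charts B. \<forall>x\<in>chart_dom c. weight False 2 (val \<gamma> c x)"
    and gg: "big_bracket B \<gamma> \<gamma> = 0" using lg unfolding dual_lie_algebroid_iff by blast+
  have Suc2: "(3 :: nat) = Suc 2" by simp
  note m' = m[unfolded Suc2] and g' = g[unfolded Suc2]
  obtain k where k: "\<And>c x. c \<in> charts B \<Longrightarrow> x \<in> chart_dom c \<Longrightarrow> adN c x (adN c x (val \<mu> c x)) = k *\<^sub>R val \<mu> c x"
    using adN_square_cps[OF lm P] by blast
  obtain l where l: "\<And>c x. c \<in> charts B \<Longrightarrow> x \<in> chart_dom c \<Longrightarrow> adN c x (adN c x (val \<gamma> c x)) = l *\<^sub>R val \<gamma> c x"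
    using adN_square_dual_cps[OF lg Q] by blast
  note mm' = bracket_adN_zero[OF m m mm k k] and gg' = bracket_adN_zero[OF g g gg l l]
    and mg' = bracket_adN_zero[OF m g mg k l]
  have M: "big_bracket B ?n \<mu> \<in> gfuns B 3" "big_bracket B ?n \<gamma> \<in> gfuns B 3"
    using big_bracket_Nv(2)[OF m'] big_bracket_Nv(2)[OF g'] by simp_all
  show "lie_bialgebroid B (big_bracket B ?n \<mu>) (big_bracket B ?n \<gamma>)"
    unfolding lie_bialgebroid_def lie_algebroid_iff dual_lie_algebroid_iff
    using M mm' gg' mg' big_bracket_Nv_weight[OF m wm] big_bracket_Nv_weight[OF g wg] by blast
  have mg3: "\<mu> + \<gamma> \<in> gfuns B (Suc 2)" by (rule gfun_add(2)[OF m' g'])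
  show add: "big_bracket B ?n \<mu> + big_bracket B ?n \<gamma> = big_bracket B ?n (\<mu> + \<gamma>)"
  proof -
    have "big_bracket B ?n (\<mu> + \<gamma>) = gfun_of (\<lambda>c x. adN c x (val (\<mu> + \<gamma>) c x))"
      by (rule big_bracket_Nv(1)[OF mg3])
    also have "\<dots> = gfun_of (\<lambda>c x. val (big_bracket B ?n \<mu>) c x + val (big_bracket B ?n \<gamma>) c x)"
      unfolding gfun_add(1)[OF m g] big_bracket_Nv(1)[OF m'] big_bracket_Nv(1)[OF g']
      by (rule gfun_of_cong) (simp add: val_gfun_of ad_linear)
    also have "\<dots> = big_bracket B ?n \<mu> + big_bracket B ?n \<gamma>"
      by (rule gfun_add(1)[OF M, symmetric])
    finally show ?thesis by (rule sym)
  qed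
  have zero: "gfun_of (\<lambda>c x. 0) = 0" by (simp add: gfun_of_def fun_eq_iff coef_zero)
  let ?M = "val (big_bracket B ?n \<mu>)" and ?G = "val (big_bracket B ?n \<gamma>)"
  have lf: "lfun c (?M c)" "lfun c (?G c)" if "c \<in> charts B" for c
    using lfun_val[OF M(1) that] lfun_val[OF M(2) that] .
  have "big_bracket B (big_bracket B ?n (\<mu> + \<gamma>)) (big_bracket B ?n (\<mu> + \<gamma>)) =
      gfun_of (\<lambda>c. bb c (\<lambda>x. ?M c x + ?G c x) (\<lambda>x. ?M c x + ?G c x))"
    unfolding add[symmetric] gfun_add(1)[OF M] by (rule big_bracket_gfun_of) (auto intro: lfun_add lf)
  also have "\<dots> = gfun_of (\<lambda>c x. 0)"
  proof (rule gfun_of_cong)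
    fix c x assume c: "c \<in> charts B" "x \<in> chart_dom c"
    \<comment> \<open>The two cross terms of the bracket of the sum with itself coincide, both
      arguments having degree 3, and they vanish by the compatibility of the deformed
      structures.\<close>
    have "bb c (?G c) (?M c) x = bb c (?M c) (?G c) x"
      by (rule bb_commute[OF c lf(2,1)[OF c(1)]]) (rule homog_val[OF M(2)], rule homog_val[OF M(1)])
    then show "bb c (\<lambda>x. ?M c x + ?G c x) (\<lambda>x. ?M c x + ?G c x) x = 0"
      unfolding bb_add[OF c lf[OF c(1)] lf[OF c(1)]]
      by (simp add: bb_eq_0[OF mm' M(1) M(1) c] bb_eq_0[OF mg' M c] bb_eq_0[OF gg' M(2) M(2) c])
  qed
  finally show "courant_algebroid B (big_bracket B ?n (\<mu> + \<gamma>))"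
    unfolding courant_algebroid_def zero using big_bracket_Nv(2)[OF mg3] by simp
qed

end

theorem theorem4p11:
  fixes A :: "('m::{second_countable_topology, t2_space}, 'v::real_vector) vbundle"
    and \<mu> \<gamma> :: "('m, 'v) gfun"
    and N :: "'m \<Rightarrow> 'v \<Rightarrow> 'v"
  assumes "smooth_vector_bundle A"
    and "lie_bialgebroid A \<mu> \<gamma>"
    and "bundle_endomorphism A N"
    and "\<exists>P. cps A (lie_bracket A \<mu>) P \<and> proportional A N P"
    and "\<exists>Q. cps (dual_bundle A) (dual_lie_bracket A \<gamma>) Q \<and>
             proportional (dual_bundle A) (transpose_endo A N) Q"
  shows "let Nt = tilde A (double_endo A N) in
         lie_bialgebroid A (big_bracket A Nt \<mu>) (big_bracket A Nt \<gamma>) \<and>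
         courant_algebroid A (big_bracket A Nt (\<mu> + \<gamma>)) \<and>
         double_structure (big_bracket A Nt \<mu>) (big_bracket A Nt \<gamma>) = big_bracket A Nt (\<mu> + \<gamma>)"
proof -
  interpret smooth_bundle_endo A N by unfold_locales (rule assms(1), rule assms(3))
  obtain P Q where PQ: "cps A (lie_bracket A \<mu>) P" "proportional A N P"
    "cps (dual_bundle A) (dual_lie_bracket A \<gamma>) Q" "proportional (dual_bundle A) (transpose_endo A N) Q"
    using assms(4,5) by blast
  show ?thesis
  proof (cases "bundle_rank A = 0")
    \<comment> \<open>Here \<open>tilde\<close> may be anything; both structures are
      \<open>0\<close>, and the bracket of any function with \<open>0\<close> is
      \<open>0\<close>.\<close>
    case True
    have "\<mu> = 0" "\<gamma> = 0"
      using rank_0_lie_algebroid[OF True] assms(2) unfolding lie_bialgebroid_def by blast+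
    then show ?thesis
      using assms(2) big_bracket_zero
      by (simp add: Let_def double_structure_def courant_algebroid_def lie_bialgebroid_def lie_algebroid_def)
  next
    case False
    then have t: "tilde A (double_endo A N) = gfun_of Nv" by (simp add: tilde_double_endo)
    show ?thesis
      unfolding Let_def t double_structure_def using deformed_bialgebroid[OF assms(2) PQ] by blast
  qed
qed

end
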